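(* Let $\mathbf{k}$ be a perfect field of characteristic $p>2$, and let $(X,\{\,,\})$ be an affine normal Poisson variety over $\mathbf{k}$ which has an open symplectic leaf. Let $n\ge 1$ and let $A$ be a flat associative $W_n(\mathbf{k})$-algebra such that $Z(A/pA)=\mathcal{O}_X$ and the deformation Poisson bracket on $Z(A/pA)$ coincides with the bracket of the Poisson variety $X$. Then for all $1\leq m\leq n$ the map $$\phi_m:W_m(\mathcal{O}_X)\to Z(A/p^mA),\qquad \phi_m(z_1,\dots,z_m)=\sum_{i=1}^m p^{i-1}\tilde z_i^{\,p^{m-i}},$$ where $\tilde z_i\in A/p^mA$ is any lift of $z_i\in\mathcal{O}_X= Z(A/pA)$, is an isomorphism.
   Context: $W_n(R)$ denotes the ring of $p$-typical Witt vectors of length $n$ of a commutative ring $R$; $Z(B)$ is the center of an algebra $B$; $\mathcal{O}_X$ is the coordinate ring of $X$. Varieties are irreducible, so that $\mathcal{O}_X$ is a normal domain. An open symplectic leaf of $X$ is a nonempty open subset of $X$ that is smooth and on which the Poisson bracket is nondegenerate, i.e. comes from a symplectic form. The deformation Poisson bracket on $Z(A/pA)$ is $\{a,b\}=\big(\tfrac1p[\tilde a,\tilde b]\big)\bmod p$ for $a,b\in Z(A/pA)$, where $\tilde a,\tilde b\in A$ are lifts of $a,b$. The map $\phi_m$ is a well-defined ring homomorphism, independent of the choice of lifts (a known result of Stewart and Vologodsky). *)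

theory Defs
  imports
    "HOL-Algebra.Algebra"
    "HOL-Algebra.Free_Abelian_Groups"
    "HOL-Computational_Algebra.Primes"
    "HOL-Library.Poly_Mapping"
    "HOL-Library.Extended_Nat"
begin

section \<open>Truncated Witt vectors\<close>

text \<open>
  Integer polynomials in the two families of indeterminates \<open>X\<^sub>i\<close> (index \<open>Inl i\<close>) and
  \<open>Y\<^sub>i\<close> (index \<open>Inr i\<close>): finitely supported functions from monomials to coefficients, with
  the convolution product.  All Witt components are indexed from 0.
\<close>

type_synonym witt_poly = "((nat + nat) \<Rightarrow>\<^sub>0 nat) \<Rightarrow>\<^sub>0 int"

definition indet :: "nat + nat \<Rightarrow> witt_poly" where
  "indet v = Poly_Mapping.single (Poly_Mapping.single v 1) 1"

definition ghost :: "nat \<Rightarrow> (nat \<Rightarrow> 'b::comm_ring_1) \<Rightarrow> nat \<Rightarrow> 'b" where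
  "ghost p x i = (\<Sum>j\<le>i. of_nat (p ^ j) * x j ^ (p ^ (i - j)))"

text \<open>
  The universal Witt polynomials: the unique families of integer polynomials through which the
  ghost components become additive and multiplicative.
\<close>

definition witt_sum_poly :: "nat \<Rightarrow> nat \<Rightarrow> witt_poly" where
  "witt_sum_poly p = (THE S. \<forall>i. ghost p S i =
     ghost p (\<lambda>j. indet (Inl j)) i + ghost p (\<lambda>j. indet (Inr j)) i)"

definition witt_prod_poly :: "nat \<Rightarrow> nat \<Rightarrow> witt_poly" where
  "witt_prod_poly p = (THE S. \<forall>i. ghost p S i =
     ghost p (\<lambda>j. indet (Inl j)) i * ghost p (\<lambda>j. indet (Inr j)) i)"

definition eval_witt_poly :: "('a, 'm) ring_scheme \<Rightarrow> (nat + nat \<Rightarrow> 'a) \<Rightarrow> witt_poly \<Rightarrow> 'a" where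
  "eval_witt_poly R v q =
     (\<Oplus>\<^bsub>R\<^esub>m\<in>Poly_Mapping.keys q. add_pow R (Poly_Mapping.lookup q m)
        (\<Otimes>\<^bsub>R\<^esub>x\<in>Poly_Mapping.keys m. v x [^]\<^bsub>R\<^esub> Poly_Mapping.lookup m x))"

definition witt_ring :: "nat \<Rightarrow> nat \<Rightarrow> ('a, 'm) ring_scheme \<Rightarrow> 'a list ring" where
  "witt_ring p n R =
     \<lparr>carrier = {xs. length xs = n \<and> set xs \<subseteq> carrier R},
      monoid.mult = (\<lambda>xs ys. map (\<lambda>i. eval_witt_poly R (case_sum (nth xs) (nth ys)) (witt_prod_poly p i)) [0..<n]),
      monoid.one = map (\<lambda>i. if i = 0 then \<one>\<^bsub>R\<^esub> else \<zero>\<^bsub>R\<^esub>) [0..<n],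
      ring.zero = replicate n \<zero>\<^bsub>R\<^esub>,
      ring.add = (\<lambda>xs ys. map (\<lambda>i. eval_witt_poly R (case_sum (nth xs) (nth ys)) (witt_sum_poly p i)) [0..<n])\<rparr>"


section \<open>Tensor products and flatness\<close>

definition tensor_relations ::
  "('r, 's) ring_scheme \<Rightarrow> ('r, 'm) module \<Rightarrow> ('r, 'n) module \<Rightarrow> ('m \<times> 'n \<Rightarrow>\<^sub>0 int) set" where
  "tensor_relations R M N = generate (free_Abelian_group (carrier M \<times> carrier N))
     ({frag_of (x \<oplus>\<^bsub>M\<^esub> x', y) - frag_of (x, y) - frag_of (x', y) | x x' y.
         x \<in> carrier M \<and> x' \<in> carrier M \<and> y \<in> carrier N}
    \<union> {frag_of (x, y \<oplus>\<^bsub>N\<^esub> y') - frag_of (x, y) - frag_of (x, y') | x y y'.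
         x \<in> carrier M \<and> y \<in> carrier N \<and> y' \<in> carrier N}
    \<union> {frag_of (r \<odot>\<^bsub>M\<^esub> x, y) - frag_of (x, r \<odot>\<^bsub>N\<^esub> y) | r x y.
         r \<in> carrier R \<and> x \<in> carrier M \<and> y \<in> carrier N})"

definition tensor_product ::
  "('r, 's) ring_scheme \<Rightarrow> ('r, 'm) module \<Rightarrow> ('r, 'n) module \<Rightarrow> ('m \<times> 'n \<Rightarrow>\<^sub>0 int) set monoid" where
  "tensor_product R M N =
     free_Abelian_group (carrier M \<times> carrier N) Mod tensor_relations R M N"

definition linear_maps ::
  "('r, 's) ring_scheme \<Rightarrow> ('r, 'm) module \<Rightarrow> ('r, 'n) module \<Rightarrow> ('m \<Rightarrow> 'n) set" where
  "linear_maps R M N = {f \<in> carrier M \<rightarrow> carrier N.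
     (\<forall>x\<in>carrier M. \<forall>y\<in>carrier M. f (x \<oplus>\<^bsub>M\<^esub> y) = f x \<oplus>\<^bsub>N\<^esub> f y) \<and>
     (\<forall>r\<in>carrier R. \<forall>x\<in>carrier M. f (r \<odot>\<^bsub>M\<^esub> x) = r \<odot>\<^bsub>N\<^esub> f x)}"

text \<open>The map \<open>f \<otimes> id : N \<otimes> M \<rightarrow> N' \<otimes> M\<close> induced by a linear map \<open>f : N \<rightarrow> N'\<close>.\<close>

definition tensor_map ::
  "('r, 's) ring_scheme \<Rightarrow> ('r, 'n2) module \<Rightarrow> ('r, 'm) module \<Rightarrow> ('n1 \<Rightarrow> 'n2)
     \<Rightarrow> ('n1 \<times> 'm \<Rightarrow>\<^sub>0 int) set \<Rightarrow> ('n2 \<times> 'm \<Rightarrow>\<^sub>0 int) set" where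
  "tensor_map R N' M f C = (\<Union>c\<in>C. tensor_relations R N' M
     #>\<^bsub>free_Abelian_group (carrier N' \<times> carrier M)\<^esub> frag_extend (\<lambda>(x, y). frag_of (f x, y)) c)"

text \<open>
  Flatness: tensoring with \<open>M\<close> preserves injectivity.  HOL cannot quantify over modules on all
  types, so the test modules live on the type \<open>'r list set\<close>.  This type carries an isomorphic copy
  of every finitely generated \<open>R\<close>-module, as a quotient of some \<open>R\<^sup>k\<close>, with cosets of lists as
  elements.  Since tensor products commute with directed unions, injections of finitely generated
  modules detect flatness, so nothing is lost.
\<close>

definition flat_module :: "('r, 's) ring_scheme \<Rightarrow> ('r, 'm) module \<Rightarrow> bool" where
  "flat_module R M \<longleftrightarrow> module R M \<and>
     (\<forall>(N :: ('r, 'r list set) module) (N' :: ('r, 'r list set) module) f.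
        module R N \<and> module R N' \<and> f \<in> linear_maps R N N' \<and> inj_on f (carrier N) \<longrightarrow>
        inj_on (tensor_map R N' M f) (carrier (tensor_product R N M)))"


section \<open>Associative algebras, reductions and centers\<close>

definition assoc_algebra :: "('r, 's) ring_scheme \<Rightarrow> ('r, 'a) module \<Rightarrow> bool" where
  "assoc_algebra R A \<longleftrightarrow> module R A \<and> ring A \<and>
     (\<forall>r\<in>carrier R. \<forall>x\<in>carrier A. \<forall>y\<in>carrier A.
        (r \<odot>\<^bsub>A\<^esub> x) \<otimes>\<^bsub>A\<^esub> y = r \<odot>\<^bsub>A\<^esub> (x \<otimes>\<^bsub>A\<^esub> y) \<and>
        x \<otimes>\<^bsub>A\<^esub> (r \<odot>\<^bsub>A\<^esub> y) = r \<odot>\<^bsub>A\<^esub> (x \<otimes>\<^bsub>A\<^esub> y))"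

definition nat_multiples :: "('a, 'm) ring_scheme \<Rightarrow> nat \<Rightarrow> 'a set" where
  "nat_multiples A k = (\<lambda>a. add_pow A k a) ` carrier A"

definition reduction :: "('a, 'm) ring_scheme \<Rightarrow> nat \<Rightarrow> 'a set ring" where
  "reduction A k = A Quot nat_multiples A k"

definition residue_class :: "('a, 'm) ring_scheme \<Rightarrow> nat \<Rightarrow> 'a \<Rightarrow> 'a set" where
  "residue_class A k a = nat_multiples A k +>\<^bsub>A\<^esub> a"

definition ring_center :: "('a, 'm) ring_scheme \<Rightarrow> ('a, 'm) ring_scheme" where
  "ring_center B = B\<lparr>carrier := {z \<in> carrier B. \<forall>x\<in>carrier B. z \<otimes>\<^bsub>B\<^esub> x = x \<otimes>\<^bsub>B\<^esub> z}\<rparr>"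

text \<open>
  \<open>w\<close> is the class modulo \<open>p\<close> of \<open>(1/p)[a, b]\<close> for all lifts \<open>a, b\<close> in \<open>A\<close> of the
  elements \<open>u, v\<close> of \<open>A/pA\<close>, that is, of elements \<open>a\<close> of the coset \<open>u\<close> and \<open>b\<close> of the coset \<open>v\<close>.
  If \<open>A\<close> is flat over \<open>W\<^sub>n(k)\<close> with \<open>n \<ge> 2\<close>, the quotient by \<open>p\<close> is unique modulo \<open>p\<^sup>n\<^sup>-\<^sup>1\<close>, so
  this determines \<open>w\<close>.  If \<open>p = 0\<close> in \<open>A\<close> (the case \<open>n = 1\<close>), division by \<open>p\<close> has no
  meaning and the condition holds for every nonempty \<open>w \<subseteq> A\<close> and all central \<open>u, v\<close>.
\<close>

definition deformation_bracket ::
  "nat \<Rightarrow> ('a, 'm) ring_scheme \<Rightarrow> 'a set \<Rightarrow> 'a set \<Rightarrow> 'a set \<Rightarrow> bool" where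
  "deformation_bracket p A u v w \<longleftrightarrow>
     (\<forall>a\<in>u. \<forall>b\<in>v. \<exists>c\<in>w. a \<otimes>\<^bsub>A\<^esub> b \<ominus>\<^bsub>A\<^esub> b \<otimes>\<^bsub>A\<^esub> a = add_pow A p c)"

text \<open>\<open>u \<in> A/p\<^sup>mA\<close> is a lift of \<open>x \<in> A/pA\<close>.\<close>

definition is_lift :: "nat \<Rightarrow> nat \<Rightarrow> ('a, 'm) ring_scheme \<Rightarrow> 'a set \<Rightarrow> 'a set \<Rightarrow> bool" where
  "is_lift p m A u x \<longleftrightarrow>
     (\<exists>a\<in>carrier A. u = residue_class A (p ^ m) a \<and> x = residue_class A p a)"

text \<open>\<open>lift z i\<close> stands for the chosen lift to \<open>A/p\<^sup>mA\<close> of the \<open>i\<close>-th component of \<open>z\<close>.\<close>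

definition phi_map ::
  "nat \<Rightarrow> nat \<Rightarrow> ('a, 'm) ring_scheme \<Rightarrow> ('o list \<Rightarrow> nat \<Rightarrow> 'a set) \<Rightarrow> 'o list \<Rightarrow> 'a set" where
  "phi_map p m A lift z =
     (\<Oplus>\<^bsub>reduction A (p ^ m)\<^esub>i\<in>{..<m}. add_pow (reduction A (p ^ m)) (p ^ i)
        (lift z i [^]\<^bsub>reduction A (p ^ m)\<^esub> (p ^ (m - 1 - i))))"


section \<open>Affine normal Poisson varieties\<close>

definition perfect_field_char :: "nat \<Rightarrow> ('k, 's) ring_scheme \<Rightarrow> bool" where
  "perfect_field_char p K \<longleftrightarrow> field K \<and> Factorial_Ring.prime p \<and> add_pow K p \<one>\<^bsub>K\<^esub> = \<zero>\<^bsub>K\<^esub> \<and>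
     (\<forall>x\<in>carrier K. \<exists>y\<in>carrier K. y [^]\<^bsub>K\<^esub> p = x)"

text \<open>
  Every fraction \<open>a/b\<close> satisfying a monic equation of degree \<open>n\<close> over the domain \<open>R\<close> lies in \<open>R\<close>;
  the equation is multiplied by \<open>b\<^sup>n\<close> to avoid the fraction field.
\<close>

definition normal_domain :: "('a, 'm) ring_scheme \<Rightarrow> bool" where
  "normal_domain R \<longleftrightarrow> domain R \<and>
     (\<forall>a\<in>carrier R. \<forall>b\<in>carrier R - {\<zero>\<^bsub>R\<^esub>}. \<forall>(n::nat). \<forall>c\<in>{..<n} \<rightarrow> carrier R.
        a [^]\<^bsub>R\<^esub> n \<oplus>\<^bsub>R\<^esub>
          (\<Oplus>\<^bsub>R\<^esub>i\<in>{..<n}. c i \<otimes>\<^bsub>R\<^esub> a [^]\<^bsub>R\<^esub> i \<otimes>\<^bsub>R\<^esub> b [^]\<^bsub>R\<^esub> (n - i)) = \<zero>\<^bsub>R\<^esub> \<longrightarrow>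
        (\<exists>q\<in>carrier R. a = q \<otimes>\<^bsub>R\<^esub> b))"

definition fg_algebra :: "('k, 's) ring_scheme \<Rightarrow> ('k, 'o) module \<Rightarrow> bool" where
  "fg_algebra K R \<longleftrightarrow> algebra K R \<and>
     (\<exists>S. finite S \<and> S \<subseteq> carrier R \<and>
        generate_ring R ((\<lambda>c. c \<odot>\<^bsub>R\<^esub> \<one>\<^bsub>R\<^esub>) ` carrier K \<union> S) = carrier R)"

definition poisson_bracket ::
  "('k, 's) ring_scheme \<Rightarrow> ('k, 'o) module \<Rightarrow> ('o \<Rightarrow> 'o \<Rightarrow> 'o) \<Rightarrow> bool" where
  "poisson_bracket K R br \<longleftrightarrow>
     (\<forall>f\<in>carrier R. \<forall>g\<in>carrier R. br f g \<in> carrier R) \<and>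
     (\<forall>f\<in>carrier R. \<forall>g\<in>carrier R. \<forall>h\<in>carrier R.
        br (f \<oplus>\<^bsub>R\<^esub> g) h = br f h \<oplus>\<^bsub>R\<^esub> br g h \<and>
        br h (f \<oplus>\<^bsub>R\<^esub> g) = br h f \<oplus>\<^bsub>R\<^esub> br h g) \<and>
     (\<forall>c\<in>carrier K. \<forall>f\<in>carrier R. \<forall>g\<in>carrier R.
        br (c \<odot>\<^bsub>R\<^esub> f) g = c \<odot>\<^bsub>R\<^esub> br f g \<and> br f (c \<odot>\<^bsub>R\<^esub> g) = c \<odot>\<^bsub>R\<^esub> br f g) \<and>
     (\<forall>f\<in>carrier R. br f f = \<zero>\<^bsub>R\<^esub>) \<and>
     (\<forall>f\<in>carrier R. \<forall>g\<in>carrier R. \<forall>h\<in>carrier R.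
        br f (br g h) \<oplus>\<^bsub>R\<^esub> br g (br h f) \<oplus>\<^bsub>R\<^esub> br h (br f g) = \<zero>\<^bsub>R\<^esub>) \<and>
     (\<forall>f\<in>carrier R. \<forall>g\<in>carrier R. \<forall>h\<in>carrier R.
        br f (g \<otimes>\<^bsub>R\<^esub> h) = br f g \<otimes>\<^bsub>R\<^esub> h \<oplus>\<^bsub>R\<^esub> g \<otimes>\<^bsub>R\<^esub> br f h)"

definition normal_poisson_variety ::
  "('k, 's) ring_scheme \<Rightarrow> ('k, 'o) module \<Rightarrow> ('o \<Rightarrow> 'o \<Rightarrow> 'o) \<Rightarrow> bool" where
  "normal_poisson_variety K R br \<longleftrightarrow>
     field K \<and> fg_algebra K R \<and> normal_domain R \<and> poisson_bracket K R br"


section \<open>Open symplectic leaves\<close>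

definition prime_chain :: "('a, 'm) ring_scheme \<Rightarrow> nat \<Rightarrow> (nat \<Rightarrow> 'a set) \<Rightarrow> bool" where
  "prime_chain R d P \<longleftrightarrow> (\<forall>i\<le>d. primeideal (P i) R) \<and> (\<forall>i<d. P i \<subset> P (Suc i))"

definition krull_dim :: "('a, 'm) ring_scheme \<Rightarrow> enat" where
  "krull_dim R = (SUP d\<in>{d. \<exists>P. prime_chain R d P}. enat d)"

text \<open>
  Points are closed points, i.e. maximal ideals \<open>x\<close> of the coordinate ring \<open>R\<close>, and the value at
  \<open>x\<close> of a function \<open>f\<close> is its coset \<open>x +> f\<close> in the residue field \<open>R Quot x\<close>.  The open
  sets of an affine variety correspond to those of its space of closed points.
\<close>

definition zariski_open :: "('a, 'm) ring_scheme \<Rightarrow> 'a set set \<Rightarrow> bool" where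
  "zariski_open R U \<longleftrightarrow>
     (\<exists>S\<subseteq>carrier R. U = {x. maximalideal x R \<and> \<not> S \<subseteq> x})"

text \<open>The Zariski tangent space at \<open>x\<close> over \<open>K\<close>: \<open>K\<close>-derivations into the residue field.\<close>

definition tangent_space ::
  "('k, 's) ring_scheme \<Rightarrow> ('k, 'o) module \<Rightarrow> 'o set \<Rightarrow> ('o \<Rightarrow> 'o set) set" where
  "tangent_space K R x = {D \<in> carrier R \<rightarrow>\<^sub>E carrier (R Quot x).
     (\<forall>f\<in>carrier R. \<forall>g\<in>carrier R. D (f \<oplus>\<^bsub>R\<^esub> g) = D f \<oplus>\<^bsub>R Quot x\<^esub> D g) \<and>
     (\<forall>f\<in>carrier R. \<forall>g\<in>carrier R. D (f \<otimes>\<^bsub>R\<^esub> g) =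
        (x +>\<^bsub>R\<^esub> f) \<otimes>\<^bsub>R Quot x\<^esub> D g \<oplus>\<^bsub>R Quot x\<^esub> (x +>\<^bsub>R\<^esub> g) \<otimes>\<^bsub>R Quot x\<^esub> D f) \<and>
     (\<forall>c\<in>carrier K. D (c \<odot>\<^bsub>R\<^esub> \<one>\<^bsub>R\<^esub>) = \<zero>\<^bsub>R Quot x\<^esub>)}"

text \<open>The tangent space at \<open>x\<close> has a basis of \<open>d\<close> elements over the residue field.\<close>

definition tangent_dim ::
  "('k, 's) ring_scheme \<Rightarrow> ('k, 'o) module \<Rightarrow> 'o set \<Rightarrow> nat \<Rightarrow> bool" where
  "tangent_dim K R x d \<longleftrightarrow> (\<exists>B\<in>{..<d} \<rightarrow> tangent_space K R x. \<forall>D\<in>tangent_space K R x.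
     \<exists>!c. c \<in> {..<d} \<rightarrow>\<^sub>E carrier (R Quot x) \<and>
       (\<forall>f\<in>carrier R. D f = (\<Oplus>\<^bsub>R Quot x\<^esub>i\<in>{..<d}. c i \<otimes>\<^bsub>R Quot x\<^esub> B i f)))"

definition smooth_point ::
  "('k, 's) ring_scheme \<Rightarrow> ('k, 'o) module \<Rightarrow> 'o set \<Rightarrow> bool" where
  "smooth_point K R x \<longleftrightarrow> (\<exists>d. tangent_dim K R x d \<and> krull_dim R = enat d)"

text \<open>
  Nondegeneracy at \<open>x\<close> of the bilinear form \<open>(df, dg) \<mapsto> {f, g}(x)\<close> on the cotangent space
  (the dual of the tangent space) at \<open>x\<close>: a covector in its radical vanishes.  Covectors are the
  finite sums \<open>\<Sum>\<^sub>i a\<^sub>i df\<^sub>i\<close> with \<open>a\<^sub>i\<close> in the residue field, and such a sum is zero iff it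
  vanishes on all tangent vectors.
\<close>

definition nondegenerate_at ::
  "('k, 's) ring_scheme \<Rightarrow> ('k, 'o) module \<Rightarrow> ('o \<Rightarrow> 'o \<Rightarrow> 'o) \<Rightarrow> 'o set \<Rightarrow> bool" where
  "nondegenerate_at K R br x \<longleftrightarrow>
     (\<forall>(r::nat). \<forall>a\<in>{..<r} \<rightarrow> carrier (R Quot x). \<forall>f\<in>{..<r} \<rightarrow> carrier R.
        (\<forall>g\<in>carrier R.
           (\<Oplus>\<^bsub>R Quot x\<^esub>i\<in>{..<r}. a i \<otimes>\<^bsub>R Quot x\<^esub> (x +>\<^bsub>R\<^esub> br (f i) g)) = \<zero>\<^bsub>R Quot x\<^esub>) \<longrightarrow>
        (\<forall>D\<in>tangent_space K R x.
           (\<Oplus>\<^bsub>R Quot x\<^esub>i\<in>{..<r}. a i \<otimes>\<^bsub>R Quot x\<^esub> D (f i)) = \<zero>\<^bsub>R Quot x\<^esub>))"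

definition open_symplectic_leaf ::
  "('k, 's) ring_scheme \<Rightarrow> ('k, 'o) module \<Rightarrow> ('o \<Rightarrow> 'o \<Rightarrow> 'o) \<Rightarrow> 'o set set \<Rightarrow> bool" where
  "open_symplectic_leaf K R br U \<longleftrightarrow> zariski_open R U \<and> U \<noteq> {} \<and>
     (\<forall>x\<in>U. smooth_point K R x \<and> nondegenerate_at K R br x)"

end

theory Submission
  imports Defs
begin

text \<open>
  Write \<open>O\<close> for the coordinate ring of \<open>X\<close>, identified with the center of \<open>A/pA\<close>, and \<open>\<phi>(z) = \<Sum> p\<^sup>i z\<^sub>i\<^bsup>p\<^sup>k\<^sup>-\<^sup>i\<^esup>\<close> (\<open>0 \<le> i \<le> k\<close>,
  \<open>m = k + 1\<close>) for the last ghost component, evaluated at lifts of the \<open>z\<^sub>i\<close> and read modulo \<open>p\<^sup>m\<close>.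

  \<^bold>\<open>Homomorphism.\<close> The Witt polynomials satisfy the ghost identities over the integers. Lifts of central elements
  of \<open>A/pA\<close> do not commute, but their commutators are divisible by \<open>p\<close>, and each \<open>p\<close>-th power gains one more factor \<open>p\<close>
  because \<open>p\<close> is odd. So the polynomials in the span of the monomials \<open>p\<^sup>k\<^sup>-\<^sup>i x\<^bsup>p\<^sup>i \<alpha>\<^esup>\<close>, among them all ghost components, can
  be evaluated at such lifts modulo \<open>p\<^sup>k\<^sup>+\<^sup>1\<close> as if these commuted (\<open>lift_eval_mult\<close>, \<open>lift_eval_ghost\<close>). This also shows that
  the values are central and do not depend on the lifts.

  \<^bold>\<open>Injectivity.\<close> In \<open>W\<^sub>n(K)\<close>, multiplication by \<open>p\<close> is the shift composed with Frobenius, so for perfect \<open>K\<close> the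
  annihilator of \<open>p\<close> is generated by \<open>p\<^sup>n\<^sup>-\<^sup>1\<close>. Flatness gives the same for \<open>A\<close> (\<open>flat_witt_torsion\<close>): \<open>p\<close> can be cancelled at
  the cost of one power of precision. As \<open>\<phi>(z)\<close> modulo \<open>p\<close> is \<open>z\<^sub>0\<close> raised to the \<open>p\<^sup>k\<close> and Frobenius is injective on \<open>O\<close>, the components
  of \<open>z\<close> can be recovered one after the other (\<open>teich_inj\<close>).

  \<^bold>\<open>Surjectivity.\<close> Let \<open>a\<close> be central modulo \<open>p\<^sup>k\<^sup>+\<^sup>2\<close>. By induction \<open>a = \<phi>(z) + p\<^sup>k\<^sup>+\<^sup>1 c\<close> with \<open>z\<close> of length \<open>k + 1\<close>. Commuting with a
  lift of \<open>g \<in> O\<close> and cancelling \<open>p\<^sup>k\<^sup>+\<^sup>1\<close> gives \<open>\<Sum> z\<^sub>i\<^bsup>p\<^sup>k\<^sup>-\<^sup>i - 1\<^esup> {z\<^sub>i, g} = 0\<close> for all \<open>g\<close>. If this forces all \<open>z\<^sub>i\<close> to be \<open>p\<close>-th powers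
  of elements \<open>w\<^sub>i\<close>, then \<open>\<phi>(z)\<close> consists of the first terms of \<open>\<phi>(w)\<close> for a longer vector \<open>w\<close>, whose last entry is supplied
  by \<open>c\<close> (\<open>teich_surj\<close>).

  It remains to see that the one-form \<open>\<omega> = \<Sum> z\<^sub>i\<^bsup>p\<^sup>k\<^sup>-\<^sup>i - 1\<^esup> dz\<^sub>i\<close> is killed by the bracket only if the \<open>z\<^sub>i\<close> are \<open>p\<close>-th powers
  (\<open>logarithmic_radical\<close>). At the closed points of the symplectic leaf \<open>\<omega>\<close> vanishes as a covector. Such points avoid any
  given nonzero function (\<open>exists_maximalideal_avoiding\<close>, a form of the Nullstellensatz), so \<open>\<omega>(D) = 0\<close> for every
  derivation \<open>D\<close> of \<open>O\<close> over \<open>K\<close> (\<open>radical_covector_vanishes\<close>). Now let \<open>z \<in> O\<close> not be a \<open>p\<close>-th power. A subfield of the function field that contains the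
  \<open>p\<close>-th powers and is maximal without \<open>z\<close> has the property that \<open>1, z, \<dots>, z\<^sup>p\<^sup>-\<^sup>1\<close> is a basis of the function field over it. Up to a
  denominator, the derivative with respect to \<open>z\<close> is a derivation \<open>D\<close> of \<open>O\<close> with \<open>D z \<noteq> 0\<close>, and the coefficient of \<open>z\<^sup>p\<^sup>-\<^sup>1\<close> is a
  Cartier operator \<open>C\<close>: it kills derivatives, is linear over \<open>p\<close>-th powers, and satisfies \<open>e C(y\<^sup>p\<^sup>-\<^sup>1 D y) = (D y)\<^sup>p\<close> (\<open>cartier_formula\<close>).
  Applied to \<open>\<omega>(D) = 0\<close>, it yields the same equation with \<open>k\<close> lowered by one, and induction on \<open>k\<close> finishes the proof
  (\<open>cartier_descent\<close>). To avoid fraction fields, subfields are replaced throughout by their intersections with \<open>O\<close>, the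
  saturated subrings.
\<close>

section \<open>Universal Witt polynomials\<close>

text \<open>
  Write \<open>x = y + p\<^sup>k\<^sup>+\<^sup>1 d\<close>: the factor \<open>\<Sum> x\<^sup>i y\<^sup>p\<^sup>-\<^sup>1\<^sup>-\<^sup>i\<close> of \<open>x\<^sup>p - y\<^sup>p\<close> is a sum of
  \<open>p\<close> terms that are congruent modulo \<open>p\<close>, so the \<open>p\<close>-th power gains one more factor \<open>p\<close>.
\<close>

lemma dvd_diff_pow_p:
  fixes x y :: "'b::comm_ring_1"
  assumes "of_nat (p ^ Suc k) dvd x - y"
  shows "of_nat (p ^ Suc (Suc k)) dvd x ^ p - y ^ p"
proof -
  have p: "of_nat p dvd x - y"
    using assms by (metis dvd_mult_left of_nat_mult power_Suc)
  have "of_nat p dvd (\<Sum>i<p. y ^ (p - Suc i) * x ^ i - y ^ (p - Suc i) * y ^ i)"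
  proof (rule dvd_sum)
    fix i
    have "x - y dvd x ^ i - y ^ i"
      by (metis dvd_triv_left power_diff_sumr2)
    then show "of_nat p dvd y ^ (p - Suc i) * x ^ i - y ^ (p - Suc i) * y ^ i"
      using p by (metis dvd_mult dvd_trans right_diff_distrib)
  qed
  moreover have "(\<Sum>i<p. y ^ (p - Suc i) * y ^ i) = of_nat p * y ^ (p - 1)"
    by (simp flip: power_add)
  ultimately have "of_nat p dvd (\<Sum>i<p. y ^ (p - Suc i) * x ^ i)"
    using dvd_add[of "of_nat p" "(\<Sum>i<p. y ^ (p - Suc i) * x ^ i) - of_nat p * y ^ (p - 1)" "of_nat p * y ^ (p - 1)"]
    by (simp add: sum_subtractf)
  then have "of_nat (p ^ Suc k) * of_nat p dvd (x - y) * (\<Sum>i<p. y ^ (p - Suc i) * x ^ i)"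
    using assms by (rule mult_dvd_mono[rotated])
  then show ?thesis
    by (simp add: power_diff_sumr2 mult_ac)
qed

lemma dvd_diff_pow_p_pow:
  fixes x y :: "'b::comm_ring_1"
  assumes "of_nat p dvd x - y"
  shows "of_nat (p ^ Suc k) dvd x ^ (p ^ k) - y ^ (p ^ k)"
proof (induction k)
  case 0
  then show ?case using assms by simp
next
  case (Suc k)
  then show ?case
    using dvd_diff_pow_p[OF Suc] by (simp flip: power_mult add: mult.commute)
qed

lemma ghost_split: "ghost p x i = of_nat (p ^ i) * x i + (\<Sum>j<i. of_nat (p ^ j) * x j ^ (p ^ (i - j)))"
  unfolding ghost_def by (simp add: lessThan_Suc_atMost[symmetric] add.commute)

text \<open>
  By induction the components below \<open>i\<close> agree modulo \<open>p\<close>, so their contributions to the \<open>i\<close>-th ghost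
  component agree modulo \<open>p\<^sup>i\<^sup>+\<^sup>1\<close>, and what remains is \<open>p\<^sup>i\<close> times the \<open>i\<close>-th component.
\<close>

lemma ghost_cong_imp_cong:
  fixes x y :: "nat \<Rightarrow> 'b::comm_ring_1"
  assumes tf: "\<And>k a. of_nat (p ^ Suc k) dvd of_nat (p ^ k) * (a::'b) \<Longrightarrow> of_nat p dvd a"
    and w: "\<And>i. of_nat (p ^ Suc i) dvd ghost p x i - ghost p y i"
  shows "of_nat p dvd x i - y i"
proof (induction i rule: less_induct)
  case (less i)
  have "of_nat (p ^ Suc i) dvd (\<Sum>j<i. of_nat (p ^ j) * x j ^ (p ^ (i - j)) - of_nat (p ^ j) * y j ^ (p ^ (i - j)))"
  proof (rule dvd_sum)
    fix j assume "j \<in> {..<i}"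
    then have j: "j < i" by simp
    have "of_nat (p ^ j) * of_nat (p ^ Suc (i - j)) dvd
        (of_nat (p ^ j) * (x j ^ (p ^ (i - j)) - y j ^ (p ^ (i - j))) :: 'b)"
      by (intro mult_dvd_mono dvd_refl dvd_diff_pow_p_pow less j)
    moreover have "j + Suc (i - j) = Suc i" using j by simp
    ultimately show "of_nat (p ^ Suc i) dvd of_nat (p ^ j) * x j ^ (p ^ (i - j)) - of_nat (p ^ j) * y j ^ (p ^ (i - j))"
      by (metis of_nat_mult power_add right_diff_distrib)
  qed
  moreover have "of_nat (p ^ i) * (x i - y i) = (ghost p x i - ghost p y i) -
     (\<Sum>j<i. of_nat (p ^ j) * x j ^ (p ^ (i - j)) - of_nat (p ^ j) * y j ^ (p ^ (i - j)))"
    by (simp add: ghost_split sum_subtractf algebra_simps)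
  ultimately have "of_nat (p ^ Suc i) dvd of_nat (p ^ i) * (x i - y i)"
    by (simp only: dvd_diff[OF w])
  then show ?case by (rule tf)
qed

lemma ghost_inject:
  fixes x y :: "nat \<Rightarrow> 'b::comm_ring_1"
  assumes tf: "\<And>k a. of_nat (p ^ k) * (a::'b) = 0 \<Longrightarrow> a = 0"
    and w: "\<And>i. ghost p x i = ghost p y i"
  shows "x = y"
proof
  fix i show "x i = y i"
  proof (induction i rule: less_induct)
    case (less i)
    then have "(\<Sum>j<i. of_nat (p ^ j) * x j ^ (p ^ (i - j))) = (\<Sum>j<i. of_nat (p ^ j) * y j ^ (p ^ (i - j)))"
      by simp
    then have "of_nat (p ^ i) * (x i - y i) = 0"
      using w[of i] by (simp add: ghost_split algebra_simps)
    then show ?case using tf by force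
  qed
qed

text \<open>
  The criterion of Dwork: given a lift \<open>\<psi>\<close> of the Frobenius endomorphism, a sequence consists of the
  ghost components of some Witt vector as soon as each entry agrees with \<open>\<psi>\<close> of the previous one to the
  right \<open>p\<close>-adic precision.
\<close>

lemma dwork_criterion:
  fixes u :: "nat \<Rightarrow> 'b::comm_ring_1" and \<psi> :: "'b \<Rightarrow> 'b"
  assumes add: "\<And>a b. \<psi> (a + b) = \<psi> a + \<psi> b" and mult: "\<And>a b. \<psi> (a * b) = \<psi> a * \<psi> b"
    and one: "\<psi> 1 = 1"
    and frob: "\<And>a. of_nat p dvd \<psi> a - a ^ p"
    and u: "\<And>i. of_nat (p ^ Suc i) dvd u (Suc i) - \<psi> (u i)"
  shows "\<exists>S. \<forall>i. ghost p S i = u i"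
proof -
  define P where "P f i r \<longleftrightarrow> of_nat (p ^ i) * r + (\<Sum>j<i. of_nat (p ^ j) * f j ^ (p ^ (i - j))) = u i"
    for f i r
  have zero: "\<psi> 0 = 0" using add[of 0 0] by simp
  have pow: "\<psi> (a ^ n) = \<psi> a ^ n" for a n by (induction n) (simp_all add: mult one)
  have nat: "\<psi> (of_nat n) = of_nat n" for n by (induction n) (simp_all add: add one zero)
  have sum: "\<psi> (\<Sum>j\<in>J. g j) = (\<Sum>j\<in>J. \<psi> (g j))" if "finite J" for g and J :: "nat set"
    using that by (induction J) (simp_all add: add zero)
  have "\<exists>f. \<forall>i. P f i (f i)"
  proof (rule dependent_wf_choice[of "{(x, y). x < (y::nat)}"])
    show "wf {(x, y). x < (y::nat)}" by (rule wf_less)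
    show "P f x r = P g x r" if "\<And>z. (z, x) \<in> {(x, y). x < y} \<Longrightarrow> f z = g z" for f g x r
      using that by (simp add: P_def)
    show "\<exists>r. P f x r" if f: "\<And>y. (y, x) \<in> {(x, y). x < y} \<Longrightarrow> P f y (f y)" for x f
    proof (cases x)
      case 0
      then show ?thesis by (auto simp: P_def)
    next
      case (Suc i)
      have "ghost p f i = u i"
        using f[of i] Suc by (simp add: P_def ghost_split)
      then have "\<psi> (u i) = \<psi> (ghost p f i)" by simp
      also have "\<dots> = (\<Sum>j<x. of_nat (p ^ j) * \<psi> (f j) ^ (p ^ (i - j)))"
        unfolding ghost_def by (subst sum) (simp_all add: mult pow nat Suc lessThan_Suc_atMost del: of_nat_power)
      finally have \<psi>u: "\<psi> (u i) = \<dots>" .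
      have "of_nat (p ^ x) dvd (\<Sum>j<x. of_nat (p ^ j) * \<psi> (f j) ^ (p ^ (i - j)) - of_nat (p ^ j) * f j ^ (p ^ (x - j)))"
      proof (rule dvd_sum)
        fix j assume "j \<in> {..<x}"
        then have j: "j < x" by simp
        then have e: "x - j = Suc (i - j)" "j + Suc (i - j) = x" using Suc by auto
        have "of_nat (p ^ j) * of_nat (p ^ Suc (i - j)) dvd
            (of_nat (p ^ j) * (\<psi> (f j) ^ (p ^ (i - j)) - (f j ^ p) ^ (p ^ (i - j))))"
          by (intro mult_dvd_mono dvd_refl dvd_diff_pow_p_pow frob)
        then show "of_nat (p ^ x) dvd of_nat (p ^ j) * \<psi> (f j) ^ (p ^ (i - j)) - of_nat (p ^ j) * f j ^ (p ^ (x - j))"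
          using e by (metis of_nat_mult power_add right_diff_distrib power_mult power_Suc)
      qed
      then have "of_nat (p ^ x) dvd \<psi> (u i) - (\<Sum>j<x. of_nat (p ^ j) * f j ^ (p ^ (x - j)))"
        by (simp add: \<psi>u sum_subtractf)
      then have "of_nat (p ^ x) dvd (u x - \<psi> (u i)) + (\<psi> (u i) - (\<Sum>j<x. of_nat (p ^ j) * f j ^ (p ^ (x - j))))"
        using u[of i] Suc by (metis dvd_add)
      then obtain r where "u x - (\<Sum>j<x. of_nat (p ^ j) * f j ^ (p ^ (x - j))) = of_nat (p ^ x) * r"
        by (auto elim!: dvdE simp: algebra_simps)
      then show ?thesis by (auto simp: P_def algebra_simps)
    qed
  qed
  then show ?thesis by (auto simp: P_def ghost_split)
qed

lemma of_nat_mult_frag: "of_nat c * f = frag_cmul (int c) f" for f :: witt_poly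
  by (induction c) (simp_all add: algebra_simps frag_cmul_distrib)

lemma witt_poly_torsion_free: "c > 0 \<Longrightarrow> of_nat c * f = 0 \<Longrightarrow> f = 0" for f :: witt_poly
  by (simp add: of_nat_mult_frag)

lemma witt_poly_cancel: "c > 0 \<Longrightarrow> of_nat c * f = of_nat c * g \<Longrightarrow> f = g" for f g :: witt_poly
  using witt_poly_torsion_free[of c "f - g"] by (simp add: algebra_simps)

lemma witt_poly_induct [case_names monom diff]:
  fixes f :: witt_poly
  assumes "\<And>\<alpha>. P (Poly_Mapping.single \<alpha> 1)" and "\<And>f g. P f \<Longrightarrow> P g \<Longrightarrow> P (f - g)"
  shows "P f"
proof (rule frag_induction[of f UNIV])
  show "P 0" using assms(2)[OF assms(1) assms(1), of 0 0] by simp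
qed (use assms in auto)

text \<open>
  The substitution \<open>x \<mapsto> x\<^sup>c\<close> on exponent vectors.
\<close>

definition scale_monom :: "nat \<Rightarrow> ((nat + nat) \<Rightarrow>\<^sub>0 nat) \<Rightarrow> ((nat + nat) \<Rightarrow>\<^sub>0 nat)" where
  "scale_monom c \<alpha> = Poly_Mapping.map ((*) c) \<alpha>"

lemma lookup_scale_monom [simp]: "Poly_Mapping.lookup (scale_monom c \<alpha>) v = c * Poly_Mapping.lookup \<alpha> v"
  by (simp add: scale_monom_def map.rep_eq when_def)

lemma scale_monom_add: "scale_monom c (\<alpha> + \<beta>) = scale_monom c \<alpha> + scale_monom c \<beta>"
  by (rule poly_mapping_eqI) (simp add: lookup_add algebra_simps)

lemma single_power: "Poly_Mapping.single \<alpha> c ^ n = Poly_Mapping.single (scale_monom n \<alpha>) (c ^ n)"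
  for c :: int
proof (induction n)
  case 0
  have "scale_monom 0 \<alpha> = 0" by (rule poly_mapping_eqI) simp
  then show ?case by simp
next
  case (Suc n)
  have "scale_monom (Suc n) \<alpha> = \<alpha> + scale_monom n \<alpha>"
    by (rule poly_mapping_eqI) (simp add: lookup_add)
  then show ?case using Suc by (simp add: mult_single)
qed

text \<open>
  The lift of Frobenius that raises each indeterminate to the \<open>p\<close>-th power and fixes the coefficients.
\<close>

definition poly_frob :: "nat \<Rightarrow> witt_poly \<Rightarrow> witt_poly" where
  "poly_frob p = frag_extend (\<lambda>\<alpha>. Poly_Mapping.single (scale_monom p \<alpha>) 1)"

lemma poly_frob_single [simp]: "poly_frob p (Poly_Mapping.single \<alpha> 1) = Poly_Mapping.single (scale_monom p \<alpha>) 1"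
  by (simp add: poly_frob_def)

lemma poly_frob_diff: "poly_frob p (f - g) = poly_frob p f - poly_frob p g"
  by (simp add: poly_frob_def frag_extend_diff)

lemma poly_frob_add: "poly_frob p (f + g) = poly_frob p f + poly_frob p g"
  by (simp add: poly_frob_def frag_extend_add)

lemma poly_frob_mult: "poly_frob p (f * g) = poly_frob p f * poly_frob p g"
proof (induction f rule: witt_poly_induct)
  case (monom \<alpha>)
  show ?case
  proof (induction g rule: witt_poly_induct)
    case (monom \<beta>)
    show ?case by (simp add: mult_single scale_monom_add)
  next
    case (diff f g)
    then show ?case by (simp add: right_diff_distrib poly_frob_diff)
  qed
next
  case (diff f g)
  then show ?case by (simp add: left_diff_distrib poly_frob_diff)
qed

lemma poly_frob_one: "poly_frob p 1 = 1"
proof -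
  have "scale_monom p 0 = 0" by (rule poly_mapping_eqI) simp
  then show ?thesis using poly_frob_single[of p 0] by simp
qed

lemma prime_dvd_frob_add:
  fixes x y :: "'b::comm_ring_1"
  assumes "Factorial_Ring.prime p"
  shows "of_nat p dvd (x + y) ^ p - x ^ p - y ^ p"
proof -
  have p: "p > 0" using assms prime_gt_0_nat by blast
  have "(x + y) ^ p = (\<Sum>k\<le>p. of_nat (p choose k) * x ^ k * y ^ (p - k))"
    by (rule binomial_ring)
  also have "{..p} = insert 0 (insert p {0<..<p})" using p by auto
  also have "(\<Sum>k\<in>\<dots>. of_nat (p choose k) * x ^ k * y ^ (p - k)) =
     y ^ p + x ^ p + (\<Sum>k\<in>{0<..<p}. of_nat (p choose k) * x ^ k * y ^ (p - k))"
    using p by simp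
  finally have "(x + y) ^ p - x ^ p - y ^ p = (\<Sum>k\<in>{0<..<p}. of_nat (p choose k) * x ^ k * y ^ (p - k))"
    by simp
  also have "of_nat p dvd \<dots>"
  proof (rule dvd_sum)
    fix k assume "k \<in> {0<..<p}"
    then have "p dvd p choose k"
      using assms by (intro dvd_choose_prime) auto
    then obtain q where "p choose k = p * q" by (rule dvdE)
    then show "of_nat p dvd (of_nat (p choose k) * x ^ k * y ^ (p - k) :: 'b)"
      by (simp add: mult.assoc)
  qed
  finally show ?thesis .
qed

lemma poly_frob_cong:
  assumes p: "Factorial_Ring.prime p" "odd p"
  shows "of_nat p dvd poly_frob p f - f ^ p"
proof (induction f rule: witt_poly_induct)
  case (monom \<alpha>)
  then show ?case by (simp add: single_power)
next
  case (diff f g)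
  have "of_nat p dvd (f + (- g)) ^ p - f ^ p - (- g) ^ p"
    by (rule prime_dvd_frob_add[OF p(1)])
  moreover have "(- g) ^ p = - (g ^ p)" using p(2) by simp
  ultimately have "of_nat p dvd (f - g) ^ p - f ^ p + g ^ p" by simp
  then have "of_nat p dvd (poly_frob p f - f ^ p) - (poly_frob p g - g ^ p) - ((f - g) ^ p - f ^ p + g ^ p)"
    by (rule dvd_diff[OF dvd_diff[OF diff]])
  then show ?case by (simp add: poly_frob_diff algebra_simps)
qed

lemma ghost_indet_frob: "ghost p (\<lambda>j. indet (f j)) (Suc i) =
    poly_frob p (ghost p (\<lambda>j. indet (f j)) i) + of_nat (p ^ Suc i) * indet (f (Suc i))"
proof -
  have pow: "poly_frob p (a ^ n) = poly_frob p a ^ n" for a n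
    by (induction n) (simp_all add: poly_frob_mult poly_frob_one)
  have zero: "poly_frob p 0 = 0" using poly_frob_diff[of p 0 0] by simp
  have nat: "poly_frob p (of_nat n) = of_nat n" for n
    by (induction n) (simp_all add: poly_frob_add poly_frob_one zero)
  have sum: "poly_frob p (\<Sum>j\<in>J. g j) = (\<Sum>j\<in>J. poly_frob p (g j))" if "finite J" for g and J :: "nat set"
    using that by (induction J) (simp_all add: poly_frob_add zero)
  have ind: "poly_frob p (indet v) = indet v ^ p" for v
    by (simp add: indet_def single_power)
  have "poly_frob p (ghost p (\<lambda>j. indet (f j)) i) = (\<Sum>j\<le>i. of_nat (p ^ j) * indet (f j) ^ (p ^ (Suc i - j)))"
    unfolding ghost_def
    by (subst sum) (auto simp: poly_frob_mult pow nat ind Suc_diff_le simp flip: power_mult intro!: sum.cong simp del: of_nat_power)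
  then show ?thesis by (simp add: ghost_def)
qed

text \<open>
  Existence is Dwork's criterion for \<open>poly_frob\<close>; uniqueness holds as the ghost map is injective over a ring
  without torsion.
\<close>

lemma witt_polys_exist_unique:
  assumes p: "Factorial_Ring.prime p" "odd p"
    and u: "\<And>i. of_nat (p ^ Suc i) dvd u (Suc i) - poly_frob p (u i)"
  shows "\<exists>!S. \<forall>i. ghost p S i = u i"
proof -
  have "\<exists>S. \<forall>i. ghost p S i = u i"
    by (rule dwork_criterion[where \<psi> = "poly_frob p"])
       (use u poly_frob_cong[OF p] in \<open>simp_all add: poly_frob_add poly_frob_mult poly_frob_one\<close>)
  moreover have "S = T" if "\<forall>i. ghost p S i = u i" "\<forall>i. ghost p T i = u i" for S T
  proof (rule ghost_inject[of p])
    show "a = 0" if "of_nat (p ^ k) * a = 0" for k and a :: witt_poly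
      using that witt_poly_torsion_free[of "p ^ k" a] prime_gt_0_nat[OF p(1)] by simp
  qed (use that in simp)
  ultimately show ?thesis by auto
qed

lemma ghost_witt_sum_poly:
  assumes p: "Factorial_Ring.prime p" "odd p"
  shows "ghost p (witt_sum_poly p) i = ghost p (\<lambda>j. indet (Inl j)) i + ghost p (\<lambda>j. indet (Inr j)) i"
proof -
  have "\<exists>!S. \<forall>i. ghost p S i = ghost p (\<lambda>j. indet (Inl j)) i + ghost p (\<lambda>j. indet (Inr j)) i"
    by (rule witt_polys_exist_unique[OF p])
       (simp add: ghost_indet_frob poly_frob_add flip: distrib_left)
  from theI'[OF this] show ?thesis unfolding witt_sum_poly_def by blast
qed

lemma ghost_witt_prod_poly:
  assumes p: "Factorial_Ring.prime p" "odd p"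
  shows "ghost p (witt_prod_poly p) i = ghost p (\<lambda>j. indet (Inl j)) i * ghost p (\<lambda>j. indet (Inr j)) i"
proof -
  have "\<exists>!S. \<forall>i. ghost p S i = ghost p (\<lambda>j. indet (Inl j)) i * ghost p (\<lambda>j. indet (Inr j)) i"
  proof (rule witt_polys_exist_unique[OF p])
    fix i
    define a b x y where ab: "a = poly_frob p (ghost p (\<lambda>j. indet (Inl j)) i)" "b = poly_frob p (ghost p (\<lambda>j. indet (Inr j)) i)"
      "x = indet (Inl (Suc i))" "y = indet (Inr (Suc i))"
    define c :: witt_poly where "c = of_nat (p ^ Suc i)"
    have "(a + c * x) * (b + c * y) - a * b = c * (x * b + a * y + c * x * y)"
      by (simp add: algebra_simps)
    then show "of_nat (p ^ Suc i) dvd ghost p (\<lambda>j. indet (Inl j)) (Suc i) * ghost p (\<lambda>j. indet (Inr j)) (Suc i) -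
          poly_frob p (ghost p (\<lambda>j. indet (Inl j)) i * ghost p (\<lambda>j. indet (Inr j)) i)"
      unfolding ghost_indet_frob poly_frob_mult ab[symmetric] c_def[symmetric] by simp
  qed
  from theI'[OF this] show ?thesis unfolding witt_prod_poly_def by blast
qed

subsection \<open>Indeterminates of the Witt polynomials\<close>

text \<open>
  Bounds the indeterminates that occur: Witt polynomials are evaluated at finite vectors, so they must not involve
  indeterminates beyond their own index.
\<close>

definition polys_in :: "(nat + nat) set \<Rightarrow> witt_poly set" where
  "polys_in V = {f. \<forall>\<alpha>\<in>Poly_Mapping.keys f. Poly_Mapping.keys \<alpha> \<subseteq> V}"

lemma polys_in_mono: "V \<subseteq> W \<Longrightarrow> polys_in V \<subseteq> polys_in W"
  by (auto simp: polys_in_def)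

lemma polys_in_add: "f \<in> polys_in V \<Longrightarrow> g \<in> polys_in V \<Longrightarrow> f + g \<in> polys_in V"
  using Poly_Mapping.keys_add[of f g] by (force simp: polys_in_def)

lemma polys_in_diff: "f \<in> polys_in V \<Longrightarrow> g \<in> polys_in V \<Longrightarrow> f - g \<in> polys_in V"
  using keys_diff[of f g] by (force simp: polys_in_def)

lemma polys_in_mult: 
  assumes "f \<in> polys_in V" "g \<in> polys_in V" shows "f * g \<in> polys_in V"
  unfolding polys_in_def
proof (intro CollectI ballI)
  fix \<alpha> assume "\<alpha> \<in> Poly_Mapping.keys (f * g)"
  then obtain a b where "\<alpha> = a + b" "a \<in> Poly_Mapping.keys f" "b \<in> Poly_Mapping.keys g"
    using keys_mult[of f g] by blast
  then show "Poly_Mapping.keys \<alpha> \<subseteq> V"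
    using assms Poly_Mapping.keys_add[of a b] by (force simp: polys_in_def)
qed

lemma polys_in_one: "1 \<in> polys_in V"
  by (auto simp: polys_in_def)

lemma polys_in_zero: "0 \<in> polys_in V"
  by (auto simp: polys_in_def)

lemma polys_in_power: "f \<in> polys_in V \<Longrightarrow> f ^ n \<in> polys_in V"
  by (induction n) (simp_all add: polys_in_one polys_in_mult)

lemma polys_in_of_nat: "of_nat n \<in> polys_in V"
  by (induction n) (simp_all add: polys_in_one polys_in_zero polys_in_add)

lemma polys_in_sum: "(\<And>j. j \<in> J \<Longrightarrow> f j \<in> polys_in V) \<Longrightarrow> sum f J \<in> polys_in V"
  by (induction J rule: infinite_finite_induct) (auto simp: polys_in_zero polys_in_add)

lemma polys_in_cancel: "c > 0 \<Longrightarrow> of_nat c * f \<in> polys_in V \<Longrightarrow> f \<in> polys_in V"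
  by (auto simp: polys_in_def of_nat_mult_frag)

lemma polys_in_indet: "v \<in> V \<Longrightarrow> indet v \<in> polys_in V"
  by (auto simp: polys_in_def indet_def)

lemma polys_in_ghost: "(\<And>j. j \<le> i \<Longrightarrow> x j \<in> polys_in V) \<Longrightarrow> ghost p x i \<in> polys_in V"
  unfolding ghost_def by (intro polys_in_sum polys_in_mult polys_in_of_nat polys_in_power) auto

definition vars_upto :: "nat \<Rightarrow> (nat + nat) set" where
  "vars_upto i = Inl ` {..i} \<union> Inr ` {..i}"

lemma ghost_polys_in:
  assumes p: "p > 0" and u: "\<And>i. ghost p S i \<in> polys_in (vars_upto i)"
  shows "S i \<in> polys_in (vars_upto i)"
proof (induction i rule: less_induct)
  case (less i)
  have "S j \<in> polys_in (vars_upto i)" if "j < i" for j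
    using less[OF that] polys_in_mono[of "vars_upto j" "vars_upto i"] that by (fastforce simp: vars_upto_def)
  then have "ghost p S i - (\<Sum>j<i. of_nat (p ^ j) * S j ^ (p ^ (i - j))) \<in> polys_in (vars_upto i)"
    by (intro polys_in_diff u polys_in_sum polys_in_mult polys_in_of_nat polys_in_power) auto
  then have "of_nat (p ^ i) * S i \<in> polys_in (vars_upto i)"
    by (simp add: ghost_split)
  then show ?case
    using p polys_in_cancel[of "p ^ i" "S i"] by simp
qed

lemma witt_sum_poly_in:
  assumes p: "Factorial_Ring.prime p" "odd p"
  shows "witt_sum_poly p i \<in> polys_in (vars_upto i)"
proof (rule ghost_polys_in[of p])
  show "p > 0" using p(1) by (rule prime_gt_0_nat)
  show "ghost p (witt_sum_poly p) i \<in> polys_in (vars_upto i)" for i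
    unfolding ghost_witt_sum_poly[OF p]
    by (intro polys_in_add polys_in_ghost polys_in_indet) (auto simp: vars_upto_def)
qed

lemma witt_prod_poly_in:
  assumes p: "Factorial_Ring.prime p" "odd p"
  shows "witt_prod_poly p i \<in> polys_in (vars_upto i)"
proof (rule ghost_polys_in[of p])
  show "p > 0" using p(1) by (rule prime_gt_0_nat)
  show "ghost p (witt_prod_poly p) i \<in> polys_in (vars_upto i)" for i
    unfolding ghost_witt_prod_poly[OF p]
    by (intro polys_in_mult polys_in_ghost polys_in_indet) (auto simp: vars_upto_def)
qed

section \<open>Evaluation of integer polynomials\<close>

text \<open>
  The additive extension of a family \<open>\<mu>\<close> to finite formal integer combinations. It serves both for
  evaluating integer polynomials and for maps out of free abelian groups.
\<close>

definition frag_sum :: "('a, 'm) ring_scheme \<Rightarrow> ('x \<Rightarrow> 'a) \<Rightarrow> ('x \<Rightarrow>\<^sub>0 int) \<Rightarrow> 'a" where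
  "frag_sum G \<mu> q = (\<Oplus>\<^bsub>G\<^esub>x\<in>Poly_Mapping.keys q. add_pow G (Poly_Mapping.lookup q x) (\<mu> x))"

context abelian_group
begin

lemma frag_sum_superset:
  assumes \<mu>: "\<And>x. \<mu> x \<in> carrier G" and S: "finite S" "Poly_Mapping.keys q \<subseteq> S"
  shows "frag_sum G \<mu> q = (\<Oplus>x\<in>S. add_pow G (Poly_Mapping.lookup q x) (\<mu> x))"
  unfolding frag_sum_def
proof (rule add.finprod_mono_neutral_cong_left[OF S])
  show "add_pow G (Poly_Mapping.lookup q i) (\<mu> i) = \<zero>" if "i \<in> S - Poly_Mapping.keys q" for i
    using that \<mu> by (simp add: in_keys_iff add_pow_def)
qed (use \<mu> in auto)

lemma frag_sum_closed: "(\<And>x. \<mu> x \<in> carrier G) \<Longrightarrow> frag_sum G \<mu> q \<in> carrier G"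
  unfolding frag_sum_def by (rule finsum_closed) auto

lemma frag_sum_single:
  assumes \<mu>: "\<And>x. \<mu> x \<in> carrier G"
  shows "frag_sum G \<mu> (Poly_Mapping.single x c) = add_pow G c (\<mu> x)"
  using \<mu> frag_sum_superset[OF \<mu>, of "{x}" "Poly_Mapping.single x c"] 
  by simp

lemma frag_sum_add:
  assumes \<mu>: "\<And>x. \<mu> x \<in> carrier G"
  shows "frag_sum G \<mu> (q + r) = frag_sum G \<mu> q \<oplus> frag_sum G \<mu> r"
proof -
  let ?S = "Poly_Mapping.keys q \<union> Poly_Mapping.keys r"
  have "frag_sum G \<mu> (q + r) = (\<Oplus>x\<in>?S. add_pow G (Poly_Mapping.lookup (q + r) x) (\<mu> x))"
    using Poly_Mapping.keys_add[of q r] by (intro frag_sum_superset \<mu>) auto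
  also have "\<dots> = (\<Oplus>x\<in>?S. add_pow G (Poly_Mapping.lookup q x) (\<mu> x) \<oplus> add_pow G (Poly_Mapping.lookup r x) (\<mu> x))"
    using \<mu> by (intro finsum_cong') (auto simp: lookup_add add.int_pow_mult)
  also have "\<dots> = (\<Oplus>x\<in>?S. add_pow G (Poly_Mapping.lookup q x) (\<mu> x)) \<oplus> (\<Oplus>x\<in>?S. add_pow G (Poly_Mapping.lookup r x) (\<mu> x))"
    using \<mu> by (intro finsum_addf) auto
  also have "\<dots> = frag_sum G \<mu> q \<oplus> frag_sum G \<mu> r"
    using frag_sum_superset[OF \<mu>, of ?S q] frag_sum_superset[OF \<mu>, of ?S r] by simp
  finally show ?thesis .
qed

lemma frag_sum_zero: "frag_sum G \<mu> 0 = \<zero>"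
  by (simp add: frag_sum_def)

lemma frag_sum_diff:
  assumes \<mu>: "\<And>x. \<mu> x \<in> carrier G"
  shows "frag_sum G \<mu> (q - r) = frag_sum G \<mu> q \<ominus> frag_sum G \<mu> r"
proof -
  have "frag_sum G \<mu> q = frag_sum G \<mu> (q - r) \<oplus> frag_sum G \<mu> r"
    using frag_sum_add[of \<mu> "q - r" r, OF \<mu>] by simp
  then show ?thesis
    using frag_sum_closed[of \<mu>, OF \<mu>] by (simp add: a_minus_def a_assoc r_neg)
qed

lemma frag_sum_sum:
  assumes \<mu>: "\<And>x. \<mu> x \<in> carrier G" and "finite J"
  shows "frag_sum G \<mu> (\<Sum>j\<in>J. q j) = (\<Oplus>j\<in>J. frag_sum G \<mu> (q j))"
  using assms(2) by (induction J) (simp_all add: frag_sum_zero frag_sum_add[OF \<mu>] frag_sum_closed[OF \<mu>])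

lemma frag_sum_of_nat_mult:
  fixes q :: "('x::monoid_add) \<Rightarrow>\<^sub>0 int"
  assumes \<mu>: "\<And>x. \<mu> x \<in> carrier G"
  shows "frag_sum G \<mu> (of_nat c * q) = add_pow G c (frag_sum G \<mu> q)"
proof (induction c)
  case (Suc c)
  then show ?case
    using frag_sum_closed[of \<mu> q, OF \<mu>] by (simp add: distrib_right frag_sum_add[OF \<mu>] a_comm)
qed (simp add: frag_sum_zero)

end

definition monom_val :: "('a, 'm) ring_scheme \<Rightarrow> (nat + nat \<Rightarrow> 'a) \<Rightarrow> (nat + nat \<Rightarrow>\<^sub>0 nat) \<Rightarrow> 'a" where
  "monom_val R v \<alpha> = (\<Otimes>\<^bsub>R\<^esub>x\<in>Poly_Mapping.keys \<alpha>. v x [^]\<^bsub>R\<^esub> Poly_Mapping.lookup \<alpha> x)"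

lemma eval_witt_poly_frag_sum: "eval_witt_poly R v = frag_sum R (monom_val R v)"
  by (rule ext) (simp add: eval_witt_poly_def frag_sum_def monom_val_def)

context cring
begin

lemma monom_val_closed: "(\<And>x. v x \<in> carrier R) \<Longrightarrow> monom_val R v \<alpha> \<in> carrier R"
  unfolding monom_val_def by (rule finprod_closed) auto

lemma monom_val_superset:
  assumes v: "\<And>x. v x \<in> carrier R" and S: "finite S" "Poly_Mapping.keys \<alpha> \<subseteq> S"
  shows "monom_val R v \<alpha> = (\<Otimes>x\<in>S. v x [^] Poly_Mapping.lookup \<alpha> x)"
  unfolding monom_val_def
proof (rule finprod_mono_neutral_cong_left[OF S])
  show "v i [^] Poly_Mapping.lookup \<alpha> i = \<one>" if "i \<in> S - Poly_Mapping.keys \<alpha>" for i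
    using that by (simp add: in_keys_iff)
qed (use v in auto)

lemma monom_val_add:
  assumes v: "\<And>x. v x \<in> carrier R"
  shows "monom_val R v (\<alpha> + \<beta>) = monom_val R v \<alpha> \<otimes> monom_val R v \<beta>"
proof -
  let ?S = "Poly_Mapping.keys \<alpha> \<union> Poly_Mapping.keys \<beta>"
  have "monom_val R v (\<alpha> + \<beta>) = (\<Otimes>x\<in>?S. v x [^] Poly_Mapping.lookup (\<alpha> + \<beta>) x)"
    using Poly_Mapping.keys_add[of \<alpha> \<beta>] by (intro monom_val_superset v) auto
  also have "\<dots> = (\<Otimes>x\<in>?S. v x [^] Poly_Mapping.lookup \<alpha> x \<otimes> v x [^] Poly_Mapping.lookup \<beta> x)"
    using v by (intro finprod_cong') (auto simp: lookup_add nat_pow_mult)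
  also have "\<dots> = (\<Otimes>x\<in>?S. v x [^] Poly_Mapping.lookup \<alpha> x) \<otimes> (\<Otimes>x\<in>?S. v x [^] Poly_Mapping.lookup \<beta> x)"
    using v by (intro finprod_multf) auto
  also have "\<dots> = monom_val R v \<alpha> \<otimes> monom_val R v \<beta>"
    using monom_val_superset[OF v, of ?S \<alpha>] monom_val_superset[OF v, of ?S \<beta>] by simp
  finally show ?thesis .
qed

lemma eval_witt_poly_closed:
  "(\<And>x. v x \<in> carrier R) \<Longrightarrow> eval_witt_poly R v q \<in> carrier R"
  by (simp add: eval_witt_poly_frag_sum frag_sum_closed monom_val_closed)

lemma eval_witt_poly_add:
  "(\<And>x. v x \<in> carrier R) \<Longrightarrow> eval_witt_poly R v (q + r) = eval_witt_poly R v q \<oplus> eval_witt_poly R v r"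
  by (simp add: eval_witt_poly_frag_sum frag_sum_add monom_val_closed)

lemma eval_witt_poly_diff:
  "(\<And>x. v x \<in> carrier R) \<Longrightarrow> eval_witt_poly R v (q - r) = eval_witt_poly R v q \<ominus> eval_witt_poly R v r"
  by (simp add: eval_witt_poly_frag_sum frag_sum_diff monom_val_closed)

lemma eval_witt_poly_single:
  "(\<And>x. v x \<in> carrier R) \<Longrightarrow> eval_witt_poly R v (Poly_Mapping.single \<alpha> c) = add_pow R c (monom_val R v \<alpha>)"
  by (simp add: eval_witt_poly_frag_sum frag_sum_single monom_val_closed)

lemma eval_witt_poly_mult:
  assumes v: "\<And>x. v x \<in> carrier R"
  shows "eval_witt_poly R v (q * r) = eval_witt_poly R v q \<otimes> eval_witt_poly R v r"
proof (induction q rule: witt_poly_induct)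
  case (monom \<alpha>)
  show ?case
  proof (induction r rule: witt_poly_induct)
    case (monom \<beta>)
    show ?case by (simp add: mult_single eval_witt_poly_single[OF v] monom_val_add[OF v] monom_val_closed[OF v])
  next
    case (diff f g)
    then show ?case
      by (simp add: right_diff_distrib eval_witt_poly_diff[OF v] eval_witt_poly_closed[OF v] a_minus_def r_distr r_minus)
  qed
next
  case (diff f g)
  then show ?case
    by (simp add: left_diff_distrib eval_witt_poly_diff[OF v] eval_witt_poly_closed[OF v] a_minus_def l_distr l_minus)
qed

lemma eval_witt_poly_one: "(\<And>x. v x \<in> carrier R) \<Longrightarrow> eval_witt_poly R v 1 = \<one>"
  using eval_witt_poly_single[of v 0 1] by (simp add: monom_val_def)

lemma eval_witt_poly_power:
  "(\<And>x. v x \<in> carrier R) \<Longrightarrow> eval_witt_poly R v (q ^ n) = eval_witt_poly R v q [^] n"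
  by (induction n) (simp_all add: eval_witt_poly_one eval_witt_poly_mult m_comm eval_witt_poly_closed)

lemma eval_witt_poly_of_nat_mult:
  "(\<And>x. v x \<in> carrier R) \<Longrightarrow> eval_witt_poly R v (of_nat c * q) = add_pow R c (eval_witt_poly R v q)"
  by (simp add: eval_witt_poly_frag_sum frag_sum_of_nat_mult monom_val_closed)

lemma eval_witt_poly_indet:
  assumes v: "\<And>x. v x \<in> carrier R"
  shows "eval_witt_poly R v (indet x) = v x"
  using v unfolding indet_def by (simp add: eval_witt_poly_single monom_val_def finprod_singleton)

text \<open>
  Indeterminates whose index exceeds the length of a Witt vector carry no specified value; by the bound on
  the support of the Witt polynomials they may be given any.
\<close>

lemma eval_witt_poly_cong:
  assumes q: "q \<in> polys_in V" and v: "\<And>x. v x \<in> carrier R" and w: "\<And>x. x \<in> V \<Longrightarrow> w x = v x"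
  shows "eval_witt_poly R w q = eval_witt_poly R v q"
  unfolding eval_witt_poly_frag_sum frag_sum_def
proof (rule finsum_cong'[OF refl])
  show "(\<lambda>x. add_pow R (Poly_Mapping.lookup q x) (monom_val R v x)) \<in> Poly_Mapping.keys q \<rightarrow> carrier R"
    using monom_val_closed[OF v] by auto
  fix \<alpha> assume "\<alpha> \<in> Poly_Mapping.keys q"
  then have "Poly_Mapping.keys \<alpha> \<subseteq> V" using q by (auto simp: polys_in_def)
  then have "monom_val R w \<alpha> = monom_val R v \<alpha>"
    unfolding monom_val_def using w v by (intro finprod_cong') auto
  then show "add_pow R (Poly_Mapping.lookup q \<alpha>) (monom_val R w \<alpha>) = add_pow R (Poly_Mapping.lookup q \<alpha>) (monom_val R v \<alpha>)"
    by simp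
qed

end

text \<open>The polynomials themselves form a ring record, and evaluation in it is substitution.\<close>

definition witt_poly_ring :: "witt_poly ring" where
  "witt_poly_ring = \<lparr>carrier = UNIV, monoid.mult = (*), monoid.one = 1, ring.zero = 0, ring.add = (+)\<rparr>"

lemma witt_poly_ring_simps [simp]:
  "carrier witt_poly_ring = UNIV" "monoid.mult witt_poly_ring = (*)" "monoid.one witt_poly_ring = 1"
  "ring.zero witt_poly_ring = 0" "ring.add witt_poly_ring = (+)"
  by (simp_all add: witt_poly_ring_def)

lemma cring_witt_poly_ring: "cring witt_poly_ring"
proof (rule cringI)
  show "abelian_group witt_poly_ring"
  proof (rule abelian_groupI)
    show "\<exists>y\<in>carrier witt_poly_ring. y \<oplus>\<^bsub>witt_poly_ring\<^esub> x = \<zero>\<^bsub>witt_poly_ring\<^esub>" for x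
      by (auto intro!: exI[of _ "- x"])
  qed (simp_all add: algebra_simps)
  show "Group.comm_monoid witt_poly_ring"
    by (rule comm_monoidI) (simp_all add: algebra_simps)
qed (simp_all add: algebra_simps)

definition subst_poly :: "(nat + nat \<Rightarrow> witt_poly) \<Rightarrow> witt_poly \<Rightarrow> witt_poly" where
  "subst_poly = eval_witt_poly witt_poly_ring"

lemma subst_poly_add: "subst_poly s (q + r) = subst_poly s q + subst_poly s r"
  using cring.eval_witt_poly_add[OF cring_witt_poly_ring, of s] by (simp add: subst_poly_def)

lemma subst_poly_mult: "subst_poly s (q * r) = subst_poly s q * subst_poly s r"
  using cring.eval_witt_poly_mult[OF cring_witt_poly_ring, of s] by (simp add: subst_poly_def)

lemma subst_poly_one: "subst_poly s 1 = 1"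
  using cring.eval_witt_poly_one[OF cring_witt_poly_ring, of s] by (simp add: subst_poly_def)

lemma subst_poly_indet: "subst_poly s (indet x) = s x"
  using cring.eval_witt_poly_indet[OF cring_witt_poly_ring, of s] by (simp add: subst_poly_def)

lemma subst_poly_diff: "subst_poly s (q - r) = subst_poly s q - subst_poly s r"
  using subst_poly_add[of s "q - r" r] by simp

lemma subst_poly_zero: "subst_poly s 0 = 0"
  using subst_poly_diff[of s 0 0] by simp

lemma subst_poly_of_nat: "subst_poly s (of_nat n) = of_nat n"
  by (induction n) (simp_all add: subst_poly_zero subst_poly_one subst_poly_add)

lemma subst_poly_power: "subst_poly s (q ^ n) = subst_poly s q ^ n"
  by (induction n) (simp_all add: subst_poly_one subst_poly_mult)

lemma subst_poly_sum: "finite J \<Longrightarrow> subst_poly s (\<Sum>j\<in>J. q j) = (\<Sum>j\<in>J. subst_poly s (q j))"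
  by (induction J rule: finite_induct) (simp_all add: subst_poly_zero subst_poly_add)

lemma subst_poly_ghost: "subst_poly s (ghost p x i) = ghost p (\<lambda>j. subst_poly s (x j)) i"
  unfolding ghost_def by (simp add: subst_poly_sum subst_poly_mult subst_poly_of_nat subst_poly_power del: of_nat_power)

lemma monom_as_indets: "Poly_Mapping.single \<alpha> 1 = (\<Prod>x\<in>Poly_Mapping.keys \<alpha>. indet x ^ Poly_Mapping.lookup \<alpha> x)"
proof -
  have prod: "(\<Prod>x\<in>S. indet x ^ n x) = Poly_Mapping.single (\<Sum>x\<in>S. Poly_Mapping.single x (n x)) 1"
    if "finite S" for S and n :: "nat + nat \<Rightarrow> nat"
    using that
  proof (induction S)
    case (insert x S)
    have "scale_monom (n x) (Poly_Mapping.single x 1) = Poly_Mapping.single x (n x)"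
      by (rule poly_mapping_eqI) (simp add: lookup_single when_def)
    then show ?case using insert by (simp add: indet_def single_power mult_single)
  qed simp
  have "(\<Sum>x\<in>Poly_Mapping.keys \<alpha>. Poly_Mapping.single x (Poly_Mapping.lookup \<alpha> x)) = \<alpha>"
    by (rule poly_mapping_eqI)
       (auto simp: lookup_sum lookup_single when_def sum.delta in_keys_iff)
  then show ?thesis by (simp add: prod)
qed

lemma (in cring) eval_witt_poly_prod:
  assumes v: "\<And>x. v x \<in> carrier R" and "finite J"
  shows "eval_witt_poly R v (\<Prod>j\<in>J. q j) = (\<Otimes>j\<in>J. eval_witt_poly R v (q j))"
  using assms(2)
  by (induction J) (simp_all add: eval_witt_poly_one[OF v] eval_witt_poly_mult[OF v] eval_witt_poly_closed[OF v])

lemma subst_poly_prod: "finite J \<Longrightarrow> subst_poly s (\<Prod>j\<in>J. q j) = (\<Prod>j\<in>J. subst_poly s (q j))"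
  by (induction J rule: finite_induct) (simp_all add: subst_poly_one subst_poly_mult)

text \<open>
  Both sides are ring homomorphisms in \<open>q\<close>, so monomials suffice.
\<close>

lemma (in cring) eval_subst_poly:
  assumes v: "\<And>x. v x \<in> carrier R"
  shows "eval_witt_poly R v (subst_poly s q) = eval_witt_poly R (\<lambda>x. eval_witt_poly R v (s x)) q"
proof (induction q rule: witt_poly_induct)
  case (monom \<alpha>)
  note c = eval_witt_poly_closed[OF v]
  show ?case
    unfolding monom_as_indets
    by (simp add: subst_poly_prod subst_poly_power subst_poly_indet eval_witt_poly_prod[OF v]
        eval_witt_poly_prod[OF c] eval_witt_poly_power[OF v] eval_witt_poly_power[OF c] eval_witt_poly_indet[OF c])
next
  case (diff f g)
  note c = eval_witt_poly_closed[OF v]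
  from diff show ?case by (simp add: subst_poly_diff eval_witt_poly_diff[OF v] eval_witt_poly_diff[OF c])
qed

section \<open>Multiplication by \<open>p\<close> on truncated Witt vectors\<close>

text \<open>
  The components of the \<open>c\<close>-fold sum of the universal Witt vector with itself.
\<close>

fun multiple_poly :: "nat \<Rightarrow> nat \<Rightarrow> nat \<Rightarrow> witt_poly" where
  "multiple_poly p 0 = (\<lambda>i. 0)"
| "multiple_poly p (Suc c) = (\<lambda>i. subst_poly (case_sum (multiple_poly p c) (\<lambda>j. indet (Inl j))) (witt_sum_poly p i))"

lemma ghost_multiple_poly:
  assumes p: "Factorial_Ring.prime p" "odd p"
  shows "ghost p (multiple_poly p c) i = of_nat c * ghost p (\<lambda>j. indet (Inl j)) i"
proof (induction c)
  case 0
  then show ?case using prime_gt_0_nat[OF p(1)] by (simp add: ghost_def zero_power)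
next
  case (Suc c)
  let ?s = "case_sum (multiple_poly p c) (\<lambda>j. indet (Inl j))"
  have "ghost p (multiple_poly p (Suc c)) i = subst_poly ?s (ghost p (witt_sum_poly p) i)"
    by (simp add: subst_poly_ghost)
  also have "\<dots> = ghost p (multiple_poly p c) i + ghost p (\<lambda>j. indet (Inl j)) i"
    by (simp add: ghost_witt_sum_poly[OF p] subst_poly_add subst_poly_ghost subst_poly_indet)
  finally show ?case using Suc by (simp add: algebra_simps)
qed

text \<open>
  The vector \<open>(0, x\<^sub>0\<^sup>p, x\<^sub>1\<^sup>p, \<dots>)\<close> has almost the ghost components of \<open>p\<cdot>x\<close>: they differ by the term
  \<open>p\<^sup>i\<^sup>+\<^sup>1 x\<^sub>i\<close> only. As ghost components modulo powers of \<open>p\<close> determine the components modulo \<open>p\<close>, the two vectors are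
  congruent.
\<close>

lemma multiple_poly_p_cong:
  assumes p: "Factorial_Ring.prime p" "odd p"
  shows "of_nat p dvd multiple_poly p p i - (case i of 0 \<Rightarrow> 0 | Suc k \<Rightarrow> indet (Inl k) ^ p)"
proof -
  define U :: "nat \<Rightarrow> witt_poly" where "U i = (case i of 0 \<Rightarrow> 0 | Suc k \<Rightarrow> indet (Inl k) ^ p)" for i
  have p0: "p > 0" using p(1) by (rule prime_gt_0_nat)
  have "of_nat p dvd multiple_poly p p i - U i"
  proof (rule ghost_cong_imp_cong)
    show "of_nat p dvd a" if d: "of_nat (p ^ Suc k) dvd of_nat (p ^ k) * a" for k and a :: witt_poly
    proof -
      from d obtain r where "of_nat (p ^ k) * a = of_nat (p ^ Suc k) * r" by (rule dvdE)
      then have "of_nat (p ^ k) * a = of_nat (p ^ k) * (of_nat p * r)" by (simp add: algebra_simps)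
      then have "a = of_nat p * r" using p0 witt_poly_cancel[of "p ^ k"] by simp
      then show ?thesis by simp
    qed
    show "of_nat (p ^ Suc i) dvd ghost p (multiple_poly p p) i - ghost p U i" for i
    proof (cases i)
      case 0
      then show ?thesis using ghost_multiple_poly[OF p, of p 0] by (simp add: ghost_def U_def)
    next
      case (Suc k)
      have "ghost p U i = (\<Sum>j\<le>k. of_nat (p ^ Suc j) * U (Suc j) ^ (p ^ (k - j)))"
        unfolding ghost_def Suc using p0 by (subst sum.atMost_Suc_shift) (simp add: U_def zero_power)
      also have "\<dots> = of_nat p * (\<Sum>j\<le>k. of_nat (p ^ j) * indet (Inl j) ^ (p ^ (i - j)))"
        unfolding sum_distrib_left Suc
        by (intro sum.cong) (simp_all add: U_def Suc_diff_le mult.assoc flip: power_mult)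
      finally have U: "ghost p U i = of_nat p * (\<Sum>j\<le>k. of_nat (p ^ j) * indet (Inl j) ^ (p ^ (i - j)))" .
      have "ghost p (multiple_poly p p) i = of_nat p *
          (of_nat (p ^ i) * indet (Inl i) + (\<Sum>j\<le>k. of_nat (p ^ j) * indet (Inl j) ^ (p ^ (i - j))))"
        unfolding ghost_multiple_poly[OF p] ghost_split[of p "\<lambda>j. indet (Inl j)"] Suc lessThan_Suc_atMost ..
      then have "ghost p (multiple_poly p p) i - ghost p U i = of_nat (p ^ Suc i) * indet (Inl i)"
        unfolding U by (simp add: algebra_simps)
      then show ?thesis by simp
    qed
  qed
  then show ?thesis by (simp add: U_def)
qed

lemma (in cring) witt_add_pow:
  assumes p: "Factorial_Ring.prime p" "odd p" and w: "w \<in> carrier (witt_ring p n R)"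
  defines "v \<equiv> \<lambda>x. case x of Inl i \<Rightarrow> if i < n then w ! i else \<zero> | Inr i \<Rightarrow> \<zero>"
  shows "add_pow (witt_ring p n R) (c::nat) w = map (\<lambda>i. eval_witt_poly R v (multiple_poly p c i)) [0..<n]"
proof -
  have v: "v x \<in> carrier R" for x
    using w by (auto simp: v_def witt_ring_def split: sum.splits)
  have W0: "add_pow (witt_ring p n R) (0::nat) w = replicate n \<zero>"
    by (simp add: add_pow_def nat_pow_def witt_ring_def)
  have WS: "add_pow (witt_ring p n R) (Suc c) w =
      map (\<lambda>i. eval_witt_poly R (case_sum (nth (add_pow (witt_ring p n R) c w)) (nth w)) (witt_sum_poly p i)) [0..<n]" for c
    by (simp add: add_pow_def nat_pow_def witt_ring_def)
  show ?thesis
  proof (induction c)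
    case 0
    have "eval_witt_poly R v 0 = \<zero>" by (simp add: eval_witt_poly_frag_sum frag_sum_zero)
    then show ?case by (simp add: W0 map_replicate_const)
  next
    case (Suc c)
    show ?case unfolding WS
    proof (rule map_cong[OF refl])
      fix i assume "i \<in> set [0..<n]"
      then have i: "i < n" by simp
      let ?u = "\<lambda>x. eval_witt_poly R v (case_sum (multiple_poly p c) (\<lambda>j. indet (Inl j)) x)"
      have "eval_witt_poly R (case_sum (nth (add_pow (witt_ring p n R) c w)) (nth w)) (witt_sum_poly p i) =
          eval_witt_poly R ?u (witt_sum_poly p i)"
      proof (rule eval_witt_poly_cong[OF witt_sum_poly_in[OF p]])
        fix x assume "x \<in> vars_upto i"
        then show "case_sum (nth (add_pow (witt_ring p n R) c w)) (nth w) x = ?u x"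
          using i Suc by (auto simp: vars_upto_def eval_witt_poly_indet[OF v]) (simp_all add: v_def)
      qed (rule eval_witt_poly_closed[OF v])
      then show "eval_witt_poly R (case_sum (nth (add_pow (witt_ring p n R) c w)) (nth w)) (witt_sum_poly p i) =
          eval_witt_poly R v (multiple_poly p (Suc c) i)"
        by (simp add: eval_subst_poly[OF v])
    qed
  qed
qed

text \<open>
  In characteristic \<open>p\<close>, multiplication by \<open>p\<close> is Verschiebung after Frobenius.
\<close>

lemma (in cring) witt_add_pow_p:
  assumes p: "Factorial_Ring.prime p" "odd p" and char: "add_pow R p \<one> = \<zero>"
    and w: "w \<in> carrier (witt_ring p n R)" and i: "i < n"
  shows "add_pow (witt_ring p n R) p w ! i = (case i of 0 \<Rightarrow> \<zero> | Suc k \<Rightarrow> w ! k [^] p)"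
proof -
  define v where "v = (\<lambda>x. case x of Inl i \<Rightarrow> if i < n then w ! i else \<zero> | Inr (i::nat) \<Rightarrow> \<zero>)"
  have v: "v x \<in> carrier R" for x
    using w by (auto simp: v_def witt_ring_def split: sum.splits)
  obtain r where r: "multiple_poly p p i - (case i of 0 \<Rightarrow> 0 | Suc k \<Rightarrow> indet (Inl k) ^ p) = of_nat p * r"
    using multiple_poly_p_cong[OF p, of i] by (rule dvdE)
  have "add_pow R p x = \<zero>" if "x \<in> carrier R" for x
    using add_pow_ldistr[OF one_closed that, of p] that char by simp
  then have "eval_witt_poly R v (of_nat p * r) = \<zero>"
    using eval_witt_poly_closed[OF v] by (simp add: eval_witt_poly_of_nat_mult[OF v])
  moreover have "multiple_poly p p i = of_nat p * r + (case i of 0 \<Rightarrow> 0 | Suc k \<Rightarrow> indet (Inl k) ^ p)"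
    using r by (simp add: algebra_simps)
  ultimately have "eval_witt_poly R v (multiple_poly p p i) = eval_witt_poly R v (case i of 0 \<Rightarrow> 0 | Suc k \<Rightarrow> indet (Inl k) ^ p)"
    using eval_witt_poly_closed[OF v] by (simp add: eval_witt_poly_add[OF v])
  also have "\<dots> = (case i of 0 \<Rightarrow> \<zero> | Suc k \<Rightarrow> w ! k [^] p)"
    using i by (cases i) (simp_all add: eval_witt_poly_frag_sum[of R v, symmetric] eval_witt_poly_power[OF v] eval_witt_poly_indet[OF v],
      simp_all add: v_def eval_witt_poly_frag_sum frag_sum_zero)
  finally show ?thesis using i by (simp add: witt_add_pow[OF p w] v_def)
qed

lemma (in cring) witt_add_pow_p_pow:
  assumes p: "Factorial_Ring.prime p" "odd p" and char: "add_pow R p \<one> = \<zero>"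
    and W: "abelian_group (witt_ring p n R)"
    and w: "w \<in> carrier (witt_ring p n R)" and i: "i < n"
  shows "add_pow (witt_ring p n R) (p ^ k) w ! i = (if i < k then \<zero> else w ! (i - k) [^] (p ^ k))"
  using i
proof (induction k arbitrary: i)
  case 0
  interpret W: abelian_group "witt_ring p n R" by fact
  have "w ! i \<in> carrier R" using w 0 by (auto simp: witt_ring_def)
  then show ?case using w by simp
next
  case (Suc k)
  interpret W: abelian_group "witt_ring p n R" by fact
  have "add_pow (witt_ring p n R) (p ^ Suc k) w = add_pow (witt_ring p n R) p (add_pow (witt_ring p n R) (p ^ k) w)"
    using w by (simp add: W.add.nat_pow_pow mult.commute)
  then have "add_pow (witt_ring p n R) (p ^ Suc k) w ! i =
      (case i of 0 \<Rightarrow> \<zero> | Suc j \<Rightarrow> add_pow (witt_ring p n R) (p ^ k) w ! j [^] p)"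
    using witt_add_pow_p[OF p char, of "add_pow (witt_ring p n R) (p ^ k) w" n i] w Suc.prems by simp
  also have "\<dots> = (if i < Suc k then \<zero> else w ! (i - Suc k) [^] (p ^ Suc k))"
  proof (cases i)
    case (Suc j)
    moreover have "w ! (j - k) \<in> carrier R" using w Suc.prems Suc by (auto simp: witt_ring_def)
    ultimately show ?thesis using Suc.IH[of j] Suc.prems prime_gt_0_nat[OF p(1)]
      by (simp add: nat_pow_pow mult.commute nat_pow_zero)
  qed simp
  finally show ?case .
qed

lemma perfect_field_root:
  assumes "perfect_field_char p K" "x \<in> carrier K"
  shows "\<exists>y\<in>carrier K. y [^]\<^bsub>K\<^esub> (p ^ k) = x"
proof (induction k)
  case 0
  interpret field K using assms by (simp add: perfect_field_char_def)
  show ?case using assms(2) by auto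
next
  case (Suc k)
  interpret field K using assms by (simp add: perfect_field_char_def)
  obtain y where y: "y \<in> carrier K" "y [^]\<^bsub>K\<^esub> (p ^ k) = x" using Suc by blast
  then obtain z where "z \<in> carrier K" "z [^]\<^bsub>K\<^esub> p = y" using assms(1) by (auto simp: perfect_field_char_def)
  then show ?case using y by (auto simp: nat_pow_pow intro!: bexI[of _ z])
qed

lemma (in domain) pow_eq_zero:
  "a \<in> carrier R \<Longrightarrow> a [^] (k::nat) = \<zero> \<Longrightarrow> a = \<zero>"
  by (induction k) (auto dest: integral)

text \<open>
  \<open>p\<cdot>w = 0\<close> says that all components but the last vanish, and over a perfect field the vector
  \<open>(0, \<dots>, 0, w\<^sub>n\<^sub>-\<^sub>1)\<close> is \<open>p\<^sup>n\<^sup>-\<^sup>1\<close> times a vector: take a root of \<open>w\<^sub>n\<^sub>-\<^sub>1\<close> of order \<open>p\<^sup>n\<^sup>-\<^sup>1\<close>.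
\<close>

lemma witt_annihilator_p:
  assumes K: "perfect_field_char p K" and odd: "odd p" and n: "n \<ge> 1" and W: "abelian_group (witt_ring p n K)"
    and w: "w \<in> carrier (witt_ring p n K)" and pw: "add_pow (witt_ring p n K) p w = \<zero>\<^bsub>witt_ring p n K\<^esub>"
  shows "\<exists>w'\<in>carrier (witt_ring p n K). w = add_pow (witt_ring p n K) (p ^ (n - 1)) w'"
proof -
  interpret field K using K by (simp add: perfect_field_char_def)
  interpret W: abelian_group "witt_ring p n K" by fact
  have p: "Factorial_Ring.prime p" "odd p" and char: "add_pow K p \<one>\<^bsub>K\<^esub> = \<zero>\<^bsub>K\<^esub>"
    using K odd by (auto simp: perfect_field_char_def)
  have len: "length x = n" if "x \<in> carrier (witt_ring p n K)" for x
    using that by (simp add: witt_ring_def)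
  have wc: "w ! i \<in> carrier K" if "i < n" for i using w that by (auto simp: witt_ring_def)
  have z: "w ! i = \<zero>\<^bsub>K\<^esub>" if i: "Suc i < n" for i
  proof -
    have "w ! i [^]\<^bsub>K\<^esub> p = \<zero>\<^bsub>K\<^esub>"
      using witt_add_pow_p[OF p char w i] i unfolding pw by (simp add: witt_ring_def)
    then show ?thesis
      using i wc[of i] by (intro pow_eq_zero[of "w ! i" p]) simp_all
  qed
  obtain y where y: "y \<in> carrier K" "y [^]\<^bsub>K\<^esub> (p ^ (n - 1)) = w ! (n - 1)"
    using perfect_field_root[OF K wc[of "n - 1"]] n by auto
  define w' where "w' = map (\<lambda>i. if i = 0 then y else \<zero>\<^bsub>K\<^esub>) [0..<n]"
  have w': "w' \<in> carrier (witt_ring p n K)" using y by (auto simp: w'_def witt_ring_def)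
  have "w = add_pow (witt_ring p n K) (p ^ (n - 1)) w'"
  proof (rule nth_equalityI)
    show "length w = length (add_pow (witt_ring p n K) (p ^ (n - 1)) w')"
      using len w w' by simp
    fix i assume "i < length w"
    then have i: "i < n" using len w by simp
    have "w' ! (i - (n - 1)) = y" using n i by (simp add: w'_def)
    moreover have "w ! i = \<zero>\<^bsub>K\<^esub>" if "i < n - 1" using z[of i] that by simp
    moreover have "i = n - 1" if "\<not> i < n - 1" using that i by simp
    ultimately show "w ! i = add_pow (witt_ring p n K) (p ^ (n - 1)) w' ! i"
      using witt_add_pow_p_pow[OF p char W w' i, of "n - 1"] y by (cases "i < n - 1") auto
  qed
  then show ?thesis using w' by blast
qed

section \<open>Reductions modulo integers\<close>

context ring
begin

lemma nat_multiples_ideal: "ideal (nat_multiples R k) R"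
proof (rule idealI[OF ring_axioms])
  show "subgroup (nat_multiples R k) (add_monoid R)"
  proof (rule add.subgroupI)
    show "nat_multiples R k \<subseteq> carrier R" by (auto simp: nat_multiples_def)
    show "nat_multiples R k \<noteq> {}" by (auto simp: nat_multiples_def)
    show "\<ominus> a \<in> nat_multiples R k" if "a \<in> nat_multiples R k" for a
      using that by (auto simp: nat_multiples_def add.nat_pow_inv[symmetric])
    show "a \<oplus> b \<in> nat_multiples R k" if "a \<in> nat_multiples R k" "b \<in> nat_multiples R k" for a b
      using that by (auto simp: nat_multiples_def add.nat_pow_distrib[symmetric])
  qed
  show "x \<otimes> a \<in> nat_multiples R k" if "a \<in> nat_multiples R k" "x \<in> carrier R" for a x
    using that by (auto simp: nat_multiples_def add_pow_rdistr)
  show "a \<otimes> x \<in> nat_multiples R k" if "a \<in> nat_multiples R k" "x \<in> carrier R" for a x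
    using that by (auto simp: nat_multiples_def add_pow_ldistr)
qed

lemma reduction_ring: "ring (reduction R k)"
  unfolding reduction_def by (rule ideal.quotient_is_ring[OF nat_multiples_ideal])

lemma residue_hom_ring: "ring_hom_ring R (reduction R k) (residue_class R k)"
proof -
  have "residue_class R k = (+>) (nat_multiples R k)"
    by (rule ext) (simp add: residue_class_def)
  then show ?thesis
    unfolding reduction_def by (simp add: ideal.rcos_ring_hom_ring[OF nat_multiples_ideal])
qed

lemma residue_surj: "carrier (reduction R k) = residue_class R k ` carrier R"
  by (auto simp: reduction_def FactRing_def A_RCOSETS_def RCOSETS_def residue_class_def a_r_coset_def)

lemma residue_class_eq_iff:
  assumes "a \<in> carrier R" "b \<in> carrier R"
  shows "residue_class R k a = residue_class R k b \<longleftrightarrow> (\<exists>c\<in>carrier R. a = b \<oplus> add_pow R k c)"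
proof -
  have "residue_class R k a = residue_class R k b \<longleftrightarrow> a \<ominus> b \<in> nat_multiples R k"
    unfolding residue_class_def by (rule quotient_eq_iff_same_a_r_cos[OF nat_multiples_ideal assms, symmetric])
  also have "\<dots> \<longleftrightarrow> (\<exists>c\<in>carrier R. a \<ominus> b = add_pow R k c)"
    by (auto simp: nat_multiples_def)
  also have "\<dots> \<longleftrightarrow> (\<exists>c\<in>carrier R. a = b \<oplus> add_pow R k c)"
  proof (rule bex_cong[OF refl])
    fix c assume "c \<in> carrier R"
    then have "add_pow R k c \<in> carrier R" by simp
    then show "a \<ominus> b = add_pow R k c \<longleftrightarrow> a = b \<oplus> add_pow R k c"
      using assms by (metis a_minus_def a_comm add.inv_solve_right minus_closed r_neg1 a_inv_closed)
  qed
  finally show ?thesis .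
qed

lemma residue_class_self: "a \<in> carrier R \<Longrightarrow> a \<in> residue_class R k a"
  unfolding residue_class_def
  by (metis abelian_subgroup.a_rcos_self abelian_subgroupI3 ideal.axioms(1) nat_multiples_ideal is_abelian_group)

lemma mem_residue_class_iff:
  assumes "b \<in> carrier R"
  shows "a \<in> residue_class R k b \<longleftrightarrow> a \<in> carrier R \<and> residue_class R k a = residue_class R k b"
proof
  assume a: "a \<in> residue_class R k b"
  have s: "abelian_subgroup (nat_multiples R k) R"
    by (rule abelian_subgroupI3[OF ideal.axioms(1)[OF nat_multiples_ideal] is_abelian_group])
  have "a \<in> carrier R"
    using a assms abelian_subgroup.a_elemrcos_carrier[OF s] by (simp add: residue_class_def)
  moreover have "residue_class R k a = residue_class R k b"
    using a assms abelian_subgroup.a_repr_independence'[OF s] by (simp add: residue_class_def)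
  ultimately show "a \<in> carrier R \<and> residue_class R k a = residue_class R k b" by blast
next
  assume "a \<in> carrier R \<and> residue_class R k a = residue_class R k b"
  then show "a \<in> residue_class R k b" using residue_class_self[of a k] by simp
qed

end

section \<open>Flatness and torsion\<close>

text \<open>
  Ideals of a ring are used as test modules for flatness, transported to the type of the test modules by
  singletons.
\<close>

definition enc :: "'r \<Rightarrow> 'r list set" where "enc w = {[w]}"
definition dec :: "'r list set \<Rightarrow> 'r" where "dec e = hd (the_elem e)"

lemma dec_enc [simp]: "dec (enc w) = w"
  by (simp add: enc_def dec_def)

definition ideal_module :: "('r, 's) ring_scheme \<Rightarrow> 'r set \<Rightarrow> ('r, 'r list set) module" where
  "ideal_module R I = \<lparr>carrier = enc ` I, monoid.mult = (\<lambda>x y. x), monoid.one = enc \<zero>\<^bsub>R\<^esub>,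
     ring.zero = enc \<zero>\<^bsub>R\<^esub>, ring.add = (\<lambda>x y. enc (dec x \<oplus>\<^bsub>R\<^esub> dec y)), smult = (\<lambda>r x. enc (r \<otimes>\<^bsub>R\<^esub> dec x))\<rparr>"

lemma (in cring) module_ideal_module:
  assumes "ideal I R"
  shows "module R (ideal_module R I)"
proof -
  interpret I: ideal I R by fact
  have c: "x \<in> carrier R" if "x \<in> I" for x using that by (rule I.Icarr)
  show ?thesis
  proof (rule moduleI)
    show "abelian_group (ideal_module R I)"
    proof (rule abelian_groupI)
      fix x assume x: "x \<in> carrier (ideal_module R I)"
      then show "\<exists>y\<in>carrier (ideal_module R I). y \<oplus>\<^bsub>ideal_module R I\<^esub> x = \<zero>\<^bsub>ideal_module R I\<^esub>"
        by (auto simp: ideal_module_def c l_neg intro!: bexI[of _ "\<ominus> _"] I.a_inv_closed)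
    qed (auto simp: ideal_module_def c a_ac I.a_closed I.zero_closed)
  qed (auto simp: ideal_module_def c is_cring I.I_l_closed l_distr r_distr m_assoc)
qed

lemma keys_diff_subset: "Poly_Mapping.keys a \<subseteq> S \<Longrightarrow> Poly_Mapping.keys b \<subseteq> S \<Longrightarrow> Poly_Mapping.keys (a - b) \<subseteq> S"
  using keys_diff[of a b] by blast

lemma generate_free_Abelian_group_mono:
  assumes "G \<subseteq> H" and "\<And>h. h \<in> G \<Longrightarrow> Poly_Mapping.keys h \<subseteq> S" and "S \<subseteq> T"
  shows "generate (free_Abelian_group S) G \<subseteq> generate (free_Abelian_group T) H"
proof
  fix r assume "r \<in> generate (free_Abelian_group S) G"
  then show "r \<in> generate (free_Abelian_group T) H"
  proof (induction rule: generate.induct)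
    case one
    then show ?case using generate.one[of "free_Abelian_group T" H] by simp
  next
    case (incl h)
    then show ?case using assms by (intro generate.incl) auto
  next
    case (inv h)
    then have "inv\<^bsub>free_Abelian_group T\<^esub> h \<in> generate (free_Abelian_group T) H"
      using assms(1) by (intro generate.inv) auto
    then show ?case using assms inv by (metis inv_free_Abelian_group order_trans)
  next
    case (eng h1 h2)
    then show ?case using generate.eng[of h1 "free_Abelian_group T" H h2] by simp
  qed
qed

lemma tensor_relations_subgroup:
  assumes "module R M" "module R N"
  shows "subgroup (tensor_relations R M N) (free_Abelian_group (carrier M \<times> carrier N))"
proof -
  interpret M: module R M by fact
  interpret N: module R N by fact
  show ?thesis
    unfolding tensor_relations_def
    by (rule group.generate_is_subgroup[OF group_free_Abelian_group])
       (auto simp: keys_diff_subset keys_frag_of)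
qed

text \<open>
  The universal property of the tensor product: a balanced biadditive map \<open>\<mu>\<close> extends to it.
\<close>

lemma tensor_relations_vanish:
  fixes \<mu> :: "'m \<times> 'n \<Rightarrow> 'c" and G :: "('c, 'd) ring_scheme"
  assumes G: "abelian_group G" and \<mu>: "\<And>e. \<mu> e \<in> carrier G"
    and keys: "\<And>x x'. x \<in> carrier M \<Longrightarrow> x' \<in> carrier M \<Longrightarrow> x \<oplus>\<^bsub>M\<^esub> x' \<in> carrier M"
      "\<And>y y'. y \<in> carrier N \<Longrightarrow> y' \<in> carrier N \<Longrightarrow> y \<oplus>\<^bsub>N\<^esub> y' \<in> carrier N"
      "\<And>r x. r \<in> carrier R \<Longrightarrow> x \<in> carrier M \<Longrightarrow> r \<odot>\<^bsub>M\<^esub> x \<in> carrier M"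
      "\<And>r y. r \<in> carrier R \<Longrightarrow> y \<in> carrier N \<Longrightarrow> r \<odot>\<^bsub>N\<^esub> y \<in> carrier N"
    and add1: "\<And>x x' y. x \<in> carrier M \<Longrightarrow> x' \<in> carrier M \<Longrightarrow> y \<in> carrier N \<Longrightarrow> \<mu> (x \<oplus>\<^bsub>M\<^esub> x', y) = \<mu> (x, y) \<oplus>\<^bsub>G\<^esub> \<mu> (x', y)"
    and add2: "\<And>x y y'. x \<in> carrier M \<Longrightarrow> y \<in> carrier N \<Longrightarrow> y' \<in> carrier N \<Longrightarrow> \<mu> (x, y \<oplus>\<^bsub>N\<^esub> y') = \<mu> (x, y) \<oplus>\<^bsub>G\<^esub> \<mu> (x, y')"
    and bal: "\<And>r x y. r \<in> carrier R \<Longrightarrow> x \<in> carrier M \<Longrightarrow> y \<in> carrier N \<Longrightarrow> \<mu> (r \<odot>\<^bsub>M\<^esub> x, y) = \<mu> (x, r \<odot>\<^bsub>N\<^esub> y)"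
    and t: "t \<in> tensor_relations R M N"
  shows "frag_sum G \<mu> t = \<zero>\<^bsub>G\<^esub>"
proof -
  interpret G: abelian_group G by fact
  have of: "frag_sum G \<mu> (frag_of e) = \<mu> e" for e
    using G.frag_sum_single[of \<mu> e 1, OF \<mu>] \<mu>[of e] by simp
  note diff = G.frag_sum_diff[OF \<mu>] and cl = G.frag_sum_closed[OF \<mu>]
  have rel: "frag_sum G \<mu> h = \<zero>\<^bsub>G\<^esub> \<and> Poly_Mapping.keys h \<subseteq> carrier M \<times> carrier N"
    if "h \<in> {frag_of (x \<oplus>\<^bsub>M\<^esub> x', y) - frag_of (x, y) - frag_of (x', y) | x x' y.
         x \<in> carrier M \<and> x' \<in> carrier M \<and> y \<in> carrier N}
    \<union> {frag_of (x, y \<oplus>\<^bsub>N\<^esub> y') - frag_of (x, y) - frag_of (x, y') | x y y'.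
         x \<in> carrier M \<and> y \<in> carrier N \<and> y' \<in> carrier N}
    \<union> {frag_of (r \<odot>\<^bsub>M\<^esub> x, y) - frag_of (x, r \<odot>\<^bsub>N\<^esub> y) | r x y.
         r \<in> carrier R \<and> x \<in> carrier M \<and> y \<in> carrier N}" for h
    using that
  proof (elim UnE CollectE exE conjE, goal_cases)
    case (1 x x' y)
    then show ?case
      using keys add1[of x x' y] \<mu>[of "(x, y)"] \<mu>[of "(x', y)"]
      by (simp add: diff of keys_diff_subset keys_frag_of a_minus_def G.a_ac G.r_neg G.minus_add G.r_neg1 G.r_neg2)
  next
    case (2 x y y')
    then show ?case
      using keys add2[of x y y'] \<mu>[of "(x, y)"] \<mu>[of "(x, y')"]
      by (simp add: diff of keys_diff_subset keys_frag_of a_minus_def G.a_ac G.r_neg G.minus_add G.r_neg1 G.r_neg2)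
  next
    case (3 r x y)
    then show ?case
      using keys bal[of r x y] \<mu>[of "(x, r \<odot>\<^bsub>N\<^esub> y)"]
      by (simp add: diff of keys_diff_subset keys_frag_of a_minus_def G.r_neg)
  qed
  show ?thesis
    using t unfolding tensor_relations_def
  proof (induction rule: generate.induct)
    case one
    then show ?case by (simp add: G.frag_sum_zero)
  next
    case (incl h)
    then show ?case using rel[of h] by simp
  next
    case (inv h)
    then have "frag_sum G \<mu> (0 - h) = \<zero>\<^bsub>G\<^esub>"
      using rel[of h] by (simp only: diff G.frag_sum_zero) (simp add: a_minus_def)
    then show ?case using rel[OF inv] by simp
  next
    case (eng h1 h2)
    then show ?case by (simp add: G.frag_sum_add[OF \<mu>])
  qed
qed

text \<open>
  Flatness makes \<open>(q) \<otimes> A \<rightarrow> R \<otimes> A\<close> injective. It sends \<open>q \<otimes> a\<close> to \<open>1 \<otimes> q a = 0\<close>, so \<open>q \<otimes> a\<close> vanishes. But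
  \<open>r q \<otimes> b \<mapsto> r b\<close> is a well-defined map from \<open>(q) \<otimes> A\<close> to \<open>A/kA\<close>, because two choices of \<open>r\<close> differ by an annihilator
  of \<open>q\<close>, and it sends \<open>q \<otimes> a\<close> to the class of \<open>a\<close>.
\<close>

lemma flat_annihilator:
  fixes R :: "('r, 's) ring_scheme" and A :: "('r, 'a) module"
  assumes flat: "flat_module R A" and alg: "ring A"
    and q: "q \<in> carrier R" and a: "a \<in> carrier A" "q \<odot>\<^bsub>A\<^esub> a = \<zero>\<^bsub>A\<^esub>"
    and ann: "\<And>w b. w \<in> carrier R \<Longrightarrow> w \<otimes>\<^bsub>R\<^esub> q = \<zero>\<^bsub>R\<^esub> \<Longrightarrow> b \<in> carrier A \<Longrightarrow> w \<odot>\<^bsub>A\<^esub> b \<in> nat_multiples A k"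
  shows "a \<in> nat_multiples A k"
proof -
  interpret module R A using flat by (simp add: flat_module_def)
  interpret A: ring A by (rule alg)
  let ?I = "cgenideal R q"
  let ?N = "ideal_module R ?I" and ?N' = "ideal_module R (carrier R)"
  let ?Q = "reduction A k"
  interpret Q: ring ?Q by (rule A.reduction_ring)
  interpret h: ring_hom_ring A ?Q "residue_class A k" by (rule A.residue_hom_ring)
  interpret I: ideal ?I R using q by (rule cgenideal_ideal)
  have mN: "module R ?N" by (rule module_ideal_module[OF I.ideal_axioms])
  have mN': "module R ?N'" by (rule module_ideal_module[OF oneideal])
  interpret N: module R ?N by (rule mN)
  interpret N': module R ?N' by (rule mN')
  have NN': "carrier ?N \<subseteq> carrier ?N'" using I.Icarr by (auto simp: ideal_module_def)
  have add_eq: "(\<oplus>\<^bsub>?N\<^esub>) = (\<oplus>\<^bsub>?N'\<^esub>)" and smult_eq: "(\<odot>\<^bsub>?N\<^esub>) = (\<odot>\<^bsub>?N'\<^esub>)"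
    by (simp_all add: ideal_module_def)
  let ?relN = "tensor_relations R ?N A" and ?relN' = "tensor_relations R ?N' A"
  let ?F = "free_Abelian_group (carrier ?N \<times> carrier A)"
  let ?F' = "free_Abelian_group (carrier ?N' \<times> carrier A)"
  have sub: "?relN \<subseteq> ?relN'"
    unfolding tensor_relations_def add_eq smult_eq
  proof (rule generate_free_Abelian_group_mono)
    show "carrier ?N \<times> carrier A \<subseteq> carrier ?N' \<times> carrier A" using NN' by blast
  next
    fix h assume "h \<in> {frag_of (x \<oplus>\<^bsub>?N'\<^esub> x', y) - frag_of (x, y) - frag_of (x', y) | x x' y.
         x \<in> carrier ?N \<and> x' \<in> carrier ?N \<and> y \<in> carrier A}
    \<union> {frag_of (x, y \<oplus>\<^bsub>A\<^esub> y') - frag_of (x, y) - frag_of (x, y') | x y y'.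
         x \<in> carrier ?N \<and> y \<in> carrier A \<and> y' \<in> carrier A}
    \<union> {frag_of (r \<odot>\<^bsub>?N'\<^esub> x, y) - frag_of (x, r \<odot>\<^bsub>A\<^esub> y) | r x y.
         r \<in> carrier R \<and> x \<in> carrier ?N \<and> y \<in> carrier A}"
    then show "Poly_Mapping.keys h \<subseteq> carrier ?N \<times> carrier A"
      using N.a_closed N.smult_closed
      by (elim UnE CollectE exE conjE) (auto simp: keys_diff_subset keys_frag_of simp flip: add_eq smult_eq)
  qed (use NN' in blast)
  have mA: "module R A" by (rule module_axioms)
  have gN: "subgroup ?relN ?F" and gN': "subgroup ?relN' ?F'"
    by (rule tensor_relations_subgroup[OF mN mA], rule tensor_relations_subgroup[OF mN' mA])
  have inj: "inj_on (tensor_map R ?N' A id) (carrier (tensor_product R ?N A))"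
  proof -
    have "id \<in> linear_maps R ?N ?N'"
      using NN' by (auto simp: linear_maps_def add_eq smult_eq)
    then show ?thesis using flat mN mN' by (auto simp: flat_module_def)
  qed
  have map_eq: "tensor_map R ?N' A id C = ?relN'" if C: "C \<subseteq> ?relN'" "C \<noteq> {}" for C
  proof -
    have "frag_extend (\<lambda>(x, y). frag_of (id x, y)) c = c" for c :: "'r list set \<times> 'a \<Rightarrow>\<^sub>0 int"
      using frag_expansion[of c] by (simp add: case_prod_unfold id_def)
    moreover have "?relN' #>\<^bsub>?F'\<^esub> c = ?relN'" if "c \<in> C" for c
      using that C(1) subgroup.mem_carrier[OF gN']
      by (intro group.coset_join2[OF group_free_Abelian_group _ gN']) auto
    ultimately show ?thesis using C(2) by (auto simp: tensor_map_def)
  qed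
  have qN: "enc q \<in> carrier ?N" using q by (auto simp: ideal_module_def cgenideal_self)
  let ?e = "frag_of (enc q, a)"
  have one: "enc \<one>\<^bsub>R\<^esub> \<in> carrier ?N'" by (simp add: ideal_module_def)
  have qe: "q \<odot>\<^bsub>?N'\<^esub> enc \<one>\<^bsub>R\<^esub> = enc q" using q by (simp add: ideal_module_def)
  have "frag_of (enc \<one>\<^bsub>R\<^esub>, \<zero>\<^bsub>A\<^esub> \<oplus>\<^bsub>A\<^esub> \<zero>\<^bsub>A\<^esub>) - frag_of (enc \<one>\<^bsub>R\<^esub>, \<zero>\<^bsub>A\<^esub>) - frag_of (enc \<one>\<^bsub>R\<^esub>, \<zero>\<^bsub>A\<^esub>) \<in> ?relN'"
    unfolding tensor_relations_def using one by (intro generate.incl) blast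
  then have 1: "- frag_of (enc \<one>\<^bsub>R\<^esub>, \<zero>\<^bsub>A\<^esub>) \<in> ?relN'" by simp
  have "frag_of (q \<odot>\<^bsub>?N'\<^esub> enc \<one>\<^bsub>R\<^esub>, a) - frag_of (enc \<one>\<^bsub>R\<^esub>, q \<odot>\<^bsub>A\<^esub> a) \<in> ?relN'"
    unfolding tensor_relations_def using one a q by (intro generate.incl) blast
  then have 2: "?e - frag_of (enc \<one>\<^bsub>R\<^esub>, \<zero>\<^bsub>A\<^esub>) \<in> ?relN'" by (simp add: qe a)
  have "inv\<^bsub>?F'\<^esub> (- frag_of (enc \<one>\<^bsub>R\<^esub>, \<zero>\<^bsub>A\<^esub>)) \<in> ?relN'"
    by (rule subgroup.m_inv_closed[OF gN' 1])
  then have "frag_of (enc \<one>\<^bsub>R\<^esub>, \<zero>\<^bsub>A\<^esub>) \<in> ?relN'"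
    using one by (simp add: inv_free_Abelian_group keys_frag_of)
  from subgroup.m_closed[OF gN' 2 this] have e': "?e \<in> ?relN'" by simp
  have eF: "?e \<in> carrier ?F" using qN a by (simp add: keys_frag_of)
  have e: "?e \<in> ?relN"
  proof -
    interpret F: group ?F by (rule group_free_Abelian_group)
    let ?C = "?relN #>\<^bsub>?F\<^esub> ?e"
    have 1: "?C \<in> carrier (tensor_product R ?N A)" "?relN \<in> carrier (tensor_product R ?N A)"
      using F.rcosetsI[OF subgroup.subset[OF gN] eF] subgroup.subgroup_in_rcosets[OF gN F.group_axioms]
      by (simp_all add: tensor_product_def FactGroup_def)
    have eC: "?e \<in> ?C" by (rule F.rcos_self[OF eF gN])
    have "?C \<subseteq> ?relN'"
    proof
      fix x assume "x \<in> ?C"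
      then obtain r where "r \<in> ?relN" "x = r + ?e" by (auto simp: r_coset_def)
      then show "x \<in> ?relN'" using subgroup.m_closed[OF gN' _ e', of r] sub by auto
    qed
    moreover have "?relN \<noteq> {}" using subgroup.one_closed[OF gN] by auto
    ultimately have "tensor_map R ?N' A id ?C = tensor_map R ?N' A id ?relN"
      using map_eq[of ?C] map_eq[OF sub] eC by auto
    then have "?C = ?relN" using inj_onD[OF inj _ 1] by simp
    then show ?thesis using eC by simp
  qed
  define \<rho> where "\<rho> s = (SOME r. r \<in> carrier R \<and> r \<otimes>\<^bsub>R\<^esub> q = s)" for s
  have \<rho>: "\<rho> s \<in> carrier R \<and> \<rho> s \<otimes>\<^bsub>R\<^esub> q = s" if "s \<in> ?I" for s
  proof -
    have "\<exists>r. r \<in> carrier R \<and> r \<otimes>\<^bsub>R\<^esub> q = s" using that unfolding cgenideal_def by blast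
    from someI_ex[OF this] show ?thesis by (simp only: \<rho>_def)
  qed
  have \<rho>_cong: "residue_class A k (r \<odot>\<^bsub>A\<^esub> b) = residue_class A k (r' \<odot>\<^bsub>A\<^esub> b)"
    if r: "r \<in> carrier R" "r' \<in> carrier R" "r \<otimes>\<^bsub>R\<^esub> q = r' \<otimes>\<^bsub>R\<^esub> q" and b: "b \<in> carrier A" for r r' b
  proof -
    have "(r \<ominus>\<^bsub>R\<^esub> r') \<otimes>\<^bsub>R\<^esub> q = \<zero>\<^bsub>R\<^esub>"
      using r q by (simp add: R.minus_eq R.l_distr R.l_minus R.r_neg)
    then have "(r \<ominus>\<^bsub>R\<^esub> r') \<odot>\<^bsub>A\<^esub> b \<in> nat_multiples A k" using r b by (intro ann) auto
    then obtain c where c: "c \<in> carrier A" "(r \<ominus>\<^bsub>R\<^esub> r') \<odot>\<^bsub>A\<^esub> b = add_pow A k c" by (auto simp: nat_multiples_def)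
    have "r = r' \<oplus>\<^bsub>R\<^esub> (r \<ominus>\<^bsub>R\<^esub> r')" using r by (simp add: R.minus_eq R.a_lcomm[of r' r] R.r_neg)
    then have "r \<odot>\<^bsub>A\<^esub> b = r' \<odot>\<^bsub>A\<^esub> b \<oplus>\<^bsub>A\<^esub> add_pow A k c"
      using smult_l_distr[of r' "r \<ominus>\<^bsub>R\<^esub> r'" b] r b c by simp
    then show ?thesis using r b c by (subst A.residue_class_eq_iff) auto
  qed
  define \<mu> where "\<mu> e = (if fst e \<in> carrier ?N \<and> snd e \<in> carrier A
      then residue_class A k (\<rho> (dec (fst e)) \<odot>\<^bsub>A\<^esub> snd e) else \<zero>\<^bsub>?Q\<^esub>)" for e
  have decI: "dec x \<in> ?I" if "x \<in> carrier ?N" for x using that by (auto simp: ideal_module_def)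
  have \<mu>: "\<mu> e \<in> carrier ?Q" for e
    using \<rho>[OF decI] by (auto simp: \<mu>_def)
  have "frag_sum ?Q \<mu> ?e = \<zero>\<^bsub>?Q\<^esub>"
  proof (rule tensor_relations_vanish[OF Q.is_abelian_group \<mu> _ _ _ _ _ _ _ e])
    fix x x' y assume xy: "x \<in> carrier ?N" "x' \<in> carrier ?N" "y \<in> carrier A"
    have "residue_class A k (\<rho> (dec (x \<oplus>\<^bsub>?N\<^esub> x')) \<odot>\<^bsub>A\<^esub> y) = residue_class A k ((\<rho> (dec x) \<oplus>\<^bsub>R\<^esub> \<rho> (dec x')) \<odot>\<^bsub>A\<^esub> y)"
      using \<rho>[OF decI[OF N.a_closed[OF xy(1,2)]]] \<rho>[OF decI[OF xy(1)]] \<rho>[OF decI[OF xy(2)]] xy q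
      by (intro \<rho>_cong) (auto simp: R.l_distr, simp add: ideal_module_def)
    then show "\<mu> (x \<oplus>\<^bsub>?N\<^esub> x', y) = \<mu> (x, y) \<oplus>\<^bsub>?Q\<^esub> \<mu> (x', y)"
      using xy \<rho>[OF decI[OF xy(1)]] \<rho>[OF decI[OF xy(2)]] by (simp add: \<mu>_def smult_l_distr)
  next
    fix x y y' assume xy: "x \<in> carrier ?N" "y \<in> carrier A" "y' \<in> carrier A"
    then show "\<mu> (x, y \<oplus>\<^bsub>A\<^esub> y') = \<mu> (x, y) \<oplus>\<^bsub>?Q\<^esub> \<mu> (x, y')"
      using \<rho>[OF decI[OF xy(1)]] by (simp add: \<mu>_def smult_r_distr)
  next
    fix r x y assume xy: "r \<in> carrier R" "x \<in> carrier ?N" "y \<in> carrier A"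
    have "residue_class A k (\<rho> (dec (r \<odot>\<^bsub>?N\<^esub> x)) \<odot>\<^bsub>A\<^esub> y) = residue_class A k ((\<rho> (dec x) \<otimes>\<^bsub>R\<^esub> r) \<odot>\<^bsub>A\<^esub> y)"
      using \<rho>[OF decI[OF N.smult_closed[OF xy(1,2)]]] \<rho>[OF decI[OF xy(2)]] xy q
      by (intro \<rho>_cong) (auto simp: R.m_ac, simp add: ideal_module_def R.m_ac, metis R.m_lcomm)
    then show "\<mu> (r \<odot>\<^bsub>?N\<^esub> x, y) = \<mu> (x, r \<odot>\<^bsub>A\<^esub> y)"
      using xy \<rho>[OF decI[OF xy(2)]] by (simp add: \<mu>_def smult_assoc1)
  qed auto
  then have "\<mu> (enc q, a) = \<zero>\<^bsub>?Q\<^esub>"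
    using Q.frag_sum_single[of \<mu> "(enc q, a)" 1, OF \<mu>] \<mu>[of "(enc q, a)"] by simp
  moreover have "\<mu> (enc q, a) = residue_class A k (\<one>\<^bsub>R\<^esub> \<odot>\<^bsub>A\<^esub> a)"
    using qN a q \<rho>[OF decI[OF qN]] \<rho>_cong[of "\<rho> (dec (enc q))" "\<one>\<^bsub>R\<^esub>" a] by (simp add: \<mu>_def)
  ultimately have "residue_class A k a = residue_class A k \<zero>\<^bsub>A\<^esub>" using a by simp
  then obtain c where "c \<in> carrier A" "a = \<zero>\<^bsub>A\<^esub> \<oplus>\<^bsub>A\<^esub> add_pow A k c"
    using a A.residue_class_eq_iff[of a "\<zero>\<^bsub>A\<^esub>" k] by auto
  then show ?thesis by (auto simp: nat_multiples_def)
qed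

section \<open>Powers of almost commuting elements\<close>

context ring
begin

lemma pow_add_square_zero:
  assumes c: "b \<in> carrier R" "e \<in> carrier R" and be: "e \<otimes> b = b \<otimes> e" and ee: "e \<otimes> e = \<zero>"
  shows "(b \<oplus> e) [^] Suc n = b [^] Suc n \<oplus> add_pow R (Suc n) (b [^] n \<otimes> e)"
proof (induction n)
  case (Suc n)
  have "(b \<oplus> e) [^] Suc (Suc n) = (b [^] Suc n \<oplus> add_pow R (Suc n) (b [^] n \<otimes> e)) \<otimes> (b \<oplus> e)"
    using Suc by simp
  also have "\<dots> = b [^] Suc (Suc n) \<oplus> add_pow R (Suc n) (b [^] Suc n \<otimes> e) \<oplus> b [^] Suc n \<otimes> e"
    using c by (simp add: l_distr r_distr add_pow_ldistr m_assoc be ee a_ac)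
  finally show ?case using c by (simp add: a_ac)
qed (use c in simp)

lemma commutator_pow_left:
  assumes c: "e \<in> carrier R" "w \<in> carrier R" "f \<in> carrier R"
    and ew: "e \<otimes> w = w \<otimes> e \<oplus> f" and fw: "f \<otimes> w = w \<otimes> f"
  shows "e \<otimes> w [^] Suc n = w [^] Suc n \<otimes> e \<oplus> add_pow R (Suc n) (w [^] n \<otimes> f)"
proof (induction n)
  case 0
  then show ?case using c ew by simp
next
  case (Suc n)
  have "e \<otimes> w [^] Suc (Suc n) = (e \<otimes> w [^] Suc n) \<otimes> w"
    using c by (simp add: m_assoc)
  also have "\<dots> = (w [^] Suc n \<otimes> e \<oplus> add_pow R (Suc n) (w [^] n \<otimes> f)) \<otimes> w"
    by (simp only: Suc)
  also have "\<dots> = w [^] Suc (Suc n) \<otimes> e \<oplus> w [^] Suc n \<otimes> f \<oplus> add_pow R (Suc n) (w [^] Suc n \<otimes> f)"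
    using c by (simp add: l_distr r_distr add_pow_ldistr m_assoc ew fw a_ac)
  finally show ?case using c by (simp add: a_ac)
qed

lemma nat_pow_Suc_left: "x \<in> carrier R \<Longrightarrow> x [^] Suc n = x \<otimes> x [^] n"
  by (metis nat_pow_Suc2)

lemma nat_pow_lcomm: "x \<in> carrier R \<Longrightarrow> y \<in> carrier R \<Longrightarrow> x \<otimes> (x [^] (k::nat) \<otimes> y) = x [^] k \<otimes> (x \<otimes> y)"
  by (metis m_assoc nat_pow_Suc nat_pow_Suc_left nat_pow_closed)

text \<open>
  Moving \<open>b\<close> through \<open>w\<^sup>n\<close> costs the commutator \<open>e\<close> once for each factor, and moving these \<open>e\<close> to the right costs
  the second-order commutator \<open>f\<close> once for each pair of factors. For \<open>n = p\<close> odd, both binomial coefficients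
  are divisible by \<open>p\<close>; this is where \<open>p \<noteq> 2\<close> enters.
\<close>

lemma commutator_pow:
  assumes c: "w \<in> carrier R" "b \<in> carrier R" "e \<in> carrier R" "f \<in> carrier R"
    and wb: "w \<otimes> b = b \<otimes> w \<oplus> e" and ew: "e \<otimes> w = w \<otimes> e \<oplus> f" and fw: "f \<otimes> w = w \<otimes> f"
  shows "w [^] Suc (Suc n) \<otimes> b = b \<otimes> w [^] Suc (Suc n) \<oplus> add_pow R (Suc (Suc n)) (w [^] Suc n \<otimes> e)
      \<oplus> add_pow R (Suc (Suc n) choose 2) (w [^] n \<otimes> f)"
proof (induction n)
  case 0
  have "w [^] Suc (Suc 0) \<otimes> b = w \<otimes> (b \<otimes> w \<oplus> e)" using c wb by (simp add: m_assoc)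
  also have "\<dots> = (w \<otimes> b) \<otimes> w \<oplus> w \<otimes> e" using c by (simp add: r_distr m_assoc)
  also have "\<dots> = b \<otimes> (w \<otimes> w) \<oplus> (w \<otimes> e \<oplus> w \<otimes> e) \<oplus> f"
    using c by (simp add: wb l_distr ew m_assoc a_ac)
  finally show ?case using c by (simp add: numeral_2_eq_2 a_ac)
next
  case (Suc n)
  let ?m = "Suc (Suc n)"
  note l = nat_pow_lcomm[OF c(1)]
  have "w [^] Suc ?m \<otimes> b = w \<otimes> (w [^] ?m \<otimes> b)"
    using c by (simp only: nat_pow_Suc_left[of w ?m] m_assoc nat_pow_closed)
  also have "\<dots> = w \<otimes> (b \<otimes> w [^] ?m) \<oplus> add_pow R (?m) (w [^] ?m \<otimes> e) \<oplus> add_pow R (?m choose 2) (w [^] Suc n \<otimes> f)"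
    unfolding Suc using c
    by (simp add: r_distr add_pow_rdistr l m_assoc del: binomial_Suc_Suc add.nat_pow_Suc)
  also have "w \<otimes> (b \<otimes> w [^] ?m) = b \<otimes> w [^] Suc ?m \<oplus> e \<otimes> w [^] ?m"
  proof -
    have "w \<otimes> (b \<otimes> w [^] ?m) = (w \<otimes> b) \<otimes> w [^] ?m" using c by (simp only: m_assoc nat_pow_closed)
    also have "\<dots> = b \<otimes> w [^] Suc ?m \<oplus> e \<otimes> w [^] ?m"
      unfolding wb using c by (simp add: l_distr m_assoc l)
    finally show ?thesis .
  qed
  also have "e \<otimes> w [^] ?m = w [^] ?m \<otimes> e \<oplus> add_pow R (?m) (w [^] Suc n \<otimes> f)"
    by (rule commutator_pow_left[OF c(3,1,4) ew fw])
  finally have "w [^] Suc ?m \<otimes> b = b \<otimes> w [^] Suc ?m \<oplus> (add_pow R (?m) (w [^] ?m \<otimes> e) \<oplus> w [^] ?m \<otimes> e)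
      \<oplus> (add_pow R (?m choose 2) (w [^] Suc n \<otimes> f) \<oplus> add_pow R (?m) (w [^] Suc n \<otimes> f))"
    using c by (simp add: a_ac del: nat_pow_Suc binomial_Suc_Suc add.nat_pow_Suc)
  also have "add_pow R (?m) (w [^] ?m \<otimes> e) \<oplus> w [^] ?m \<otimes> e = add_pow R (Suc ?m) (w [^] ?m \<otimes> e)" by simp
  also have "add_pow R (?m choose 2) (w [^] Suc n \<otimes> f) \<oplus> add_pow R (?m) (w [^] Suc n \<otimes> f) = add_pow R (Suc ?m choose 2) (w [^] Suc n \<otimes> f)"
    using c by (subst add.nat_pow_mult) (simp_all add: numeral_2_eq_2 add.commute)
  finally show ?case .
qed

lemma pow_mult_commutator:
  assumes c: "a \<in> carrier R" "b \<in> carrier R" "e \<in> carrier R"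
    and ba: "b \<otimes> a = a \<otimes> b \<oplus> e" and ea: "e \<otimes> a = a \<otimes> e" and eb: "e \<otimes> b = b \<otimes> e" and ee: "e \<otimes> e = \<zero>"
  shows "(a \<otimes> b) [^] Suc n = a [^] Suc n \<otimes> b [^] Suc n \<oplus> add_pow R (Suc n choose 2) (a [^] n \<otimes> b [^] n \<otimes> e)"
proof (induction n)
  case 0
  then show ?case using c by (simp add: numeral_2_eq_2)
next
  case (Suc n)
  have en: "e \<otimes> b [^] k = b [^] k \<otimes> e" for k :: nat
    using commutator_pow_left[of e b \<zero> "k - 1"] c eb by (cases k) simp_all
  have bn: "b [^] Suc k \<otimes> a = a \<otimes> b [^] Suc k \<oplus> add_pow R (Suc k) (b [^] k \<otimes> e)" for k
  proof (induction k)
    case 0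
    then show ?case using c ba by simp
  next
    case (Suc n)
    have "b [^] Suc (Suc n) \<otimes> a = b \<otimes> (b [^] Suc n \<otimes> a)"
      using c by (simp only: nat_pow_Suc_left[of b "Suc n"] m_assoc nat_pow_closed)
    also have "\<dots> = (b \<otimes> a) \<otimes> b [^] Suc n \<oplus> add_pow R (Suc n) (b [^] Suc n \<otimes> e)"
      unfolding Suc using c by (simp add: r_distr add_pow_rdistr m_assoc nat_pow_lcomm del: add.nat_pow_Suc)
    also have "\<dots> = a \<otimes> b [^] Suc (Suc n) \<oplus> e \<otimes> b [^] Suc n \<oplus> add_pow R (Suc n) (b [^] Suc n \<otimes> e)"
      unfolding ba using c by (simp add: l_distr m_assoc nat_pow_lcomm del: add.nat_pow_Suc)
    finally show ?case using c en[of "Suc n"] by (simp add: a_ac)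
  qed
  have "(a \<otimes> b) [^] Suc (Suc n) = (a [^] Suc n \<otimes> b [^] Suc n \<oplus> add_pow R (Suc n choose 2) (a [^] n \<otimes> b [^] n \<otimes> e)) \<otimes> (a \<otimes> b)"
    using Suc by simp
  also have "\<dots> = a [^] Suc n \<otimes> (b [^] Suc n \<otimes> a) \<otimes> b \<oplus> add_pow R (Suc n choose 2) (a [^] n \<otimes> (b [^] n \<otimes> a) \<otimes> b \<otimes> e)"
  proof -
    have "e \<otimes> (a \<otimes> b) = a \<otimes> (b \<otimes> e)" using c by (metis ea eb m_assoc)
    then show ?thesis using c by (simp add: l_distr add_pow_ldistr m_assoc del: binomial_Suc_Suc)
  qed
  also have "a [^] n \<otimes> (b [^] n \<otimes> a) \<otimes> b \<otimes> e = a [^] Suc n \<otimes> b [^] Suc n \<otimes> e"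
  proof -
    have "b [^] n \<otimes> a \<otimes> e = a \<otimes> b [^] n \<otimes> e"
    proof (cases n)
      case (Suc k)
      show ?thesis unfolding Suc bn using c by (simp add: l_distr add_pow_ldistr m_assoc ee del: nat_pow_Suc)
    qed (use c in simp)
    then have "a [^] n \<otimes> (b [^] n \<otimes> a \<otimes> e) \<otimes> b = a [^] n \<otimes> (a \<otimes> b [^] n \<otimes> e) \<otimes> b" by simp
    then show ?thesis using c by (simp add: m_assoc eb)
  qed
  also have "a [^] Suc n \<otimes> (b [^] Suc n \<otimes> a) \<otimes> b = a [^] Suc (Suc n) \<otimes> b [^] Suc (Suc n) \<oplus> add_pow R (Suc n) (a [^] Suc n \<otimes> b [^] Suc n \<otimes> e)"
    unfolding bn using c
    by (simp add: l_distr r_distr add_pow_ldistr add_pow_rdistr m_assoc eb del: add.nat_pow_Suc)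
  finally have "(a \<otimes> b) [^] Suc (Suc n) = a [^] Suc (Suc n) \<otimes> b [^] Suc (Suc n) \<oplus>
      (add_pow R (Suc n) (a [^] Suc n \<otimes> b [^] Suc n \<otimes> e) \<oplus> add_pow R (Suc n choose 2) (a [^] Suc n \<otimes> b [^] Suc n \<otimes> e))"
    using c by (simp add: a_ac del: nat_pow_Suc binomial_Suc_Suc add.nat_pow_Suc)
  also have "add_pow R (Suc n) (a [^] Suc n \<otimes> b [^] Suc n \<otimes> e) \<oplus> add_pow R (Suc n choose 2) (a [^] Suc n \<otimes> b [^] Suc n \<otimes> e)
      = add_pow R (Suc (Suc n) choose 2) (a [^] Suc n \<otimes> b [^] Suc n \<otimes> e)"
    using c by (subst add.nat_pow_mult) (simp_all add: numeral_2_eq_2)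
  finally show ?case .
qed

text \<open>
  The binomial expansion with all factors \<open>a\<close> on the left, for elements that need not commute.
\<close>

definition ordered_binom :: "'a \<Rightarrow> 'a \<Rightarrow> nat \<Rightarrow> 'a" where
  "ordered_binom a b n = (\<Oplus>k\<in>{..n}. add_pow R (n choose k) (a [^] k \<otimes> b [^] (n - k)))"

lemma ordered_binom_closed [simp]:
  "a \<in> carrier R \<Longrightarrow> b \<in> carrier R \<Longrightarrow> ordered_binom a b n \<in> carrier R"
  unfolding ordered_binom_def by (rule finsum_closed) auto

lemma ordered_binom_0: "a \<in> carrier R \<Longrightarrow> b \<in> carrier R \<Longrightarrow> ordered_binom a b 0 = \<one>"
  by (simp add: ordered_binom_def)

lemma ordered_binom_Suc:
  assumes c: "a \<in> carrier R" "b \<in> carrier R"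
  shows "ordered_binom a b (Suc n) = a \<otimes> ordered_binom a b n \<oplus> ordered_binom a b n \<otimes> b"
proof -
  let ?t = "\<lambda>k. a [^] k \<otimes> b [^] (Suc n - k)"
  have t: "?t k \<in> carrier R" for k using c by simp
  have "ordered_binom a b (Suc n) = (\<Oplus>k\<in>{..n}. add_pow R (Suc n choose Suc k) (?t (Suc k))) \<oplus> add_pow R (Suc n choose 0) (?t 0)"
    unfolding ordered_binom_def by (rule finsum_Suc2) (use c in auto)
  also have "(\<Oplus>k\<in>{..n}. add_pow R (Suc n choose Suc k) (?t (Suc k))) =
      (\<Oplus>k\<in>{..n}. add_pow R (n choose k) (?t (Suc k)) \<oplus> add_pow R (n choose Suc k) (?t (Suc k)))"
    using c by (intro finsum_cong') (auto simp: add.nat_pow_mult)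
  also have "\<dots> = (\<Oplus>k\<in>{..n}. add_pow R (n choose k) (?t (Suc k))) \<oplus> (\<Oplus>k\<in>{..n}. add_pow R (n choose Suc k) (?t (Suc k)))"
    using c by (intro finsum_addf) auto
  also have "(\<Oplus>k\<in>{..n}. add_pow R (n choose k) (?t (Suc k))) = a \<otimes> ordered_binom a b n"
    unfolding ordered_binom_def using c
    by (subst finsum_rdistr) (auto simp: nat_pow_lcomm m_assoc add_pow_rdistr intro!: finsum_cong')
  finally have 1: "ordered_binom a b (Suc n) = a \<otimes> ordered_binom a b n \<oplus>
      ((\<Oplus>k\<in>{..n}. add_pow R (n choose Suc k) (?t (Suc k))) \<oplus> add_pow R (n choose 0) (?t 0))"
    using c t by (simp add: a_assoc)
  have "(\<Oplus>k\<in>{..n}. add_pow R (n choose Suc k) (?t (Suc k))) \<oplus> add_pow R (n choose 0) (?t 0) = (\<Oplus>k\<in>{..Suc n}. add_pow R (n choose k) (?t k))"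
    by (rule finsum_Suc2[symmetric]) (use t in auto)
  also have "\<dots> = add_pow R (n choose Suc n) (?t (Suc n)) \<oplus> (\<Oplus>k\<in>{..n}. add_pow R (n choose k) (?t k))"
    by (rule finsum_Suc) (use t in auto)
  also have "\<dots> = (\<Oplus>k\<in>{..n}. add_pow R (n choose k) (?t k))"
    using c finsum_closed[of "\<lambda>k. add_pow R (n choose k) (?t k)" "{..n}"] by (simp add: binomial_eq_0)
  also have "\<dots> = ordered_binom a b n \<otimes> b"
    unfolding ordered_binom_def using c
    by (subst finsum_ldistr) (auto simp: m_assoc add_pow_ldistr Suc_diff_le intro!: finsum_cong')
  finally show ?thesis using 1 by simp
qed

lemma ordered_binom_mult_left:
  assumes c: "a \<in> carrier R" "b \<in> carrier R" "e \<in> carrier R"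
    and ba: "b \<otimes> a = a \<otimes> b \<oplus> e" and eb: "e \<otimes> b = b \<otimes> e"
  shows "ordered_binom a b (Suc n) \<otimes> a = a \<otimes> ordered_binom a b (Suc n) \<oplus> add_pow R (Suc n) (ordered_binom a b n \<otimes> e)"
proof (induction n)
  case 0
  then show ?case using c by (simp add: ordered_binom_0 ordered_binom_Suc l_distr r_distr ba a_ac)
next
  case (Suc n)
  let ?T = "ordered_binom a b (Suc n)" and ?S = "ordered_binom a b n"
  have "ordered_binom a b (Suc (Suc n)) \<otimes> a = a \<otimes> (?T \<otimes> a) \<oplus> ?T \<otimes> (b \<otimes> a)"
    using c by (simp add: ordered_binom_Suc[of a b "Suc n"] l_distr m_assoc)
  also have "?T \<otimes> (b \<otimes> a) = (?T \<otimes> a) \<otimes> b \<oplus> ?T \<otimes> e"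
    unfolding ba using c by (simp add: r_distr m_assoc)
  also have "a \<otimes> (?T \<otimes> a) \<oplus> ((?T \<otimes> a) \<otimes> b \<oplus> ?T \<otimes> e) =
      a \<otimes> (a \<otimes> ?T \<oplus> ?T \<otimes> b) \<oplus> add_pow R (Suc n) ((a \<otimes> ?S \<oplus> ?S \<otimes> b) \<otimes> e) \<oplus> ?T \<otimes> e"
    unfolding Suc using c
    by (simp add: l_distr r_distr add_pow_ldistr add_pow_rdistr m_assoc eb add.nat_pow_distrib a_ac del: add.nat_pow_Suc)
  finally show ?case using c
    by (simp add: ordered_binom_Suc[of a b "Suc n"] ordered_binom_Suc[of a b n, symmetric] a_ac)
qed

text \<open>
  With a central commutator \<open>e\<close> of square zero, reordering the expansion of \<open>(a + b)\<^sup>n\<close> costs one \<open>e\<close> for each pair of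
  factors.
\<close>

lemma pow_add_commutator:
  assumes c: "a \<in> carrier R" "b \<in> carrier R" "e \<in> carrier R"
    and ba: "b \<otimes> a = a \<otimes> b \<oplus> e" and ea: "e \<otimes> a = a \<otimes> e" and eb: "e \<otimes> b = b \<otimes> e" and ee: "e \<otimes> e = \<zero>"
  shows "(a \<oplus> b) [^] Suc (Suc n) = ordered_binom a b (Suc (Suc n)) \<oplus> add_pow R (Suc (Suc n) choose 2) (ordered_binom a b n \<otimes> e)"
proof (induction n)
  case 0
  then show ?case
    using c by (simp add: ordered_binom_0 ordered_binom_Suc l_distr r_distr ba a_ac numeral_2_eq_2)
next
  case (Suc n)
  let ?T = "ordered_binom a b"
  let ?m = "Suc (Suc n)"
  have S: "?T n \<otimes> e \<otimes> (a \<oplus> b) = ?T (Suc n) \<otimes> e"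
  proof -
    have "?T n \<otimes> a \<otimes> e = a \<otimes> ?T n \<otimes> e"
    proof (cases n)
      case 0
      then show ?thesis using c by (simp add: ordered_binom_0)
    next
      case (Suc k)
      show ?thesis unfolding Suc ordered_binom_mult_left[OF c ba eb]
        using c by (simp add: l_distr add_pow_ldistr m_assoc ee del: add.nat_pow_Suc)
    qed
    then show ?thesis
      using c by (simp add: ordered_binom_Suc l_distr r_distr m_assoc ea eb)
  qed
  have "(a \<oplus> b) [^] Suc ?m = (?T ?m \<oplus> add_pow R (?m choose 2) (?T n \<otimes> e)) \<otimes> (a \<oplus> b)"
    using Suc by simp
  also have "\<dots> = ?T ?m \<otimes> (a \<oplus> b) \<oplus> add_pow R (?m choose 2) (?T n \<otimes> e \<otimes> (a \<oplus> b))"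
    using c by (subst l_distr) (simp_all add: add_pow_ldistr del: binomial_Suc_Suc)
  also have "\<dots> = ?T ?m \<otimes> a \<oplus> ?T ?m \<otimes> b \<oplus> add_pow R (?m choose 2) (?T (Suc n) \<otimes> e)"
    using c by (simp add: S r_distr del: binomial_Suc_Suc)
  also have "?T ?m \<otimes> a = a \<otimes> ?T ?m \<oplus> add_pow R (?m) (?T (Suc n) \<otimes> e)"
    by (rule ordered_binom_mult_left[OF c ba eb])
  finally have "(a \<oplus> b) [^] Suc ?m = (a \<otimes> ?T ?m \<oplus> ?T ?m \<otimes> b) \<oplus> (add_pow R (?m) (?T (Suc n) \<otimes> e) \<oplus> add_pow R (?m choose 2) (?T (Suc n) \<otimes> e))"
    using c by (simp add: a_ac del: binomial_Suc_Suc add.nat_pow_Suc nat_pow_Suc)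
  also have "add_pow R (?m) (?T (Suc n) \<otimes> e) \<oplus> add_pow R (?m choose 2) (?T (Suc n) \<otimes> e) = add_pow R (Suc ?m choose 2) (?T (Suc n) \<otimes> e)"
    using c by (subst add.nat_pow_mult) (simp_all add: numeral_2_eq_2)
  finally show ?case using c by (simp only: ordered_binom_Suc)
qed

end

section \<open>Elements that are central modulo powers of \<open>p\<close>\<close>

locale odd_prime_ring = ring R for R (structure) +
  fixes p :: nat
  assumes prime_p: "Factorial_Ring.prime p" and odd_p: "odd p"
begin

definition res :: "nat \<Rightarrow> 'a \<Rightarrow> 'a set" where "res j = residue_class R (p ^ j)"
definition red :: "nat \<Rightarrow> 'a set ring" where "red j = reduction R (p ^ j)"

sublocale res: ring_hom_ring R "red j" "res j" for j
  unfolding res_def red_def by (rule residue_hom_ring)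

lemma res_eq_iff:
  assumes "a \<in> carrier R" "b \<in> carrier R"
  shows "res j a = res j b \<longleftrightarrow> (\<exists>c\<in>carrier R. a = b \<oplus> add_pow R (p ^ j) c)"
  unfolding res_def by (rule residue_class_eq_iff[OF assms])

lemma res_eqE:
  assumes "res j a = res j b" "a \<in> carrier R" "b \<in> carrier R"
  obtains c where "c \<in> carrier R" "a = b \<oplus> add_pow R (p ^ j) c"
  using res_eq_iff[OF assms(2,3), of j] assms(1) that by auto

lemma res_surj: "carrier (red j) = res j ` carrier R"
  unfolding res_def red_def by (rule residue_surj)

text \<open>
  The lifts to \<open>R\<close> of the central elements of \<open>R/p\<^sup>jR\<close>.
\<close>

definition central_mod :: "nat \<Rightarrow> 'a \<Rightarrow> bool" where
  "central_mod j a \<longleftrightarrow> a \<in> carrier R \<and> (\<forall>x\<in>carrier R. res j (a \<otimes> x) = res j (x \<otimes> a))"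

lemma central_mod_closed [simp]: "central_mod j a \<Longrightarrow> a \<in> carrier R"
  by (simp add: central_mod_def)

lemma p_eq: obtains n where "p = Suc (Suc (Suc n))"
proof -
  have "p \<ge> 2" "p \<noteq> 2" using prime_ge_2_nat[OF prime_p] odd_p by auto
  then show ?thesis using that[of "p - 3"] by simp
qed

lemma res_mono:
  assumes "a \<in> carrier R" "b \<in> carrier R" "i \<le> j" "res j a = res j b"
  shows "res i a = res i b"
proof -
  obtain c where c: "c \<in> carrier R" "a = b \<oplus> add_pow R (p ^ j) c"
    using assms res_eq_iff by blast
  have "add_pow R (p ^ j) c = add_pow R (p ^ i) (add_pow R (p ^ (j - i)) c)"
    using c assms(3) by (simp add: add.nat_pow_pow flip: power_add)
  then show ?thesis using assms c by (subst res_eq_iff) auto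
qed

lemma res_add_pow:
  assumes "a \<in> carrier R" "b \<in> carrier R" "res j a = res j b"
  shows "res (i + j) (add_pow R (p ^ i) a) = res (i + j) (add_pow R (p ^ i) b)"
proof -
  obtain c where c: "c \<in> carrier R" "a = b \<oplus> add_pow R (p ^ j) c"
    using assms res_eq_iff by blast
  have "add_pow R (p ^ i) a = add_pow R (p ^ i) b \<oplus> add_pow R (p ^ (i + j)) c"
    using c assms by (simp add: add.nat_pow_distrib add.nat_pow_pow power_add mult.commute)
  then show ?thesis using assms c by (subst res_eq_iff) auto
qed

lemma res_multiple_zero: "a \<in> carrier R \<Longrightarrow> j \<le> i \<Longrightarrow> res j (add_pow R (p ^ i) a) = \<zero>\<^bsub>red j\<^esub>"
proof -
  assume a: "a \<in> carrier R" "j \<le> i"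
  have "add_pow R (p ^ i) a = add_pow R (p ^ j) (add_pow R (p ^ (i - j)) a)"
    using a by (simp add: add.nat_pow_pow flip: power_add)
  then have "res j (add_pow R (p ^ i) a) = res j \<zero>"
    using a by (subst res_eq_iff) auto
  then show ?thesis by simp
qed

lemma res_hom_add_pow: "a \<in> carrier R \<Longrightarrow> res j (add_pow R (k::nat) a) = add_pow (red j) k (res j a)"
  by (induction k) simp_all

lemma central_modD: "central_mod j a \<Longrightarrow> x \<in> carrier R \<Longrightarrow> res j (a \<otimes> x) = res j (x \<otimes> a)"
  unfolding central_mod_def by blast

lemma central_modE:
  assumes "central_mod j a" "x \<in> carrier R"
  obtains c where "c \<in> carrier R" "a \<otimes> x = x \<otimes> a \<oplus> add_pow R (p ^ j) c"
proof (rule res_eqE[OF central_modD[OF assms]])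
  show "a \<otimes> x \<in> carrier R" "x \<otimes> a \<in> carrier R" using assms by simp_all
qed (rule that)

lemma central_mod_cong:
  assumes a: "a \<in> carrier R" and ab: "res j a = res j b" and b: "central_mod j b"
  shows "central_mod j a"
  unfolding central_mod_def
proof (intro conjI ballI a)
  fix x assume x: "x \<in> carrier R"
  have "res j (a \<otimes> x) = res j (b \<otimes> x)" using a x ab central_mod_closed[OF b] by simp
  also have "\<dots> = res j (x \<otimes> b)" using b x by (rule central_modD)
  also have "\<dots> = res j (x \<otimes> a)" using a x ab central_mod_closed[OF b] by simp
  finally show "res j (a \<otimes> x) = res j (x \<otimes> a)" .
qed

lemma central_mod_mono: "central_mod j a \<Longrightarrow> i \<le> j \<Longrightarrow> central_mod i a"
  unfolding central_mod_def
proof (elim conjE, intro conjI ballI)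
  fix x assume "a \<in> carrier R" "\<forall>x\<in>carrier R. res j (a \<otimes> x) = res j (x \<otimes> a)" "i \<le> j" "x \<in> carrier R"
  then show "res i (a \<otimes> x) = res i (x \<otimes> a)" by (intro res_mono[of _ _ i j]) simp_all
qed

text \<open>
  The next three facts describe the ideal \<open>p\<^sup>jR/p\<^sup>j\<^sup>+\<^sup>1R\<close>, where all commutators below live: it is killed by \<open>p\<close>, has
  square zero if \<open>j \<ge> 1\<close>, and commutes with lifts of central elements of \<open>R/pR\<close>.
\<close>

lemma res_p_torsion:
  assumes "c \<in> carrier R" "p dvd k"
  shows "add_pow (red (Suc j)) k (res (Suc j) (add_pow R (p ^ j) c)) = \<zero>\<^bsub>red (Suc j)\<^esub>"
proof -
  obtain q where k: "k = p * q" using assms(2) by (rule dvdE)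
  have "add_pow (red (Suc j)) k (res (Suc j) (add_pow R (p ^ j) c)) = res (Suc j) (add_pow R (p ^ Suc j) (add_pow R q c))"
    using assms k by (simp add: res_hom_add_pow[symmetric] add.nat_pow_pow mult_ac)
  then show ?thesis using assms res_multiple_zero[of "add_pow R q c" "Suc j" "Suc j"] by simp
qed

lemma res_square_zero:
  assumes "c \<in> carrier R" "c' \<in> carrier R" "j \<ge> 1"
  shows "res (Suc j) (add_pow R (p ^ j) c) \<otimes>\<^bsub>red (Suc j)\<^esub> res (Suc j) (add_pow R (p ^ j) c') = \<zero>\<^bsub>red (Suc j)\<^esub>"
proof -
  have "add_pow R (p ^ j) c \<otimes> add_pow R (p ^ j) c' = add_pow R (p ^ (j + j)) (c \<otimes> c')"
    using assms by (simp add: add_pow_ldistr add_pow_rdistr add.nat_pow_pow power_add)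
  then show ?thesis
    using assms res_multiple_zero[of "c \<otimes> c'" "Suc j" "j + j"] by (simp flip: res.hom_mult)
qed

lemma res_central_comm:
  assumes "c \<in> carrier R" "central_mod 1 b"
  shows "res (Suc j) (add_pow R (p ^ j) c) \<otimes>\<^bsub>red (Suc j)\<^esub> res (Suc j) b = res (Suc j) b \<otimes>\<^bsub>red (Suc j)\<^esub> res (Suc j) (add_pow R (p ^ j) c)"
proof -
  have b: "b \<in> carrier R" using assms by simp
  have "res (j + 1) (add_pow R (p ^ j) (b \<otimes> c)) = res (j + 1) (add_pow R (p ^ j) (c \<otimes> b))"
    by (rule res_add_pow[OF _ _ central_modD[OF assms(2,1)]]) (use assms b in simp_all)
  then show ?thesis
    using assms b by (simp add: add_pow_ldistr add_pow_rdistr flip: res.hom_mult)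
qed

lemma res_pow_p:
  assumes j: "j \<ge> 1" and b: "central_mod 1 b" and a: "a \<in> carrier R" and ab: "res j a = res j b"
  shows "res (Suc j) (a [^] p) = res (Suc j) (b [^] p)"
proof -
  obtain n where n: "p = Suc (Suc (Suc n))" by (rule p_eq)
  obtain c where c: "c \<in> carrier R" "a = b \<oplus> add_pow R (p ^ j) c"
    by (rule res_eqE[OF ab]) (use a b in simp_all)
  let ?E = "res (Suc j) (add_pow R (p ^ j) c)" and ?b = "res (Suc j) b" and ?Q = "red (Suc j)"
  have "res (Suc j) (a [^] p) = (?b \<oplus>\<^bsub>?Q\<^esub> ?E) [^]\<^bsub>?Q\<^esub> p"
    using b c by (simp add: res.hom_nat_pow)
  also have "\<dots> = ?b [^]\<^bsub>?Q\<^esub> p \<oplus>\<^bsub>?Q\<^esub> add_pow ?Q p (?b [^]\<^bsub>?Q\<^esub> Suc (Suc n) \<otimes>\<^bsub>?Q\<^esub> ?E)"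
    using b c res_central_comm[OF c(1) b] res_square_zero[OF c(1) c(1) j]
    by (intro res.S.pow_add_square_zero[where n = "Suc (Suc n)", folded n]) simp_all
  also have "add_pow ?Q p (?b [^]\<^bsub>?Q\<^esub> Suc (Suc n) \<otimes>\<^bsub>?Q\<^esub> ?E) = ?b [^]\<^bsub>?Q\<^esub> Suc (Suc n) \<otimes>\<^bsub>?Q\<^esub> add_pow ?Q p ?E"
    using b c by (intro res.S.add_pow_rdistr[symmetric]) simp_all
  also have "\<dots> = \<zero>\<^bsub>?Q\<^esub>" using b c res_p_torsion[OF c(1) dvd_refl, of j] by simp
  finally show ?thesis using b by (simp add: res.hom_nat_pow)
qed

text \<open>
  Commutators with \<open>a\<close> are divisible by \<open>p\<^sup>j\<close>; the Leibniz rule for the \<open>p\<close>-th power multiplies them by another \<open>p\<close>.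
\<close>

lemma central_mod_pow_p:
  assumes j: "j \<ge> 1" and a: "central_mod j a"
  shows "central_mod (Suc j) (a [^] p)"
  unfolding central_mod_def
proof (intro conjI ballI)
  have a1: "central_mod 1 a" using a j by (rule central_mod_mono)
  show "a [^] p \<in> carrier R" using a by simp
  fix x assume x: "x \<in> carrier R"
  obtain n where n: "p = Suc (Suc (Suc n))" by (rule p_eq)
  obtain c where c: "c \<in> carrier R" "a \<otimes> x = x \<otimes> a \<oplus> add_pow R (p ^ j) c"
    using a x by (rule central_modE)
  let ?E = "res (Suc j) (add_pow R (p ^ j) c)" and ?a = "res (Suc j) a" and ?x = "res (Suc j) x" and ?Q = "red (Suc j)"
  have "?a \<otimes>\<^bsub>?Q\<^esub> ?x = res (Suc j) (x \<otimes> a \<oplus> add_pow R (p ^ j) c)" using a x c(2) by (simp flip: res.hom_mult)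
  then have ax: "?a \<otimes>\<^bsub>?Q\<^esub> ?x = ?x \<otimes>\<^bsub>?Q\<^esub> ?a \<oplus>\<^bsub>?Q\<^esub> ?E" using a x c(1) by simp
  have "?a [^]\<^bsub>?Q\<^esub> p \<otimes>\<^bsub>?Q\<^esub> ?x = ?x \<otimes>\<^bsub>?Q\<^esub> ?a [^]\<^bsub>?Q\<^esub> p \<oplus>\<^bsub>?Q\<^esub> add_pow ?Q p (?a [^]\<^bsub>?Q\<^esub> Suc (Suc n) \<otimes>\<^bsub>?Q\<^esub> ?E)
     \<oplus>\<^bsub>?Q\<^esub> add_pow ?Q (p choose 2) (?a [^]\<^bsub>?Q\<^esub> Suc n \<otimes>\<^bsub>?Q\<^esub> \<zero>\<^bsub>?Q\<^esub>)"
    using a x c ax res_central_comm[OF c(1) a1]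
    by (intro res.S.commutator_pow[where n = "Suc n", folded n]) simp_all
  also have "add_pow ?Q p (?a [^]\<^bsub>?Q\<^esub> Suc (Suc n) \<otimes>\<^bsub>?Q\<^esub> ?E) = ?a [^]\<^bsub>?Q\<^esub> Suc (Suc n) \<otimes>\<^bsub>?Q\<^esub> add_pow ?Q p ?E"
    using a c by (intro res.S.add_pow_rdistr[symmetric]) simp_all
  also have "\<dots> = \<zero>\<^bsub>?Q\<^esub>" using a c res_p_torsion[OF c(1) dvd_refl, of j] by simp
  finally have "?a [^]\<^bsub>?Q\<^esub> p \<otimes>\<^bsub>?Q\<^esub> ?x = ?x \<otimes>\<^bsub>?Q\<^esub> ?a [^]\<^bsub>?Q\<^esub> p" using a x by simp
  then show "res (Suc j) (a [^] p \<otimes> x) = res (Suc j) (x \<otimes> a [^] p)"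
    using a x by (simp add: res.hom_nat_pow)
qed

lemma central_mod_pow: "central_mod 1 a \<Longrightarrow> central_mod (Suc k) (a [^] (p ^ k))"
proof (induction k)
  case (Suc k)
  then have "central_mod (Suc (Suc k)) ((a [^] (p ^ k)) [^] p)" by (intro central_mod_pow_p) simp_all
  then show ?case using Suc by (simp add: nat_pow_pow mult.commute)
qed simp

lemma res_pow_p_pow:
  assumes b: "central_mod 1 b" and a: "a \<in> carrier R" and ab: "res 1 a = res 1 b"
  shows "res (Suc k) (a [^] (p ^ k)) = res (Suc k) (b [^] (p ^ k))"
proof (induction k)
  case 0
  then show ?case using assms by simp
next
  case (Suc k)
  have "central_mod 1 (b [^] (p ^ k))" using central_mod_mono[OF central_mod_pow[OF b]] by simp
  then have "res (Suc (Suc k)) ((a [^] (p ^ k)) [^] p) = res (Suc (Suc k)) ((b [^] (p ^ k)) [^] p)"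
    using a Suc by (intro res_pow_p) simp_all
  then show ?case using a b by (simp add: nat_pow_pow mult.commute)
qed

lemma p_dvd_choose_2: "p dvd p choose 2"
proof -
  obtain n where "p = Suc (Suc (Suc n))" by (rule p_eq)
  then show ?thesis using prime_p by (intro dvd_choose_prime) simp_all
qed

lemma res_mult_pow_p:
  assumes j: "j \<ge> 1" and a: "central_mod j a" and b: "central_mod j b"
  shows "res (Suc j) ((a \<otimes> b) [^] p) = res (Suc j) (a [^] p \<otimes> b [^] p)"
proof -
  have a1: "central_mod 1 a" "central_mod 1 b" using a b j by (auto intro: central_mod_mono)
  obtain n where n: "p = Suc (Suc (Suc n))" by (rule p_eq)
  obtain c where c: "c \<in> carrier R" "b \<otimes> a = a \<otimes> b \<oplus> add_pow R (p ^ j) c"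
    using central_modE[OF b central_mod_closed[OF a]] by blast
  let ?E = "res (Suc j) (add_pow R (p ^ j) c)" and ?a = "res (Suc j) a" and ?b = "res (Suc j) b" and ?Q = "red (Suc j)"
  have "?b \<otimes>\<^bsub>?Q\<^esub> ?a = res (Suc j) (a \<otimes> b \<oplus> add_pow R (p ^ j) c)" using a b c(2) by (simp flip: res.hom_mult)
  then have ba: "?b \<otimes>\<^bsub>?Q\<^esub> ?a = ?a \<otimes>\<^bsub>?Q\<^esub> ?b \<oplus>\<^bsub>?Q\<^esub> ?E" using a b c(1) by simp
  have "(?a \<otimes>\<^bsub>?Q\<^esub> ?b) [^]\<^bsub>?Q\<^esub> p = ?a [^]\<^bsub>?Q\<^esub> p \<otimes>\<^bsub>?Q\<^esub> ?b [^]\<^bsub>?Q\<^esub> p \<oplus>\<^bsub>?Q\<^esub>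
      add_pow ?Q (p choose 2) (?a [^]\<^bsub>?Q\<^esub> Suc (Suc n) \<otimes>\<^bsub>?Q\<^esub> ?b [^]\<^bsub>?Q\<^esub> Suc (Suc n) \<otimes>\<^bsub>?Q\<^esub> ?E)"
    using a b c ba res_central_comm[OF c(1) a1(1)] res_central_comm[OF c(1) a1(2)] res_square_zero[OF c(1) c(1) j]
    by (intro res.S.pow_mult_commutator[where n = "Suc (Suc n)", folded n]) simp_all
  also have "add_pow ?Q (p choose 2) (?a [^]\<^bsub>?Q\<^esub> Suc (Suc n) \<otimes>\<^bsub>?Q\<^esub> ?b [^]\<^bsub>?Q\<^esub> Suc (Suc n) \<otimes>\<^bsub>?Q\<^esub> ?E) =
      ?a [^]\<^bsub>?Q\<^esub> Suc (Suc n) \<otimes>\<^bsub>?Q\<^esub> ?b [^]\<^bsub>?Q\<^esub> Suc (Suc n) \<otimes>\<^bsub>?Q\<^esub> add_pow ?Q (p choose 2) ?E"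
    using a b c by (intro res.S.add_pow_rdistr[symmetric]) simp_all
  also have "\<dots> = \<zero>\<^bsub>?Q\<^esub>" using a b c res_p_torsion[OF c(1) p_dvd_choose_2, of j] by simp
  finally show ?thesis using a b by (simp add: res.hom_nat_pow)
qed

lemma res_ordered_binom:
  assumes "a \<in> carrier R" "b \<in> carrier R"
  shows "res j (ordered_binom a b n) = ring.ordered_binom (red j) (res j a) (res j b) n"
proof -
  let ?f = "\<lambda>k. add_pow R (n choose k) (a [^] k \<otimes> b [^] (n - k))"
  have "res j (finsum R ?f {..n}) = finsum (red j) (res j \<circ> ?f) {..n}"
    using assms by (intro res.hom_finsum) auto
  also have "\<dots> = (\<Oplus>\<^bsub>red j\<^esub>k\<in>{..n}. add_pow (red j) (n choose k) (res j a [^]\<^bsub>red j\<^esub> k \<otimes>\<^bsub>red j\<^esub> res j b [^]\<^bsub>red j\<^esub> (n - k)))"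
    using assms by (intro res.S.finsum_cong') (simp_all add: res_hom_add_pow res.hom_nat_pow)
  finally show ?thesis unfolding ordered_binom_def res.S.ordered_binom_def .
qed

lemma res_add_pow_p:
  assumes j: "j \<ge> 1" and a: "central_mod j a" and b: "central_mod j b"
  shows "res (Suc j) ((a \<oplus> b) [^] p) = res (Suc j) (ordered_binom a b p)"
proof -
  have a1: "central_mod 1 a" "central_mod 1 b" using a b j by (auto intro: central_mod_mono)
  obtain n where n: "p = Suc (Suc (Suc n))" by (rule p_eq)
  obtain c where c: "c \<in> carrier R" "b \<otimes> a = a \<otimes> b \<oplus> add_pow R (p ^ j) c"
    using central_modE[OF b central_mod_closed[OF a]] by blast
  let ?E = "res (Suc j) (add_pow R (p ^ j) c)" and ?a = "res (Suc j) a" and ?b = "res (Suc j) b" and ?Q = "red (Suc j)"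
  have "?b \<otimes>\<^bsub>?Q\<^esub> ?a = res (Suc j) (a \<otimes> b \<oplus> add_pow R (p ^ j) c)" using a b c(2) by (simp flip: res.hom_mult)
  then have ba: "?b \<otimes>\<^bsub>?Q\<^esub> ?a = ?a \<otimes>\<^bsub>?Q\<^esub> ?b \<oplus>\<^bsub>?Q\<^esub> ?E" using a b c(1) by simp
  let ?T = "ring.ordered_binom ?Q ?a ?b"
  have "(?a \<oplus>\<^bsub>?Q\<^esub> ?b) [^]\<^bsub>?Q\<^esub> p = ?T p \<oplus>\<^bsub>?Q\<^esub> add_pow ?Q (p choose 2) (?T (Suc n) \<otimes>\<^bsub>?Q\<^esub> ?E)"
    using a b c ba res_central_comm[OF c(1) a1(1)] res_central_comm[OF c(1) a1(2)] res_square_zero[OF c(1) c(1) j]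
    by (intro res.S.pow_add_commutator[where n = "Suc n", folded n]) simp_all
  also have "add_pow ?Q (p choose 2) (?T (Suc n) \<otimes>\<^bsub>?Q\<^esub> ?E) = ?T (Suc n) \<otimes>\<^bsub>?Q\<^esub> add_pow ?Q (p choose 2) ?E"
    using a b c by (intro res.S.add_pow_rdistr[symmetric]) simp_all
  also have "\<dots> = \<zero>\<^bsub>?Q\<^esub>" using a b c res_p_torsion[OF c(1) p_dvd_choose_2, of j] by simp
  finally show ?thesis using a b by (simp add: res.hom_nat_pow res_ordered_binom)
qed

lemma res_commutator_pow_p:
  assumes w: "central_mod 1 w" and b: "b \<in> carrier R" and d: "d \<in> carrier R"
    and wb: "res (Suc j) (w \<otimes> b) = res (Suc j) (b \<otimes> w \<oplus> add_pow R (p ^ j) d)"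
  shows "res (Suc (Suc j)) (w [^] p \<otimes> b) = res (Suc (Suc j)) (b \<otimes> w [^] p \<oplus> add_pow R (p ^ Suc j) (w [^] (p - 1) \<otimes> d))"
proof -
  obtain n where n: "p = Suc (Suc (Suc n))" by (rule p_eq)
  have wc: "w \<in> carrier R" using w by simp
  obtain r where r: "r \<in> carrier R" "w \<otimes> b = b \<otimes> w \<oplus> add_pow R (p ^ j) d \<oplus> add_pow R (p ^ Suc j) r"
    by (rule res_eqE[OF wb]) (use wc b d in simp_all)
  define d' where "d' = d \<oplus> add_pow R p r"
  have d': "d' \<in> carrier R" using d r by (simp add: d'_def)
  have wb': "w \<otimes> b = b \<otimes> w \<oplus> add_pow R (p ^ j) d'"
    using r d wc b by (simp add: d'_def add.nat_pow_distrib add.nat_pow_pow a_assoc mult.commute)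
  have "res 1 (d' \<otimes> w) = res 1 (w \<otimes> d')" using central_modD[OF w d'] by (rule sym)
  then obtain y where y: "y \<in> carrier R" "d' \<otimes> w = w \<otimes> d' \<oplus> add_pow R p y"
    using res_eqE[of 1 "d' \<otimes> w" "w \<otimes> d'"] wc d' by (metis m_closed power_one_right)
  have dw: "add_pow R (p ^ j) d' \<otimes> w = w \<otimes> add_pow R (p ^ j) d' \<oplus> add_pow R (p ^ Suc j) y"
    using y d' wc by (simp add: add_pow_ldistr add_pow_rdistr add.nat_pow_distrib add.nat_pow_pow mult.commute)
  let ?Q = "red (Suc (Suc j))" and ?h = "res (Suc (Suc j))"
  let ?E = "?h (add_pow R (p ^ j) d')" and ?F = "?h (add_pow R (p ^ Suc j) y)"
  have 1: "?h w \<otimes>\<^bsub>?Q\<^esub> ?h b = ?h b \<otimes>\<^bsub>?Q\<^esub> ?h w \<oplus>\<^bsub>?Q\<^esub> ?E"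
    using arg_cong[OF wb', of ?h] wc b d' by simp
  have 2: "?E \<otimes>\<^bsub>?Q\<^esub> ?h w = ?h w \<otimes>\<^bsub>?Q\<^esub> ?E \<oplus>\<^bsub>?Q\<^esub> ?F"
    using arg_cong[OF dw, of ?h] wc y d' by simp
  have 3: "?F \<otimes>\<^bsub>?Q\<^esub> ?h w = ?h w \<otimes>\<^bsub>?Q\<^esub> ?F"
    using res_central_comm[OF y(1) w, of "Suc j"] by simp
  have "?h w [^]\<^bsub>?Q\<^esub> p \<otimes>\<^bsub>?Q\<^esub> ?h b = ?h b \<otimes>\<^bsub>?Q\<^esub> ?h w [^]\<^bsub>?Q\<^esub> p \<oplus>\<^bsub>?Q\<^esub> add_pow ?Q p (?h w [^]\<^bsub>?Q\<^esub> Suc (Suc n) \<otimes>\<^bsub>?Q\<^esub> ?E)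
     \<oplus>\<^bsub>?Q\<^esub> add_pow ?Q (p choose 2) (?h w [^]\<^bsub>?Q\<^esub> Suc n \<otimes>\<^bsub>?Q\<^esub> ?F)"
    using wc b d' y 1 2 3 by (intro res.S.commutator_pow[where n = "Suc n", folded n]) simp_all
  also have "add_pow ?Q (p choose 2) (?h w [^]\<^bsub>?Q\<^esub> Suc n \<otimes>\<^bsub>?Q\<^esub> ?F) = ?h w [^]\<^bsub>?Q\<^esub> Suc n \<otimes>\<^bsub>?Q\<^esub> add_pow ?Q (p choose 2) ?F"
    using wc y by (intro res.S.add_pow_rdistr[symmetric]) simp_all
  also have "\<dots> = \<zero>\<^bsub>?Q\<^esub>" using wc y res_p_torsion[OF y(1) p_dvd_choose_2, of "Suc j"] by simp
  also have "add_pow ?Q p (?h w [^]\<^bsub>?Q\<^esub> Suc (Suc n) \<otimes>\<^bsub>?Q\<^esub> ?E) = ?h w [^]\<^bsub>?Q\<^esub> Suc (Suc n) \<otimes>\<^bsub>?Q\<^esub> add_pow ?Q p ?E"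
    using wc d' by (intro res.S.add_pow_rdistr[symmetric]) simp_all
  also have "add_pow ?Q p ?E = ?h (add_pow R (p ^ Suc j) d \<oplus> add_pow R (p ^ Suc (Suc j)) r)"
    using d r by (simp add: d'_def res_hom_add_pow[symmetric] add.nat_pow_distrib add.nat_pow_pow mult_ac del: res.hom_add)
  also have "\<dots> = ?h (add_pow R (p ^ Suc j) d)"
    using d r res_multiple_zero[of r "Suc (Suc j)" "Suc (Suc j)"] by simp
  finally have "?h (w [^] p \<otimes> b) = ?h (b \<otimes> w [^] p) \<oplus>\<^bsub>?Q\<^esub> ?h (w [^] Suc (Suc n) \<otimes> add_pow R (p ^ Suc j) d)"
    using wc b d by (simp add: res.hom_nat_pow)
  moreover have e: "p - 1 = Suc (Suc n)" using n by simp
  ultimately show ?thesis unfolding e using wc b d by (simp add: add_pow_rdistr)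
qed

text \<open>
  Modulo \<open>p\<^sup>k\<^sup>+\<^sup>2\<close>, the commutator of \<open>b\<close> with \<open>z\<close> raised to the \<open>p\<^sup>k\<close> is given by the Leibniz rule as for commuting
  elements; each further \<open>p\<close>-th power pushes the error terms one power of \<open>p\<close> higher.
\<close>

lemma res_commutator_pow:
  assumes z: "central_mod 1 z" and b: "b \<in> carrier R" and c: "c \<in> carrier R"
    and zb: "z \<otimes> b = b \<otimes> z \<oplus> add_pow R p c"
  shows "res (Suc (Suc k)) (z [^] (p ^ k) \<otimes> b) =
     res (Suc (Suc k)) (b \<otimes> z [^] (p ^ k) \<oplus> add_pow R (p ^ Suc k) (z [^] (p ^ k - 1) \<otimes> c))"
proof (induction k)
  case 0
  then show ?case using z b c zb by simp
next
  case (Suc k)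
  have zc: "z \<in> carrier R" using z by simp
  let ?w = "z [^] (p ^ k)"
  have "p ^ k > 0" using prime_gt_0_nat[OF prime_p] by simp
  then have e: "p ^ k * (p - 1) + (p ^ k - 1) = p ^ Suc k - 1"
    by (cases p) (simp_all add: algebra_simps)
  have "central_mod 1 ?w" using central_mod_mono[OF central_mod_pow[OF z]] by simp
  from res_commutator_pow_p[OF this b _ Suc] zc c
  have "res (Suc (Suc (Suc k))) (?w [^] p \<otimes> b) =
     res (Suc (Suc (Suc k))) (b \<otimes> ?w [^] p \<oplus> add_pow R (p ^ Suc (Suc k)) (?w [^] (p - 1) \<otimes> (z [^] (p ^ k - 1) \<otimes> c)))"
    by simp
  moreover have "?w [^] (p - 1) \<otimes> (z [^] (p ^ k - 1) \<otimes> c) = z [^] (p ^ Suc k - 1) \<otimes> c"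
    using zc c by (simp only: nat_pow_pow m_assoc[symmetric] nat_pow_mult nat_pow_closed e)
  ultimately show ?case using zc by (simp add: nat_pow_pow mult.commute)
qed

end

section \<open>Evaluation at almost commuting elements\<close>

context odd_prime_ring
begin

lemma central_mod_mult:
  assumes a: "central_mod j a" and b: "central_mod j b"
  shows "central_mod j (a \<otimes> b)"
  unfolding central_mod_def
proof (intro conjI ballI)
  have c: "a \<in> carrier R" "b \<in> carrier R" using a b by simp_all
  then show "a \<otimes> b \<in> carrier R" by simp
  fix x assume x: "x \<in> carrier R"
  have "res j (a \<otimes> b \<otimes> x) = res j a \<otimes>\<^bsub>red j\<^esub> res j (b \<otimes> x)" using c x by (simp add: m_assoc)
  also have "\<dots> = res j a \<otimes>\<^bsub>red j\<^esub> res j (x \<otimes> b)" by (simp only: central_modD[OF b x])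
  also have "\<dots> = res j (a \<otimes> x) \<otimes>\<^bsub>red j\<^esub> res j b" using c x by (simp add: res.S.m_assoc)
  also have "\<dots> = res j (x \<otimes> a) \<otimes>\<^bsub>red j\<^esub> res j b" by (simp only: central_modD[OF a x])
  also have "\<dots> = res j (x \<otimes> (a \<otimes> b))" using c x by (simp add: res.S.m_assoc)
  finally show "res j (a \<otimes> b \<otimes> x) = res j (x \<otimes> (a \<otimes> b))" .
qed

lemma central_mod_add:
  assumes a: "central_mod j a" and b: "central_mod j b"
  shows "central_mod j (a \<oplus> b)"
  unfolding central_mod_def
proof (intro conjI ballI)
  have c: "a \<in> carrier R" "b \<in> carrier R" using a b by simp_all
  then show "a \<oplus> b \<in> carrier R" by simp
  fix x assume x: "x \<in> carrier R"
  have "res j ((a \<oplus> b) \<otimes> x) = res j (a \<otimes> x) \<oplus>\<^bsub>red j\<^esub> res j (b \<otimes> x)" using c x by (simp add: l_distr)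
  also have "\<dots> = res j (x \<otimes> a) \<oplus>\<^bsub>red j\<^esub> res j (x \<otimes> b)" by (simp only: central_modD[OF a x] central_modD[OF b x])
  also have "\<dots> = res j (x \<otimes> (a \<oplus> b))" using c x by (simp add: r_distr)
  finally show "res j ((a \<oplus> b) \<otimes> x) = res j (x \<otimes> (a \<oplus> b))" .
qed

lemma central_mod_one: "central_mod j \<one>"
  unfolding central_mod_def by (intro conjI ballI) (simp_all only: l_one r_one one_closed)

lemma central_mod_zero: "central_mod j \<zero>"
  unfolding central_mod_def by (intro conjI ballI) (simp_all only: l_null r_null zero_closed)

lemma central_mod_nat_pow: "central_mod j a \<Longrightarrow> central_mod j (a [^] (n::nat))"
  by (induction n) (simp_all add: central_mod_one central_mod_mult)

lemma central_mod_a_inv: 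
  assumes a: "central_mod j a" shows "central_mod j (\<ominus> a)"
  unfolding central_mod_def
proof (intro conjI ballI)
  have c: "a \<in> carrier R" using a by simp
  then show "\<ominus> a \<in> carrier R" by simp
  fix x assume x: "x \<in> carrier R"
  have "res j (\<ominus> a \<otimes> x) = \<ominus>\<^bsub>red j\<^esub> res j (a \<otimes> x)" using c x by (simp add: l_minus del: res.hom_mult)
  also have "\<dots> = \<ominus>\<^bsub>red j\<^esub> res j (x \<otimes> a)" by (simp only: central_modD[OF a x])
  also have "\<dots> = res j (x \<otimes> \<ominus> a)" using c x by (simp add: r_minus del: res.hom_mult)
  finally show "res j (\<ominus> a \<otimes> x) = res j (x \<otimes> \<ominus> a)" .
qed

lemma central_mod_add_pow: "central_mod j a \<Longrightarrow> central_mod j (add_pow R (n::nat) a)"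
  by (induction n) (simp_all add: central_mod_zero central_mod_add)

lemma central_mod_add_pow_int: "central_mod j a \<Longrightarrow> central_mod j (add_pow R (n::int) a)"
  by (cases "n \<ge> 0")
     (simp_all only: add_pow_int_ge[of n R a] add_pow_int_lt[of n R a] not_le central_mod_add_pow central_mod_a_inv)

lemma central_mod_shift:
  assumes a: "central_mod j a" shows "central_mod (i + j) (add_pow R (p ^ i) a)"
  unfolding central_mod_def
proof (intro conjI ballI)
  have c: "a \<in> carrier R" using a by simp
  then show "add_pow R (p ^ i) a \<in> carrier R" by simp
  fix x assume x: "x \<in> carrier R"
  show "res (i + j) (add_pow R (p ^ i) a \<otimes> x) = res (i + j) (x \<otimes> add_pow R (p ^ i) a)"
    using res_add_pow[OF _ _ central_modD[OF a x], of i] c x by (simp add: add_pow_ldistr add_pow_rdistr del: res.hom_mult)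
qed

lemma add_pow_int_mult: "a \<in> carrier R \<Longrightarrow> add_pow R (c::int) (add_pow R (d::int) a) = add_pow R (c * d) a"
  by (simp add: add.int_pow_pow mult.commute)

lemma add_pow_int_mult_nat: "a \<in> carrier R \<Longrightarrow> add_pow R (int k * c) a = add_pow R k (add_pow R c a)"
  using add.int_pow_pow[of a "int k" c] by (simp add: add_pow_int_ge mult.commute)

lemma res_add_pow_int:
  assumes "a \<in> carrier R" "b \<in> carrier R" "res j a = res j b"
  shows "res j (add_pow R (c::int) a) = res j (add_pow R c b)"
  using assms by (cases "c \<ge> 0")
     (simp_all only: add_pow_int_ge[of c R] add_pow_int_lt[of c R] not_le res_hom_add_pow res.hom_a_inv add.nat_pow_closed)

subsection \<open>Monomials\<close>

text \<open>
  Monomials in noncommuting values, with the indeterminates in the order of a list.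
\<close>

fun list_monom :: "('v \<Rightarrow> 'a) \<Rightarrow> 'v list \<Rightarrow> ('v \<Rightarrow> nat) \<Rightarrow> 'a" where
  "list_monom y [] e = \<one>"
| "list_monom y (v # vs) e = y v [^] e v \<otimes> list_monom y vs e"

lemma list_monom_closed [simp]: "(\<And>v. y v \<in> carrier R) \<Longrightarrow> list_monom y vs e \<in> carrier R"
  by (induction vs) auto

lemma list_monom_central:
  assumes y: "\<And>v. central_mod 1 (y v)"
  shows "central_mod (Suc i) (list_monom y vs (\<lambda>v. p ^ i * e v))"
proof (induction vs)
  case (Cons v vs)
  have "central_mod (Suc i) ((y v [^] (p ^ i)) [^] e v)" by (intro central_mod_nat_pow central_mod_pow y)
  then show ?case using Cons central_mod_closed[OF y] by (simp add: nat_pow_pow central_mod_mult)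
qed (simp add: central_mod_one)

lemma list_monom_add:
  assumes y: "\<And>v. central_mod 1 (y v)"
  shows "res (Suc i) (list_monom y vs (\<lambda>v. p ^ i * e v) \<otimes> list_monom y vs (\<lambda>v. p ^ i * e' v)) =
     res (Suc i) (list_monom y vs (\<lambda>v. p ^ i * e v + p ^ i * e' v))"
proof (induction vs)
  case (Cons v vs)
  have yc: "y v \<in> carrier R" for v by (rule central_mod_closed[OF y])
  let ?Q = "red (Suc i)"
  let ?M = "list_monom y vs (\<lambda>v. p ^ i * e v)" and ?M' = "list_monom y vs (\<lambda>v. p ^ i * e' v)"
  let ?a = "y v [^] (p ^ i * e v)" and ?b = "y v [^] (p ^ i * e' v)"
  have "central_mod (Suc i) ((y v [^] (p ^ i)) [^] e' v)" by (intro central_mod_nat_pow central_mod_pow y)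
  then have b: "central_mod (Suc i) ?b" using yc by (simp add: nat_pow_pow)
  have M: "?M \<in> carrier R" "?M' \<in> carrier R" "?a \<in> carrier R" "?b \<in> carrier R" using yc by auto
  have "res (Suc i) ((?a \<otimes> ?M) \<otimes> (?b \<otimes> ?M')) = res (Suc i) ?a \<otimes>\<^bsub>?Q\<^esub> res (Suc i) (?M \<otimes> ?b) \<otimes>\<^bsub>?Q\<^esub> res (Suc i) ?M'"
    using M by (simp add: m_assoc res.S.m_assoc)
  also have "res (Suc i) (?M \<otimes> ?b) = res (Suc i) (?b \<otimes> ?M)" by (rule central_modD[OF b M(1), symmetric])
  also have "res (Suc i) ?a \<otimes>\<^bsub>?Q\<^esub> res (Suc i) (?b \<otimes> ?M) \<otimes>\<^bsub>?Q\<^esub> res (Suc i) ?M' = res (Suc i) (?a \<otimes> ?b) \<otimes>\<^bsub>?Q\<^esub> res (Suc i) (?M \<otimes> ?M')"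
    using M by (simp add: m_assoc res.S.m_assoc)
  also have "\<dots> = res (Suc i) (?a \<otimes> ?b) \<otimes>\<^bsub>?Q\<^esub> res (Suc i) (list_monom y vs (\<lambda>v. p ^ i * e v + p ^ i * e' v))"
    by (simp only: Cons)
  finally show ?case using M yc by (simp add: nat_pow_mult)
qed simp

lemma list_monom_pow_p:
  assumes y: "\<And>v. central_mod 1 (y v)"
  shows "res (Suc (Suc i)) (list_monom y vs (\<lambda>v. p ^ i * e v) [^] p) = res (Suc (Suc i)) (list_monom y vs (\<lambda>v. p ^ Suc i * e v))"
proof (induction vs)
  case (Cons v vs)
  have yc: "y v \<in> carrier R" for v by (rule central_mod_closed[OF y])
  let ?M = "list_monom y vs (\<lambda>v. p ^ i * e v)"
  let ?a = "y v [^] (p ^ i * e v)"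
  have "central_mod (Suc i) ((y v [^] (p ^ i)) [^] e v)" by (intro central_mod_nat_pow central_mod_pow y)
  then have a: "central_mod (Suc i) ?a" using yc by (simp add: nat_pow_pow)
  have "res (Suc (Suc i)) ((?a \<otimes> ?M) [^] p) = res (Suc (Suc i)) (?a [^] p \<otimes> ?M [^] p)"
    by (rule res_mult_pow_p[OF _ a list_monom_central[OF y]]) simp
  also have "\<dots> = res (Suc (Suc i)) (?a [^] p) \<otimes>\<^bsub>red (Suc (Suc i))\<^esub> res (Suc (Suc i)) (list_monom y vs (\<lambda>v. p ^ Suc i * e v))"
    unfolding Cons[symmetric] using yc by simp
  finally show ?case using yc by (simp add: nat_pow_pow mult_ac)
qed simp

subsection \<open>Polynomials with high divisibility\<close>

text \<open>
  The polynomials that can be evaluated at lifts of central elements of \<open>R/pR\<close> with precision \<open>p\<^sup>k\<^sup>+\<^sup>1\<close>: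
  in \<open>p\<^sup>k\<^sup>-\<^sup>i c x\<^bsup>p\<^sup>i \<alpha>\<^esup>\<close> the power is central modulo \<open>p\<^sup>i\<^sup>+\<^sup>1\<close> and the coefficient supplies the rest. Ghost components are of
  this form.
\<close>

inductive_set high_polys :: "nat \<Rightarrow> witt_poly set" for k where
  monom: "i \<le> k \<Longrightarrow> Poly_Mapping.single (scale_monom (p ^ i) \<alpha>) (int (p ^ (k - i)) * c) \<in> high_polys k"
| add: "f \<in> high_polys k \<Longrightarrow> g \<in> high_polys k \<Longrightarrow> f + g \<in> high_polys k"

lemma high_polys_zero: "0 \<in> high_polys k"
  using high_polys.monom[of k k 0 0] by simp

lemma high_polys_one: "1 \<in> high_polys k"
proof -
  have "scale_monom (p ^ k) 0 = 0" by (rule poly_mapping_eqI) simp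
  then show ?thesis using high_polys.monom[of k k 0 1] by simp
qed

lemma high_polys_uminus: "f \<in> high_polys k \<Longrightarrow> - f \<in> high_polys k"
proof (induction rule: high_polys.induct)
  case (monom i \<alpha> c)
  then show ?case using high_polys.monom[of i k \<alpha> "- c"] by (simp add: single_uminus)
next
  case (add f g)
  then show ?case using high_polys.add[of "- f" k "- g"] by simp
qed

lemma high_polys_sum: "(\<And>j. j \<in> J \<Longrightarrow> f j \<in> high_polys k) \<Longrightarrow> sum f J \<in> high_polys k"
  by (induction J rule: infinite_finite_induct) (auto simp: high_polys_zero intro: high_polys.add)

lemma high_polys_0: "f \<in> high_polys 0"
proof (induction f rule: witt_poly_induct)
  case (monom \<alpha>)
  have "scale_monom 1 \<alpha> = \<alpha>" by (rule poly_mapping_eqI) simp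
  then show ?case using high_polys.monom[of 0 0 \<alpha> 1] by simp
next
  case (diff f g)
  then show ?case using high_polys.add[OF diff(1) high_polys_uminus[OF diff(2)]] by simp
qed

lemma monom_product:
  assumes "i \<le> k" "j \<le> k"
  obtains h \<alpha>' \<beta>' e where "h \<le> k" "scale_monom (p ^ i) \<alpha> = scale_monom (p ^ h) \<alpha>'" "scale_monom (p ^ j) \<beta> = scale_monom (p ^ h) \<beta>'"
    "(int (p ^ (k - i)) * c) * (int (p ^ (k - j)) * d) = int (p ^ (k - h)) * e"
proof (cases "i \<le> j")
  case True
  have "scale_monom (p ^ j) \<beta> = scale_monom (p ^ i) (scale_monom (p ^ (j - i)) \<beta>)"
    using True by (intro poly_mapping_eqI) (simp flip: mult.assoc power_add)
  then show thesis using assms that[of i \<alpha> "scale_monom (p ^ (j - i)) \<beta>" "c * (int (p ^ (k - j)) * d)"] by simp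
next
  case False
  have "scale_monom (p ^ i) \<alpha> = scale_monom (p ^ j) (scale_monom (p ^ (i - j)) \<alpha>)"
    using False by (intro poly_mapping_eqI) (simp flip: mult.assoc power_add)
  then show thesis using assms that[of j "scale_monom (p ^ (i - j)) \<alpha>" \<beta> "(int (p ^ (k - i)) * c) * d"] by simp
qed

lemma high_polys_mult: "f \<in> high_polys k \<Longrightarrow> g \<in> high_polys k \<Longrightarrow> f * g \<in> high_polys k"
proof (induction f rule: high_polys.induct)
  case (monom i \<alpha> c)
  from monom(2) show ?case
  proof (induction g rule: high_polys.induct)
    case (monom j \<beta> d)
    obtain h \<alpha>' \<beta>' e where h: "h \<le> k" "scale_monom (p ^ i) \<alpha> = scale_monom (p ^ h) \<alpha>'" "scale_monom (p ^ j) \<beta> = scale_monom (p ^ h) \<beta>'"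
        "(int (p ^ (k - i)) * c) * (int (p ^ (k - j)) * d) = int (p ^ (k - h)) * e"
      using monom_product[OF \<open>i \<le> k\<close> monom, of \<alpha> \<beta> c d] by blast
    have "Poly_Mapping.single (scale_monom (p ^ i) \<alpha>) (int (p ^ (k - i)) * c) * Poly_Mapping.single (scale_monom (p ^ j) \<beta>) (int (p ^ (k - j)) * d) =
        Poly_Mapping.single (scale_monom (p ^ h) (\<alpha>' + \<beta>')) (int (p ^ (k - h)) * e)"
      unfolding mult_single h(2-4) scale_monom_add ..
    then show ?case using high_polys.monom[OF h(1)] by simp
  qed (simp add: distrib_left high_polys.add)
qed (simp add: distrib_right high_polys.add)

lemma high_polys_power: "f \<in> high_polys k \<Longrightarrow> f ^ n \<in> high_polys k"
  by (induction n) (simp_all add: high_polys_one high_polys_mult)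

lemma high_polys_p_mult: "f \<in> high_polys k \<Longrightarrow> of_nat p * f \<in> high_polys (Suc k)"
proof (induction rule: high_polys.induct)
  case (monom i \<alpha> c)
  have "of_nat p * Poly_Mapping.single (scale_monom (p ^ i) \<alpha>) (int (p ^ (k - i)) * c) =
     Poly_Mapping.single (scale_monom (p ^ i) \<alpha>) (int (p ^ (Suc k - i)) * c)"
    using monom by (simp add: mult_single Suc_diff_le mult_ac flip: single_of_nat)
  then show ?case using high_polys.monom[of i "Suc k" \<alpha> c] monom by simp
qed (simp add: distrib_left high_polys.add)

lemma high_polys_p_pow_mult: "f \<in> high_polys k \<Longrightarrow> of_nat (p ^ i) * f \<in> high_polys (i + k)"
  by (induction i) (simp_all add: mult.assoc high_polys_p_mult)

lemma high_polys_pow_p: "f \<in> high_polys k \<Longrightarrow> f ^ p \<in> high_polys (Suc k)"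
proof (induction rule: high_polys.induct)
  case (monom i \<alpha> c)
  have "k - i \<le> (k - i) * p" using prime_gt_0_nat[OF prime_p] by simp
  then have "p ^ ((k - i) * p) = p ^ (k - i) * p ^ ((k - i) * p - (k - i))" by (simp flip: power_add)
  then have "int (p ^ ((k - i) * p)) = int (p ^ (k - i)) * int (p ^ ((k - i) * p - (k - i)))" by (simp only: of_nat_mult)
  then have "(int (p ^ (k - i)) * c) ^ p = int (p ^ (Suc k - Suc i)) * (int (p ^ ((k - i) * p - (k - i))) * c ^ p)"
    by (simp add: power_mult_distrib mult.assoc flip: power_mult)
  moreover have "scale_monom p (scale_monom (p ^ i) \<alpha>) = scale_monom (p ^ Suc i) \<alpha>"
    by (rule poly_mapping_eqI) simp
  ultimately show ?case using high_polys.monom[of "Suc i" "Suc k" \<alpha>] monom by (simp only: single_power)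
next
  case (add f g)
  have "(f + g) ^ p = (\<Sum>i\<le>p. of_nat (p choose i) * f ^ i * g ^ (p - i))" by (rule binomial_ring)
  also have "\<dots> \<in> high_polys (Suc k)"
  proof (rule high_polys_sum)
    fix i assume "i \<in> {..p}"
    then consider "i = 0" | "i = p" | "0 < i" "i < p" by fastforce
    then show "of_nat (p choose i) * f ^ i * g ^ (p - i) \<in> high_polys (Suc k)"
    proof cases
      case 3
      then obtain q where "p choose i = p * q" using dvd_choose_prime[OF _ _ _ prime_p, of i] by (auto elim: dvdE)
      moreover have "of_nat p * (f ^ i * g ^ (p - i)) \<in> high_polys (Suc k)"
        by (intro high_polys_p_mult high_polys_mult high_polys_power add)
      then have "(\<Sum>j<q. of_nat p * (f ^ i * g ^ (p - i))) \<in> high_polys (Suc k)" by (rule high_polys_sum)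
      ultimately show ?thesis by (simp add: mult_ac)
    qed (use add in simp_all)
  qed
  finally show ?case .
qed

lemma high_polys_p_pow: "f ^ (p ^ k) \<in> high_polys k"
proof (induction k)
  case (Suc k)
  then show ?case using high_polys_pow_p[OF Suc] by (simp add: mult.commute flip: power_mult)
qed (simp add: high_polys_0)

lemma high_polys_ghost: "ghost p S k \<in> high_polys k"
  unfolding ghost_def
proof (rule high_polys_sum)
  fix j assume "j \<in> {..k}"
  then show "of_nat (p ^ j) * S j ^ p ^ (k - j) \<in> high_polys k"
    using high_polys_p_pow_mult[OF high_polys_p_pow, of j "S j" "k - j"] by simp
qed

subsection \<open>Evaluation at lifts\<close>

text \<open>
  Evaluation at noncommuting values, ordered by a list. It is additive but not multiplicative; on \<open>high_polys\<close> the
  failure is invisible at the relevant precision.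
\<close>

definition lift_eval :: "(nat + nat \<Rightarrow> 'a) \<Rightarrow> (nat + nat) list \<Rightarrow> witt_poly \<Rightarrow> 'a" where
  "lift_eval y vs = frag_sum R (\<lambda>\<alpha>. list_monom y vs (Poly_Mapping.lookup \<alpha>))"

context
  fixes y :: "nat + nat \<Rightarrow> 'a" and vs :: "(nat + nat) list"
  assumes y: "\<And>v. central_mod 1 (y v)"
begin

lemma y_closed: "y v \<in> carrier R"
  by (rule central_mod_closed[OF y])

lemma lm_closed: "list_monom y vs (Poly_Mapping.lookup \<alpha>) \<in> carrier R"
  by (rule list_monom_closed[OF y_closed])

lemma lift_eval_closed [simp]: "lift_eval y vs q \<in> carrier R"
  unfolding lift_eval_def by (rule frag_sum_closed[OF lm_closed])

lemma lift_eval_add: "lift_eval y vs (q + r) = lift_eval y vs q \<oplus> lift_eval y vs r"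
  unfolding lift_eval_def by (rule frag_sum_add[OF lm_closed])

lemma lift_eval_diff: "lift_eval y vs (q - r) = lift_eval y vs q \<ominus> lift_eval y vs r"
  unfolding lift_eval_def by (rule frag_sum_diff[OF lm_closed])

lemma lift_eval_sum: "finite J \<Longrightarrow> lift_eval y vs (\<Sum>j\<in>J. q j) = (\<Oplus>j\<in>J. lift_eval y vs (q j))"
  unfolding lift_eval_def by (rule frag_sum_sum[OF lm_closed])

lemma lift_eval_of_nat_mult: "lift_eval y vs (of_nat c * q) = add_pow R c (lift_eval y vs q)"
  unfolding lift_eval_def by (rule frag_sum_of_nat_mult[OF lm_closed])

lemma lift_eval_single: "lift_eval y vs (Poly_Mapping.single (scale_monom k \<alpha>) c) =
    add_pow R c (list_monom y vs (\<lambda>v. k * Poly_Mapping.lookup \<alpha> v))"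
proof -
  have "Poly_Mapping.lookup (scale_monom k \<alpha>) = (\<lambda>v. k * Poly_Mapping.lookup \<alpha> v)" by (rule ext) simp
  then show ?thesis
    unfolding lift_eval_def by (subst frag_sum_single[OF lm_closed]) simp
qed

lemma lift_eval_one: "lift_eval y vs 1 = \<one>"
proof -
  have "list_monom y ws (\<lambda>v. 0) = \<one>" for ws by (induction ws) simp_all
  moreover have "scale_monom 0 0 = 0" by (rule poly_mapping_eqI) simp
  ultimately show ?thesis using lift_eval_single[of 0 0 1] by simp
qed

lemma scaled_multiple:
  assumes "x \<in> carrier R" "x' \<in> carrier R" "res (Suc i) x = res (Suc i) x'" "i \<le> k"
  shows "res (Suc k) (add_pow R (int (p ^ (k - i)) * c) x) = res (Suc k) (add_pow R (int (p ^ (k - i)) * c) x')"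
proof -
  have "res (k - i + Suc i) (add_pow R (p ^ (k - i)) (add_pow R c x)) = res (k - i + Suc i) (add_pow R (p ^ (k - i)) (add_pow R c x'))"
    by (rule res_add_pow[OF _ _ res_add_pow_int[OF assms(1-3)]]) (use assms in simp_all)
  moreover have "k - i + Suc i = Suc k" using assms by simp
  ultimately show ?thesis using assms by (simp only: add_pow_int_mult_nat)
qed

lemma lift_eval_central: "f \<in> high_polys k \<Longrightarrow> central_mod (Suc k) (lift_eval y vs f)"
proof (induction rule: high_polys.induct)
  case (monom i \<alpha> c)
  have "central_mod (k - i + Suc i) (add_pow R (p ^ (k - i)) (add_pow R c (list_monom y vs (\<lambda>v. p ^ i * Poly_Mapping.lookup \<alpha> v))))"
    by (intro central_mod_shift central_mod_add_pow_int list_monom_central y)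
  moreover have "k - i + Suc i = Suc k" using monom by simp
  ultimately show ?case
    by (simp only: lift_eval_single add_pow_int_mult_nat list_monom_closed y_closed)
next
  case (add f g)
  then show ?case by (simp add: lift_eval_add central_mod_add)
qed

text \<open>
  By additivity it is enough to multiply two monomials, with a common exponent factor \<open>p\<^sup>h\<close>: their values are
  central to the precision that the coefficients leave open.
\<close>

lemma lift_eval_mult:
  "f \<in> high_polys k \<Longrightarrow> g \<in> high_polys k \<Longrightarrow> res (Suc k) (lift_eval y vs (f * g)) = res (Suc k) (lift_eval y vs f \<otimes> lift_eval y vs g)"
proof (induction f rule: high_polys.induct)
  case (monom i \<alpha> c)
  from monom(2) show ?case
  proof (induction g rule: high_polys.induct)
    case (monom j \<beta> d)
    obtain h \<alpha>' \<beta>' e where h: "h \<le> k" "scale_monom (p ^ i) \<alpha> = scale_monom (p ^ h) \<alpha>'" "scale_monom (p ^ j) \<beta> = scale_monom (p ^ h) \<beta>'"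
        "(int (p ^ (k - i)) * c) * (int (p ^ (k - j)) * d) = int (p ^ (k - h)) * e"
      using monom_product[OF \<open>i \<le> k\<close> monom, of \<alpha> \<beta> c d] by blast
    let ?c = "int (p ^ (k - i)) * c" and ?d = "int (p ^ (k - j)) * d"
    let ?M = "list_monom y vs (\<lambda>v. p ^ h * Poly_Mapping.lookup \<alpha>' v)" and ?M' = "list_monom y vs (\<lambda>v. p ^ h * Poly_Mapping.lookup \<beta>' v)"
    have M: "?M \<in> carrier R" "?M' \<in> carrier R" by (simp_all add: y_closed)
    have "res (Suc h) (list_monom y vs (\<lambda>v. p ^ h * Poly_Mapping.lookup (\<alpha>' + \<beta>') v)) = res (Suc h) (?M \<otimes> ?M')"
      unfolding lookup_add distrib_left by (rule list_monom_add[OF y, symmetric])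
    then have "res (Suc k) (add_pow R (int (p ^ (k - h)) * e) (list_monom y vs (\<lambda>v. p ^ h * Poly_Mapping.lookup (\<alpha>' + \<beta>') v))) =
        res (Suc k) (add_pow R (int (p ^ (k - h)) * e) (?M \<otimes> ?M'))"
      by (intro scaled_multiple h) (use M y_closed in simp_all)
    moreover have "Poly_Mapping.single (scale_monom (p ^ i) \<alpha>) ?c * Poly_Mapping.single (scale_monom (p ^ j) \<beta>) ?d =
        Poly_Mapping.single (scale_monom (p ^ h) (\<alpha>' + \<beta>')) (int (p ^ (k - h)) * e)"
      unfolding mult_single h(2-4) scale_monom_add ..
    moreover have "add_pow R ?c ?M \<otimes> add_pow R ?d ?M' = add_pow R (int (p ^ (k - h)) * e) (?M \<otimes> ?M')"
    proof -
      have "add_pow R ?c ?M \<otimes> add_pow R ?d ?M' = add_pow R (?c * ?d) (?M \<otimes> ?M')"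
        using M by (simp only: add_pow_ldistr_int add_pow_rdistr_int add.int_pow_closed m_closed add_pow_int_mult mult.commute[of ?c ?d])
      then show ?thesis by (simp only: h(4))
    qed
    ultimately show ?case by (simp only: lift_eval_single h(2,3))
  next
    case (add f g)
    then show ?case by (simp add: distrib_left lift_eval_add r_distr)
  qed
next
  case (add f g)
  then show ?case by (simp add: distrib_right lift_eval_add l_distr)
qed

lemma lift_eval_power:
  "f \<in> high_polys k \<Longrightarrow> res (Suc k) (lift_eval y vs (f ^ n)) = res (Suc k) (lift_eval y vs f [^] n)"
proof (induction n)
  case (Suc n)
  have "res (Suc k) (lift_eval y vs (f ^ n * f)) = res (Suc k) (lift_eval y vs (f ^ n) \<otimes> lift_eval y vs f)"
    by (intro lift_eval_mult high_polys_power Suc)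
  then show ?case using Suc by (simp add: mult.commute)
qed (simp add: lift_eval_one)

text \<open>
  For a sum, the \<open>p\<close>-th power is compared with the ordered binomial expansion, whose middle coefficients are
  divisible by \<open>p\<close>; there multiplicativity at the lower precision suffices.
\<close>

lemma lift_eval_pow_p:
  "f \<in> high_polys k \<Longrightarrow> res (Suc (Suc k)) (lift_eval y vs (f ^ p)) = res (Suc (Suc k)) (lift_eval y vs f [^] p)"
proof (induction rule: high_polys.induct)
  case (monom i \<alpha> c)
  let ?c = "int (p ^ (k - i)) * c"
  let ?M = "list_monom y vs (\<lambda>v. p ^ i * Poly_Mapping.lookup \<alpha> v)" and ?M' = "list_monom y vs (\<lambda>v. p ^ Suc i * Poly_Mapping.lookup \<alpha> v)"
  have M: "?M \<in> carrier R" "?M' \<in> carrier R" by (simp_all only: list_monom_closed y_closed)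
  have "k - i \<le> (k - i) * p" using prime_gt_0_nat[OF prime_p] by simp
  then have "p ^ ((k - i) * p) = p ^ (k - i) * p ^ ((k - i) * p - (k - i))" by (simp flip: power_add)
  then have "int (p ^ ((k - i) * p)) = int (p ^ (k - i)) * int (p ^ ((k - i) * p - (k - i)))" by (simp only: of_nat_mult)
  then have c: "?c ^ p = int (p ^ (Suc k - Suc i)) * (int (p ^ ((k - i) * p - (k - i))) * c ^ p)"
    by (simp add: power_mult_distrib mult.assoc flip: power_mult)
  have "scale_monom p (scale_monom (p ^ i) \<alpha>) = scale_monom (p ^ Suc i) \<alpha>"
    by (rule poly_mapping_eqI) simp
  then have "lift_eval y vs (Poly_Mapping.single (scale_monom (p ^ i) \<alpha>) ?c ^ p) = add_pow R (?c ^ p) ?M'"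
    by (simp only: single_power lift_eval_single)
  moreover have "add_pow R ?c ?M [^] n = add_pow R (?c ^ n) (?M [^] n)" for n :: nat
  proof (induction n)
    case (Suc n)
    have "add_pow R ?c ?M [^] Suc n = add_pow R (?c ^ n) (?M [^] n) \<otimes> add_pow R ?c ?M" using Suc by simp
    also have "\<dots> = add_pow R (?c * ?c ^ n) (?M [^] n \<otimes> ?M)"
      using M by (simp only: add_pow_ldistr_int add_pow_rdistr_int add.int_pow_closed m_closed nat_pow_closed add_pow_int_mult)
    finally show ?case by (simp add: mult.commute)
  qed simp
  moreover have "res (Suc (Suc k)) (add_pow R (?c ^ p) (?M [^] p)) = res (Suc (Suc k)) (add_pow R (?c ^ p) ?M')"
    unfolding c by (intro scaled_multiple list_monom_pow_p y) (use M monom in simp_all)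
  ultimately show ?case by (simp only: lift_eval_single)
next
  case (add f g)
  let ?h = "res (Suc (Suc k))" and ?F = "lift_eval y vs f" and ?G = "lift_eval y vs g"
  have tm: "?h (lift_eval y vs (of_nat (p choose i) * f ^ i * g ^ (p - i))) = ?h (add_pow R (p choose i) (?F [^] i \<otimes> ?G [^] (p - i)))"
    if ip: "i \<le> p" for i
  proof -
    consider "i = 0" | "i = p" | "0 < i" "i < p" using ip by linarith
    then show ?thesis
    proof cases
      case 3
      then obtain q where q: "p choose i = p * q" using dvd_choose_prime[OF _ _ _ prime_p, of i] by (auto elim: dvdE)
      have "res (Suc k) (lift_eval y vs (f ^ i * g ^ (p - i))) = res (Suc k) (?F [^] i \<otimes> ?G [^] (p - i))"
        using lift_eval_mult[OF high_polys_power[OF add(1)] high_polys_power[OF add(2)], of i "p - i"]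
          lift_eval_power[OF add(1), of i] lift_eval_power[OF add(2), of "p - i"] by simp
      then have "?h (add_pow R (p ^ 1) (lift_eval y vs (f ^ i * g ^ (p - i)))) = ?h (add_pow R (p ^ 1) (?F [^] i \<otimes> ?G [^] (p - i)))"
        using res_add_pow[of _ _ "Suc k" 1] by (simp del: res.hom_mult)
      then have "?h (add_pow R q (add_pow R p (lift_eval y vs (f ^ i * g ^ (p - i))))) = ?h (add_pow R q (add_pow R p (?F [^] i \<otimes> ?G [^] (p - i))))"
        by (simp add: res_hom_add_pow del: res.hom_mult)
      then show ?thesis by (simp add: q mult.assoc lift_eval_of_nat_mult add.nat_pow_pow mult.commute[of q] del: of_nat_mult res.hom_mult)
    qed (use add in simp_all)
  qed
  have "lift_eval y vs ((f + g) ^ p) = (\<Oplus>i\<in>{..p}. lift_eval y vs (of_nat (p choose i) * f ^ i * g ^ (p - i)))"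
    by (simp add: binomial_ring lift_eval_sum)
  then have "?h (lift_eval y vs ((f + g) ^ p)) = finsum (red (Suc (Suc k))) (?h \<circ> (\<lambda>i. lift_eval y vs (of_nat (p choose i) * f ^ i * g ^ (p - i)))) {..p}"
    by (simp only:) (intro res.hom_finsum, simp)
  also have "\<dots> = finsum (red (Suc (Suc k))) (?h \<circ> (\<lambda>i. add_pow R (p choose i) (?F [^] i \<otimes> ?G [^] (p - i)))) {..p}"
    by (intro res.S.finsum_cong') (use tm in auto)
  also have "\<dots> = ?h (ordered_binom ?F ?G p)"
    unfolding ordered_binom_def by (rule res.hom_finsum[symmetric]) simp
  also have "\<dots> = ?h ((?F \<oplus> ?G) [^] p)"
    by (rule res_add_pow_p[symmetric]) (simp_all add: lift_eval_central add)
  finally show ?case by (simp only: lift_eval_add)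
qed

lemma lift_eval_p_pow: "res (Suc k) (lift_eval y vs (f ^ (p ^ k))) = res (Suc k) (lift_eval y vs f [^] (p ^ k))"
proof (induction k)
  case (Suc k)
  have c: "central_mod 1 (lift_eval y vs f)" using lift_eval_central[OF high_polys_0] by simp
  have c': "central_mod 1 (lift_eval y vs f [^] (p ^ k))" by (rule central_mod_nat_pow[OF c])
  have "res (Suc (Suc k)) (lift_eval y vs ((f ^ (p ^ k)) ^ p)) = res (Suc (Suc k)) (lift_eval y vs (f ^ (p ^ k)) [^] p)"
    by (rule lift_eval_pow_p[OF high_polys_p_pow])
  also have "\<dots> = res (Suc (Suc k)) ((lift_eval y vs f [^] (p ^ k)) [^] p)"
    by (rule res_pow_p[OF _ c' _ Suc]) simp_all
  finally show ?case by (simp add: nat_pow_pow mult.commute flip: power_mult)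
qed simp

text \<open>
  Lifts that agree modulo \<open>p\<close> have \<open>p\<^sup>k\<^sup>-\<^sup>j\<close>-th powers that agree modulo \<open>p\<^sup>k\<^sup>-\<^sup>j\<^sup>+\<^sup>1\<close>, and the factor \<open>p\<^sup>j\<close> does the rest. So a
  polynomial identity between ghost components becomes an identity in \<open>R/p\<^sup>k\<^sup>+\<^sup>1R\<close> between sums formed from any lifts of
  the components.
\<close>

lemma lift_eval_ghost:
  assumes t: "\<And>j. j \<le> k \<Longrightarrow> t j \<in> carrier R \<and> res 1 (t j) = res 1 (lift_eval y vs (T j))"
  shows "res (Suc k) (lift_eval y vs (ghost p T k)) = res (Suc k) (\<Oplus>j\<in>{..k}. add_pow R (p ^ j) (t j [^] (p ^ (k - j))))"
proof -
  let ?h = "res (Suc k)"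
  have tm: "?h (lift_eval y vs (of_nat (p ^ j) * T j ^ p ^ (k - j))) = ?h (add_pow R (p ^ j) (t j [^] (p ^ (k - j))))"
    if j: "j \<le> k" for j
  proof -
    have c: "central_mod 1 (lift_eval y vs (T j))" using lift_eval_central[OF high_polys_0] by simp
    have e: "j + Suc (k - j) = Suc k" using j by simp
    have "res (Suc (k - j)) (lift_eval y vs (T j ^ p ^ (k - j))) = res (Suc (k - j)) (t j [^] (p ^ (k - j)))"
      using lift_eval_p_pow[of "k - j" "T j"] res_pow_p_pow[OF c, of "t j" "k - j"] t[OF j] by simp
    from res_add_pow[OF _ _ this, of j] t[OF j] show ?thesis
      unfolding e lift_eval_of_nat_mult by simp
  qed
  have "lift_eval y vs (ghost p T k) = (\<Oplus>j\<in>{..k}. lift_eval y vs (of_nat (p ^ j) * T j ^ p ^ (k - j)))"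
    unfolding ghost_def by (rule lift_eval_sum) simp
  then have "?h (lift_eval y vs (ghost p T k)) = finsum (red (Suc k)) (?h \<circ> (\<lambda>j. lift_eval y vs (of_nat (p ^ j) * T j ^ p ^ (k - j)))) {..k}"
    by (simp only:) (intro res.hom_finsum, simp)
  also have "\<dots> = finsum (red (Suc k)) (?h \<circ> (\<lambda>j. add_pow R (p ^ j) (t j [^] (p ^ (k - j))))) {..k}"
    by (intro res.S.finsum_cong') (use tm t in \<open>auto simp del: of_nat_power\<close>)
  also have "\<dots> = ?h (\<Oplus>j\<in>{..k}. add_pow R (p ^ j) (t j [^] (p ^ (k - j))))"
    by (rule res.hom_finsum[symmetric]) (use t in auto)
  finally show ?thesis .
qed

end

end

section \<open>The map from Witt vectors\<close>

text \<open>
  \<open>Z\<close> is identified with the center of \<open>A/pA\<close>.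
\<close>

locale witt_center = odd_prime_ring A p + Z: cring Z
  for A :: "('a, 'm) ring_scheme" (structure) and p :: nat and Z :: "('o, 's) ring_scheme" +
  fixes \<iota> :: "'o \<Rightarrow> 'a set"
  assumes iso: "\<iota> \<in> ring_iso Z (ring_center (red 1))"
begin

lemma center_carrier: "carrier (ring_center (red j)) = res j ` {a. central_mod j a}"
proof (intro equalityI subsetI)
  fix c assume "c \<in> carrier (ring_center (red j))"
  then have c: "c \<in> carrier (red j)" "\<And>x. x \<in> carrier (red j) \<Longrightarrow> c \<otimes>\<^bsub>red j\<^esub> x = x \<otimes>\<^bsub>red j\<^esub> c"
    by (auto simp: ring_center_def)
  obtain a where a: "a \<in> carrier A" "c = res j a" using c(1) by (auto simp: res_surj)
  have "central_mod j a" unfolding central_mod_def using a c(2)[of "res j _"] by simp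
  then show "c \<in> res j ` {a. central_mod j a}" using a by blast
next
  fix c assume "c \<in> res j ` {a. central_mod j a}"
  then obtain a where a: "central_mod j a" "c = res j a" by blast
  have "res j a \<otimes>\<^bsub>red j\<^esub> x = x \<otimes>\<^bsub>red j\<^esub> res j a" if x: "x \<in> carrier (red j)" for x
  proof -
    obtain y where y: "y \<in> carrier A" "x = res j y" using x by (auto simp: res_surj)
    then show ?thesis using central_modD[OF a(1) y(1)] central_mod_closed[OF a(1)] by simp
  qed
  then show "c \<in> carrier (ring_center (red j))"
    using a central_mod_closed[OF a(1)] by (simp add: ring_center_def)
qed

lemma center_ops [simp]:
  "monoid.mult (ring_center B) = monoid.mult B" "ring.add (ring_center B) = ring.add B"
  "monoid.one (ring_center B) = monoid.one B" "ring.zero (ring_center B) = ring.zero B"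
  by (simp_all add: ring_center_def)

lemma \<iota>_props:
  shows \<iota>_mult: "f \<in> carrier Z \<Longrightarrow> g \<in> carrier Z \<Longrightarrow> \<iota> (f \<otimes>\<^bsub>Z\<^esub> g) = \<iota> f \<otimes>\<^bsub>red 1\<^esub> \<iota> g"
    and \<iota>_add: "f \<in> carrier Z \<Longrightarrow> g \<in> carrier Z \<Longrightarrow> \<iota> (f \<oplus>\<^bsub>Z\<^esub> g) = \<iota> f \<oplus>\<^bsub>red 1\<^esub> \<iota> g"
    and \<iota>_one: "\<iota> \<one>\<^bsub>Z\<^esub> = \<one>\<^bsub>red 1\<^esub>"
    and \<iota>_inj: "inj_on \<iota> (carrier Z)"
    and \<iota>_image: "\<iota> ` carrier Z = carrier (ring_center (red 1))"
  using iso by (auto simp: ring_iso_def ring_hom_def bij_betw_def)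

lemma \<iota>_closed: "f \<in> carrier Z \<Longrightarrow> \<iota> f \<in> carrier (red 1)"
  using \<iota>_image by (auto simp: ring_center_def)

lemma \<iota>_zero: "\<iota> \<zero>\<^bsub>Z\<^esub> = \<zero>\<^bsub>red 1\<^esub>"
proof -
  have "\<iota> \<zero>\<^bsub>Z\<^esub> \<oplus>\<^bsub>red 1\<^esub> \<iota> \<zero>\<^bsub>Z\<^esub> = \<iota> \<zero>\<^bsub>Z\<^esub>" using \<iota>_add[of "\<zero>\<^bsub>Z\<^esub>" "\<zero>\<^bsub>Z\<^esub>"] by simp
  then show ?thesis using \<iota>_closed[of "\<zero>\<^bsub>Z\<^esub>"] by simp
qed

lemma \<iota>_diff: "f \<in> carrier Z \<Longrightarrow> g \<in> carrier Z \<Longrightarrow> \<iota> (f \<ominus>\<^bsub>Z\<^esub> g) = \<iota> f \<ominus>\<^bsub>red 1\<^esub> \<iota> g"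
proof -
  assume fg: "f \<in> carrier Z" "g \<in> carrier Z"
  have "f = (f \<ominus>\<^bsub>Z\<^esub> g) \<oplus>\<^bsub>Z\<^esub> g" using fg by (simp add: Z.minus_eq Z.a_assoc Z.l_neg)
  then have "\<iota> f = \<iota> (f \<ominus>\<^bsub>Z\<^esub> g) \<oplus>\<^bsub>red 1\<^esub> \<iota> g" using fg \<iota>_add[of "f \<ominus>\<^bsub>Z\<^esub> g" g] by simp
  then show ?thesis
    using fg \<iota>_closed by (simp add: res.S.minus_eq res.S.a_assoc res.S.r_neg)
qed

lemma \<iota>_nat_pow: "f \<in> carrier Z \<Longrightarrow> \<iota> (f [^]\<^bsub>Z\<^esub> (n::nat)) = \<iota> f [^]\<^bsub>red 1\<^esub> n"
  by (induction n) (simp_all add: \<iota>_one \<iota>_mult)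

lemma \<iota>_finsum:
  "finite J \<Longrightarrow> (\<And>j. j \<in> J \<Longrightarrow> f j \<in> carrier Z) \<Longrightarrow> \<iota> (\<Oplus>\<^bsub>Z\<^esub>j\<in>J. f j) = (\<Oplus>\<^bsub>red 1\<^esub>j\<in>J. \<iota> (f j))"
  by (induction J rule: finite_induct) (simp_all add: \<iota>_zero \<iota>_add \<iota>_closed Pi_def del: One_nat_def)

definition rep :: "'o \<Rightarrow> 'a" where
  "rep f = (SOME a. central_mod 1 a \<and> res 1 a = \<iota> f)"

lemma rep:
  assumes "f \<in> carrier Z"
  shows "central_mod 1 (rep f) \<and> res 1 (rep f) = \<iota> f"
proof -
  have "\<iota> f \<in> res 1 ` {a. central_mod 1 a}"
    unfolding center_carrier[symmetric] \<iota>_image[symmetric] using assms by (rule imageI)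
  then obtain a where "central_mod 1 a \<and> res 1 a = \<iota> f" by auto
  then show ?thesis unfolding rep_def by (rule someI)
qed

lemma rep_central: "f \<in> carrier Z \<Longrightarrow> central_mod 1 (rep f)"
  by (simp only: rep)

lemma rep_res: "f \<in> carrier Z \<Longrightarrow> res 1 (rep f) = \<iota> f"
  by (simp only: rep)

lemma rep_closed: "f \<in> carrier Z \<Longrightarrow> rep f \<in> carrier A"
  by (rule central_mod_closed[OF rep_central])

lemma \<iota>_lift_eval:
  assumes v: "\<And>x. v x \<in> carrier Z" and v1: "\<And>x. x \<notin> set vs \<Longrightarrow> v x = \<one>\<^bsub>Z\<^esub>" and vs: "distinct vs"
  shows "\<iota> (eval_witt_poly Z v q) = res 1 (lift_eval (\<lambda>x. rep (v x)) vs q)"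
proof -
  have y: "central_mod 1 (rep (v x))" for x by (rule rep_central[OF v])
  have yc: "rep (v x) \<in> carrier A" for x by (rule rep_closed[OF v])
  have mon: "\<iota> (\<Otimes>\<^bsub>Z\<^esub>x\<in>set ws. v x [^]\<^bsub>Z\<^esub> (e x :: nat)) = res 1 (list_monom (\<lambda>x. rep (v x)) ws e)"
    if "distinct ws" for ws e
    using that
  proof (induction ws)
    case Nil
    then show ?case by (simp add: \<iota>_one)
  next
    case (Cons x ws)
    then have IH: "\<iota> (\<Otimes>\<^bsub>Z\<^esub>x\<in>set ws. v x [^]\<^bsub>Z\<^esub> (e x :: nat)) = res 1 (list_monom (\<lambda>x. rep (v x)) ws e)" by simp
    have "(\<Otimes>\<^bsub>Z\<^esub>x\<in>set (x # ws). v x [^]\<^bsub>Z\<^esub> e x) = v x [^]\<^bsub>Z\<^esub> e x \<otimes>\<^bsub>Z\<^esub> (\<Otimes>\<^bsub>Z\<^esub>x\<in>set ws. v x [^]\<^bsub>Z\<^esub> e x)"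
      using Cons v by simp
    then have "\<iota> (\<Otimes>\<^bsub>Z\<^esub>x\<in>set (x # ws). v x [^]\<^bsub>Z\<^esub> e x) = \<iota> (v x) [^]\<^bsub>red 1\<^esub> e x \<otimes>\<^bsub>red 1\<^esub> res 1 (list_monom (\<lambda>x. rep (v x)) ws e)"
      using v by (simp add: \<iota>_mult \<iota>_nat_pow IH)
    also have "\<dots> = res 1 (rep (v x) [^] e x \<otimes> list_monom (\<lambda>x. rep (v x)) ws e)"
      using yc rep_res[OF v] by (simp add: res.hom_nat_pow)
    finally show ?case by simp
  qed
  show ?thesis
  proof (induction q rule: witt_poly_induct)
    case (monom \<alpha>)
    have "monom_val Z v \<alpha> = (\<Otimes>\<^bsub>Z\<^esub>x\<in>Poly_Mapping.keys \<alpha> \<union> set vs. v x [^]\<^bsub>Z\<^esub> Poly_Mapping.lookup \<alpha> x)"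
      by (rule Z.monom_val_superset[OF v]) auto
    also have "\<dots> = (\<Otimes>\<^bsub>Z\<^esub>x\<in>set vs. v x [^]\<^bsub>Z\<^esub> Poly_Mapping.lookup \<alpha> x)"
      by (rule Z.finprod_mono_neutral_cong_right) (use v v1 in auto)
    finally have "\<iota> (eval_witt_poly Z v (Poly_Mapping.single \<alpha> 1)) = res 1 (list_monom (\<lambda>x. rep (v x)) vs (Poly_Mapping.lookup \<alpha>))"
      using mon[OF vs, of "Poly_Mapping.lookup \<alpha>"] v by (simp add: Z.eval_witt_poly_single Z.monom_val_closed)
    moreover have "scale_monom 1 \<alpha> = \<alpha>" by (rule poly_mapping_eqI) simp
    ultimately show ?case using lift_eval_single[of "\<lambda>x. rep (v x)", OF y, of vs 1 \<alpha> 1] yc by simp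
  next
    case (diff f g)
    then show ?case
      by (simp only: Z.eval_witt_poly_diff[OF v] Z.eval_witt_poly_closed[OF v] \<iota>_diff lift_eval_diff[OF y])
        (simp add: lift_eval_closed[OF y] a_minus_def)
  qed
qed

text \<open>
  The last ghost component, on elements of \<open>A\<close>: the value of the map in question at a Witt vector is its class
  for lifts \<open>t\<close> of the components.
\<close>

definition teich :: "nat \<Rightarrow> (nat \<Rightarrow> 'a) \<Rightarrow> 'a" where
  "teich k t = (\<Oplus>j\<in>{..k}. add_pow A (p ^ j) (t j [^] (p ^ (k - j))))"

lemma teich_closed: "(\<And>j. j \<le> k \<Longrightarrow> t j \<in> carrier A) \<Longrightarrow> teich k t \<in> carrier A"
  unfolding teich_def by (rule finsum_closed) auto

lemma central_mod_finsum:
  "finite J \<Longrightarrow> (\<And>j. j \<in> J \<Longrightarrow> central_mod i (f j)) \<Longrightarrow> central_mod i (\<Oplus>j\<in>J. f j)"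
proof (induction J rule: finite_induct)
  case (insert x J)
  then have "(\<Oplus>j\<in>insert x J. f j) = f x \<oplus> (\<Oplus>j\<in>J. f j)"
    by (intro finsum_insert) (auto intro: central_mod_closed)
  then show ?case using insert by (simp add: central_mod_add)
qed (simp add: central_mod_zero)

lemma teich_central:
  assumes "\<And>j. j \<le> k \<Longrightarrow> central_mod 1 (t j)"
  shows "central_mod (Suc k) (teich k t)"
  unfolding teich_def
proof (rule central_mod_finsum)
  fix j assume "j \<in> {..k}"
  then have j: "j \<le> k" by simp
  have "central_mod (j + Suc (k - j)) (add_pow A (p ^ j) (t j [^] (p ^ (k - j))))"
    by (intro central_mod_shift central_mod_pow assms j)
  then show "central_mod (Suc k) (add_pow A (p ^ j) (t j [^] (p ^ (k - j))))" using j by simp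
qed simp

lemma res_finsum_cong:
  assumes "finite J" and "\<And>j. j \<in> J \<Longrightarrow> f j \<in> carrier A" and "\<And>j. j \<in> J \<Longrightarrow> g j \<in> carrier A"
    and "\<And>j. j \<in> J \<Longrightarrow> res i (f j) = res i (g j)"
  shows "res i (\<Oplus>j\<in>J. f j) = res i (\<Oplus>j\<in>J. g j)"
  using assms by (induction J rule: finite_induct) (simp_all add: Pi_def)

lemma teich_cong:
  assumes t: "\<And>j. j \<le> k \<Longrightarrow> t j \<in> carrier A" and t': "\<And>j. j \<le> k \<Longrightarrow> central_mod 1 (t' j)"
    and tt': "\<And>j. j \<le> k \<Longrightarrow> res 1 (t j) = res 1 (t' j)"
  shows "res (Suc k) (teich k t) = res (Suc k) (teich k t')"
  unfolding teich_def
proof (rule res_finsum_cong)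
  fix j assume "j \<in> {..k}"
  then have j: "j \<le> k" by simp
  have "res (j + Suc (k - j)) (add_pow A (p ^ j) (t j [^] (p ^ (k - j)))) = res (j + Suc (k - j)) (add_pow A (p ^ j) (t' j [^] (p ^ (k - j))))"
    using t[OF j] t'[OF j] by (intro res_add_pow res_pow_p_pow tt'[OF j]) simp_all
  then show "res (Suc k) (add_pow A (p ^ j) (t j [^] (p ^ (k - j)))) = res (Suc k) (add_pow A (p ^ j) (t' j [^] (p ^ (k - j))))"
    using j by simp
qed (use t central_mod_closed[OF t'] in auto)

text \<open>
  The Witt polynomials satisfy the ghost identities over the integers. Evaluated at lifts of the components of
  \<open>xs\<close> and \<open>ys\<close>, these say that the last ghost component respects sums and products.
\<close>

lemma witt_hom:
  assumes xs: "xs \<in> carrier (witt_ring p (Suc k) Z)" and ys: "ys \<in> carrier (witt_ring p (Suc k) Z)"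
  shows witt_hom_add: "res (Suc k) (teich k (\<lambda>j. rep ((xs \<oplus>\<^bsub>witt_ring p (Suc k) Z\<^esub> ys) ! j))) =
      res (Suc k) (teich k (\<lambda>j. rep (xs ! j)) \<oplus> teich k (\<lambda>j. rep (ys ! j)))" (is ?add)
    and witt_hom_mult: "res (Suc k) (teich k (\<lambda>j. rep ((xs \<otimes>\<^bsub>witt_ring p (Suc k) Z\<^esub> ys) ! j))) =
      res (Suc k) (teich k (\<lambda>j. rep (xs ! j)) \<otimes> teich k (\<lambda>j. rep (ys ! j)))" (is ?mult)
    and witt_add_closed: "xs \<oplus>\<^bsub>witt_ring p (Suc k) Z\<^esub> ys \<in> carrier (witt_ring p (Suc k) Z)" (is ?addc)
    and witt_mult_closed: "xs \<otimes>\<^bsub>witt_ring p (Suc k) Z\<^esub> ys \<in> carrier (witt_ring p (Suc k) Z)" (is ?multc)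
proof -
  define v where "v = (\<lambda>x. case x of Inl i \<Rightarrow> if i \<le> k then xs ! i else \<one>\<^bsub>Z\<^esub> | Inr i \<Rightarrow> if i \<le> k then ys ! i else \<one>\<^bsub>Z\<^esub>)"
  define vs :: "(nat + nat) list" where "vs = map Inl [0..<Suc k] @ map Inr [0..<Suc k]"
  have v: "v x \<in> carrier Z" for x
    using xs ys by (auto simp: v_def witt_ring_def split: sum.splits)
  have v1: "v x = \<one>\<^bsub>Z\<^esub>" if "x \<notin> set vs" for x
    using that by (cases x) (auto simp: v_def vs_def image_iff)
  have vs: "distinct vs" by (auto simp: vs_def distinct_map)
  let ?y = "\<lambda>x. rep (v x)"
  have y: "central_mod 1 (?y x)" for x by (rule rep_central[OF v])
  note \<iota>e = \<iota>_lift_eval[OF v v1 vs]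
  have ev: "eval_witt_poly Z (case_sum ((!) xs) ((!) ys)) q = eval_witt_poly Z v q"
    if "q \<in> polys_in (vars_upto i)" "i \<le> k" for q i
    by (rule Z.eval_witt_poly_cong[OF that(1) v]) (use that(2) in \<open>auto simp: vars_upto_def v_def\<close>)
  have gh: "res (Suc k) (lift_eval ?y vs (ghost p T k)) = res (Suc k) (teich k (\<lambda>j. rep (z j)))"
    if z: "\<And>j. j \<le> k \<Longrightarrow> z j = eval_witt_poly Z v (T j)" for T z
    unfolding teich_def
    by (rule lift_eval_ghost[OF y]) (simp add: z rep_closed[OF Z.eval_witt_poly_closed[OF v]] rep_res[OF Z.eval_witt_poly_closed[OF v]] \<iota>e del: One_nat_def)
  have X: "res (Suc k) (lift_eval ?y vs (ghost p (\<lambda>j. indet (Inl j)) k)) = res (Suc k) (teich k (\<lambda>j. rep (xs ! j)))"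
    by (rule gh) (simp add: Z.eval_witt_poly_indet[OF v], simp add: v_def)
  have Y: "res (Suc k) (lift_eval ?y vs (ghost p (\<lambda>j. indet (Inr j)) k)) = res (Suc k) (teich k (\<lambda>j. rep (ys ! j)))"
    by (rule gh) (simp add: Z.eval_witt_poly_indet[OF v], simp add: v_def)
  have c: "teich k (\<lambda>j. rep (xs ! j)) \<in> carrier A" "teich k (\<lambda>j. rep (ys ! j)) \<in> carrier A"
    using xs ys by (auto intro!: teich_closed rep_closed simp: witt_ring_def subset_iff)
  have lc: "lift_eval ?y vs q \<in> carrier A" for q by (rule lift_eval_closed[OF y])
  have "res (Suc k) (teich k (\<lambda>j. rep ((xs \<oplus>\<^bsub>witt_ring p (Suc k) Z\<^esub> ys) ! j))) = res (Suc k) (lift_eval ?y vs (ghost p (witt_sum_poly p) k))"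
    by (rule gh[symmetric]) (simp add: witt_ring_def ev[OF witt_sum_poly_in[OF prime_p odd_p]] del: upt_Suc)
  also have "\<dots> = res (Suc k) (lift_eval ?y vs (ghost p (\<lambda>j. indet (Inl j)) k) \<oplus> lift_eval ?y vs (ghost p (\<lambda>j. indet (Inr j)) k))"
    by (simp only: ghost_witt_sum_poly[OF prime_p odd_p] lift_eval_add[OF y])
  finally show ?add using lc c X Y by simp
  have "res (Suc k) (teich k (\<lambda>j. rep ((xs \<otimes>\<^bsub>witt_ring p (Suc k) Z\<^esub> ys) ! j))) = res (Suc k) (lift_eval ?y vs (ghost p (witt_prod_poly p) k))"
    by (rule gh[symmetric]) (simp add: witt_ring_def ev[OF witt_prod_poly_in[OF prime_p odd_p]] del: upt_Suc)
  also have "\<dots> = res (Suc k) (lift_eval ?y vs (ghost p (\<lambda>j. indet (Inl j)) k) \<otimes> lift_eval ?y vs (ghost p (\<lambda>j. indet (Inr j)) k))"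
    by (simp only: ghost_witt_prod_poly[OF prime_p odd_p]) (rule lift_eval_mult[OF y high_polys_ghost high_polys_ghost])
  finally show ?mult using lc c X Y by simp
  show ?addc ?multc
    by (auto simp: witt_ring_def ev[OF witt_sum_poly_in[OF prime_p odd_p]] ev[OF witt_prod_poly_in[OF prime_p odd_p]] Z.eval_witt_poly_closed[OF v] less_Suc_eq_le
        simp del: upt_Suc)
qed

lemma witt_hom_one: "res (Suc k) (teich k (\<lambda>j. rep (\<one>\<^bsub>witt_ring p (Suc k) Z\<^esub> ! j))) = \<one>\<^bsub>red (Suc k)\<^esub>"
proof -
  let ?t = "\<lambda>j. if j = 0 then \<one> else \<zero>"
  have "res (Suc k) (teich k (\<lambda>j. rep (\<one>\<^bsub>witt_ring p (Suc k) Z\<^esub> ! j))) = res (Suc k) (teich k ?t)"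
    by (rule teich_cong)
       (auto simp: witt_ring_def rep_closed central_mod_one central_mod_zero rep_res \<iota>_one \<iota>_zero less_Suc_eq_le simp del: upt_Suc One_nat_def)
  also have "teich k ?t = (\<Oplus>j\<in>{..k}. if j = 0 then \<one> else \<zero>)"
    unfolding teich_def using prime_gt_0_nat[OF prime_p] by (intro finsum_cong') (auto simp: nat_pow_zero)
  also have "\<dots> = \<one>" using add.finprod_singleton[of 0 "{..k}" "\<lambda>_. \<one>"] by (simp add: eq_commute)
  finally show ?thesis by simp
qed

end

section \<open>Injectivity and surjectivity\<close>

lemma (in abelian_group) add_eq_selfD:
  "x \<in> carrier G \<Longrightarrow> y \<in> carrier G \<Longrightarrow> x = x \<oplus> y \<Longrightarrow> y = \<zero>"
proof -
  assume xy: "x \<in> carrier G" "y \<in> carrier G" "x = x \<oplus> y"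
  have "\<ominus> x \<oplus> x = \<ominus> x \<oplus> (x \<oplus> y)" using arg_cong[OF xy(3), of "\<lambda>u. \<ominus> x \<oplus> u"] .
  then show ?thesis using xy(1,2) by (simp add: a_assoc[symmetric] l_neg)
qed

lemma (in cring) frobenius_add:
  assumes p: "Factorial_Ring.prime (p::nat)" "odd p" and char: "add_pow R p \<one> = \<zero>"
    and ab: "a \<in> carrier R" "b \<in> carrier R"
  shows "(a \<oplus> b) [^] p = a [^] p \<oplus> b [^] p"
proof -
  have p0: "p > 0" using p(1) by (rule prime_gt_0_nat)
  have "p \<ge> 2" "p \<noteq> 2" using prime_ge_2_nat[OF p(1)] p(2) by auto
  then have "p = Suc (Suc (Suc (p - 3)))" by simp
  then obtain n where n: "p = Suc (Suc (Suc n))" by blast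
  have ch: "add_pow R p x = \<zero>" if "x \<in> carrier R" for x
    using add_pow_ldistr[OF one_closed that, of p] that char by simp
  have "(a \<oplus> b) [^] p = ordered_binom a b p"
    using pow_add_commutator[of a b \<zero> "Suc n", folded n] ab by (simp add: m_comm)
  also have "\<dots> = (\<Oplus>k\<in>{0, p}. add_pow R (p choose k) (a [^] k \<otimes> b [^] (p - k)))"
    unfolding ordered_binom_def
  proof (rule add.finprod_mono_neutral_cong_right)
    show "add_pow R (p choose k) (a [^] k \<otimes> b [^] (p - k)) = \<zero>" if "k \<in> {..p} - {0, p}" for k
    proof -
      have "p dvd p choose k" using that p by (intro dvd_choose_prime) auto
      then obtain q where "p choose k = p * q" by (rule dvdE)
      then have "add_pow R (p choose k) (a [^] k \<otimes> b [^] (p - k)) = add_pow R p (add_pow R q (a [^] k \<otimes> b [^] (p - k)))"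
        using ab by (simp add: add.nat_pow_pow mult.commute)
      then show ?thesis using ab ch by simp
    qed
  qed (use ab in auto)
  also have "\<dots> = a [^] p \<oplus> b [^] p"
    using ab p0 by (simp add: a_comm)
  finally show ?thesis .
qed

lemma (in domain) frobenius_inj:
  assumes p: "Factorial_Ring.prime (p::nat)" "odd p" and char: "add_pow R p \<one> = \<zero>"
    and ab: "a \<in> carrier R" "b \<in> carrier R" and eq: "a [^] (p ^ k) = b [^] (p ^ k)"
  shows "a = b"
proof -
  have step: "x = y" if xy: "x \<in> carrier R" "y \<in> carrier R" "x [^] p = y [^] p" for x y
  proof -
    have "x [^] p = ((x \<ominus> y) \<oplus> y) [^] p" using xy by (simp add: minus_eq a_assoc l_neg)
    also have "\<dots> = (x \<ominus> y) [^] p \<oplus> y [^] p" using xy by (intro frobenius_add[OF p char]) auto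
    finally have "(x \<ominus> y) [^] p \<oplus> y [^] p = \<zero> \<oplus> y [^] p" unfolding xy(3) using xy by simp
    then have "(x \<ominus> y) [^] p = \<zero>" using xy by (simp only: add.r_cancel nat_pow_closed minus_closed zero_closed)
    then have "x \<ominus> y = \<zero>" using xy pow_eq_zero[of "x \<ominus> y" p] by simp
    then show ?thesis using xy by (simp add: r_right_minus_eq)
  qed
  show ?thesis using eq
  proof (induction k)
    case (Suc k)
    then have "(a [^] (p ^ k)) [^] p = (b [^] (p ^ k)) [^] p" using ab by (simp add: nat_pow_pow mult.commute)
    then have "a [^] (p ^ k) = b [^] (p ^ k)" using step[of "a [^] (p ^ k)" "b [^] (p ^ k)"] ab by simp
    then show ?case by (rule Suc)
  qed (use ab in simp)
qed

context witt_center
begin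

lemma Z_char: "add_pow Z p \<one>\<^bsub>Z\<^esub> = \<zero>\<^bsub>Z\<^esub>"
proof -
  have i: "\<iota> (add_pow Z (k::nat) \<one>\<^bsub>Z\<^esub>) = res 1 (add_pow A k \<one>)" for k
    by (induction k) (simp_all add: \<iota>_zero \<iota>_add \<iota>_one del: One_nat_def)
  have "res 1 (add_pow A p \<one>) = \<zero>\<^bsub>red 1\<^esub>" using res_multiple_zero[of \<one> 1 1] by simp
  then have "\<iota> (add_pow Z p \<one>\<^bsub>Z\<^esub>) = \<iota> \<zero>\<^bsub>Z\<^esub>" by (simp only: i \<iota>_zero)
  then show ?thesis using inj_onD[OF \<iota>_inj] by simp
qed

lemma add_pow_finsum:
  "finite J \<Longrightarrow> (\<And>j. j \<in> J \<Longrightarrow> f j \<in> carrier A) \<Longrightarrow> add_pow A (c::nat) (\<Oplus>j\<in>J. f j) = (\<Oplus>j\<in>J. add_pow A c (f j))"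
  by (induction J rule: finite_induct) (simp_all add: Pi_def add.nat_pow_distrib del: add.nat_pow_Suc)

lemma teich_Suc:
  assumes t: "\<And>j. j \<le> Suc k \<Longrightarrow> t j \<in> carrier A"
  shows "teich (Suc k) t = add_pow A p (teich k (\<lambda>j. t (Suc j))) \<oplus> t 0 [^] (p ^ Suc k)"
proof -
  let ?f = "\<lambda>j. add_pow A (p ^ j) (t j [^] (p ^ (Suc k - j)))"
  have "teich (Suc k) t = (\<Oplus>j\<in>{..k}. ?f (Suc j)) \<oplus> ?f 0"
    unfolding teich_def by (rule finsum_Suc2) (use t in auto)
  also have "(\<Oplus>j\<in>{..k}. ?f (Suc j)) = (\<Oplus>j\<in>{..k}. add_pow A p (add_pow A (p ^ j) (t (Suc j) [^] (p ^ (k - j)))))"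
    by (rule finsum_cong') (use t in \<open>auto simp: add.nat_pow_pow mult.commute\<close>)
  also have "\<dots> = add_pow A p (teich k (\<lambda>j. t (Suc j)))"
    unfolding teich_def by (rule add_pow_finsum[symmetric]) (use t in auto)
  finally show ?thesis using t by simp
qed

lemma res_eq_iff_diff:
  "a \<in> carrier A \<Longrightarrow> b \<in> carrier A \<Longrightarrow> res j a = res j b \<longleftrightarrow> res j (a \<ominus> b) = \<zero>\<^bsub>red j\<^esub>"
proof -
  assume ab: "a \<in> carrier A" "b \<in> carrier A"
  then have "res j (a \<ominus> b) = res j a \<ominus>\<^bsub>red j\<^esub> res j b" by (simp add: a_minus_def)
  then show ?thesis using ab res.S.r_right_minus_eq[of "res j a" j "res j b"] by simp
qed

end

text \<open>
  The torsion condition is what flatness over \<open>W\<^sub>n(K)\<close> gives: \<open>p c = 0\<close> only for multiples \<open>c\<close> of \<open>p\<^sup>n\<^sup>-\<^sup>1\<close>. Hence \<open>p\<close> may be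
  cancelled at the cost of one power of precision.
\<close>

locale torsion_witt_center = witt_center + Z: domain Z +
  fixes n :: nat
  assumes torsion: "c \<in> carrier A \<Longrightarrow> add_pow A p c = \<zero> \<Longrightarrow> \<exists>d\<in>carrier A. c = add_pow A (p ^ (n - 1)) d"
begin

lemma res_p_cancel_zero:
  assumes a: "a \<in> carrier A" and j: "j < n" and z: "res (Suc j) (add_pow A p a) = \<zero>\<^bsub>red (Suc j)\<^esub>"
  shows "res j a = \<zero>\<^bsub>red j\<^esub>"
proof -
  have "res (Suc j) (add_pow A p a) = res (Suc j) \<zero>" using z by simp
  then obtain c where c: "c \<in> carrier A" "add_pow A p a = \<zero> \<oplus> add_pow A (p ^ Suc j) c"
    by (rule res_eqE) (use a in simp_all)
  then have "add_pow A p a = add_pow A p (add_pow A (p ^ j) c)" by (simp add: add.nat_pow_pow mult.commute)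
  then have "add_pow A p (a \<ominus> add_pow A (p ^ j) c) = \<zero>"
    using a c(1) by (simp add: a_minus_def add.nat_pow_distrib add.nat_pow_inv r_neg)
  then obtain d where d: "d \<in> carrier A" "a \<ominus> add_pow A (p ^ j) c = add_pow A (p ^ (n - 1)) d"
    using torsion[of "a \<ominus> add_pow A (p ^ j) c"] a c(1) by auto
  have "res j (a \<ominus> add_pow A (p ^ j) c) = \<zero>\<^bsub>red j\<^esub>"
    unfolding d(2) by (rule res_multiple_zero[OF d(1)]) (use j in simp)
  then have "res j a = res j (add_pow A (p ^ j) c)" using a c(1) by (simp add: res_eq_iff_diff)
  also have "\<dots> = \<zero>\<^bsub>red j\<^esub>" by (rule res_multiple_zero[OF c(1)]) simp
  finally show ?thesis .
qed

lemma res_p_cancel: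
  assumes ab: "a \<in> carrier A" "b \<in> carrier A" and j: "j < n"
    and eq: "res (Suc j) (add_pow A p a) = res (Suc j) (add_pow A p b)"
  shows "res j a = res j b"
proof -
  have "add_pow A p (a \<ominus> b) = add_pow A p a \<ominus> add_pow A p b"
    using ab by (simp add: a_minus_def add.nat_pow_distrib add.nat_pow_inv)
  then have "res (Suc j) (add_pow A p (a \<ominus> b)) = \<zero>\<^bsub>red (Suc j)\<^esub>"
    using res_eq_iff_diff[of "add_pow A p a" "add_pow A p b" "Suc j"] ab eq by simp
  then show ?thesis using res_p_cancel_zero[of "a \<ominus> b" j] ab j by (simp add: res_eq_iff_diff)
qed

lemma res_p_pow_cancel_zero:
  "a \<in> carrier A \<Longrightarrow> i + j \<le> n \<Longrightarrow> res (i + j) (add_pow A (p ^ i) a) = \<zero>\<^bsub>red (i + j)\<^esub> \<Longrightarrow> res j a = \<zero>\<^bsub>red j\<^esub>"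
proof (induction i)
  case (Suc i)
  have "res (Suc (i + j)) (add_pow A p (add_pow A (p ^ i) a)) = \<zero>\<^bsub>red (Suc (i + j))\<^esub>"
    using Suc by (simp add: add.nat_pow_pow mult.commute)
  then have "res (i + j) (add_pow A (p ^ i) a) = \<zero>\<^bsub>red (i + j)\<^esub>"
    using Suc.prems res_p_cancel_zero[of "add_pow A (p ^ i) a" "i + j"] by simp
  then show ?case using Suc.IH Suc.prems by simp
qed simp

lemma res_1_pow_inj:
  assumes a: "central_mod 1 a" and b: "central_mod 1 b" and eq: "res 1 (a [^] (p ^ k)) = res 1 (b [^] (p ^ k))"
  shows "res 1 a = res 1 b"
proof -
  have "res 1 a \<in> \<iota> ` carrier Z" "res 1 b \<in> \<iota> ` carrier Z"
    unfolding \<iota>_image center_carrier using a b by blast+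
  then obtain f g where fg: "f \<in> carrier Z" "g \<in> carrier Z" "res 1 a = \<iota> f" "res 1 b = \<iota> g" by auto
  have "\<iota> (f [^]\<^bsub>Z\<^esub> (p ^ k)) = \<iota> (g [^]\<^bsub>Z\<^esub> (p ^ k))"
    using eq fg central_mod_closed[OF a] central_mod_closed[OF b] by (simp add: \<iota>_nat_pow res.hom_nat_pow del: One_nat_def)
  then have "f [^]\<^bsub>Z\<^esub> (p ^ k) = g [^]\<^bsub>Z\<^esub> (p ^ k)" using inj_onD[OF \<iota>_inj] fg by simp
  then have "f = g" using Z.frobenius_inj[OF prime_p odd_p Z_char] fg by blast
  then show ?thesis using fg by simp
qed

text \<open>
  Modulo \<open>p\<close> only \<open>t\<^sub>0\<close> raised to the \<open>p\<^sup>k\<close> survives, and Frobenius is injective on the domain \<open>Z\<close>. After subtracting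
  these terms, divide by \<open>p\<close> and continue with the shifted vector.
\<close>

lemma teich_inj:
  assumes "\<And>j. j \<le> k \<Longrightarrow> central_mod 1 (t j)" and "\<And>j. j \<le> k \<Longrightarrow> central_mod 1 (s j)"
    and "Suc k \<le> n" and "res (Suc k) (teich k t) = res (Suc k) (teich k s)" and "j \<le> k"
  shows "res 1 (t j) = res 1 (s j)"
  using assms
proof (induction k arbitrary: t s j)
  case 0
  have "teich 0 u = u 0" if "central_mod 1 (u 0)" for u
    using central_mod_closed[OF that] by (simp add: teich_def)
  then show ?case using 0 by simp
next
  case (Suc k)
  have tc: "t j \<in> carrier A" if "j \<le> Suc k" for j using central_mod_closed[OF Suc.prems(1)[OF that]] .
  have sc: "s j \<in> carrier A" if "j \<le> Suc k" for j using central_mod_closed[OF Suc.prems(2)[OF that]] .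
  let ?T = "teich k (\<lambda>j. t (Suc j))" and ?S = "teich k (\<lambda>j. s (Suc j))"
  have TS: "?T \<in> carrier A" "?S \<in> carrier A" by (auto intro!: teich_closed tc sc)
  have eq: "res (Suc (Suc k)) (add_pow A p ?T \<oplus> t 0 [^] (p ^ Suc k)) = res (Suc (Suc k)) (add_pow A p ?S \<oplus> s 0 [^] (p ^ Suc k))"
    using Suc.prems(4) by (simp only: teich_Suc tc sc)
  have z: "res 1 (add_pow A p x) = \<zero>\<^bsub>red 1\<^esub>" if "x \<in> carrier A" for x
    using res_multiple_zero[OF that, of 1 1] by simp
  have "res 1 (add_pow A p ?T \<oplus> t 0 [^] (p ^ Suc k)) = res 1 (add_pow A p ?S \<oplus> s 0 [^] (p ^ Suc k))"
    using TS tc[of 0] sc[of 0] by (intro res_mono[OF _ _ _ eq]) auto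
  then have "res 1 (t 0 [^] (p ^ Suc k)) = res 1 (s 0 [^] (p ^ Suc k))"
    using TS tc[of 0] sc[of 0] z by (simp del: One_nat_def)
  then have 0: "res 1 (t 0) = res 1 (s 0)" by (rule res_1_pow_inj[rotated 2]) (use Suc.prems(1,2)[of 0] in simp_all)
  have "res (Suc (Suc k)) (t 0 [^] (p ^ Suc k)) = res (Suc (Suc k)) (s 0 [^] (p ^ Suc k))"
    by (rule res_pow_p_pow[OF Suc.prems(2) tc 0]) simp_all
  then have "res (Suc (Suc k)) (add_pow A p ?T) = res (Suc (Suc k)) (add_pow A p ?S)"
    using eq TS tc[of 0] sc[of 0] by (simp add: res.S.add.r_cancel)
  then have "res (Suc k) ?T = res (Suc k) ?S"
    using TS Suc.prems(3) res_p_cancel[of ?T ?S "Suc k"] by simp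
  then have "res 1 (t (Suc i)) = res 1 (s (Suc i))" if "i \<le> k" for i
    using that Suc.prems Suc.IH[of "\<lambda>j. t (Suc j)" "\<lambda>j. s (Suc j)" i] by simp
  then show ?case using 0 Suc.prems(5) by (cases j) simp_all
qed

end

text \<open>
  The bracket \<open>br\<close> is the deformation bracket. The assumption \<open>kernel\<close> is the geometric input: if the one-form
  \<open>\<Sum> z\<^sub>i\<^bsup>p\<^sup>k\<^sup>-\<^sup>i - 1\<^esup> dz\<^sub>i\<close> pairs to zero with all Hamiltonian vector fields, the \<open>z\<^sub>i\<close> are \<open>p\<close>-th powers.
\<close>

locale poisson_witt_center = torsion_witt_center +
  fixes br :: "'c \<Rightarrow> 'c \<Rightarrow> 'c"
  assumes br_closed: "f \<in> carrier Z \<Longrightarrow> g \<in> carrier Z \<Longrightarrow> br f g \<in> carrier Z"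
    and commutator: "f \<in> carrier Z \<Longrightarrow> g \<in> carrier Z \<Longrightarrow> a \<in> carrier A \<Longrightarrow> b \<in> carrier A \<Longrightarrow> res 1 a = \<iota> f \<Longrightarrow> res 1 b = \<iota> g \<Longrightarrow>
        \<exists>c\<in>carrier A. res 1 c = \<iota> (br f g) \<and> a \<otimes> b = b \<otimes> a \<oplus> add_pow A p c"
    and kernel: "(\<And>i. i \<le> k \<Longrightarrow> z i \<in> carrier Z) \<Longrightarrow>
        (\<And>g. g \<in> carrier Z \<Longrightarrow> (\<Oplus>\<^bsub>Z\<^esub>i\<in>{..k}. z i [^]\<^bsub>Z\<^esub> (p ^ (k - i) - 1) \<otimes>\<^bsub>Z\<^esub> br (z i) g) = \<zero>\<^bsub>Z\<^esub>) \<Longrightarrow>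
        i \<le> k \<Longrightarrow> \<exists>w\<in>carrier Z. z i = w [^]\<^bsub>Z\<^esub> p"
begin

text \<open>
  By the Leibniz rule for powers, the commutator of \<open>a\<close> with a lift of \<open>g\<close> is, modulo \<open>p\<^sup>k\<^sup>+\<^sup>2\<close>, \<open>p\<^sup>k\<^sup>+\<^sup>1\<close> times a lift of the
  displayed sum plus \<open>p\<^sup>k\<^sup>+\<^sup>1\<close> times the commutator of \<open>c\<close> with this lift. The last term vanishes because \<open>g\<close> is
  central modulo \<open>p\<close>, and the whole because \<open>a\<close> is central; then \<open>p\<^sup>k\<^sup>+\<^sup>1\<close> can be cancelled.
\<close>

lemma central_lift_commutator_vanishes:
  assumes k: "Suc (Suc k) \<le> n" and a: "central_mod (Suc (Suc k)) a"
    and z: "\<And>i. i \<le> k \<Longrightarrow> z i \<in> carrier Z" and c: "c \<in> carrier A"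
    and az: "a = teich k (\<lambda>i. rep (z i)) \<oplus> add_pow A (p ^ Suc k) c" and g: "g \<in> carrier Z"
  shows "(\<Oplus>\<^bsub>Z\<^esub>i\<in>{..k}. z i [^]\<^bsub>Z\<^esub> (p ^ (k - i) - 1) \<otimes>\<^bsub>Z\<^esub> br (z i) g) = \<zero>\<^bsub>Z\<^esub>"
proof -
  let ?b = "rep g" and ?h = "res (Suc (Suc k))" and ?Q = "red (Suc (Suc k))"
  have b: "?b \<in> carrier A" by (rule rep_closed[OF g])
  have rc: "rep (z i) \<in> carrier A" if "i \<le> k" for i by (rule rep_closed[OF z[OF that]])
  have "\<exists>d. i \<le> k \<longrightarrow> d \<in> carrier A \<and> res 1 d = \<iota> (br (z i) g) \<and> rep (z i) \<otimes> ?b = ?b \<otimes> rep (z i) \<oplus> add_pow A p d" for i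
  proof (cases "i \<le> k")
    case True
    from commutator[OF z[OF True] g rc[OF True] b rep_res[OF z[OF True]] rep_res[OF g]] show ?thesis by blast
  qed simp
  then obtain d where "\<And>i. i \<le> k \<longrightarrow> d i \<in> carrier A \<and> res 1 (d i) = \<iota> (br (z i) g) \<and> rep (z i) \<otimes> ?b = ?b \<otimes> rep (z i) \<oplus> add_pow A p (d i)"
    by metis
  then have d: "\<And>i. i \<le> k \<Longrightarrow> d i \<in> carrier A" "\<And>i. i \<le> k \<Longrightarrow> res 1 (d i) = \<iota> (br (z i) g)"
    "\<And>i. i \<le> k \<Longrightarrow> rep (z i) \<otimes> ?b = ?b \<otimes> rep (z i) \<oplus> add_pow A p (d i)"
    by blast+
  let ?t = "\<lambda>i. add_pow A (p ^ i) (rep (z i) [^] (p ^ (k - i)))"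
  let ?s = "\<lambda>i. rep (z i) [^] (p ^ (k - i) - 1) \<otimes> d i"
  have tc: "?t i \<in> carrier A" "?s i \<in> carrier A" if "i \<le> k" for i using rc[OF that] d(1)[OF that] by auto
  have tm: "?h (?t i \<otimes> ?b) = ?h (?b \<otimes> ?t i \<oplus> add_pow A (p ^ Suc k) (?s i))" if i: "i \<le> k" for i
  proof -
    have "res (Suc (Suc (k - i))) (rep (z i) [^] (p ^ (k - i)) \<otimes> ?b) =
        res (Suc (Suc (k - i))) (?b \<otimes> rep (z i) [^] (p ^ (k - i)) \<oplus> add_pow A (p ^ Suc (k - i)) (?s i))"
      by (rule res_commutator_pow[OF rep_central[OF z[OF i]] b d(1)[OF i] d(3)[OF i]])
    then have "res (i + Suc (Suc (k - i))) (add_pow A (p ^ i) (rep (z i) [^] (p ^ (k - i)) \<otimes> ?b)) =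
        res (i + Suc (Suc (k - i))) (add_pow A (p ^ i) (?b \<otimes> rep (z i) [^] (p ^ (k - i)) \<oplus> add_pow A (p ^ Suc (k - i)) (?s i)))"
      using b rc[OF i] d(1)[OF i] by (intro res_add_pow) auto
    moreover have "i + Suc (Suc (k - i)) = Suc (Suc k)" using i by simp
    moreover have "p ^ Suc (k - i) * p ^ i = p ^ Suc k" using i by (simp flip: power_add power_Suc)
    ultimately show ?thesis
      using b rc[OF i] d(1)[OF i]
      by (simp add: add_pow_ldistr add_pow_rdistr add.nat_pow_distrib add.nat_pow_pow del: power_Suc res.hom_mult res.hom_add)
  qed
  let ?T = "teich k (\<lambda>i. rep (z i))" and ?S = "(\<Oplus>i\<in>{..k}. ?s i)"
  have T: "?T \<in> carrier A" by (intro teich_closed rc)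
  have S: "?S \<in> carrier A" using tc by (intro finsum_closed) auto
  have "?T \<otimes> ?b = (\<Oplus>i\<in>{..k}. ?t i \<otimes> ?b)"
    unfolding teich_def using tc b by (intro finsum_ldistr) auto
  then have "?h (?T \<otimes> ?b) = ?h (\<Oplus>i\<in>{..k}. ?t i \<otimes> ?b)" by simp
  also have "\<dots> = ?h (\<Oplus>i\<in>{..k}. ?b \<otimes> ?t i \<oplus> add_pow A (p ^ Suc k) (?s i))"
    by (rule res_finsum_cong) (use tc b tm in auto)
  also have "(\<Oplus>i\<in>{..k}. ?b \<otimes> ?t i \<oplus> add_pow A (p ^ Suc k) (?s i)) = (\<Oplus>i\<in>{..k}. ?b \<otimes> ?t i) \<oplus> (\<Oplus>i\<in>{..k}. add_pow A (p ^ Suc k) (?s i))"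
    using tc b by (intro finsum_addf) auto
  also have "(\<Oplus>i\<in>{..k}. ?b \<otimes> ?t i) = ?b \<otimes> ?T"
    unfolding teich_def using tc b by (intro finsum_rdistr[symmetric]) auto
  also have "(\<Oplus>i\<in>{..k}. add_pow A (p ^ Suc k) (?s i)) = add_pow A (p ^ Suc k) ?S"
    using tc by (intro add_pow_finsum[symmetric]) auto
  finally have 1: "?h (?T \<otimes> ?b) = ?h (?b \<otimes> ?T) \<oplus>\<^bsub>?Q\<^esub> ?h (add_pow A (p ^ Suc k) ?S)"
    using T S b by simp
  have "res (Suc k + 1) (add_pow A (p ^ Suc k) (?b \<otimes> c)) = res (Suc k + 1) (add_pow A (p ^ Suc k) (c \<otimes> ?b))"
    by (rule res_add_pow[OF _ _ central_modD[OF rep_central[OF g] c]]) (use b c in simp_all)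
  then have 2: "?h (add_pow A (p ^ Suc k) c \<otimes> ?b) = ?h (?b \<otimes> add_pow A (p ^ Suc k) c)"
    using b c by (simp add: add_pow_ldistr add_pow_rdistr del: power_Suc res.hom_mult)
  have "?h (a \<otimes> ?b) = ?h (?T \<otimes> ?b) \<oplus>\<^bsub>?Q\<^esub> ?h (add_pow A (p ^ Suc k) c \<otimes> ?b)"
    unfolding az using T b c by (simp add: l_distr del: power_Suc)
  also have "\<dots> = ?h (?b \<otimes> a) \<oplus>\<^bsub>?Q\<^esub> ?h (add_pow A (p ^ Suc k) ?S)"
    unfolding az 1 2 using T S b c by (simp add: r_distr res.S.a_ac del: power_Suc)
  finally have "?h (?b \<otimes> a) = ?h (?b \<otimes> a) \<oplus>\<^bsub>?Q\<^esub> ?h (add_pow A (p ^ Suc k) ?S)"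
    using central_modD[OF a b] by simp
  then have "?h (add_pow A (p ^ Suc k) ?S) = \<zero>\<^bsub>?Q\<^esub>"
    by (rule res.S.add_eq_selfD[rotated 2]) (use S b central_mod_closed[OF a] in auto)
  then have "res 1 ?S = \<zero>\<^bsub>red 1\<^esub>"
    using res_p_pow_cancel_zero[of ?S "Suc k" 1] S k by simp
  moreover have "res 1 ?S = \<iota> (\<Oplus>\<^bsub>Z\<^esub>i\<in>{..k}. z i [^]\<^bsub>Z\<^esub> (p ^ (k - i) - 1) \<otimes>\<^bsub>Z\<^esub> br (z i) g)"
  proof -
    have "res 1 ?S = finsum (red 1) (res 1 \<circ> ?s) {..k}" using tc by (intro res.hom_finsum) auto
    also have "\<dots> = (\<Oplus>\<^bsub>red 1\<^esub>i\<in>{..k}. \<iota> (z i [^]\<^bsub>Z\<^esub> (p ^ (k - i) - 1) \<otimes>\<^bsub>Z\<^esub> br (z i) g))"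
      using z g rc d br_closed
      by (intro res.S.finsum_cong') (simp_all add: \<iota>_mult \<iota>_nat_pow \<iota>_closed res.hom_nat_pow rep_res del: One_nat_def)
    also have "\<dots> = \<iota> (\<Oplus>\<^bsub>Z\<^esub>i\<in>{..k}. z i [^]\<^bsub>Z\<^esub> (p ^ (k - i) - 1) \<otimes>\<^bsub>Z\<^esub> br (z i) g)"
      using z g br_closed by (intro \<iota>_finsum[symmetric]) auto
    finally show ?thesis .
  qed
  ultimately have "\<iota> (\<Oplus>\<^bsub>Z\<^esub>i\<in>{..k}. z i [^]\<^bsub>Z\<^esub> (p ^ (k - i) - 1) \<otimes>\<^bsub>Z\<^esub> br (z i) g) = \<iota> \<zero>\<^bsub>Z\<^esub>"
    by (simp only: \<iota>_zero)
  then show ?thesis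
    using z g br_closed inj_onD[OF \<iota>_inj] by (simp add: Pi_def)
qed

text \<open>
  By induction a central element is \<open>teich k\<close> of some \<open>z\<close> up to a multiple of \<open>p\<^sup>k\<^sup>+\<^sup>1\<close>. The vanishing of its commutators makes
  every \<open>z\<^sub>i\<close> a \<open>p\<close>-th power \<open>w\<^sub>i\<^sup>p\<close>, so that \<open>teich k z\<close> agrees with the first terms of \<open>teich (k + 1) w\<close>; the remaining
  multiple of \<open>p\<^sup>k\<^sup>+\<^sup>1\<close> is central modulo \<open>p\<close> and supplies the last component.
\<close>

lemma teich_surj:
  "central_mod (Suc k) a \<Longrightarrow> Suc k \<le> n \<Longrightarrow>
    \<exists>z. (\<forall>i\<le>k. z i \<in> carrier Z) \<and> res (Suc k) a = res (Suc k) (teich k (\<lambda>i. rep (z i)))"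
proof (induction k arbitrary: a)
  case 0
  have "res 1 a \<in> \<iota> ` carrier Z" unfolding \<iota>_image center_carrier using 0 by auto
  then obtain f where f: "f \<in> carrier Z" "res 1 a = \<iota> f" by auto
  have "teich 0 (\<lambda>i. rep f) = rep f" using rep_closed[OF f(1)] by (simp add: teich_def)
  then show ?case using f rep_res[OF f(1)] by (intro exI[of _ "\<lambda>_. f"]) simp
next
  case (Suc k)
  have ac: "a \<in> carrier A" by (rule central_mod_closed[OF Suc.prems(1)])
  have "central_mod (Suc k) a" by (rule central_mod_mono[OF Suc.prems(1)]) simp
  then obtain z where z: "\<And>i. i \<le> k \<Longrightarrow> z i \<in> carrier Z" "res (Suc k) a = res (Suc k) (teich k (\<lambda>i. rep (z i)))"
    using Suc.IH[of a] Suc.prems by auto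
  have rc: "rep (z i) \<in> carrier A" if "i \<le> k" for i by (rule rep_closed[OF z(1)[OF that]])
  obtain c where c: "c \<in> carrier A" "a = teich k (\<lambda>i. rep (z i)) \<oplus> add_pow A (p ^ Suc k) c"
    by (rule res_eqE[OF z(2)]) (use ac teich_closed rc in auto)
  have "\<exists>w\<in>carrier Z. z i = w [^]\<^bsub>Z\<^esub> p" if "i \<le> k" for i
    by (rule kernel[OF z(1) central_lift_commutator_vanishes[OF Suc.prems(2,1) z(1) c] that])
  then obtain w where w: "\<And>i. i \<le> k \<Longrightarrow> w i \<in> carrier Z" "\<And>i. i \<le> k \<Longrightarrow> z i = w i [^]\<^bsub>Z\<^esub> p"
    by metis
  have wc: "rep (w i) \<in> carrier A" if "i \<le> k" for i by (rule rep_closed[OF w(1)[OF that]])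
  define T where "T = (\<Oplus>i\<in>{..k}. add_pow A (p ^ i) (rep (w i) [^] (p ^ (Suc k - i))))"
  have T: "T \<in> carrier A" unfolding T_def using wc by (intro finsum_closed) auto
  have TC: "central_mod (Suc (Suc k)) T"
    unfolding T_def
  proof (rule central_mod_finsum)
    fix i assume "i \<in> {..k}"
    then have i: "i \<le> k" by simp
    have "central_mod (i + Suc (Suc k - i)) (add_pow A (p ^ i) (rep (w i) [^] (p ^ (Suc k - i))))"
      by (intro central_mod_shift central_mod_pow rep_central w i)
    then show "central_mod (Suc (Suc k)) (add_pow A (p ^ i) (rep (w i) [^] (p ^ (Suc k - i))))" using i by simp
  qed simp
  have "res (Suc k) (teich k (\<lambda>i. rep (z i))) = res (Suc k) (teich k (\<lambda>i. rep (w i) [^] p))"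
  proof (rule teich_cong)
    fix i assume i: "i \<le> k"
    show "res 1 (rep (z i)) = res 1 (rep (w i) [^] p)"
      using i w wc z by (simp add: rep_res \<iota>_nat_pow res.hom_nat_pow del: One_nat_def)
  qed (use rc w in \<open>auto intro: central_mod_nat_pow rep_central simp del: One_nat_def\<close>)
  also have "teich k (\<lambda>i. rep (w i) [^] p) = T"
    unfolding teich_def T_def using wc
    by (intro finsum_cong') (auto simp: nat_pow_pow Suc_diff_le)
  finally obtain c' where c': "c' \<in> carrier A" "a = T \<oplus> add_pow A (p ^ Suc k) c'"
    using res_eqE[of "Suc k" a T] ac T z(2) by auto
  have "add_pow A (p ^ Suc k) c' = a \<oplus> \<ominus> T" using c' T by (simp add: a_comm[of T] a_assoc r_neg)
  then have pc: "central_mod (Suc (Suc k)) (add_pow A (p ^ Suc k) c')"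
    using central_mod_add[OF Suc.prems(1) central_mod_a_inv[OF TC]] by simp
  have "central_mod 1 c'"
    unfolding central_mod_def
  proof (intro conjI ballI c')
    fix x assume x: "x \<in> carrier A"
    have "res (Suc (Suc k)) (add_pow A (p ^ Suc k) (c' \<otimes> x)) = res (Suc (Suc k)) (add_pow A (p ^ Suc k) (x \<otimes> c'))"
      using central_modD[OF pc x] c' x by (simp add: add_pow_ldistr add_pow_rdistr del: power_Suc res.hom_mult)
    moreover have "add_pow A (p ^ Suc k) (c' \<otimes> x \<ominus> x \<otimes> c') = add_pow A (p ^ Suc k) (c' \<otimes> x) \<ominus> add_pow A (p ^ Suc k) (x \<otimes> c')"
      using c' x by (simp add: a_minus_def add.nat_pow_distrib add.nat_pow_inv del: power_Suc)
    ultimately have "res (Suc k + 1) (add_pow A (p ^ Suc k) (c' \<otimes> x \<ominus> x \<otimes> c')) = \<zero>\<^bsub>red (Suc k + 1)\<^esub>"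
      using res_eq_iff_diff[of "add_pow A (p ^ Suc k) (c' \<otimes> x)" "add_pow A (p ^ Suc k) (x \<otimes> c')" "Suc (Suc k)"] c' x
      by (simp del: power_Suc res.hom_mult)
    then have "res 1 (c' \<otimes> x \<ominus> x \<otimes> c') = \<zero>\<^bsub>red 1\<^esub>"
      using c' x Suc.prems(2) by (intro res_p_pow_cancel_zero[of _ "Suc k" 1]) auto
    then show "res 1 (c' \<otimes> x) = res 1 (x \<otimes> c')"
      using c' x res_eq_iff_diff[of "c' \<otimes> x" "x \<otimes> c'" 1] by blast
  qed
  then have "res 1 c' \<in> \<iota> ` carrier Z" unfolding \<iota>_image center_carrier by blast
  then obtain f where f: "f \<in> carrier Z" "res 1 c' = \<iota> f" by auto
  define u where "u i = (if i \<le> k then w i else f)" for i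
  have u: "u i \<in> carrier Z" for i using w f by (simp add: u_def)
  have "teich (Suc k) (\<lambda>i. rep (u i)) = add_pow A (p ^ Suc k) (rep (u (Suc k)) [^] (p ^ 0)) \<oplus> (\<Oplus>i\<in>{..k}. add_pow A (p ^ i) (rep (u i) [^] (p ^ (Suc k - i))))"
    unfolding teich_def using rep_closed[OF u] by (subst finsum_Suc) auto
  also have "(\<Oplus>i\<in>{..k}. add_pow A (p ^ i) (rep (u i) [^] (p ^ (Suc k - i)))) = T"
    unfolding T_def using wc by (intro finsum_cong') (auto simp: u_def)
  finally have 3: "teich (Suc k) (\<lambda>i. rep (u i)) = T \<oplus> add_pow A (p ^ Suc k) (rep f)"
    using T rep_closed[OF f(1)] by (simp add: u_def a_comm del: power_Suc)
  have "res (Suc k + 1) (add_pow A (p ^ Suc k) c') = res (Suc k + 1) (add_pow A (p ^ Suc k) (rep f))"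
    by (rule res_add_pow) (use c' rep_closed[OF f(1)] rep_res[OF f(1)] f in simp_all)
  then have "res (Suc (Suc k)) a = res (Suc (Suc k)) (teich (Suc k) (\<lambda>i. rep (u i)))"
    unfolding 3 c'(2) using T c' rep_closed[OF f(1)] by (simp del: power_Suc)
  then show ?case using u by blast
qed

end

section \<open>Simple ring extensions inside a domain\<close>

lemma (in ring) subring_finsum:
  assumes S: "subring S R" and "finite I" and "\<And>i. i \<in> I \<Longrightarrow> f i \<in> S"
  shows "(\<Oplus>i\<in>I. f i) \<in> S"
  using assms(2,3)
proof (induction I rule: finite_induct)
  case empty
  then show ?case by (simp add: subringE(2)[OF S])
next
  case (insert x I)
  then have "(\<Oplus>i\<in>insert x I. f i) = f x \<oplus> (\<Oplus>i\<in>I. f i)"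
    using subringE(1)[OF S] by (intro finsum_insert) auto
  then show ?case using insert by (simp add: subringE(7)[OF S])
qed

lemma (in abelian_monoid) finsum_swap:
  assumes "finite I" "finite J" "\<And>i j. i \<in> I \<Longrightarrow> j \<in> J \<Longrightarrow> f i j \<in> carrier G"
  shows "(\<Oplus>i\<in>I. (\<Oplus>j\<in>J. f i j)) = (\<Oplus>j\<in>J. (\<Oplus>i\<in>I. f i j))"
  using assms(1,3)
proof (induction I rule: finite_induct)
  case (insert x I)
  have "(\<Oplus>i\<in>insert x I. (\<Oplus>j\<in>J. f i j)) = (\<Oplus>j\<in>J. f x j) \<oplus> (\<Oplus>i\<in>I. (\<Oplus>j\<in>J. f i j))"
    using insert by (intro finsum_insert) (auto intro!: finsum_closed)
  also have "\<dots> = (\<Oplus>j\<in>J. f x j) \<oplus> (\<Oplus>j\<in>J. (\<Oplus>i\<in>I. f i j))" using insert by simp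
  also have "\<dots> = (\<Oplus>j\<in>J. f x j \<oplus> (\<Oplus>i\<in>I. f i j))"
    using insert by (intro finsum_addf[symmetric]) (auto intro!: finsum_closed)
  also have "\<dots> = (\<Oplus>j\<in>J. (\<Oplus>i\<in>insert x I. f i j))"
    using insert by (intro finsum_cong') (auto intro!: finsum_closed)
  finally show ?case .
qed simp

lemma (in ring) subring_nat_pow: "subring S R \<Longrightarrow> x \<in> S \<Longrightarrow> x [^] (n::nat) \<in> S"
  by (induction n) (simp_all add: subringE(3,6))

lemma (in domain) nat_pow_nonzero: "x \<in> carrier R \<Longrightarrow> x \<noteq> \<zero> \<Longrightarrow> x [^] (n::nat) \<noteq> \<zero>"
  by (induction n) (auto simp: integral_iff)

text \<open>
  Gaussian elimination without division: cross-multiplication with a pivot keeps the coefficients in \<open>S\<close> and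
  removes one coordinate and one vector.
\<close>

lemma (in domain) linear_dependence:
  assumes S: "subring S R" and I: "finite I" "card I > n"
    and M: "\<And>i j. i \<in> I \<Longrightarrow> j < n \<Longrightarrow> M i j \<in> S"
  shows "\<exists>a. (\<forall>i\<in>I. a i \<in> S) \<and> (\<exists>i\<in>I. a i \<noteq> \<zero>) \<and> (\<forall>j<n. (\<Oplus>i\<in>I. a i \<otimes> M i j) = \<zero>)"
  using I M
proof (induction n arbitrary: I M)
  case 0
  then obtain i where "i \<in> I" by fastforce
  then show ?case using subringE(3)[OF S] by (intro exI[of _ "\<lambda>_. \<one>"]) auto
next
  case (Suc n)
  note Sc = subsetD[OF subringE(1)[OF S]]
  show ?case
  proof (cases "\<forall>i\<in>I. M i n = \<zero>")
    case True
    have "\<exists>a. (\<forall>i\<in>I. a i \<in> S) \<and> (\<exists>i\<in>I. a i \<noteq> \<zero>) \<and> (\<forall>j<n. (\<Oplus>i\<in>I. a i \<otimes> M i j) = \<zero>)"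
      by (rule Suc.IH) (use Suc.prems in auto)
    then obtain a where a: "\<forall>i\<in>I. a i \<in> S" "\<exists>i\<in>I. a i \<noteq> \<zero>" "\<forall>j<n. (\<Oplus>i\<in>I. a i \<otimes> M i j) = \<zero>" by blast
    have "(\<Oplus>i\<in>I. a i \<otimes> M i n) = (\<Oplus>i\<in>I. \<zero>)"
      using True a(1) Sc by (intro finsum_cong') auto
    then have "(\<Oplus>i\<in>I. a i \<otimes> M i n) = \<zero>" by simp
    then show ?thesis using a less_Suc_eq by (intro exI[of _ a]) auto
  next
    case False
    then obtain q where q: "q \<in> I" "M q n \<noteq> \<zero>" by blast
    define J where "J = I - {q}"
    define d where "d = M q n"
    define N where "N i j = d \<otimes> M i j \<ominus> M i n \<otimes> M q j" for i j
    have J: "finite J" "card J > n" "q \<notin> J" "I = insert q J" using Suc.prems q by (auto simp: J_def)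
    have MS: "M i j \<in> S" if "i \<in> I" "j < Suc n" for i j using Suc.prems(3) that by blast
    have dS: "d \<in> S" unfolding d_def using MS q by blast
    have "\<exists>a. (\<forall>i\<in>J. a i \<in> S) \<and> (\<exists>i\<in>J. a i \<noteq> \<zero>) \<and> (\<forall>j<n. (\<Oplus>i\<in>J. a i \<otimes> N i j) = \<zero>)"
    proof (rule Suc.IH)
      show "N i j \<in> S" if "i \<in> J" "j < n" for i j
        unfolding N_def a_minus_def using that dS MS[of i j] MS[of i n] MS[of q j] q J
        by (intro subringE(5-7)[OF S]) auto
    qed (use J in auto)
    then obtain a where a: "\<forall>i\<in>J. a i \<in> S" "\<exists>i\<in>J. a i \<noteq> \<zero>" "\<forall>j<n. (\<Oplus>i\<in>J. a i \<otimes> N i j) = \<zero>" by blast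
    have aS: "a i \<in> S" if "i \<in> J" for i using a(1) that by blast
    define s where "s = (\<Oplus>i\<in>J. a i \<otimes> M i n)"
    have sS: "s \<in> S" unfolding s_def using aS MS J by (intro subring_finsum[OF S] subringE(6)[OF S]) auto
    define b where "b i = (if i = q then \<ominus> s else d \<otimes> a i)" for i
    have bS: "b i \<in> S" if "i \<in> I" for i
      using that J aS dS sS by (auto simp: b_def intro: subringE(5,6)[OF S])
    have sum: "(\<Oplus>i\<in>I. b i \<otimes> M i j) = (\<Oplus>i\<in>J. d \<otimes> a i \<otimes> M i j) \<ominus> s \<otimes> M q j" if j: "j < Suc n" for j
    proof -
      have "(\<Oplus>i\<in>I. b i \<otimes> M i j) = b q \<otimes> M q j \<oplus> (\<Oplus>i\<in>J. b i \<otimes> M i j)"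
        unfolding J(4) using J bS MS j q Sc by (intro finsum_insert) auto
      also have "(\<Oplus>i\<in>J. b i \<otimes> M i j) = (\<Oplus>i\<in>J. d \<otimes> a i \<otimes> M i j)"
        using J aS dS MS j Sc by (intro finsum_cong') (auto simp: b_def)
      finally show ?thesis
        using J aS dS MS j sS q Sc by (simp add: b_def a_minus_def l_minus a_comm Pi_def)
    qed
    have "(\<Oplus>i\<in>I. b i \<otimes> M i j) = \<zero>" if j: "j < Suc n" for j
    proof (cases "j = n")
      case True
      have "(\<Oplus>i\<in>J. d \<otimes> a i \<otimes> M i n) = d \<otimes> s"
        unfolding s_def using J aS dS MS Sc by (subst finsum_rdistr) (auto simp: m_assoc intro!: finsum_cong')
      then show ?thesis using sum[OF j] True Sc[OF sS] Sc[OF dS] by (simp add: d_def[symmetric] m_comm a_minus_def r_neg)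
    next
      case False
      then have j': "j < n" using j by simp
      have "(\<Oplus>i\<in>J. d \<otimes> a i \<otimes> M i j) = (\<Oplus>i\<in>J. a i \<otimes> N i j \<oplus> a i \<otimes> M i n \<otimes> M q j)"
      proof (rule finsum_cong')
        show "d \<otimes> a i \<otimes> M i j = a i \<otimes> N i j \<oplus> a i \<otimes> M i n \<otimes> M q j" if i: "i \<in> J" for i
        proof -
          have c: "a i \<in> carrier R" "M i j \<in> carrier R" "M i n \<in> carrier R" "M q j \<in> carrier R" "d \<in> carrier R"
            using Sc aS[OF i] MS[of i j] MS[of i n] MS[of q j] dS i J j q by auto
          have "a i \<otimes> N i j \<oplus> a i \<otimes> M i n \<otimes> M q j = a i \<otimes> (d \<otimes> M i j)"
            unfolding N_def using c by (simp add: a_minus_def r_distr r_minus m_assoc a_assoc l_neg)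
          then show ?thesis using c by (simp add: m_ac)
        qed
      qed (use J aS MS j q Sc dS in \<open>auto simp: N_def\<close>)
      also have "\<dots> = (\<Oplus>i\<in>J. a i \<otimes> N i j) \<oplus> (\<Oplus>i\<in>J. a i \<otimes> M i n \<otimes> M q j)"
        using J aS MS j q Sc dS by (intro finsum_addf) (auto simp: N_def)
      also have "(\<Oplus>i\<in>J. a i \<otimes> M i n \<otimes> M q j) = s \<otimes> M q j"
        unfolding s_def using J aS MS j q Sc by (intro finsum_ldistr[symmetric]) auto
      finally show ?thesis using sum[OF j] a(3) j' Sc[OF sS] Sc[OF MS[OF q(1) j]] by (simp add: a_minus_def r_neg)
    qed
    moreover have "\<exists>i\<in>I. b i \<noteq> \<zero>"
    proof -
      obtain i where i: "i \<in> J" "a i \<noteq> \<zero>" using a(2) by blast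
      then have "b i \<noteq> \<zero>" using q J(3) dS aS Sc by (auto simp: b_def d_def integral_iff)
      then show ?thesis using i J(4) by blast
    qed
    ultimately show ?thesis using bS by blast
  qed
qed

text \<open>
  The values at \<open>t\<close> of the polynomials over \<open>S\<close> of degree less than \<open>n\<close>.
\<close>

definition (in ring) poly_span :: "'a set \<Rightarrow> 'a \<Rightarrow> nat \<Rightarrow> 'a set" where
  "poly_span S t n = {(\<Oplus>i\<in>{..<n}. c i \<otimes> t [^] i) | c. \<forall>i<n. c i \<in> S}"

context domain
begin

lemma poly_span_dependence:
  assumes S: "subring S R" and t: "t \<in> carrier R" and I: "finite I" "card I > n"
    and u: "\<And>i. i \<in> I \<Longrightarrow> u i \<in> carrier R"
    and d: "\<And>i. i \<in> I \<Longrightarrow> \<exists>d\<in>S - {\<zero>}. d \<otimes> u i \<in> poly_span S t n"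
  shows "\<exists>a. (\<forall>i\<in>I. a i \<in> S) \<and> (\<exists>i\<in>I. a i \<noteq> \<zero>) \<and> (\<Oplus>i\<in>I. a i \<otimes> u i) = \<zero>"
proof -
  note Sc = subsetD[OF subringE(1)[OF S]]
  have "\<exists>d c. i \<in> I \<longrightarrow> d \<in> S - {\<zero>} \<and> (\<forall>j<n. c j \<in> S) \<and> d \<otimes> u i = (\<Oplus>j\<in>{..<n}. c j \<otimes> t [^] j)" for i
    using d[of i] unfolding poly_span_def by blast
  then obtain d M where dM: "\<And>i. i \<in> I \<longrightarrow> d i \<in> S - {\<zero>} \<and> (\<forall>j<n. M i j \<in> S) \<and> d i \<otimes> u i = (\<Oplus>j\<in>{..<n}. M i j \<otimes> t [^] j)"
    by metis
  have dS: "d i \<in> S" "d i \<noteq> \<zero>" "d i \<otimes> u i = (\<Oplus>j\<in>{..<n}. M i j \<otimes> t [^] j)" if "i \<in> I" for i using dM that by auto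
  have MS: "M i j \<in> S" if "i \<in> I" "j < n" for i j using dM that by auto
  obtain a where a: "\<forall>i\<in>I. a i \<in> S" "\<exists>i\<in>I. a i \<noteq> \<zero>" "\<forall>j<n. (\<Oplus>i\<in>I. a i \<otimes> M i j) = \<zero>"
    using linear_dependence[OF S I, of M] MS by blast
  have aS: "a i \<in> S" if "i \<in> I" for i using a(1) that by blast
  have "(\<Oplus>i\<in>I. a i \<otimes> d i \<otimes> u i) = (\<Oplus>i\<in>I. (\<Oplus>j\<in>{..<n}. a i \<otimes> M i j \<otimes> t [^] j))"
  proof (rule finsum_cong')
    show "a i \<otimes> d i \<otimes> u i = (\<Oplus>j\<in>{..<n}. a i \<otimes> M i j \<otimes> t [^] j)" if i: "i \<in> I" for i
    proof -
      have "a i \<otimes> d i \<otimes> u i = a i \<otimes> (\<Oplus>j\<in>{..<n}. M i j \<otimes> t [^] j)"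
        using Sc aS[OF i] dS[OF i] u[OF i] by (simp add: m_assoc)
      also have "\<dots> = (\<Oplus>j\<in>{..<n}. a i \<otimes> M i j \<otimes> t [^] j)"
        using Sc aS[OF i] MS[OF i] t by (subst finsum_rdistr) (auto simp: m_assoc intro!: finsum_cong')
      finally show ?thesis .
    qed
  qed (use Sc aS MS t in \<open>auto intro!: finsum_closed\<close>)
  also have "\<dots> = (\<Oplus>j\<in>{..<n}. (\<Oplus>i\<in>I. a i \<otimes> M i j \<otimes> t [^] j))"
    using Sc aS MS t I by (intro finsum_swap) auto
  also have "\<dots> = (\<Oplus>j\<in>{..<n}. \<zero>)"
  proof (rule finsum_cong')
    show "(\<Oplus>i\<in>I. a i \<otimes> M i j \<otimes> t [^] j) = \<zero>" if j: "j \<in> {..<n}" for j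
    proof -
      have "(\<Oplus>i\<in>I. a i \<otimes> M i j \<otimes> t [^] j) = (\<Oplus>i\<in>I. a i \<otimes> M i j) \<otimes> t [^] j"
        using Sc aS MS t I j by (intro finsum_ldistr[symmetric]) auto
      then show ?thesis using a(3) j t by simp
    qed
  qed auto
  finally have "(\<Oplus>i\<in>I. a i \<otimes> d i \<otimes> u i) = \<zero>" by simp
  moreover have "\<exists>i\<in>I. a i \<otimes> d i \<noteq> \<zero>" using a(2) dS aS Sc by (auto simp: integral_iff)
  moreover have "a i \<otimes> d i \<in> S" if "i \<in> I" for i using aS[OF that] dS[OF that] by (intro subringE(6)[OF S])
  ultimately show ?thesis by (intro exI[of _ "\<lambda>i. a i \<otimes> d i"]) blast
qed

end

lemma (in ring) poly_spanI:
  "(\<And>i. i < n \<Longrightarrow> c i \<in> S) \<Longrightarrow> x = (\<Oplus>i\<in>{..<n}. c i \<otimes> t [^] i) \<Longrightarrow> x \<in> poly_span S t n"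
  unfolding poly_span_def by blast

text \<open>
  The subring \<open>S[t]\<close>.
\<close>

definition (in ring) adjoin :: "'a set \<Rightarrow> 'a \<Rightarrow> 'a set" where
  "adjoin S t = (\<Union>n. poly_span S t n)"

context UP_domain
begin

lemma eval_hom: "t \<in> carrier R \<Longrightarrow> UnivPoly.eval R R id t \<in> ring_hom P R"
proof -
  assume t: "t \<in> carrier R"
  interpret UP_pre_univ_prop R R id P by standard simp
  show ?thesis using eval_ring_hom[OF t] by simp
qed

lemma eval_bounded_sum:
  assumes f: "f \<in> carrier P" and t: "t \<in> carrier R" and n: "\<And>i. i \<ge> n \<Longrightarrow> up_ring.coeff P f i = \<zero>"
  shows "UnivPoly.eval R R id t f = (\<Oplus>i\<in>{..<n}. up_ring.coeff P f i \<otimes> t [^] i)"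
proof -
  let ?N = "max n (Suc (UnivPoly.deg R f))"
  have c: "up_ring.coeff P f i \<otimes> t [^] i \<in> carrier R" for i using f t by simp
  have "UnivPoly.eval R R id t f = (\<Oplus>i\<in>{..deg R f}. up_ring.coeff P f i \<otimes> t [^] i)"
    using eval_on_carrier[OF f, of R id t] by simp
  also have "\<dots> = (\<Oplus>i\<in>{..<?N}. up_ring.coeff P f i \<otimes> t [^] i)"
  proof (rule R.add.finprod_mono_neutral_cong_left)
    show "up_ring.coeff P f i \<otimes> t [^] i = \<zero>" if "i \<in> {..<?N} - {..deg R f}" for i
      using that deg_aboveD[of f i] f t by simp
  qed (use c in auto)
  also have "\<dots> = (\<Oplus>i\<in>{..<n}. up_ring.coeff P f i \<otimes> t [^] i)"
  proof (rule R.add.finprod_mono_neutral_cong_right)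
    show "up_ring.coeff P f i \<otimes> t [^] i = \<zero>" if "i \<in> {..<?N} - {..<n}" for i
      using that n[of i] t by simp
  qed (use c in auto)
  finally show ?thesis .
qed

lemma poly_of_coeffs:
  assumes c: "\<And>i. i < n \<Longrightarrow> c i \<in> carrier R"
  shows "\<exists>f\<in>carrier P. \<forall>i. up_ring.coeff P f i = (if i < n then c i else \<zero>)"
proof -
  let ?f = "\<lambda>i. if i < n then c i else \<zero>"
  have f: "?f \<in> up R"
  proof (rule mem_upI)
    show "?f i \<in> carrier R" for i using c by simp
    have "UnivPoly.bound \<zero> n ?f" by (rule bound.intro) simp
    then show "\<exists>n. UnivPoly.bound \<zero> n ?f" ..
  qed
  then have "?f \<in> carrier P" unfolding P_def UP_def by simp
  moreover have "up_ring.coeff P ?f i = ?f i" for i using f unfolding P_def UP_def by simp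
  ultimately show ?thesis by blast
qed

text \<open>
  The polynomials over the subring \<open>S\<close>, as polynomials over \<open>R\<close>.
\<close>

definition sub_polys :: "'a set \<Rightarrow> (nat \<Rightarrow> 'a) set" where
  "sub_polys S = {f \<in> carrier P. \<forall>i. up_ring.coeff P f i \<in> S}"

lemma subring_sub_polys:
  assumes S: "subring S R" shows "subring (sub_polys S) P"
proof (rule P.subringI)
  show "sub_polys S \<subseteq> carrier P" by (auto simp: sub_polys_def)
  show "\<one>\<^bsub>P\<^esub> \<in> sub_polys S" using subringE(2,3)[OF S] by (simp add: sub_polys_def)
  show "\<ominus>\<^bsub>P\<^esub> f \<in> sub_polys S" if "f \<in> sub_polys S" for f
    using that subringE(5)[OF S] by (simp add: sub_polys_def)
  show "f \<oplus>\<^bsub>P\<^esub> g \<in> sub_polys S" if "f \<in> sub_polys S" "g \<in> sub_polys S" for f g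
    using that subringE(7)[OF S] by (simp add: sub_polys_def)
  show "f \<otimes>\<^bsub>P\<^esub> g \<in> sub_polys S" if "f \<in> sub_polys S" "g \<in> sub_polys S" for f g
    using that subringE(6)[OF S] by (auto simp: sub_polys_def intro!: R.subring_finsum[OF S])
qed

lemma poly_span_eval:
  assumes S: "subring S R" and t: "t \<in> carrier R"
  shows "R.poly_span S t n = UnivPoly.eval R R id t ` {f \<in> sub_polys S. \<forall>i\<ge>n. up_ring.coeff P f i = \<zero>}"
proof (intro equalityI subsetI)
  fix x assume "x \<in> R.poly_span S t n"
  then obtain c where c: "\<forall>i<n. c i \<in> S" "x = (\<Oplus>i\<in>{..<n}. c i \<otimes> t [^] i)" by (auto simp: R.poly_span_def)
  then obtain f where f: "f \<in> carrier P" "\<forall>i. up_ring.coeff P f i = (if i < n then c i else \<zero>)"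
    using poly_of_coeffs[of n c] subringE(1)[OF S] by auto
  then have "f \<in> sub_polys S" using c subringE(2)[OF S] by (simp add: sub_polys_def)
  moreover have "UnivPoly.eval R R id t f = (\<Oplus>i\<in>{..<n}. up_ring.coeff P f i \<otimes> t [^] i)"
    using f t by (intro eval_bounded_sum) auto
  moreover have "\<dots> = x" unfolding c(2) using f c subringE(1)[OF S] t by (intro R.finsum_cong') auto
  ultimately show "x \<in> UnivPoly.eval R R id t ` {f \<in> sub_polys S. \<forall>i\<ge>n. up_ring.coeff P f i = \<zero>}" using f by auto
next
  fix x assume "x \<in> UnivPoly.eval R R id t ` {f \<in> sub_polys S. \<forall>i\<ge>n. up_ring.coeff P f i = \<zero>}"
  then obtain f where f: "f \<in> sub_polys S" "\<forall>i\<ge>n. up_ring.coeff P f i = \<zero>" "x = UnivPoly.eval R R id t f" by blast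
  then have "x = (\<Oplus>i\<in>{..<n}. up_ring.coeff P f i \<otimes> t [^] i)"
    using t eval_bounded_sum[of f t n] by (auto simp: sub_polys_def)
  then show "x \<in> R.poly_span S t n" using f unfolding R.poly_span_def sub_polys_def by blast
qed

lemma adjoin_eval:
  assumes S: "subring S R" and t: "t \<in> carrier R"
  shows "R.adjoin S t = UnivPoly.eval R R id t ` sub_polys S"
proof -
  have "\<exists>n. \<forall>i\<ge>n. up_ring.coeff P f i = \<zero>" if "f \<in> sub_polys S" for f
    using that deg_aboveD[of f] by (intro exI[of _ "Suc (UnivPoly.deg R f)"]) (auto simp: sub_polys_def)
  then show ?thesis unfolding R.adjoin_def poly_span_eval[OF S t] by blast
qed

lemma eval_ring_hom_ring: "t \<in> carrier R \<Longrightarrow> ring_hom_ring P R (UnivPoly.eval R R id t)"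
  by (rule ring_hom_ringI2[OF P.ring_axioms R.ring_axioms eval_hom])

lemma subring_adjoin_aux:
  assumes S: "subring S R" and t: "t \<in> carrier R"
  shows "subring (R.adjoin S t) R"
  unfolding adjoin_eval[OF S t]
  by (rule ring_hom_ring.img_is_subring[OF eval_ring_hom_ring[OF t] subring_sub_polys[OF S]])

text \<open>
  If \<open>t\<close> were transcendental, \<open>S[t]\<close> would be a polynomial ring. There \<open>1 - t h\<close> has positive degree, divides a
  power \<open>h\<^sup>k\<close> by assumption, and also divides \<open>1 - (t h)\<^sup>k\<close>; so it would divide \<open>1\<close>.
\<close>

lemma algebraic_if_dividing_powers_aux:
  assumes S: "subring S R" and t: "t \<in> carrier R" and h: "h \<in> R.adjoin S t" "h \<noteq> \<zero>"
    and div: "\<And>d. d \<in> R.adjoin S t \<Longrightarrow> d \<noteq> \<zero> \<Longrightarrow> \<exists>k::nat. \<exists>g\<in>R.adjoin S t. h [^] k = d \<otimes> g"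
  shows "\<exists>(n::nat) c. (\<forall>i<n. c i \<in> S) \<and> (\<Oplus>i\<in>{..<n}. c i \<otimes> t [^] i) = \<zero> \<and> (\<exists>i<n. c i \<noteq> \<zero>)"
proof (rule ccontr)
  assume "\<not> ?thesis"
  then have indep: "c i = \<zero>" if "\<forall>i<n. c i \<in> S" "(\<Oplus>i\<in>{..<n}. c i \<otimes> t [^] i) = \<zero>" "i < n" for n i :: nat and c
    using that by blast
  interpret ev: ring_hom_ring P R "UnivPoly.eval R R id t" by (rule eval_ring_hom_ring[OF t])
  note ev = ev.homh
  have hom_nat_pow: "UnivPoly.eval R R id t (f [^]\<^bsub>P\<^esub> k) = UnivPoly.eval R R id t f [^] k"
    if "f \<in> carrier P" for f and k :: nat
    using that by (induction k) simp_all
  have ev_c: "UnivPoly.eval R R id t f \<in> carrier R" if "f \<in> carrier P" for f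
    using ring_hom_closed[OF ev that] .
  have ev_0: "UnivPoly.eval R R id t \<zero>\<^bsub>P\<^esub> = \<zero>"
    by (rule ring_hom_zero[OF ev P.ring_axioms R.ring_axioms])
  let ?P = "P" and ?ev = "UnivPoly.eval R R id t"
  have sub: "subring (sub_polys S) ?P" by (rule subring_sub_polys[OF S])
  note Pc = subsetD[OF subringE(1)[OF sub]]
  have inj: "f = \<zero>\<^bsub>?P\<^esub>" if f: "f \<in> sub_polys S" "?ev f = \<zero>" for f
  proof (rule up_eqI)
    fix i
    have fP: "f \<in> carrier ?P" by (rule Pc[OF f(1)])
    have "?ev f = (\<Oplus>i\<in>{..<Suc (UnivPoly.deg R f)}. up_ring.coeff ?P f i \<otimes> t [^] i)"
      using deg_aboveD[OF _ fP] by (intro eval_bounded_sum[OF fP t]) auto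
    then have "up_ring.coeff ?P f i = \<zero>" if "i < Suc (UnivPoly.deg R f)" for i
      using indep[of "Suc (UnivPoly.deg R f)" "up_ring.coeff ?P f" i] that f by (simp add: sub_polys_def)
    moreover have "up_ring.coeff ?P f i = \<zero>" if "\<not> i < Suc (UnivPoly.deg R f)" for i
      using deg_aboveD[OF _ fP] that by simp
    ultimately show "up_ring.coeff ?P f i = up_ring.coeff ?P \<zero>\<^bsub>?P\<^esub> i" by (cases "i < Suc (UnivPoly.deg R f)") auto
  qed (use Pc[OF f(1)] in auto)
  obtain H where H: "H \<in> sub_polys S" "h = ?ev H" using h(1) unfolding adjoin_eval[OF S t] by blast
  have Hc: "H \<in> carrier ?P" by (rule Pc[OF H(1)])
  define V where "V = up_ring.monom ?P \<one> 1"
  have V: "V \<in> carrier ?P" by (simp add: V_def)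
  have VS: "V \<in> sub_polys S" using V subringE(2,3)[OF S] by (simp add: sub_polys_def V_def)
  define D where "D = \<one>\<^bsub>?P\<^esub> \<ominus>\<^bsub>?P\<^esub> V \<otimes>\<^bsub>?P\<^esub> H"
  have DS: "D \<in> sub_polys S"
    unfolding D_def a_minus_def by (intro subringE(3,5,6,7)[OF sub] VS H)
  have Dc: "D \<in> carrier ?P" by (rule Pc[OF DS])
  have H0: "H \<noteq> \<zero>\<^bsub>?P\<^esub>" using h(2) H(2) ev_0 by auto
  have V0: "V \<noteq> \<zero>\<^bsub>?P\<^esub>" and degV: "UnivPoly.deg R V = 1"
  proof -
    show d: "UnivPoly.deg R V = 1" unfolding V_def by (rule deg_monom) simp_all
    then show "V \<noteq> \<zero>\<^bsub>?P\<^esub>" by auto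
  qed
  have degVH: "UnivPoly.deg R (V \<otimes>\<^bsub>?P\<^esub> H) = Suc (UnivPoly.deg R H)"
    using deg_mult[OF V0 H0 V Hc] degV by simp
  have VH: "V \<otimes>\<^bsub>?P\<^esub> H = \<one>\<^bsub>?P\<^esub> \<ominus>\<^bsub>?P\<^esub> D"
    using V Hc by (simp add: D_def P.minus_eq P.minus_add P.a_assoc[symmetric] P.r_neg)
  have degD: "UnivPoly.deg R D \<noteq> 0"
  proof
    assume "UnivPoly.deg R D = 0"
    then have "UnivPoly.deg R (\<one>\<^bsub>?P\<^esub> \<ominus>\<^bsub>?P\<^esub> D) \<le> 0"
      using deg_add[of "\<one>\<^bsub>?P\<^esub>" "\<ominus>\<^bsub>?P\<^esub> D"] Dc by (simp add: P.minus_eq)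
    then show False using degVH VH by simp
  qed
  have D0: "D \<noteq> \<zero>\<^bsub>?P\<^esub>" using degD by auto
  then have "?ev D \<noteq> \<zero>" using inj[OF DS] by blast
  then obtain k g where kg: "g \<in> R.adjoin S t" "h [^] (k::nat) = ?ev D \<otimes> g"
    using div[of "?ev D"] DS unfolding adjoin_eval[OF S t] by blast
  then obtain G where G: "G \<in> sub_polys S" "g = ?ev G" unfolding adjoin_eval[OF S t] by blast
  have Gc: "G \<in> carrier ?P" by (rule Pc[OF G(1)])
  have HkS: "H [^]\<^bsub>?P\<^esub> k \<in> sub_polys S" by (rule P.subring_nat_pow[OF sub H(1)])
  have "?ev (H [^]\<^bsub>?P\<^esub> k \<ominus>\<^bsub>?P\<^esub> D \<otimes>\<^bsub>?P\<^esub> G) = h [^] k \<ominus> ?ev D \<otimes> g"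
    using Hc Dc Gc H(2) G(2) by (simp add: P.minus_eq R.minus_eq hom_nat_pow)
  also have "\<dots> = \<zero>" using kg Dc Gc G(2) by (simp add: R.minus_eq R.r_neg)
  finally have "H [^]\<^bsub>?P\<^esub> k \<ominus>\<^bsub>?P\<^esub> D \<otimes>\<^bsub>?P\<^esub> G = \<zero>\<^bsub>?P\<^esub>"
    by (intro inj) (simp_all add: a_minus_def subringE(5-7)[OF sub] HkS DS G)
  then have Hk: "H [^]\<^bsub>?P\<^esub> k = D \<otimes>\<^bsub>?P\<^esub> G" using Hc Dc Gc by (simp add: P.r_right_minus_eq)
  have "\<exists>Q\<in>carrier ?P. (V \<otimes>\<^bsub>?P\<^esub> H) [^]\<^bsub>?P\<^esub> j = \<one>\<^bsub>?P\<^esub> \<ominus>\<^bsub>?P\<^esub> D \<otimes>\<^bsub>?P\<^esub> Q" for j :: nat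
  proof (induction j)
    case 0
    then show ?case using Dc by (intro bexI[of _ "\<zero>\<^bsub>?P\<^esub>"]) (simp_all add: P.minus_eq)
  next
    case (Suc j)
    then obtain Q where Q: "Q \<in> carrier ?P" "(V \<otimes>\<^bsub>?P\<^esub> H) [^]\<^bsub>?P\<^esub> j = \<one>\<^bsub>?P\<^esub> \<ominus>\<^bsub>?P\<^esub> D \<otimes>\<^bsub>?P\<^esub> Q" by blast
    let ?Q = "\<one>\<^bsub>?P\<^esub> \<oplus>\<^bsub>?P\<^esub> (\<one>\<^bsub>?P\<^esub> \<ominus>\<^bsub>?P\<^esub> D) \<otimes>\<^bsub>?P\<^esub> Q"
    have "(V \<otimes>\<^bsub>?P\<^esub> H) [^]\<^bsub>?P\<^esub> Suc j = (\<one>\<^bsub>?P\<^esub> \<ominus>\<^bsub>?P\<^esub> D \<otimes>\<^bsub>?P\<^esub> Q) \<otimes>\<^bsub>?P\<^esub> (\<one>\<^bsub>?P\<^esub> \<ominus>\<^bsub>?P\<^esub> D)"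
      using Q VH by simp
    also have "\<dots> = \<one>\<^bsub>?P\<^esub> \<ominus>\<^bsub>?P\<^esub> D \<otimes>\<^bsub>?P\<^esub> ?Q"
      using Q(1) Dc
      by (simp add: P.minus_eq P.l_distr P.r_distr P.l_minus P.r_minus P.minus_add P.m_ac P.a_ac)
    finally show ?case using Q(1) Dc by (intro bexI[of _ ?Q]) simp_all
  qed
  then obtain Q where Q: "Q \<in> carrier ?P" "(V \<otimes>\<^bsub>?P\<^esub> H) [^]\<^bsub>?P\<^esub> k = \<one>\<^bsub>?P\<^esub> \<ominus>\<^bsub>?P\<^esub> D \<otimes>\<^bsub>?P\<^esub> Q" by blast
  have "(V \<otimes>\<^bsub>?P\<^esub> H) [^]\<^bsub>?P\<^esub> k = D \<otimes>\<^bsub>?P\<^esub> (V [^]\<^bsub>?P\<^esub> k \<otimes>\<^bsub>?P\<^esub> G)"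
    using V Hc Dc Gc Hk by (simp add: P.nat_pow_distrib P.m_ac)
  then have unit: "D \<otimes>\<^bsub>?P\<^esub> (V [^]\<^bsub>?P\<^esub> k \<otimes>\<^bsub>?P\<^esub> G \<oplus>\<^bsub>?P\<^esub> Q) = \<one>\<^bsub>?P\<^esub>"
    unfolding P.r_distr[OF P.m_closed[OF P.nat_pow_closed[OF V] Gc] Q(1) Dc] \<open>(V \<otimes>\<^bsub>?P\<^esub> H) [^]\<^bsub>?P\<^esub> k = D \<otimes>\<^bsub>?P\<^esub> _\<close>[symmetric] Q(2)
    using Q(1) Dc by (simp add: P.minus_eq P.a_assoc P.l_neg)
  let ?U = "V [^]\<^bsub>?P\<^esub> k \<otimes>\<^bsub>?P\<^esub> G \<oplus>\<^bsub>?P\<^esub> Q"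
  have Uc: "?U \<in> carrier ?P" using V Gc Q(1) by simp
  have "?U \<noteq> \<zero>\<^bsub>?P\<^esub>" using unit Dc by auto
  then have "UnivPoly.deg R D + UnivPoly.deg R ?U = UnivPoly.deg R \<one>\<^bsub>?P\<^esub>"
    using deg_mult[OF D0 _ Dc Uc] unit by simp
  then show False using degD by simp
qed

end

context domain
begin

lemma UP_domain_UP: "UP_domain R"
  by (intro UP_domain.intro UP_cring.intro is_cring domain_axioms)

lemmas subring_adjoin = UP_domain.subring_adjoin_aux[OF UP_domain_UP]
lemmas algebraic_if_dividing_powers = UP_domain.algebraic_if_dividing_powers_aux[OF UP_domain_UP]

lemma poly_span_add:
  assumes S: "subring S R" and t: "t \<in> carrier R" and x: "x \<in> poly_span S t n" and y: "y \<in> poly_span S t n"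
  shows "x \<oplus> y \<in> poly_span S t n"
proof -
  note Sc = subsetD[OF subringE(1)[OF S]]
  obtain c where c: "\<And>i. i < n \<Longrightarrow> c i \<in> S" "x = (\<Oplus>i\<in>{..<n}. c i \<otimes> t [^] i)" using x by (auto simp: poly_span_def)
  obtain d where d: "\<And>i. i < n \<Longrightarrow> d i \<in> S" "y = (\<Oplus>i\<in>{..<n}. d i \<otimes> t [^] i)" using y by (auto simp: poly_span_def)
  have "x \<oplus> y = (\<Oplus>i\<in>{..<n}. c i \<otimes> t [^] i \<oplus> d i \<otimes> t [^] i)"
    unfolding c(2) d(2) using c(1) d(1) Sc t by (intro finsum_addf[symmetric]) auto
  also have "\<dots> = (\<Oplus>i\<in>{..<n}. (c i \<oplus> d i) \<otimes> t [^] i)"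
    using c(1) d(1) Sc t by (intro finsum_cong') (auto simp: l_distr)
  finally show ?thesis by (rule poly_spanI[rotated]) (intro subringE(7)[OF S] c(1) d(1))
qed

lemma poly_span_smult:
  assumes S: "subring S R" and t: "t \<in> carrier R" and a: "a \<in> S" and x: "x \<in> poly_span S t n"
  shows "a \<otimes> x \<in> poly_span S t n"
proof -
  note Sc = subsetD[OF subringE(1)[OF S]]
  obtain c where c: "\<And>i. i < n \<Longrightarrow> c i \<in> S" "x = (\<Oplus>i\<in>{..<n}. c i \<otimes> t [^] i)" using x by (auto simp: poly_span_def)
  have "a \<otimes> x = (\<Oplus>i\<in>{..<n}. a \<otimes> (c i \<otimes> t [^] i))"
    unfolding c(2) using c(1) Sc t a by (intro finsum_rdistr) auto
  also have "\<dots> = (\<Oplus>i\<in>{..<n}. (a \<otimes> c i) \<otimes> t [^] i)"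
    using c(1) Sc t a by (intro finsum_cong') (auto simp: m_assoc)
  finally show ?thesis by (rule poly_spanI[rotated]) (intro subringE(6)[OF S] c(1) a)
qed

lemma poly_span_carrier:
  assumes S: "subring S R" and t: "t \<in> carrier R"
  shows "poly_span S t n \<subseteq> carrier R"
proof -
  note Sc = subsetD[OF subringE(1)[OF S]]
  have "(\<Oplus>i\<in>{..<n}. c i \<otimes> t [^] i) \<in> carrier R" if "\<forall>i<n. c i \<in> S" for c
    by (rule finsum_closed) (use that Sc t in auto)
  then show ?thesis by (auto simp: poly_span_def)
qed

lemma monom_in_poly_span:
  assumes S: "subring S R" and t: "t \<in> carrier R" and a: "a \<in> S" and i: "i < n"
  shows "a \<otimes> t [^] i \<in> poly_span S t n"
proof -
  note Sc = subsetD[OF subringE(1)[OF S]]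
  have "(\<Oplus>j\<in>{..<n}. (if j = i then a else \<zero>) \<otimes> t [^] j) = (\<Oplus>j\<in>{..<n}. if i = j then a \<otimes> t [^] j else \<zero>)"
    using Sc[OF a] t by (intro finsum_cong') auto
  also have "\<dots> = a \<otimes> t [^] i"
    using Sc[OF a] t i by (subst finsum_singleton) auto
  finally have "a \<otimes> t [^] i = (\<Oplus>j\<in>{..<n}. (if j = i then a else \<zero>) \<otimes> t [^] j)" by simp
  then show ?thesis unfolding poly_span_def using a subringE(2)[OF S] by fastforce
qed

lemma poly_span_sum:
  assumes S: "subring S R" and t: "t \<in> carrier R" and "finite I" and "\<And>i. i \<in> I \<Longrightarrow> f i \<in> poly_span S t n"
  shows "(\<Oplus>i\<in>I. f i) \<in> poly_span S t n"
  using assms(3,4)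
proof (induction I rule: finite_induct)
  case empty
  have "(\<Oplus>i\<in>{..<n}. \<zero> \<otimes> t [^] i) = (\<Oplus>i\<in>{..<n}. \<zero>)" using t by (intro finsum_cong') auto
  then have "\<zero> = (\<Oplus>i\<in>{..<n}. \<zero> \<otimes> t [^] i)" by simp
  then show ?case unfolding poly_span_def using subringE(2)[OF S] by (auto intro!: exI[of _ "\<lambda>_. \<zero>"])
next
  case (insert x I)
  then have "(\<Oplus>i\<in>insert x I. f i) = f x \<oplus> (\<Oplus>i\<in>I. f i)"
    using poly_span_carrier[OF S t] by (intro finsum_insert) auto
  then show ?case using insert poly_span_add[OF S t] by simp
qed

text \<open>
  Multiplication by \<open>c t\<close> preserves \<open>poly_span S t e\<close>.
\<close>

lemma adjoin_into_span:
  assumes S: "subring S R" and t: "t \<in> carrier R" and c: "c \<in> S" and e: "e \<ge> 1"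
    and rel: "c \<otimes> t [^] e \<in> poly_span S t e" and g: "g \<in> adjoin S t"
  shows "\<exists>l. c [^] (l::nat) \<otimes> g \<in> poly_span S t e"
proof -
  note Sc = subsetD[OF subringE(1)[OF S]]
  note E = poly_span_carrier[OF S t]
  have cc: "c \<in> carrier R" by (rule Sc[OF c])
  have step: "c \<otimes> (t \<otimes> x) \<in> poly_span S t e" if x: "x \<in> poly_span S t e" for x
  proof -
    obtain d where d: "\<And>i. i < e \<Longrightarrow> d i \<in> S" "x = (\<Oplus>i\<in>{..<e}. d i \<otimes> t [^] i)" using x by (auto simp: poly_span_def)
    have "c \<otimes> (t \<otimes> x) = (\<Oplus>i\<in>{..<e}. (c \<otimes> t) \<otimes> (d i \<otimes> t [^] i))"
      unfolding m_assoc[OF cc t subsetD[OF E x], symmetric] unfolding d(2) using d(1) Sc t cc by (intro finsum_rdistr) auto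
    also have "\<dots> \<in> poly_span S t e"
    proof (rule poly_span_sum[OF S t])
      fix i assume "i \<in> {..<e}"
      then have i: "i < e" by simp
      have di: "d i \<in> carrier R" by (rule Sc[OF d(1)[OF i]])
      have eq: "(c \<otimes> t) \<otimes> (d i \<otimes> t [^] i) = d i \<otimes> (c \<otimes> t [^] Suc i)" using di cc t by (simp add: m_ac)
      show "(c \<otimes> t) \<otimes> (d i \<otimes> t [^] i) \<in> poly_span S t e"
      proof (cases "Suc i < e")
        case True
        then show ?thesis unfolding eq by (intro poly_span_smult[OF S t d(1)[OF i]] monom_in_poly_span[OF S t c])
      next
        case False
        then have "Suc i = e" using i by simp
        then show ?thesis unfolding eq using rel poly_span_smult[OF S t d(1)[OF i]] by simp
      qed
    qed simp
    finally show ?thesis .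
  qed
  have pw: "c [^] n \<otimes> t [^] n \<in> poly_span S t e" for n :: nat
  proof (induction n)
    case 0
    then show ?case using monom_in_poly_span[OF S t subringE(3)[OF S], of 0 e] e by simp
  next
    case (Suc n)
    have "c [^] Suc n \<otimes> t [^] Suc n = c \<otimes> (t \<otimes> (c [^] n \<otimes> t [^] n))" using cc t by (simp add: m_ac)
    then show ?case using step[OF Suc] by simp
  qed
  obtain n :: nat and d where d: "\<And>i. i < n \<Longrightarrow> d i \<in> S" "g = (\<Oplus>i\<in>{..<n}. d i \<otimes> t [^] i)"
    using g by (force simp: adjoin_def poly_span_def)
  have "c [^] n \<otimes> g = (\<Oplus>i\<in>{..<n}. c [^] n \<otimes> (d i \<otimes> t [^] i))"
    unfolding d(2) using d(1) Sc t cc by (intro finsum_rdistr) auto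
  also have "\<dots> \<in> poly_span S t e"
  proof (rule poly_span_sum[OF S t])
    fix i assume "i \<in> {..<n}"
    then have i: "i < n" by simp
    have di: "d i \<in> carrier R" by (rule Sc[OF d(1)[OF i]])
    have "c [^] n = c [^] (n - i) \<otimes> c [^] i" using i cc by (simp add: nat_pow_mult)
    then have "c [^] n \<otimes> (d i \<otimes> t [^] i) = (c [^] (n - i) \<otimes> d i) \<otimes> (c [^] i \<otimes> t [^] i)"
      using di cc t by (simp add: m_ac)
    moreover have "c [^] (n - i) \<otimes> d i \<in> S" using c d(1)[OF i] by (intro subringE(6)[OF S] subring_nat_pow[OF S])
    ultimately show "c [^] n \<otimes> (d i \<otimes> t [^] i) \<in> poly_span S t e" using poly_span_smult[OF S t _ pw] by simp
  qed simp
  finally show ?thesis by blast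
qed

lemma subset_adjoin:
  assumes S: "subring S R" and t: "t \<in> carrier R"
  shows "S \<subseteq> adjoin S t" and "t \<in> adjoin S t"
proof -
  note Sc = subsetD[OF subringE(1)[OF S]]
  have "a \<in> adjoin S t" if "a \<in> S" for a
    using monom_in_poly_span[OF S t that, of 0 1] Sc[OF that] unfolding adjoin_def by auto
  then show "S \<subseteq> adjoin S t" by blast
  show "t \<in> adjoin S t"
    using monom_in_poly_span[OF S t subringE(3)[OF S], of 1 2] t unfolding adjoin_def by auto
qed

lemma adjoin_generate_ring:
  assumes H: "H \<subseteq> carrier R" and t: "t \<in> carrier R"
  shows "adjoin (generate_ring R H) t = generate_ring R (insert t H)"
proof
  let ?S = "generate_ring R H" and ?T = "generate_ring R (insert t H)"
  have gen: "insert t H \<subseteq> carrier R" using H t by blast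
  have S: "subring ?S R" by (rule generate_ring_is_subring[OF H])
  have T: "subring ?T R" by (rule generate_ring_is_subring[OF gen])
  have ST: "?S \<subseteq> ?T" by (rule mono_generate_ring[OF _ gen]) auto
  have tT: "t \<in> ?T" by (rule generate_ring.incl) simp
  show "adjoin ?S t \<subseteq> ?T"
  proof
    fix x assume "x \<in> adjoin ?S t"
    then obtain n :: nat and c where c: "\<forall>i<n. c i \<in> ?S" "x = (\<Oplus>i\<in>{..<n}. c i \<otimes> t [^] i)"
      by (force simp: adjoin_def poly_span_def)
    show "x \<in> ?T" unfolding c(2) using c(1) ST
      by (intro subring_finsum[OF T] subringE(6)[OF T] subring_nat_pow[OF T tT]) auto
  qed
  show "?T \<subseteq> adjoin ?S t"
    using subset_adjoin[OF S t] generate_ring.incl[of _ H R]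
    by (intro generate_ring_min_subring1[OF gen subring_adjoin[OF S t]]) auto
qed

text \<open>
  Eliminating one generator \<open>t\<close>. It satisfies a relation over \<open>S\<close>; take one of minimal degree \<open>e\<close> with leading
  coefficient \<open>c\<close>. The powers of any \<open>d \<noteq> 0\<close> then satisfy a relation as well; after cancelling a power of \<open>d\<close>, its constant coefficient is
  a nonzero multiple of \<open>d\<close> in \<open>S\<close>. In particular so has \<open>h\<close> a nonzero multiple in \<open>S\<close>, and \<open>c\<close> times it can serve as the new \<open>h'\<close>: since
  \<open>1, t, \<dots>, t\<^sup>e\<^sup>-\<^sup>1\<close> are independent, divisibility in \<open>S[t]\<close> descends to \<open>S\<close> by comparing constant coefficients.
\<close>

lemma dividing_powers_step:
  assumes S: "subring S R" and t: "t \<in> carrier R" and h: "h \<in> adjoin S t" "h \<noteq> \<zero>"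
    and div: "\<And>d. d \<in> adjoin S t \<Longrightarrow> d \<noteq> \<zero> \<Longrightarrow> \<exists>k::nat. \<exists>g\<in>adjoin S t. h [^] k = d \<otimes> g"
  shows "\<exists>h'\<in>S. h' \<noteq> \<zero> \<and> (\<forall>d\<in>S. d \<noteq> \<zero> \<longrightarrow> (\<exists>k::nat. \<exists>g\<in>S. h' [^] k = d \<otimes> g))"
    and "\<And>d. d \<in> adjoin S t \<Longrightarrow> d \<noteq> \<zero> \<Longrightarrow> \<exists>g\<in>adjoin S t. d \<otimes> g \<in> S \<and> d \<otimes> g \<noteq> \<zero>"
proof -
  note Sc = subsetD[OF subringE(1)[OF S]]
  let ?T = "adjoin S t"
  have T: "subring ?T R" by (rule subring_adjoin[OF S t])
  note Tc = subsetD[OF subringE(1)[OF T]]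
  have ST: "S \<subseteq> ?T" by (rule subset_adjoin(1)[OF S t])
  define rel where "rel n \<longleftrightarrow> (\<exists>c. (\<forall>i<n. c i \<in> S) \<and> (\<Oplus>i\<in>{..<n}. c i \<otimes> t [^] i) = \<zero> \<and> (\<exists>i<n. c i \<noteq> \<zero>))" for n :: nat
  have "\<exists>n. rel n" unfolding rel_def by (rule algebraic_if_dividing_powers[OF S t h]) (rule div)
  define m where "m = (LEAST n. rel n)"
  have m: "rel m" using LeastI_ex[of rel] \<open>\<exists>n. rel n\<close> by (simp add: m_def)
  have min: "\<not> rel n" if "n < m" for n using that unfolding m_def by (rule not_less_Least)
  obtain c where c: "\<And>i. i < m \<Longrightarrow> c i \<in> S" "(\<Oplus>i\<in>{..<m}. c i \<otimes> t [^] i) = \<zero>" "\<exists>i<m. c i \<noteq> \<zero>"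
    using m unfolding rel_def by blast
  obtain e where e: "m = Suc e" using c(3) by (cases m) auto
  have ce: "c e \<in> S" using c(1) e by simp
  have sum: "(\<Oplus>i\<in>{..<m}. c i \<otimes> t [^] i) = c e \<otimes> t [^] e \<oplus> (\<Oplus>i\<in>{..<e}. c i \<otimes> t [^] i)"
    unfolding e lessThan_Suc using c(1) Sc t e by (subst finsum_insert) auto
  have ce0: "c e \<noteq> \<zero>"
  proof
    assume z: "c e = \<zero>"
    have "(\<Oplus>i\<in>{..<e}. c i \<otimes> t [^] i) \<in> carrier R" using c(1) Sc t e by (intro finsum_closed) auto
    then have "(\<Oplus>i\<in>{..<e}. c i \<otimes> t [^] i) = \<zero>" using sum c(2) z t by simp
    moreover have "\<exists>i<e. c i \<noteq> \<zero>" using c(3) z e less_Suc_eq by auto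
    ultimately have "rel e" unfolding rel_def using c(1) e less_SucI by blast
    then show False using min[of e] e by simp
  qed
  have e1: "e \<ge> 1"
  proof (rule ccontr)
    assume "\<not> e \<ge> 1"
    then have "e = 0" by simp
    then have "c e = \<zero>" using sum c(2) Sc[OF ce] by simp
    then show False using ce0 by simp
  qed
  have indep: "d i = \<zero>" if "\<And>i. i < e \<Longrightarrow> d i \<in> S" "(\<Oplus>i\<in>{..<e}. d i \<otimes> t [^] i) = \<zero>" "i < e" for d i
    using min[of e] e that unfolding rel_def by blast
  have "c e \<otimes> t [^] e = (\<Oplus>i\<in>{..<e}. (\<ominus> c i) \<otimes> t [^] i)"
  proof -
    have s: "(\<Oplus>i\<in>{..<e}. c i \<otimes> t [^] i) \<in> carrier R" using c(1) Sc t e by (intro finsum_closed) auto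
    have "(\<Oplus>i\<in>{..<e}. (\<ominus> c i) \<otimes> t [^] i) = (\<Oplus>i\<in>{..<e}. (\<ominus> \<one>) \<otimes> (c i \<otimes> t [^] i))"
      using c(1) Sc t e by (intro finsum_cong') (auto simp: l_minus)
    also have "\<dots> = \<ominus> (\<Oplus>i\<in>{..<e}. c i \<otimes> t [^] i)"
      using c(1) Sc t e s by (subst finsum_rdistr[symmetric]) (auto simp: l_minus)
    finally show ?thesis using sum c(2) s Sc[OF ce] t by (metis m_closed nat_pow_closed minus_equality)
  qed
  then have rl: "c e \<otimes> t [^] e \<in> poly_span S t e"
    by (rule poly_spanI[rotated]) (intro subringE(5)[OF S] c(1), simp add: e)
  note clear = adjoin_into_span[OF S t ce e1 rl]
  have ck: "c e [^] (l::nat) \<in> S - {\<zero>}" for l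
    using subring_nat_pow[OF S ce] nat_pow_nonzero[OF Sc[OF ce] ce0] by simp
  show mult: "\<exists>g\<in>?T. d \<otimes> g \<in> S \<and> d \<otimes> g \<noteq> \<zero>" if d: "d \<in> ?T" "d \<noteq> \<zero>" for d
  proof -
    have dc: "d \<in> carrier R" by (rule Tc[OF d(1)])
    have "\<exists>a. (\<forall>i\<in>{..e}. a i \<in> S) \<and> (\<exists>i\<in>{..e}. a i \<noteq> \<zero>) \<and> (\<Oplus>i\<in>{..e}. a i \<otimes> d [^] i) = \<zero>"
    proof (rule poly_span_dependence[OF S t, of "{..e}" e])
      fix i :: nat
      show "\<exists>b\<in>S - {\<zero>}. b \<otimes> d [^] i \<in> poly_span S t e"
        using clear[OF subring_nat_pow[OF T d(1)], of i] ck by blast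
    qed (use dc in auto)
    then obtain a where a: "\<And>i. i \<le> e \<Longrightarrow> a i \<in> S" "\<exists>i\<le>e. a i \<noteq> \<zero>" "(\<Oplus>i\<in>{..e}. a i \<otimes> d [^] i) = \<zero>" by auto
    define r where "r = (LEAST i. i \<le> e \<and> a i \<noteq> \<zero>)"
    have r: "r \<le> e" "a r \<noteq> \<zero>" using LeastI_ex[OF a(2)] unfolding r_def by auto
    have r': "a i = \<zero>" if "i < r" for i
      using not_less_Least[of i "\<lambda>i. i \<le> e \<and> a i \<noteq> \<zero>"] that r(1) unfolding r_def by auto
    have ac: "a i \<in> carrier R" if "i \<le> e" for i using Sc[OF a(1)[OF that]] .
    define y where "y = (\<Oplus>i\<in>{r<..e}. a i \<otimes> d [^] (i - Suc r))"
    have yT: "y \<in> ?T" unfolding y_def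
      using a(1) ST by (intro subring_finsum[OF T] subringE(6)[OF T] subring_nat_pow[OF T] d(1)) auto
    have "(\<Oplus>i\<in>{..e}. a i \<otimes> d [^] i) = (\<Oplus>i\<in>insert r {r<..e}. a i \<otimes> d [^] i)"
      using r r' ac dc by (intro add.finprod_mono_neutral_cong_right) (auto simp: not_le)
    also have "\<dots> = a r \<otimes> d [^] r \<oplus> (\<Oplus>i\<in>{r<..e}. a i \<otimes> d [^] i)"
      using r ac dc by (intro finsum_insert) auto
    also have "(\<Oplus>i\<in>{r<..e}. a i \<otimes> d [^] i) = (\<Oplus>i\<in>{r<..e}. d [^] Suc r \<otimes> (a i \<otimes> d [^] (i - Suc r)))"
    proof (rule finsum_cong')
      fix i assume i: "i \<in> {r<..e}"
      then have "Suc r + (i - Suc r) = i" by auto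
      then have "d [^] i = d [^] Suc r \<otimes> d [^] (i - Suc r)" using nat_pow_mult[OF dc, of "Suc r" "i - Suc r"] by simp
      then show "a i \<otimes> d [^] i = d [^] Suc r \<otimes> (a i \<otimes> d [^] (i - Suc r))"
        using i ac[of i] dc by (simp add: m_lcomm del: nat_pow_Suc)
    qed (use ac dc in auto)
    also have "\<dots> = d [^] Suc r \<otimes> y"
      unfolding y_def using ac dc by (intro finsum_rdistr[symmetric]) auto
    finally have "d [^] r \<otimes> (a r \<oplus> d \<otimes> y) = \<zero>"
      using a(3) ac[OF r(1)] dc Tc[OF yT] by (simp add: r_distr m_ac)
    then have "a r \<oplus> d \<otimes> y = \<zero>"
      using integral_iff[of "d [^] r"] nat_pow_nonzero[OF dc d(2), of r] ac[OF r(1)] dc Tc[OF yT] by simp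
    then have "d \<otimes> (\<ominus> y) = a r"
      using ac[OF r(1)] dc Tc[OF yT] by (simp add: r_minus) (metis m_closed minus_equality)
    then show ?thesis using r a(1)[OF r(1)] yT subringE(5)[OF T] by (intro bexI[of _ "\<ominus> y"]) auto
  qed
  obtain g where g: "g \<in> ?T" "h \<otimes> g \<in> S" "h \<otimes> g \<noteq> \<zero>" using mult[OF h] by blast
  \<comment> \<open>The factor \<open>c e\<close> clears the denominators that arise from reducing to degree below \<open>e\<close>.\<close>
  define h' where "h' = c e \<otimes> (h \<otimes> g)"
  have hc: "h \<in> carrier R" and gc: "g \<in> carrier R" using Tc h(1) g(1) by auto
  have h'S: "h' \<in> S" unfolding h'_def by (rule subringE(6)[OF S ce g(2)])
  have h'0: "h' \<noteq> \<zero>" unfolding h'_def using ce0 g Sc ce by (simp add: integral_iff)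
  have "\<exists>k::nat. \<exists>b\<in>S. h' [^] k = d \<otimes> b" if d: "d \<in> S" "d \<noteq> \<zero>" for d
  proof -
    have dc: "d \<in> carrier R" by (rule Sc[OF d(1)])
    obtain k b where kb: "b \<in> ?T" "h [^] (k::nat) = d \<otimes> b" using div[of d] d ST by blast
    have bc: "b \<in> carrier R" by (rule Tc[OF kb(1)])
    let ?b = "b \<otimes> g [^] k"
    have bT: "?b \<in> ?T" by (intro subringE(6)[OF T kb(1)] subring_nat_pow[OF T g(1)])
    obtain l where l: "c e [^] (l::nat) \<otimes> ?b \<in> poly_span S t e" using clear[OF bT] by blast
    then obtain f where f: "\<And>i. i < e \<Longrightarrow> f i \<in> S" "c e [^] l \<otimes> ?b = (\<Oplus>i\<in>{..<e}. f i \<otimes> t [^] i)"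
      unfolding poly_span_def by blast
    have fc: "f i \<in> carrier R" if "i < e" for i by (rule Sc[OF f(1)[OF that]])
    define a where "a = c e [^] l \<otimes> (h \<otimes> g) [^] k"
    have aS: "a \<in> S" unfolding a_def by (intro subringE(6)[OF S] subring_nat_pow[OF S] ce g(2))
    have "a = d \<otimes> (c e [^] l \<otimes> ?b)"
      unfolding a_def using hc gc dc bc Sc[OF ce] kb(2) by (simp add: nat_pow_distrib m_ac)
    also have "\<dots> = (\<Oplus>i\<in>{..<e}. d \<otimes> (f i \<otimes> t [^] i))"
      unfolding f(2) using fc dc t by (intro finsum_rdistr) auto
    finally have a: "a = (\<Oplus>i\<in>{..<e}. d \<otimes> (f i \<otimes> t [^] i))" .
    let ?u = "\<lambda>i. (if i = 0 then a else \<zero>) \<ominus> d \<otimes> f i"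
    have uS: "?u i \<in> S" if "i < e" for i
      unfolding a_minus_def using that aS d f(1) subringE(2)[OF S] by (intro subringE(5-7)[OF S]) auto
    have "(\<Oplus>i\<in>{..<e}. ?u i \<otimes> t [^] i) = (\<Oplus>i\<in>{..<e}. (if 0 = i then a else \<zero>) \<oplus> (\<ominus> \<one>) \<otimes> (d \<otimes> (f i \<otimes> t [^] i)))"
      using fc dc t Sc[OF aS] by (intro finsum_cong') (auto simp: a_minus_def l_distr l_minus m_assoc)
    also have "\<dots> = (\<Oplus>i\<in>{..<e}. if 0 = i then a else \<zero>) \<oplus> (\<Oplus>i\<in>{..<e}. (\<ominus> \<one>) \<otimes> (d \<otimes> (f i \<otimes> t [^] i)))"
      using fc dc t Sc[OF aS] by (intro finsum_addf) auto
    also have "(\<Oplus>i\<in>{..<e}. if 0 = i then a else \<zero>) = a"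
      using e1 Sc[OF aS] finsum_singleton[of 0 "{..<e}" "\<lambda>_. a"] by simp
    also have "(\<Oplus>i\<in>{..<e}. (\<ominus> \<one>) \<otimes> (d \<otimes> (f i \<otimes> t [^] i))) = (\<ominus> \<one>) \<otimes> a"
      unfolding a using fc dc t by (intro finsum_rdistr[symmetric]) auto
    finally have "(\<Oplus>i\<in>{..<e}. ?u i \<otimes> t [^] i) = \<zero>" using Sc[OF aS] by (simp add: l_minus r_neg)
    then have "?u 0 = \<zero>" using indep[of ?u 0] uS e1 by simp
    then have ad: "a = d \<otimes> f 0" using Sc[OF aS] dc fc[of 0] e1 by (simp add: r_right_minus_eq)
    have hg: "h \<otimes> g \<in> carrier R" using hc gc by simp
    have "h' [^] (l + k) = (c e [^] l \<otimes> (h \<otimes> g) [^] k) \<otimes> (c e [^] k \<otimes> (h \<otimes> g) [^] l)"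
      unfolding h'_def nat_pow_distrib[OF Sc[OF ce] hg] using hg Sc[OF ce]
      by (simp add: nat_pow_mult[symmetric] m_ac)
    also have "\<dots> = d \<otimes> (f 0 \<otimes> (c e [^] k \<otimes> (h \<otimes> g) [^] l))"
      unfolding a_def[symmetric] ad using dc fc[of 0] e1 hg Sc[OF ce] by (simp add: m_assoc)
    finally have "h' [^] (l + k) = d \<otimes> (f 0 \<otimes> (c e [^] k \<otimes> (h \<otimes> g) [^] l))" .
    moreover have "f 0 \<otimes> (c e [^] k \<otimes> (h \<otimes> g) [^] l) \<in> S"
      using f(1)[of 0] e1 by (intro subringE(6)[OF S] subring_nat_pow[OF S] ce g(2)) simp
    ultimately show ?thesis by blast
  qed
  then show "\<exists>h'\<in>S. h' \<noteq> \<zero> \<and> (\<forall>d\<in>S. d \<noteq> \<zero> \<longrightarrow> (\<exists>k::nat. \<exists>g\<in>S. h' [^] k = d \<otimes> g))"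
    using h'S h'0 by blast
qed

text \<open>
  Induction over the generators down to the field \<open>k\<close>: an element has a nonzero multiple in the smaller ring,
  which is invertible there.
\<close>

lemma generated_field_if_dividing_powers:
  assumes k: "subring k R" and kf: "\<And>a. a \<in> k \<Longrightarrow> a \<noteq> \<zero> \<Longrightarrow> \<exists>b\<in>k. a \<otimes> b = \<one>"
    and ts: "set ts \<subseteq> carrier R"
    and h: "h \<in> generate_ring R (k \<union> set ts)" "h \<noteq> \<zero>"
    and div: "\<And>d. d \<in> generate_ring R (k \<union> set ts) \<Longrightarrow> d \<noteq> \<zero> \<Longrightarrow>
       \<exists>l::nat. \<exists>g\<in>generate_ring R (k \<union> set ts). h [^] l = d \<otimes> g"
    and d: "d \<in> generate_ring R (k \<union> set ts)" "d \<noteq> \<zero>"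
  shows "\<exists>g\<in>generate_ring R (k \<union> set ts). d \<otimes> g = \<one>"
  using ts h div d
proof (induction ts arbitrary: h d)
  case Nil
  have kc: "k \<subseteq> carrier R" by (rule subringE(1)[OF k])
  have "generate_ring R k = k" using generate_ring_min_subring1[OF kc k] generate_ring.incl[of _ k R] by blast
  then show ?case using Nil kf by simp
next
  case (Cons t ts)
  have kc: "k \<subseteq> carrier R" by (rule subringE(1)[OF k])
  let ?S = "generate_ring R (k \<union> set ts)" and ?T = "generate_ring R (k \<union> set (t # ts))"
  have t: "t \<in> carrier R" and ts: "set ts \<subseteq> carrier R" using Cons.prems(1) by auto
  have gen: "k \<union> set ts \<subseteq> carrier R" "k \<union> set (t # ts) \<subseteq> carrier R" using kc Cons.prems(1) by auto
  have S: "subring ?S R" by (rule generate_ring_is_subring[OF gen(1)])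
  have T: "subring ?T R" by (rule generate_ring_is_subring[OF gen(2)])
  note Sc = subsetD[OF subringE(1)[OF S]]
  have ST: "?S \<subseteq> ?T" by (rule mono_generate_ring[OF _ gen(2)]) auto
  have adj: "adjoin ?S t = ?T" using adjoin_generate_ring[OF gen(1) t] by simp
  note step = dividing_powers_step[OF S t, unfolded adj, OF Cons.prems(2,3)]
  obtain h' where h': "h' \<in> ?S" "h' \<noteq> \<zero>" "\<And>d. d \<in> ?S \<Longrightarrow> d \<noteq> \<zero> \<Longrightarrow> \<exists>k::nat. \<exists>g\<in>?S. h' [^] k = d \<otimes> g"
    using step(1)[OF Cons.prems(4)] by blast
  obtain g where g: "g \<in> ?T" "d \<otimes> g \<in> ?S" "d \<otimes> g \<noteq> \<zero>" using step(2)[OF Cons.prems(4) Cons.prems(5,6)] by blast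
  obtain b where b: "b \<in> ?S" "(d \<otimes> g) \<otimes> b = \<one>" using Cons.IH[OF ts h'(1,2) _ g(2,3)] h'(3) by blast
  have "d \<otimes> (g \<otimes> b) = \<one>"
    using b Cons.prems(5) g(1) subringE(1)[OF T] Sc by (metis m_assoc subsetD)
  moreover have "g \<otimes> b \<in> ?T" using g(1) b(1) ST subringE(6)[OF T] by blast
  ultimately show ?case by blast
qed

end

section \<open>Closed points are dense\<close>

lemma scalars_subring:
  assumes "algebra K R"
  shows "subring ((\<lambda>c. c \<odot>\<^bsub>R\<^esub> \<one>\<^bsub>R\<^esub>) ` carrier K) R"
proof -
  interpret algebra K R by fact
  show ?thesis
  proof (rule ring.subringI)
    show "ring R" ..
    show "\<one>\<^bsub>R\<^esub> \<in> (\<lambda>c. c \<odot>\<^bsub>R\<^esub> \<one>\<^bsub>R\<^esub>) ` carrier K" by (intro image_eqI[of _ _ "\<one>\<^bsub>K\<^esub>"]) auto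
    fix x y assume "x \<in> (\<lambda>c. c \<odot>\<^bsub>R\<^esub> \<one>\<^bsub>R\<^esub>) ` carrier K"
    then obtain c where c: "c \<in> carrier K" "x = c \<odot>\<^bsub>R\<^esub> \<one>\<^bsub>R\<^esub>" by blast
    show "\<ominus>\<^bsub>R\<^esub> x \<in> (\<lambda>c. c \<odot>\<^bsub>R\<^esub> \<one>\<^bsub>R\<^esub>) ` carrier K"
      using c by (intro image_eqI[of _ _ "\<ominus>\<^bsub>K\<^esub> c"]) (auto simp: smult_l_minus)
    assume "y \<in> (\<lambda>c. c \<odot>\<^bsub>R\<^esub> \<one>\<^bsub>R\<^esub>) ` carrier K"
    then obtain d where d: "d \<in> carrier K" "y = d \<odot>\<^bsub>R\<^esub> \<one>\<^bsub>R\<^esub>" by blast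
    show "x \<otimes>\<^bsub>R\<^esub> y \<in> (\<lambda>c. c \<odot>\<^bsub>R\<^esub> \<one>\<^bsub>R\<^esub>) ` carrier K"
      using c d by (intro image_eqI[of _ _ "c \<otimes>\<^bsub>K\<^esub> d"]) (auto simp: smult_assoc2 smult_assoc1)
    show "x \<oplus>\<^bsub>R\<^esub> y \<in> (\<lambda>c. c \<odot>\<^bsub>R\<^esub> \<one>\<^bsub>R\<^esub>) ` carrier K"
      using c d by (intro image_eqI[of _ _ "c \<oplus>\<^bsub>K\<^esub> d"]) (auto simp: smult_l_distr)
  qed auto
qed

lemma (in ring_hom_ring) image_generate_ring:
  assumes "H \<subseteq> carrier R" "x \<in> generate_ring R H"
  shows "h x \<in> generate_ring S (h ` H)"
  using assms(2)
proof (induction rule: generate_ring.induct)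
  case (a_inv x)
  then show ?case using R.generate_ring_in_carrier[OF assms(1)] by (auto intro: generate_ring.a_inv)
next
  case (eng_add x y)
  then show ?case using R.generate_ring_in_carrier[OF assms(1)] by (auto intro: generate_ring.eng_add)
next
  case (eng_mult x y)
  then show ?case using R.generate_ring_in_carrier[OF assms(1)] by (auto intro: generate_ring.eng_mult)
qed (auto intro: generate_ring.intros)

text \<open>
  An ideal \<open>P\<close> that is maximal among those containing no power of \<open>h\<close> is prime, and in \<open>R/P\<close> every
  nonzero element divides a power of \<open>h\<close>.  As \<open>R/P\<close> is finitely generated over a field, it is then
  itself a field.
\<close>

lemma (in domain) exists_primeideal_avoiding:
  assumes h: "h \<in> carrier R" "h \<noteq> \<zero>"
  shows "\<exists>P. primeideal P R \<and> h \<notin> P \<and>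
    (\<forall>a\<in>carrier R - P. \<exists>(k::nat). \<exists>x\<in>P. \<exists>r\<in>carrier R. h [^] k = x \<oplus> r \<otimes> a)"
proof -
  define \<A> where "\<A> = {I. ideal I R \<and> (\<forall>n::nat. h [^]\<^bsub>R\<^esub> n \<notin> I)}"
  have "\<exists>P\<in>\<A>. \<forall>I\<in>\<A>. P \<subseteq> I \<longrightarrow> I = P"
  proof (rule subset_Zorn_nonempty)
    have "{\<zero>\<^bsub>R\<^esub>} \<in> \<A>" using zeroideal nat_pow_nonzero[OF h] by (auto simp: \<A>_def)
    then show "\<A> \<noteq> {}" by blast
    fix C assume C: "C \<noteq> {}" "subset.chain \<A> C"
    have CA: "C \<subseteq> \<A>" using C(2) unfolding pred_on.chain_def by auto
    have "subset.chain {I. ideal I R} C"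
      using C(2) unfolding pred_on.chain_def \<A>_def by auto
    then have "ideal (\<Union>C) R" using chain_Union_is_ideal[of C] C(1) by auto
    then show "\<Union>C \<in> \<A>" using CA by (auto simp: \<A>_def)
  qed
  then obtain P where P: "P \<in> \<A>" "\<And>I. I \<in> \<A> \<Longrightarrow> P \<subseteq> I \<Longrightarrow> I = P" by blast
  then have idl: "ideal P R" and hP: "\<And>n::nat. h [^]\<^bsub>R\<^esub> n \<notin> P" by (auto simp: \<A>_def)
  interpret ideal P R by (rule idl)
  have div: "\<exists>(k::nat) x r. x \<in> P \<and> r \<in> carrier R \<and> h [^]\<^bsub>R\<^esub> k = x \<oplus>\<^bsub>R\<^esub> r \<otimes>\<^bsub>R\<^esub> a"
    if a: "a \<in> carrier R" "a \<notin> P" for a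
  proof -
    let ?J = "P <+>\<^bsub>R\<^esub> PIdl\<^bsub>R\<^esub> a"
    have J: "ideal ?J R" by (rule add_ideals[OF idl cgenideal_ideal[OF a(1)]])
    have J_iff: "y \<in> ?J \<longleftrightarrow> (\<exists>x\<in>P. \<exists>r\<in>carrier R. y = x \<oplus>\<^bsub>R\<^esub> r \<otimes>\<^bsub>R\<^esub> a)" for y
      unfolding set_add_def' cgenideal_def by blast
    have "P \<subseteq> ?J"
    proof
      fix x assume x: "x \<in> P"
      then have "x = x \<oplus>\<^bsub>R\<^esub> \<zero>\<^bsub>R\<^esub> \<otimes>\<^bsub>R\<^esub> a" using a Icarr by simp
      then show "x \<in> ?J" unfolding J_iff using x zero_closed by blast
    qed
    moreover have "a \<in> ?J"
    proof -
      have "a = \<zero>\<^bsub>R\<^esub> \<oplus>\<^bsub>R\<^esub> \<one>\<^bsub>R\<^esub> \<otimes>\<^bsub>R\<^esub> a" using a by simp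
      then show ?thesis unfolding J_iff using additive_subgroup.zero_closed[OF additive_subgroup_axioms] one_closed by blast
    qed
    ultimately have "?J \<notin> \<A>" using P(2)[of ?J] a by blast
    then show ?thesis using J unfolding \<A>_def by (auto simp: J_iff)
  qed
  have "h [^]\<^bsub>R\<^esub> (0::nat) \<notin> P" by (rule hP)
  then have one: "\<one>\<^bsub>R\<^esub> \<notin> P" by simp
  then have PR: "carrier R \<noteq> P" using one_closed by metis
  have prime: "primeideal P R"
  proof (rule primeidealI[OF idl is_cring PR])
    fix a b assume ab: "a \<in> carrier R" "b \<in> carrier R" "a \<otimes>\<^bsub>R\<^esub> b \<in> P"
    show "a \<in> P \<or> b \<in> P"
    proof (rule ccontr)
      assume "\<not> ?thesis"
      then obtain k l :: nat and x r y s where kl: "x \<in> P" "r \<in> carrier R" "h [^]\<^bsub>R\<^esub> k = x \<oplus>\<^bsub>R\<^esub> r \<otimes>\<^bsub>R\<^esub> a"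
        "y \<in> P" "s \<in> carrier R" "h [^]\<^bsub>R\<^esub> l = y \<oplus>\<^bsub>R\<^esub> s \<otimes>\<^bsub>R\<^esub> b"
        using div[OF ab(1)] div[OF ab(2)] by metis
      have c: "x \<in> carrier R" "y \<in> carrier R" using kl Icarr by auto
      have "h [^]\<^bsub>R\<^esub> (k + l) = (x \<oplus>\<^bsub>R\<^esub> r \<otimes>\<^bsub>R\<^esub> a) \<otimes>\<^bsub>R\<^esub> (y \<oplus>\<^bsub>R\<^esub> s \<otimes>\<^bsub>R\<^esub> b)"
        using kl(3,6) h by (simp add: nat_pow_mult[symmetric])
      also have "\<dots> = x \<otimes>\<^bsub>R\<^esub> (y \<oplus>\<^bsub>R\<^esub> s \<otimes>\<^bsub>R\<^esub> b) \<oplus>\<^bsub>R\<^esub> (r \<otimes>\<^bsub>R\<^esub> a \<otimes>\<^bsub>R\<^esub> y \<oplus>\<^bsub>R\<^esub> (r \<otimes>\<^bsub>R\<^esub> s) \<otimes>\<^bsub>R\<^esub> (a \<otimes>\<^bsub>R\<^esub> b))"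
        using kl c ab by (simp add: l_distr r_distr m_ac a_ac)
      also have "\<dots> \<in> P"
        by (intro additive_subgroup.a_closed[OF additive_subgroup_axioms] I_r_closed[OF kl(1)] I_l_closed[OF kl(4)]
            I_l_closed[OF ab(3)]) (use kl c ab in auto)
      finally show False using hP by simp
    qed
  qed
  have "h \<notin> P" using hP[of 1] h by simp
  moreover have "\<forall>a\<in>carrier R - P. \<exists>(k::nat). \<exists>x\<in>P. \<exists>r\<in>carrier R. h [^] k = x \<oplus> r \<otimes> a"
  proof
    fix a assume "a \<in> carrier R - P"
    then obtain k :: nat and x r where "x \<in> P" "r \<in> carrier R" "h [^] k = x \<oplus> r \<otimes> a"
      using div[of a] by auto
    then show "\<exists>(k::nat). \<exists>x\<in>P. \<exists>r\<in>carrier R. h [^] k = x \<oplus> r \<otimes> a" by (intro exI bexI)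
  qed
  ultimately show ?thesis using prime by (intro exI conjI)
qed

lemma quotient_field_if_dividing_powers:
  assumes fg: "fg_algebra K R" and K: "field K" and hom: "ring_hom_ring R D \<pi>" and dom: "domain D"
    and surj: "\<And>d. d \<in> carrier D \<Longrightarrow> \<exists>a\<in>carrier R. d = \<pi> a"
    and h: "h \<in> carrier D" "h \<noteq> \<zero>\<^bsub>D\<^esub>"
    and div: "\<And>d. d \<in> carrier D \<Longrightarrow> d \<noteq> \<zero>\<^bsub>D\<^esub> \<Longrightarrow> \<exists>l::nat. \<exists>g\<in>carrier D. h [^]\<^bsub>D\<^esub> l = d \<otimes>\<^bsub>D\<^esub> g"
    and d: "d \<in> carrier D" "d \<noteq> \<zero>\<^bsub>D\<^esub>"
  shows "\<exists>g\<in>carrier D. d \<otimes>\<^bsub>D\<^esub> g = \<one>\<^bsub>D\<^esub>"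
proof -
  interpret D: domain D by fact
  interpret \<pi>: ring_hom_ring R D \<pi> by fact
  interpret alg: algebra K R using fg by (simp add: fg_algebra_def)
  let ?D = D and ?\<pi> = \<pi>
  let ?K1 = "(\<lambda>c. c \<odot>\<^bsub>R\<^esub> \<one>\<^bsub>R\<^esub>) ` carrier K"
  obtain S where S: "finite S" "S \<subseteq> carrier R" "generate_ring R (?K1 \<union> S) = carrier R"
    using fg by (auto simp: fg_algebra_def)
  have gen: "generate_ring ?D (?\<pi> ` (?K1 \<union> S)) = carrier ?D"
  proof
    have sub: "?K1 \<union> S \<subseteq> carrier R" using S(2) by auto
    have "?\<pi> ` (?K1 \<union> S) \<subseteq> carrier ?D" using sub by auto
    then show "generate_ring ?D (?\<pi> ` (?K1 \<union> S)) \<subseteq> carrier ?D" by (rule D.generate_ring_incl)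
    show "carrier ?D \<subseteq> generate_ring ?D (?\<pi> ` (?K1 \<union> S))"
      using surj \<pi>.image_generate_ring[OF sub] S(3) by blast
  qed
  obtain ts where ts: "set ts = ?\<pi> ` S" using S(1) finite_list[of "?\<pi> ` S"] by auto
  have gen': "generate_ring ?D (?\<pi> ` ?K1 \<union> set ts) = carrier ?D" using gen ts by (simp add: image_Un)
  note gf = D.generated_field_if_dividing_powers[of "?\<pi> ` ?K1" ts, unfolded gen']
  show ?thesis
    proof (rule gf[where h = h])
      show "subring (?\<pi> ` ?K1) ?D" by (rule \<pi>.img_is_subring[OF scalars_subring]) unfold_locales
      show "set ts \<subseteq> carrier ?D" using ts S(2) by auto
      show "h \<in> carrier ?D" "h \<noteq> \<zero>\<^bsub>?D\<^esub>" by fact+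
      show "\<exists>b\<in>?\<pi> ` ?K1. a \<otimes>\<^bsub>?D\<^esub> b = \<one>\<^bsub>?D\<^esub>" if a: "a \<in> ?\<pi> ` ?K1" "a \<noteq> \<zero>\<^bsub>?D\<^esub>" for a
      proof -
        interpret K: field K by fact
        obtain c where c: "c \<in> carrier K" "a = ?\<pi> (c \<odot>\<^bsub>R\<^esub> \<one>\<^bsub>R\<^esub>)" using a(1) by (elim imageE) simp
        have "c \<noteq> \<zero>\<^bsub>K\<^esub>" using a c by auto
        then have u: "c \<in> Units K" using c K.field_Units by blast
        let ?i = "inv\<^bsub>K\<^esub> c"
        have i: "?i \<in> carrier K" "c \<otimes>\<^bsub>K\<^esub> ?i = \<one>\<^bsub>K\<^esub>" using u by auto
        have "(c \<odot>\<^bsub>R\<^esub> \<one>\<^bsub>R\<^esub>) \<otimes>\<^bsub>R\<^esub> (?i \<odot>\<^bsub>R\<^esub> \<one>\<^bsub>R\<^esub>) = (c \<otimes>\<^bsub>K\<^esub> ?i) \<odot>\<^bsub>R\<^esub> \<one>\<^bsub>R\<^esub>"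
          using c i(1) by (simp add: alg.smult_assoc2 alg.smult_assoc1)
        also have "\<dots> = \<one>\<^bsub>R\<^esub>" using i(2) by simp
        finally have "a \<otimes>\<^bsub>?D\<^esub> ?\<pi> (?i \<odot>\<^bsub>R\<^esub> \<one>\<^bsub>R\<^esub>) = \<one>\<^bsub>?D\<^esub>"
          unfolding c(2) using c i by (subst \<pi>.hom_mult[symmetric]) auto
        then show ?thesis using i(1) by blast
      qed
      show "\<exists>l::nat. \<exists>g\<in>carrier ?D. h [^]\<^bsub>?D\<^esub> l = a \<otimes>\<^bsub>?D\<^esub> g" if a: "a \<in> carrier ?D" "a \<noteq> \<zero>\<^bsub>?D\<^esub>" for a
        by (rule div[OF a])
    qed (use d in auto)
qed

text \<open>
  The prime ideal found above is maximal, as its quotient is a field.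
\<close>

theorem exists_maximalideal_avoiding:
  assumes fg: "fg_algebra K R" and K: "field K" and dom: "domain R"
    and h: "h \<in> carrier R" "h \<noteq> \<zero>\<^bsub>R\<^esub>"
  shows "\<exists>M. maximalideal M R \<and> h \<notin> M"
proof -
  interpret domain R by fact
  obtain P where prime: "primeideal P R" and hP: "h \<notin> P"
    and div: "\<And>a. a \<in> carrier R \<Longrightarrow> a \<notin> P \<Longrightarrow> \<exists>(k::nat). \<exists>x\<in>P. \<exists>r\<in>carrier R. h [^]\<^bsub>R\<^esub> k = x \<oplus>\<^bsub>R\<^esub> r \<otimes>\<^bsub>R\<^esub> a"
    using exists_primeideal_avoiding[OF h] by blast
  have idl: "ideal P R" by (rule primeideal.axioms(1)[OF prime])
  have PR: "carrier R \<noteq> P" using h hP by blast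
  obtain D \<pi> where D: "D = R Quot P" and \<pi>: "\<pi> = (\<lambda>a. P +>\<^bsub>R\<^esub> a)" by blast
  have dD: "domain D" unfolding D by (rule primeideal.quotient_is_domain[OF prime])
  have hom: "ring_hom_ring R D \<pi>" unfolding D \<pi> by (rule ideal.rcos_ring_hom_ring[OF idl])
  have surj: "\<exists>a\<in>carrier R. d = \<pi> a" if "d \<in> carrier D" for d
    using that by (simp add: D \<pi> FactRing_def A_RCOSETS_def')
  have zero: "\<pi> a = \<zero>\<^bsub>D\<^esub> \<longleftrightarrow> a \<in> P" if a: "a \<in> carrier R" for a
    using ideal.rcos_const_imp_mem[OF idl a] abelian_subgroup.a_rcos_const[OF abelian_subgroupI3[OF ideal.axioms(1)[OF idl]], of a]
    by (auto simp: D \<pi> FactRing_def is_abelian_group)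
  interpret D: domain D by (rule dD)
  interpret \<pi>: ring_hom_ring R D \<pi> by (rule hom)
  have inv: "\<exists>g\<in>carrier D. d \<otimes>\<^bsub>D\<^esub> g = \<one>\<^bsub>D\<^esub>" if d: "d \<in> carrier D" "d \<noteq> \<zero>\<^bsub>D\<^esub>" for d
  proof (rule quotient_field_if_dividing_powers[OF fg K hom dD surj _ _ _ d])
    show "\<pi> h \<in> carrier D" using h by simp
    show "\<pi> h \<noteq> \<zero>\<^bsub>D\<^esub>" using zero h hP by blast
    fix a assume a: "a \<in> carrier D" "a \<noteq> \<zero>\<^bsub>D\<^esub>"
    obtain b where b: "b \<in> carrier R" "a = \<pi> b" using surj a by blast
    then have "b \<notin> P" using zero a by blast
    then obtain k :: nat and x r where kx: "x \<in> P" "r \<in> carrier R" "h [^]\<^bsub>R\<^esub> k = x \<oplus>\<^bsub>R\<^esub> r \<otimes>\<^bsub>R\<^esub> b"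
      using div b by blast
    have x: "x \<in> carrier R" using kx ideal.Icarr[OF idl] by simp
    have "\<pi> h [^]\<^bsub>D\<^esub> k = \<pi> (h [^]\<^bsub>R\<^esub> k)" using h by (simp add: \<pi>.hom_nat_pow)
    also have "\<dots> = \<pi> x \<oplus>\<^bsub>D\<^esub> \<pi> r \<otimes>\<^bsub>D\<^esub> \<pi> b" unfolding kx(3) using x kx b by simp
    also have "\<dots> = a \<otimes>\<^bsub>D\<^esub> \<pi> r" using zero[OF x] kx b x by (simp add: D.m_comm)
    finally have "\<pi> h [^]\<^bsub>D\<^esub> k = a \<otimes>\<^bsub>D\<^esub> \<pi> r" .
    moreover have "\<pi> r \<in> carrier D" using kx(2) by simp
    ultimately show "\<exists>l::nat. \<exists>g\<in>carrier D. \<pi> h [^]\<^bsub>D\<^esub> l = a \<otimes>\<^bsub>D\<^esub> g" by (intro exI bexI)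
  qed
  have "maximalideal P R"
  proof (rule maximalidealI[OF idl PR])
    fix J assume J: "ideal J R" "P \<subseteq> J" "J \<subseteq> carrier R"
    interpret J: ideal J R by fact
    show "J = P \<or> J = carrier R"
    proof (cases "J = P")
      case False
      then obtain a where a: "a \<in> J" "a \<notin> P" using J(2) by auto
      then have aR: "a \<in> carrier R" using J by blast
      obtain g where g: "g \<in> carrier D" "\<pi> a \<otimes>\<^bsub>D\<^esub> g = \<one>\<^bsub>D\<^esub>" using inv[of "\<pi> a"] zero aR a by auto
      obtain b where b: "b \<in> carrier R" "g = \<pi> b" using surj g by blast
      have "\<pi> (\<one>\<^bsub>R\<^esub> \<ominus>\<^bsub>R\<^esub> a \<otimes>\<^bsub>R\<^esub> b) = \<zero>\<^bsub>D\<^esub>"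
        using g b aR by (simp add: minus_eq D.r_neg)
      then have "\<one>\<^bsub>R\<^esub> \<ominus>\<^bsub>R\<^esub> a \<otimes>\<^bsub>R\<^esub> b \<in> J" using zero[of "\<one>\<^bsub>R\<^esub> \<ominus>\<^bsub>R\<^esub> a \<otimes>\<^bsub>R\<^esub> b"] aR b J(2) by auto
      moreover have "a \<otimes>\<^bsub>R\<^esub> b \<in> J" using J.I_r_closed a b by blast
      ultimately have "(\<one>\<^bsub>R\<^esub> \<ominus>\<^bsub>R\<^esub> a \<otimes>\<^bsub>R\<^esub> b) \<oplus>\<^bsub>R\<^esub> a \<otimes>\<^bsub>R\<^esub> b \<in> J" by (rule J.a_closed)
      moreover have "(\<one>\<^bsub>R\<^esub> \<ominus>\<^bsub>R\<^esub> a \<otimes>\<^bsub>R\<^esub> b) \<oplus>\<^bsub>R\<^esub> a \<otimes>\<^bsub>R\<^esub> b = \<one>\<^bsub>R\<^esub>"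
        using aR b by (simp add: minus_eq a_assoc l_neg)
      ultimately show ?thesis using J.one_imp_carrier by simp
    qed simp
  qed
  then show ?thesis using hP by blast
qed

section \<open>Purely inseparable elements of degree \<open>p\<close>\<close>

context UP_domain
begin

text \<open>
  The polynomial \<open>Y - z\<close>.
\<close>

abbreviation lin :: "'a \<Rightarrow> nat \<Rightarrow> 'a" where
  "lin z \<equiv> up_ring.monom P \<one> 1 \<ominus>\<^bsub>P\<^esub> up_ring.monom P z 0"

lemma coeff_shift:
  assumes "g \<in> carrier P" "c \<in> carrier R"
  shows "up_ring.coeff P (up_ring.monom P c 1 \<otimes>\<^bsub>P\<^esub> g) (Suc i) = c \<otimes> up_ring.coeff P g i"
    and "up_ring.coeff P (up_ring.monom P c 1 \<otimes>\<^bsub>P\<^esub> g) 0 = \<zero>"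
    and "up_ring.coeff P (up_ring.monom P c 0 \<otimes>\<^bsub>P\<^esub> g) i = c \<otimes> up_ring.coeff P g i"
  using coeff_monom_mult[OF assms(2,1), of 1 i] coeff_monom_mult[OF assms(2,1), of 0 i] assms
  by simp_all

lemma coeff_lin_mult:
  assumes "g \<in> carrier P" "z \<in> carrier R"
  shows "up_ring.coeff P (lin z \<otimes>\<^bsub>P\<^esub> g) (Suc i) = up_ring.coeff P g i \<ominus> z \<otimes> up_ring.coeff P g (Suc i)"
    and "up_ring.coeff P (lin z \<otimes>\<^bsub>P\<^esub> g) 0 = \<ominus> z \<otimes> up_ring.coeff P g 0"
proof -
  have e: "lin z \<otimes>\<^bsub>P\<^esub> g = up_ring.monom P \<one> 1 \<otimes>\<^bsub>P\<^esub> g \<ominus>\<^bsub>P\<^esub> up_ring.monom P z 0 \<otimes>\<^bsub>P\<^esub> g"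
    using assms by (simp add: P.minus_eq P.l_distr P.l_minus)
  show "up_ring.coeff P (lin z \<otimes>\<^bsub>P\<^esub> g) (Suc i) = up_ring.coeff P g i \<ominus> z \<otimes> up_ring.coeff P g (Suc i)"
    unfolding e using assms coeff_shift(1)[OF assms(1), of \<one> i] coeff_shift(3)[OF assms, of "Suc i"] by simp
  show "up_ring.coeff P (lin z \<otimes>\<^bsub>P\<^esub> g) 0 = \<ominus> z \<otimes> up_ring.coeff P g 0"
    unfolding e using assms coeff_shift(2)[OF assms(1), of \<one>] coeff_shift(3)[OF assms, of 0]
    by (simp add: R.minus_eq R.l_minus)
qed

lemma coeff_lin_pow:
  assumes z: "z \<in> carrier R"
  shows "up_ring.coeff P (lin z [^]\<^bsub>P\<^esub> (j::nat)) j = \<one>"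
    and "i > j \<Longrightarrow> up_ring.coeff P (lin z [^]\<^bsub>P\<^esub> j) i = \<zero>"
    and "up_ring.coeff P (lin z [^]\<^bsub>P\<^esub> j) 0 = (\<ominus> z) [^] j"
proof -
  have "up_ring.coeff P (lin z [^]\<^bsub>P\<^esub> j) j = \<one> \<and> (\<forall>i>j. up_ring.coeff P (lin z [^]\<^bsub>P\<^esub> j) i = \<zero>)
    \<and> up_ring.coeff P (lin z [^]\<^bsub>P\<^esub> j) 0 = (\<ominus> z) [^] j" for j
  proof (induction j)
    case 0
    then show ?case by simp
  next
    case (Suc j)
    let ?g = "lin z [^]\<^bsub>P\<^esub> j"
    have g: "?g \<in> carrier P" using z by simp
    have e: "lin z [^]\<^bsub>P\<^esub> Suc j = lin z \<otimes>\<^bsub>P\<^esub> ?g" using z by (simp add: P.m_comm)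
    have "up_ring.coeff P (lin z \<otimes>\<^bsub>P\<^esub> ?g) (Suc i) = \<zero>" if "i > j" for i
      unfolding coeff_lin_mult(1)[OF g z] using Suc.IH z that by (simp add: R.minus_eq)
    then have "up_ring.coeff P (lin z \<otimes>\<^bsub>P\<^esub> ?g) i = \<zero>" if "i > Suc j" for i using that by (cases i) auto
    moreover have "up_ring.coeff P (lin z \<otimes>\<^bsub>P\<^esub> ?g) (Suc j) = \<one>"
      unfolding coeff_lin_mult(1)[OF g z] using Suc.IH z by (simp add: R.minus_eq)
    moreover have "up_ring.coeff P (lin z \<otimes>\<^bsub>P\<^esub> ?g) 0 = (\<ominus> z) [^] Suc j"
      unfolding coeff_lin_mult(2)[OF g z] using Suc.IH z by (simp add: R.m_comm)
    ultimately show ?case unfolding e by blast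
  qed
  then show "up_ring.coeff P (lin z [^]\<^bsub>P\<^esub> j) j = \<one>"
    "i > j \<Longrightarrow> up_ring.coeff P (lin z [^]\<^bsub>P\<^esub> j) i = \<zero>"
    "up_ring.coeff P (lin z [^]\<^bsub>P\<^esub> j) 0 = (\<ominus> z) [^] j" by auto
qed

lemma lin_nonzero: "z \<in> carrier R \<Longrightarrow> lin z \<noteq> \<zero>\<^bsub>P\<^esub>"
proof
  assume z: "z \<in> carrier R" and "lin z = \<zero>\<^bsub>P\<^esub>"
  then have "up_ring.coeff P (lin z [^]\<^bsub>P\<^esub> (1::nat)) 1 = \<zero>" by simp
  then show False using coeff_lin_pow(1)[OF z, of 1] by simp
qed

lemma lin_dvd_if_root:
  assumes f: "f \<in> carrier P" and z: "z \<in> carrier R" and "UnivPoly.eval R R id z f = \<zero>"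
  shows "\<exists>g\<in>carrier P. f = lin z \<otimes>\<^bsub>P\<^esub> g"
proof -
  have "carrier R \<noteq> {\<zero>}" using R.one_not_zero R.one_closed by (metis singletonD)
  then obtain q where "q \<in> carrier P" "f = lin z \<otimes>\<^bsub>P\<^esub> q \<oplus>\<^bsub>P\<^esub> up_ring.monom P (UnivPoly.eval R R id z f) 0"
    using remainder_theorem[OF f z] by blast
  then show ?thesis using assms z by (intro bexI[of _ q]) simp_all
qed

lemma eval_lin: "z \<in> carrier R \<Longrightarrow> UnivPoly.eval R R id z (lin z) = \<zero>"
proof -
  assume z: "z \<in> carrier R"
  interpret ev: ring_hom_ring P R "UnivPoly.eval R R id z" by (rule eval_ring_hom_ring[OF z])
  have pre: "UP_pre_univ_prop R R id" by (intro UP_pre_univ_propI R.is_cring) (simp add: ring_hom_def)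
  show ?thesis
    using UP_pre_univ_prop.eval_monom[OF pre R.one_closed z, of 1] UP_pre_univ_prop.eval_monom[OF pre z z, of 0] z
    by (simp add: P.minus_eq R.r_neg P_def[symmetric])
qed

text \<open>
  \<open>Y - z\<close> is prime: a product that vanishes at \<open>z\<close> has a factor that does, and \<open>Y - z\<close> can be cancelled from it.
\<close>

lemma factor_of_lin_pow:
  assumes z: "z \<in> carrier R" and a: "a \<in> carrier R" "a \<noteq> \<zero>"
    and f: "f \<in> carrier P" and q: "q \<in> carrier P"
    and eq: "f \<otimes>\<^bsub>P\<^esub> q = up_ring.monom P a 0 \<otimes>\<^bsub>P\<^esub> lin z [^]\<^bsub>P\<^esub> (n::nat)"
  shows "\<exists>j::nat. \<exists>b\<in>carrier R. f = up_ring.monom P b 0 \<otimes>\<^bsub>P\<^esub> lin z [^]\<^bsub>P\<^esub> j"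
  using f q eq
proof (induction n arbitrary: f q)
  case 0
  let ?a = "up_ring.monom P a 0"
  have ca: "up_ring.coeff P ?a 0 = a" using a by simp
  then have "?a \<noteq> \<zero>\<^bsub>P\<^esub>" using a(2) coeff_zero by metis
  then have nz: "f \<noteq> \<zero>\<^bsub>P\<^esub>" "q \<noteq> \<zero>\<^bsub>P\<^esub>" using 0 a by auto
  have "UnivPoly.deg R f + UnivPoly.deg R q = 0" using deg_mult[OF nz 0(1,2)] 0(3) a by simp
  then have "f = up_ring.monom P (up_ring.coeff P f 0) 0" using deg_zero_impl_monom[OF 0(1)] by simp
  then have "f = up_ring.monom P (up_ring.coeff P f 0) 0 \<otimes>\<^bsub>P\<^esub> lin z [^]\<^bsub>P\<^esub> (0::nat)" using 0(1) by simp
  then show ?case using 0(1) coeff_closed by blast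
next
  case (Suc n)
  let ?ev = "UnivPoly.eval R R id z" and ?a = "up_ring.monom P a 0"
  interpret ev: ring_hom_ring P R ?ev by (rule eval_ring_hom_ring[OF z])
  have B: "lin z \<in> carrier P" using z by simp
  have eq: "f \<otimes>\<^bsub>P\<^esub> q = lin z \<otimes>\<^bsub>P\<^esub> (?a \<otimes>\<^bsub>P\<^esub> lin z [^]\<^bsub>P\<^esub> n)"
    unfolding Suc.prems(3) using B a by (simp add: P.m_ac)
  have "?ev f \<otimes> ?ev q = ?ev (lin z \<otimes>\<^bsub>P\<^esub> (?a \<otimes>\<^bsub>P\<^esub> lin z [^]\<^bsub>P\<^esub> n))"
    unfolding eq[symmetric] by (rule ev.hom_mult[symmetric]) (use Suc.prems in auto)
  also have "\<dots> = \<zero>" using ev.hom_mult[of "lin z" "?a \<otimes>\<^bsub>P\<^esub> lin z [^]\<^bsub>P\<^esub> n"] eval_lin[OF z] B a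
    by simp
  finally have "?ev f \<otimes> ?ev q = \<zero>" .
  then consider "?ev f = \<zero>" | "?ev q = \<zero>" using R.integral Suc.prems(1,2) by (metis ev.hom_closed)
  then show ?case
  proof cases
    case 1
    then obtain g where g: "g \<in> carrier P" "f = lin z \<otimes>\<^bsub>P\<^esub> g" using lin_dvd_if_root[OF Suc.prems(1) z] by blast
    have "lin z \<otimes>\<^bsub>P\<^esub> (g \<otimes>\<^bsub>P\<^esub> q) = lin z \<otimes>\<^bsub>P\<^esub> (?a \<otimes>\<^bsub>P\<^esub> lin z [^]\<^bsub>P\<^esub> n)"
      unfolding eq[symmetric] g(2) using B g Suc.prems(2) by (simp add: P.m_assoc)
    then have "g \<otimes>\<^bsub>P\<^esub> q = ?a \<otimes>\<^bsub>P\<^esub> lin z [^]\<^bsub>P\<^esub> n"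
      using domain.m_lcancel[OF UP_domain lin_nonzero[OF z] B] g Suc.prems(2) a B by simp
    then obtain j :: nat and b where jb: "b \<in> carrier R" "g = up_ring.monom P b 0 \<otimes>\<^bsub>P\<^esub> lin z [^]\<^bsub>P\<^esub> j"
      using Suc.IH[OF g(1) Suc.prems(2)] by blast
    have "f = up_ring.monom P b 0 \<otimes>\<^bsub>P\<^esub> lin z [^]\<^bsub>P\<^esub> Suc j"
      unfolding g(2) jb(2) using jb(1) B by (simp add: P.m_ac)
    then show ?thesis using jb(1) by blast
  next
    case 2
    then obtain g where g: "g \<in> carrier P" "q = lin z \<otimes>\<^bsub>P\<^esub> g" using lin_dvd_if_root[OF Suc.prems(2) z] by blast
    have "lin z \<otimes>\<^bsub>P\<^esub> (f \<otimes>\<^bsub>P\<^esub> g) = lin z \<otimes>\<^bsub>P\<^esub> (?a \<otimes>\<^bsub>P\<^esub> lin z [^]\<^bsub>P\<^esub> n)"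
      unfolding eq[symmetric] g(2) using B g Suc.prems(1) by (simp add: P.m_lcomm)
    then have "f \<otimes>\<^bsub>P\<^esub> g = ?a \<otimes>\<^bsub>P\<^esub> lin z [^]\<^bsub>P\<^esub> n"
      using domain.m_lcancel[OF UP_domain lin_nonzero[OF z] B] g Suc.prems(1) a B by simp
    then show ?thesis using Suc.IH[OF Suc.prems(1) g(1)] by blast
  qed
qed

text \<open>
  Division with remainder by \<open>f\<close>, up to powers of its leading coefficient \<open>c\<close> so as to stay over \<open>S\<close>.
\<close>

lemma monom_division:
  assumes S: "subring S R" and f: "f \<in> sub_polys S" and e: "e \<ge> 1" and top: "\<And>i. i > e \<Longrightarrow> up_ring.coeff P f i = \<zero>"
    and c: "c = up_ring.coeff P f e"
  shows "\<exists>q\<in>carrier P. \<exists>r\<in>sub_polys S. (\<forall>i\<ge>e. up_ring.coeff P r i = \<zero>) \<and>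
    up_ring.monom P (c [^] n) n = f \<otimes>\<^bsub>P\<^esub> q \<oplus>\<^bsub>P\<^esub> r"
proof (induction n)
  have sub: "subring (sub_polys S) P" by (rule subring_sub_polys[OF S])
  have fP: "f \<in> carrier P" using f by (simp add: sub_polys_def)
  case 0
  have "up_ring.monom P \<one> 0 \<in> sub_polys S" using subringE(2,3)[OF S] by (simp add: sub_polys_def)
  moreover have "\<forall>i\<ge>e. up_ring.coeff P (up_ring.monom P \<one> 0) i = \<zero>" using e by simp
  moreover have "up_ring.monom P (c [^] (0::nat)) 0 = f \<otimes>\<^bsub>P\<^esub> \<zero>\<^bsub>P\<^esub> \<oplus>\<^bsub>P\<^esub> up_ring.monom P \<one> 0" using fP by simp
  ultimately show ?case using P.zero_closed by blast
next
  have sub: "subring (sub_polys S) P" by (rule subring_sub_polys[OF S])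
  note Pc = subsetD[OF subringE(1)[OF sub]]
  have fP: "f \<in> carrier P" using f by (simp add: sub_polys_def)
  have cS: "c \<in> S" using f c by (simp add: sub_polys_def)
  have cR: "c \<in> carrier R" using subringE(1)[OF S] cS by blast
  case (Suc n)
  then obtain q r where q: "q \<in> carrier P" and r: "r \<in> sub_polys S" "\<And>i. i \<ge> e \<Longrightarrow> up_ring.coeff P r i = \<zero>"
    and eq: "up_ring.monom P (c [^] n) n = f \<otimes>\<^bsub>P\<^esub> q \<oplus>\<^bsub>P\<^esub> r" by blast
  define s where "s = up_ring.coeff P r (e - 1)"
  have sS: "s \<in> S" using r(1) by (simp add: s_def sub_polys_def)
  have sR: "s \<in> carrier R" using subringE(1)[OF S] sS by blast
  let ?m = "up_ring.monom P c 1" and ?s = "up_ring.monom P s 0"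
  have mS: "?m \<in> sub_polys S" "?s \<in> sub_polys S" using cR cS sR sS subringE(2)[OF S] by (simp_all add: sub_polys_def)
  let ?q = "?m \<otimes>\<^bsub>P\<^esub> q \<oplus>\<^bsub>P\<^esub> ?s" and ?r = "?m \<otimes>\<^bsub>P\<^esub> r \<ominus>\<^bsub>P\<^esub> ?s \<otimes>\<^bsub>P\<^esub> f"
  have rP: "r \<in> carrier P" by (rule Pc[OF r(1)])
  have "up_ring.monom P (c [^] Suc n) (Suc n) = up_ring.monom P (c [^] n) n \<otimes>\<^bsub>P\<^esub> ?m"
    using monom_mult[of "c [^] n" c n 1] cR by simp
  also have "\<dots> = f \<otimes>\<^bsub>P\<^esub> ?q \<oplus>\<^bsub>P\<^esub> ?r"
  proof -
    have "f \<otimes>\<^bsub>P\<^esub> ?q \<oplus>\<^bsub>P\<^esub> ?r = ?m \<otimes>\<^bsub>P\<^esub> (f \<otimes>\<^bsub>P\<^esub> q) \<oplus>\<^bsub>P\<^esub> (?s \<otimes>\<^bsub>P\<^esub> f \<oplus>\<^bsub>P\<^esub> (?m \<otimes>\<^bsub>P\<^esub> r \<oplus>\<^bsub>P\<^esub> \<ominus>\<^bsub>P\<^esub> (?s \<otimes>\<^bsub>P\<^esub> f)))"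
      using fP q rP cR sR by (simp add: P.r_distr P.m_ac P.a_assoc P.minus_eq)
    also have "?s \<otimes>\<^bsub>P\<^esub> f \<oplus>\<^bsub>P\<^esub> (?m \<otimes>\<^bsub>P\<^esub> r \<oplus>\<^bsub>P\<^esub> \<ominus>\<^bsub>P\<^esub> (?s \<otimes>\<^bsub>P\<^esub> f)) = ?m \<otimes>\<^bsub>P\<^esub> r"
      using fP rP cR sR by (subst P.a_comm[of "?m \<otimes>\<^bsub>P\<^esub> r"]) (simp_all add: P.r_neg2)
    finally show ?thesis unfolding eq using fP q rP cR by (simp add: P.r_distr P.l_distr P.m_comm)
  qed
  finally have "up_ring.monom P (c [^] Suc n) (Suc n) = f \<otimes>\<^bsub>P\<^esub> ?q \<oplus>\<^bsub>P\<^esub> ?r" .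
  moreover have "?q \<in> carrier P" using q cR sR by simp
  moreover have "?r \<in> sub_polys S" unfolding a_minus_def by (intro subringE(5-7)[OF sub] mS r(1) f)
  moreover have "up_ring.coeff P ?r i = \<zero>" if i: "i \<ge> e" for i
  proof -
    obtain i' where i': "i = Suc i'" "i' \<ge> e - 1" using i e by (cases i) auto
    have "up_ring.coeff P ?r i = c \<otimes> up_ring.coeff P r i' \<ominus> s \<otimes> up_ring.coeff P f (Suc i')"
      unfolding i'(1) using coeff_shift(1)[OF rP cR, of i'] coeff_shift(3)[OF fP sR, of "Suc i'"] rP fP cR sR by simp
    also have "\<dots> = \<zero>"
    proof (cases "i' = e - 1")
      case True
      then have "Suc i' = e" "up_ring.coeff P r i' = s" using e by (simp_all add: s_def)
      then show ?thesis using cR sR R.m_comm[OF cR sR] by (simp add: c[symmetric] R.minus_eq R.r_neg)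
    next
      case False
      then have "i' \<ge> e" using i' by simp
      then show ?thesis using r(2)[of i'] top[of "Suc i'"] cR sR by (simp add: R.minus_eq)
    qed
    finally show ?thesis .
  qed
  ultimately show ?case by blast
qed

end

text \<open>
  A minimal relation \<open>f\<close> of degree \<open>e < p\<close> would divide \<open>Y\<^sup>p - z\<^sup>p = (Y - z)\<^sup>p\<close> up to a constant, hence be
  \<open>c (Y - z)\<^sup>e\<close>; its constant term puts \<open>z\<^sup>e\<close> into \<open>S\<close>, and then \<open>z\<close> itself as \<open>e\<close> is prime to \<open>p\<close>.
\<close>

lemma (in UP_domain) independent_powers_aux:
  assumes p: "Factorial_Ring.prime (p::nat)" "odd p" and char: "add_pow R p \<one> = \<zero>"
    and S: "subring S R" and sat: "\<And>a b. a \<in> carrier R \<Longrightarrow> b \<in> S \<Longrightarrow> b \<noteq> \<zero> \<Longrightarrow> a \<otimes> b \<in> S \<Longrightarrow> a \<in> S"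
    and z: "z \<in> carrier R" "z \<notin> S" "z [^] p \<in> S"
    and d: "\<And>i. i < p \<Longrightarrow> d i \<in> S" "(\<Oplus>i\<in>{..<p}. d i \<otimes> z [^] i) = \<zero>"
  shows "\<forall>i<p. d i = \<zero>"
proof (rule ccontr)
  assume not: "\<not> ?thesis"
  note Sc = subsetD[OF subringE(1)[OF S]]
  define rel where "rel n \<longleftrightarrow> (\<exists>c. (\<forall>i<n. c i \<in> S) \<and> (\<Oplus>i\<in>{..<n}. c i \<otimes> z [^] i) = \<zero> \<and> (\<exists>i<n. c i \<noteq> \<zero>))" for n :: nat
  have relp: "rel p" unfolding rel_def using d not by blast
  define m where "m = (LEAST n. rel n)"
  have m: "rel m" using LeastI[of rel p] relp by (simp add: m_def)
  have mp: "m \<le> p" unfolding m_def using relp by (rule Least_le)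
  have min: "\<not> rel n" if "n < m" for n using that unfolding m_def by (rule not_less_Least)
  obtain c where c: "\<And>i. i < m \<Longrightarrow> c i \<in> S" "(\<Oplus>i\<in>{..<m}. c i \<otimes> z [^] i) = \<zero>" "\<exists>i<m. c i \<noteq> \<zero>"
    using m unfolding rel_def by auto
  obtain e where e: "m = Suc e" using c(3) by (cases m) auto
  have cR: "c i \<in> carrier R" if "i < m" for i using Sc c(1) that by blast
  have ce: "c e \<in> S" "c e \<in> carrier R" using c(1) cR e by simp_all
  have sum: "(\<Oplus>i\<in>{..<m}. c i \<otimes> z [^] i) = c e \<otimes> z [^] e \<oplus> (\<Oplus>i\<in>{..<e}. c i \<otimes> z [^] i)"
    unfolding e lessThan_Suc using cR z e by (subst R.finsum_insert) auto
  have ce0: "c e \<noteq> \<zero>"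
  proof
    assume z0: "c e = \<zero>"
    have "(\<Oplus>i\<in>{..<e}. c i \<otimes> z [^] i) \<in> carrier R" using cR z e by (intro R.finsum_closed) auto
    then have "(\<Oplus>i\<in>{..<e}. c i \<otimes> z [^] i) = \<zero>" using sum c(2) z0 z by simp
    moreover have "\<exists>i<e. c i \<noteq> \<zero>" using c(3) z0 e less_Suc_eq by auto
    ultimately have "rel e" unfolding rel_def using c(1) e less_SucI by blast
    then show False using min[of e] e by simp
  qed
  have e1: "e \<ge> 1"
  proof (rule ccontr)
    assume "\<not> e \<ge> 1"
    then have "e = 0" by simp
    then have "c e = \<zero>" using sum c(2) ce by simp
    then show False using ce0 by simp
  qed
  let ?ev = "UnivPoly.eval R R id z"
  interpret ev: ring_hom_ring P R ?ev by (rule eval_ring_hom_ring[OF z(1)])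
  have pre: "UP_pre_univ_prop R R id" by (intro UP_pre_univ_propI R.is_cring) (simp add: ring_hom_def)
  have ev_monom: "?ev (up_ring.monom P a n) = a \<otimes> z [^] n" if "a \<in> carrier R" for a n
    using UP_pre_univ_prop.eval_monom[OF pre that z(1), of n] by (simp add: P_def)
  have sub: "subring (sub_polys S) P" by (rule subring_sub_polys[OF S])
  note Pc = subsetD[OF subringE(1)[OF sub]]
  obtain f where f: "f \<in> carrier P" "\<And>i. up_ring.coeff P f i = (if i < m then c i else \<zero>)"
    using poly_of_coeffs[of m c] cR by blast
  have fS: "f \<in> sub_polys S" using f c(1) subringE(2)[OF S] by (simp add: sub_polys_def)
  have evf: "?ev f = \<zero>"
  proof -
    have "?ev f = (\<Oplus>i\<in>{..<m}. up_ring.coeff P f i \<otimes> z [^] i)" by (rule eval_bounded_sum[OF f(1) z(1)]) (simp add: f(2))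
    also have "\<dots> = (\<Oplus>i\<in>{..<m}. c i \<otimes> z [^] i)" using cR z f(2) by (intro R.finsum_cong') auto
    finally show ?thesis using c(2) by simp
  qed
  have minimal: "g = \<zero>\<^bsub>P\<^esub>" if g: "g \<in> sub_polys S" "\<And>i. i \<ge> e \<Longrightarrow> up_ring.coeff P g i = \<zero>" "?ev g = \<zero>" for g
  proof (rule up_eqI[OF _ Pc[OF g(1)] P.zero_closed])
    fix i
    have "(\<Oplus>i\<in>{..<e}. up_ring.coeff P g i \<otimes> z [^] i) = \<zero>"
      using eval_bounded_sum[OF Pc[OF g(1)] z(1), of e] g by simp
    then have "\<not> (\<exists>i<e. up_ring.coeff P g i \<noteq> \<zero>)"
      using min[of e] e g(1) unfolding rel_def sub_polys_def by blast
    then show "up_ring.coeff P g i = up_ring.coeff P \<zero>\<^bsub>P\<^esub> i" using g(2)[of i] by (cases "i < e") auto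
  qed
  define w where "w = z [^] p"
  have w: "w \<in> S" "w \<in> carrier R" using z Sc by (auto simp: w_def)
  define a where "a = c e [^] p"
  have a: "a \<in> S" "a \<in> carrier R" "a \<noteq> \<zero>"
    using R.subring_nat_pow[OF S ce(1)] R.nat_pow_nonzero[OF ce(2) ce0] ce(2) by (auto simp: a_def)
  obtain q r where q: "q \<in> carrier P" and r: "r \<in> sub_polys S" "\<And>i. i \<ge> e \<Longrightarrow> up_ring.coeff P r i = \<zero>"
    and eq: "up_ring.monom P a p = f \<otimes>\<^bsub>P\<^esub> q \<oplus>\<^bsub>P\<^esub> r"
    using monom_division[OF S fS e1, of "c e" p] f(2) e unfolding a_def by auto
  note rP = Pc[OF r(1)]
  have evr: "?ev r = a \<otimes> w"
  proof -
    have "a \<otimes> w = ?ev (f \<otimes>\<^bsub>P\<^esub> q \<oplus>\<^bsub>P\<^esub> r)" using ev_monom[OF a(2), of p] unfolding eq w_def by simp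
    also have "\<dots> = ?ev r" using evf f(1) q rP by simp
    finally show ?thesis by simp
  qed
  let ?w = "up_ring.monom P (a \<otimes> w) 0"
  have wS: "?w \<in> sub_polys S"
    using a w subringE(2)[OF S] subringE(6)[OF S a(1) w(1)] by (simp add: sub_polys_def)
  have "r \<ominus>\<^bsub>P\<^esub> ?w = \<zero>\<^bsub>P\<^esub>"
  proof (rule minimal)
    show "r \<ominus>\<^bsub>P\<^esub> ?w \<in> sub_polys S" unfolding a_minus_def by (intro subringE(5,7)[OF sub] r(1) wS)
    show "up_ring.coeff P (r \<ominus>\<^bsub>P\<^esub> ?w) i = \<zero>" if "i \<ge> e" for i
      using that e1 r(2)[OF that] rP a w by (simp add: R.minus_eq)
    show "?ev (r \<ominus>\<^bsub>P\<^esub> ?w) = \<zero>"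
      using evr ev_monom[of "a \<otimes> w" 0] rP a w by (simp add: P.minus_eq R.r_neg)
  qed
  then have rw: "r = ?w" using rP a w by (simp add: P.r_right_minus_eq)
  have B: "lin z \<in> carrier P" using z by simp
  have neg: "(\<ominus> z) [^] p = \<ominus> w"
  proof -
    have "(z \<oplus> \<ominus> z) [^] p = z [^] p \<oplus> (\<ominus> z) [^] p" using z by (intro R.frobenius_add[OF p char]) auto
    then have "w \<oplus> (\<ominus> z) [^] p = \<zero>" using z p(1) prime_gt_0_nat[of p] by (simp add: R.r_neg w_def R.nat_pow_zero)
    then show ?thesis using R.minus_equality[of "(\<ominus> z) [^] p" w] w z by (simp add: R.a_comm)
  qed
  have pow: "lin z [^]\<^bsub>P\<^esub> p = up_ring.monom P \<one> p \<oplus>\<^bsub>P\<^esub> up_ring.monom P (\<ominus> w) 0"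
  proof -
    have one: "add_pow P (k::nat) \<one>\<^bsub>P\<^esub> = up_ring.monom P (add_pow R k \<one>) 0" for k
      by (induction k) (simp_all add: P.add.nat_pow_Suc)
    have charP: "add_pow P p \<one>\<^bsub>P\<^esub> = \<zero>\<^bsub>P\<^esub>" unfolding one char by simp
    have mpow: "up_ring.monom P x i [^]\<^bsub>P\<^esub> k = up_ring.monom P (x [^] k) (i * k)" if "x \<in> carrier R" for x i and k :: nat
    proof (induction k)
      case (Suc k)
      then show ?case using monom_mult[of "x [^] k" x "i * k" i] that by (simp add: add.commute del: monom_mult)
    qed simp
    have "lin z [^]\<^bsub>P\<^esub> p = up_ring.monom P \<one> 1 [^]\<^bsub>P\<^esub> p \<oplus>\<^bsub>P\<^esub> up_ring.monom P (\<ominus> z) 0 [^]\<^bsub>P\<^esub> p"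
      unfolding P.minus_eq monom_a_inv[OF z(1), symmetric] by (rule P.frobenius_add[OF p charP]) (use z in auto)
    then show ?thesis using neg z mpow[of \<one> 1 p] mpow[of "\<ominus> z" 0 p] by simp
  qed
  have "f \<otimes>\<^bsub>P\<^esub> q = up_ring.monom P a p \<ominus>\<^bsub>P\<^esub> ?w"
    unfolding eq rw using f(1) q a w by (simp add: P.minus_eq P.a_assoc P.r_neg)
  also have "\<dots> = up_ring.monom P a 0 \<otimes>\<^bsub>P\<^esub> lin z [^]\<^bsub>P\<^esub> p"
    unfolding pow using a w monom_mult[of a \<one> 0 p] monom_mult[of a "\<ominus> w" 0 0]
    by (simp add: P.r_distr P.minus_eq R.r_minus)
  finally obtain j :: nat and b where jb: "b \<in> carrier R" "f = up_ring.monom P b 0 \<otimes>\<^bsub>P\<^esub> lin z [^]\<^bsub>P\<^esub> j"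
    using factor_of_lin_pow[OF z(1) a(2,3) f(1) q] by blast
  have fc: "up_ring.coeff P f i = b \<otimes> up_ring.coeff P (lin z [^]\<^bsub>P\<^esub> j) i" for i
    unfolding jb(2) by (rule coeff_shift(3)) (use B jb(1) in auto)
  have fe: "up_ring.coeff P f e = c e" using f(2) e by simp
  have "b \<noteq> \<zero>" using fc[of e] fe ce0 B by auto
  then have "up_ring.coeff P f j \<noteq> \<zero>" using fc[of j] coeff_lin_pow(1)[OF z(1), of j] jb(1) by simp
  then have "j \<le> e" using f(2)[of j] e by (cases "j < m") auto
  moreover have "\<not> e > j" using fc[of e] fe ce0 coeff_lin_pow(2)[OF z(1), of j e] jb(1) by auto
  ultimately have je: "j = e" by simp
  have bc: "b = c e" using fc[of e] fe coeff_lin_pow(1)[OF z(1), of e] jb(1) je by simp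
  let ?y = "\<ominus> z"
  have y: "?y \<in> carrier R" using z by simp
  have "c 0 = c e \<otimes> ?y [^] e" using fc[of 0] f(2)[of 0] coeff_lin_pow(3)[OF z(1), of j] bc je e by simp
  then have "?y [^] e \<otimes> c e \<in> S" using c(1)[of 0] e y ce R.m_comm[of "c e" "?y [^] e"] by simp
  then have ye: "?y [^] e \<in> S" using sat[of "?y [^] e" "c e"] y ce(1) ce0 by simp
  have "e < p" using mp e by simp
  then have "gcd e p = 1" using e1 p(1)
    by (metis One_nat_def coprime_iff_gcd_eq_1 gcd.commute less_le_trans nat_dvd_not_less prime_imp_coprime_nat zero_less_one)
  then obtain u v where uv: "e * u = p * v + 1" using bezout_nat[of e p] e1 by auto
  have yp: "?y [^] p \<in> S" unfolding neg by (rule subringE(5)[OF S w(1)])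
  have y0: "?y \<noteq> \<zero>"
  proof
    assume "?y = \<zero>"
    then have "z = \<zero>" using z R.minus_minus[of z] by simp
    then show False using z subringE(2)[OF S] by simp
  qed
  have "?y \<otimes> (?y [^] p) [^] v = (?y [^] e) [^] u"
    using y uv by (simp add: R.nat_pow_pow R.m_comm)
  also have "\<dots> \<in> S" by (rule R.subring_nat_pow[OF S ye])
  finally have "?y \<in> S"
    using sat[OF y R.subring_nat_pow[OF S yp]] R.nat_pow_nonzero[OF R.nat_pow_closed[OF y] R.nat_pow_nonzero[OF y y0]] by blast
  then have "\<ominus> ?y \<in> S" by (rule subringE(5)[OF S])
  then show False using z by simp
qed

lemmas (in domain) independent_powers = UP_domain.independent_powers_aux[OF UP_domain_UP]

section \<open>Maximal saturated subrings\<close>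

context domain
begin

text \<open>
  With \<open>n = p\<close> and \<open>S\<close> containing all \<open>p\<close>-th powers, every element of \<open>S[t]\<close> is a combination of \<open>1, t, \<dots>, t\<^sup>p\<^sup>-\<^sup>1\<close>.
\<close>

lemma adjoin_eq_span:
  assumes S: "subring S R" and t: "t \<in> carrier R" and n: "n \<ge> 1" "t [^] n \<in> S"
  shows "adjoin S t = poly_span S t n"
proof
  show "poly_span S t n \<subseteq> adjoin S t" unfolding adjoin_def by blast
  have "\<one> \<otimes> t [^] n = t [^] n \<otimes> t [^] (0::nat)" using t by simp
  then have "\<one> \<otimes> t [^] n \<in> poly_span S t n" using monom_in_poly_span[OF S t n(2), of 0 n] n(1) by simp
  then show "adjoin S t \<subseteq> poly_span S t n"
    using adjoin_into_span[OF S t subringE(3)[OF S] n(1)] subsetD[OF subringE(1)[OF subring_adjoin[OF S t]]] by auto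
qed

text \<open>Saturated subrings are the traces on \<open>R\<close> of subfields of its field of fractions.\<close>

definition saturated :: "'a set \<Rightarrow> bool" where
  "saturated M \<longleftrightarrow> (\<forall>a\<in>carrier R. \<forall>d\<in>M. d \<noteq> \<zero> \<longrightarrow> a \<otimes> d \<in> M \<longrightarrow> a \<in> M)"

text \<open>
  The elements of \<open>R\<close> in the field of fractions of \<open>N\<close>.
\<close>

definition saturation :: "'a set \<Rightarrow> 'a set" where
  "saturation N = {a \<in> carrier R. \<exists>d\<in>N. d \<noteq> \<zero> \<and> a \<otimes> d \<in> N}"

lemma subset_saturation:
  assumes N: "subring N R" shows "N \<subseteq> saturation N"
  using subringE(1,3)[OF N] one_not_zero by (auto simp: saturation_def intro!: bexI[of _ \<one>])

lemma subring_saturation: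
  assumes N: "subring N R" shows "subring (saturation N) R"
proof (rule subringI)
  note Nc = subsetD[OF subringE(1)[OF N]]
  show "saturation N \<subseteq> carrier R" by (auto simp: saturation_def)
  show "\<one> \<in> saturation N" using subset_saturation[OF N] subringE(3)[OF N] by blast
  fix x y assume "x \<in> saturation N"
  then obtain d where d: "d \<in> N" "d \<noteq> \<zero>" "x \<otimes> d \<in> N" and x: "x \<in> carrier R" by (auto simp: saturation_def)
  note dR = Nc[OF d(1)]
  have "(\<ominus> x) \<otimes> d = \<ominus> (x \<otimes> d)" using x dR by (simp add: l_minus)
  then show "\<ominus> x \<in> saturation N"
    unfolding saturation_def using d x subringE(5)[OF N d(3)] by auto
  assume "y \<in> saturation N"
  then obtain e where e: "e \<in> N" "e \<noteq> \<zero>" "y \<otimes> e \<in> N" and y: "y \<in> carrier R" by (auto simp: saturation_def)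
  note eR = Nc[OF e(1)]
  have de: "d \<otimes> e \<in> N" "d \<otimes> e \<noteq> \<zero>" using subringE(6)[OF N d(1) e(1)] d e dR eR by (auto simp: integral_iff)
  have "(x \<otimes> y) \<otimes> (d \<otimes> e) = (x \<otimes> d) \<otimes> (y \<otimes> e)" using x y dR eR by (simp add: m_ac)
  then have "(x \<otimes> y) \<otimes> (d \<otimes> e) \<in> N" using subringE(6)[OF N d(3) e(3)] by simp
  then show "x \<otimes> y \<in> saturation N" unfolding saturation_def using de x y by auto
  have "(x \<oplus> y) \<otimes> (d \<otimes> e) = (x \<otimes> d) \<otimes> e \<oplus> (y \<otimes> e) \<otimes> d" using x y dR eR by (simp add: l_distr r_distr m_ac)
  then have "(x \<oplus> y) \<otimes> (d \<otimes> e) \<in> N"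
    using subringE(7)[OF N subringE(6)[OF N d(3) e(1)] subringE(6)[OF N e(3) d(1)]] by simp
  then show "x \<oplus> y \<in> saturation N" unfolding saturation_def using de x y by auto
qed

lemma saturated_saturation:
  assumes N: "subring N R" shows "saturated (saturation N)"
  unfolding saturated_def
proof (intro ballI impI)
  note Nc = subsetD[OF subringE(1)[OF N]]
  fix a x assume a: "a \<in> carrier R" and "x \<in> saturation N" "x \<noteq> \<zero>" "a \<otimes> x \<in> saturation N"
  then obtain d e where d: "d \<in> N" "d \<noteq> \<zero>" "x \<otimes> d \<in> N" and x: "x \<in> carrier R" "x \<noteq> \<zero>"
    and e: "e \<in> N" "e \<noteq> \<zero>" "(a \<otimes> x) \<otimes> e \<in> N" by (auto simp: saturation_def)
  note c = Nc[OF d(1)] Nc[OF e(1)]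
  have "a \<otimes> (e \<otimes> (x \<otimes> d)) = ((a \<otimes> x) \<otimes> e) \<otimes> d" using a x c by (simp add: m_ac)
  then have "a \<otimes> (e \<otimes> (x \<otimes> d)) \<in> N" using subringE(6)[OF N e(3) d(1)] by simp
  moreover have "e \<otimes> (x \<otimes> d) \<in> N" "e \<otimes> (x \<otimes> d) \<noteq> \<zero>"
    using subringE(6)[OF N e(1) d(3)] c d e x by (auto simp: integral_iff)
  ultimately show "a \<in> saturation N" unfolding saturation_def using a by auto
qed

text \<open>
  Zorn's lemma. A maximal such \<open>M\<close> plays the role of a subfield \<open>L\<close> of the function field that is maximal with \<open>z \<notin> L\<close>;
  the function field then has degree \<open>p\<close> over it.
\<close>

lemma exists_maximal_saturated_subring:
  assumes F: "subring F R" "saturated F" and z: "z \<notin> F"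
  shows "\<exists>M. subring M R \<and> F \<subseteq> M \<and> saturated M \<and> z \<notin> M \<and>
    (\<forall>N. subring N R \<longrightarrow> saturated N \<longrightarrow> M \<subseteq> N \<longrightarrow> z \<notin> N \<longrightarrow> N = M)"
proof -
  define \<A> where "\<A> = {M. subring M R \<and> F \<subseteq> M \<and> saturated M \<and> z \<notin> M}"
  have "\<exists>M\<in>\<A>. \<forall>N\<in>\<A>. M \<subseteq> N \<longrightarrow> N = M"
  proof (rule subset_Zorn_nonempty)
    show "\<A> \<noteq> {}" using F z by (auto simp: \<A>_def)
    fix C assume C: "C \<noteq> {}" "subset.chain \<A> C"
    have CA: "\<And>V. V \<in> C \<Longrightarrow> V \<in> \<A>" and tot: "\<And>V U. V \<in> C \<Longrightarrow> U \<in> C \<Longrightarrow> V \<subseteq> U \<or> U \<subseteq> V"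
      using C(2) unfolding pred_on.chain_def by auto
    have CS: "subring V R" "F \<subseteq> V" "saturated V" "z \<notin> V" if "V \<in> C" for V using CA[OF that] by (auto simp: \<A>_def)
    obtain V0 where V0: "V0 \<in> C" using C(1) by blast
    have pair: "\<exists>V\<in>C. x \<in> V \<and> y \<in> V" if "x \<in> \<Union>C" "y \<in> \<Union>C" for x y
      using that tot by (meson UnionE subsetD)
    have "subring (\<Union>C) R"
    proof (rule subringI)
      show "\<Union>C \<subseteq> carrier R" using subringE(1)[OF CS(1)] by blast
      show "\<one> \<in> \<Union>C" using subringE(3)[OF CS(1)[OF V0]] V0 by blast
      show "\<ominus> x \<in> \<Union>C" if "x \<in> \<Union>C" for x using that subringE(5)[OF CS(1)] by blast
      fix x y assume "x \<in> \<Union>C" "y \<in> \<Union>C"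
      then obtain V where V: "V \<in> C" "x \<in> V" "y \<in> V" using pair by blast
      show "x \<otimes> y \<in> \<Union>C" using subringE(6)[OF CS(1)[OF V(1)] V(2,3)] V(1) by blast
      show "x \<oplus> y \<in> \<Union>C" using subringE(7)[OF CS(1)[OF V(1)] V(2,3)] V(1) by blast
    qed
    moreover have "saturated (\<Union>C)" unfolding saturated_def
    proof (intro ballI impI)
      fix a d assume a: "a \<in> carrier R" and "d \<in> \<Union>C" "d \<noteq> \<zero>" "a \<otimes> d \<in> \<Union>C"
      then obtain V where V: "V \<in> C" "d \<in> V" "a \<otimes> d \<in> V" using pair by blast
      then have "a \<in> V" using CS(3)[OF V(1)] a \<open>d \<noteq> \<zero>\<close> unfolding saturated_def by blast
      then show "a \<in> \<Union>C" using V(1) by blast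
    qed
    ultimately show "\<Union>C \<in> \<A>" using CS(2)[OF V0] V0 CS(4) by (auto simp: \<A>_def)
  qed
  then obtain M where M: "M \<in> \<A>" "\<And>N. N \<in> \<A> \<Longrightarrow> M \<subseteq> N \<Longrightarrow> N = M" by blast
  then show ?thesis by (intro exI[of _ M]) (auto simp: \<A>_def)
qed

end

locale frobenius_domain = domain +
  fixes p :: nat
  assumes prime_p: "Factorial_Ring.prime p" and odd_p: "odd p" and char_p: "add_pow R p \<one> = \<zero>"
begin

lemmas frob_add = frobenius_add[OF prime_p odd_p char_p]

lemma p_pos: "p > 0" using prime_p by (rule prime_gt_0_nat)

lemma zero_pow_p: "\<zero> [^] p = \<zero>" using p_pos by (simp add: nat_pow_zero)

lemma frob_neg: "x \<in> carrier R \<Longrightarrow> (\<ominus> x) [^] p = \<ominus> (x [^] p)"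
proof -
  assume x: "x \<in> carrier R"
  have "x [^] p \<oplus> (\<ominus> x) [^] p = \<zero>" using frob_add[of x "\<ominus> x"] x zero_pow_p by (simp add: r_neg)
  then show ?thesis using minus_equality[of "(\<ominus> x) [^] p" "x [^] p"] x by (simp add: a_comm)
qed

definition frobenius_image :: "'a set" where "frobenius_image = (\<lambda>x. x [^] p) ` carrier R"

lemma subring_frobenius_image: "subring frobenius_image R"
proof (rule subringI)
  show "frobenius_image \<subseteq> carrier R" by (auto simp: frobenius_image_def)
  show "\<one> \<in> frobenius_image" unfolding frobenius_image_def by (rule image_eqI[of _ _ \<one>]) auto
  fix x y assume "x \<in> frobenius_image"
  then obtain u where u: "u \<in> carrier R" "x = u [^] p" by (auto simp: frobenius_image_def)
  show "\<ominus> x \<in> frobenius_image" unfolding frobenius_image_def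
    by (rule image_eqI[of _ _ "\<ominus> u"]) (use u frob_neg in auto)
  assume "y \<in> frobenius_image"
  then obtain v where v: "v \<in> carrier R" "y = v [^] p" by (auto simp: frobenius_image_def)
  show "x \<otimes> y \<in> frobenius_image" unfolding frobenius_image_def
    by (rule image_eqI[of _ _ "u \<otimes> v"]) (use u v in \<open>auto simp: nat_pow_distrib\<close>)
  show "x \<oplus> y \<in> frobenius_image" unfolding frobenius_image_def
    by (rule image_eqI[of _ _ "u \<oplus> v"]) (use u v frob_add in auto)
qed

end

text \<open>
  On the level of fraction fields, a purely inseparable extension of degree \<open>p\<close> generated by \<open>z\<close>; one
  denominator \<open>b\<close> serves for all of \<open>R\<close>.
\<close>

locale degree_p_extension = frobenius_domain +
  fixes M and z and b
  assumes M: "subring M R" and p_powers: "\<And>x. x \<in> carrier R \<Longrightarrow> x [^] p \<in> M" and sat_M: "saturated M"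
    and z: "z \<in> carrier R" "z \<notin> M"
    and b: "b \<in> M" "b \<noteq> \<zero>" and denominator: "\<And>y. y \<in> carrier R \<Longrightarrow> b \<otimes> y \<in> poly_span M z p"

context frobenius_domain
begin

text \<open>
  If \<open>y \<notin> M\<close>, maximality puts \<open>z\<close> into the fraction field of \<open>M[y]\<close>, which has dimension at most \<open>p\<close> over that of \<open>M\<close>. So
  \<open>1, z, \<dots>, z\<^sup>p\<^sup>-\<^sup>1, y\<close> are dependent, and the coefficient of \<open>y\<close> is nonzero as the powers of \<open>z\<close> are independent.
\<close>

lemma power_basis_denominator:
  assumes M: "subring M R" and pp: "\<And>x. x \<in> carrier R \<Longrightarrow> x [^] p \<in> M" and sat: "saturated M"
    and z: "z \<in> carrier R" "z \<notin> M"
    and max: "\<And>N. subring N R \<Longrightarrow> saturated N \<Longrightarrow> M \<subseteq> N \<Longrightarrow> z \<notin> N \<Longrightarrow> N = M"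
    and y: "y \<in> carrier R"
  shows "\<exists>a\<in>M. a \<noteq> \<zero> \<and> a \<otimes> y \<in> poly_span M z p"
proof (cases "y \<in> M")
  case True
  have "\<one> \<otimes> y = y \<otimes> z [^] (0::nat)" using y by simp
  then have "\<one> \<otimes> y \<in> poly_span M z p" using monom_in_poly_span[OF M z(1) True, of 0 p] p_pos by simp
  then show ?thesis using subringE(3)[OF M] one_not_zero by blast
next
  case False
  note Mc = subsetD[OF subringE(1)[OF M]]
  have A: "subring (adjoin M y) R" by (rule subring_adjoin[OF M y])
  note Ac = subsetD[OF subringE(1)[OF A]]
  have Asp: "adjoin M y = poly_span M y p" using adjoin_eq_span[OF M y _ pp[OF y]] p_pos by simp
  let ?N = "saturation (adjoin M y)"
  have "M \<subseteq> ?N" "y \<in> ?N" using subset_adjoin[OF M y] subset_saturation[OF A] by auto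
  then have "z \<in> ?N" using max[OF subring_saturation[OF A] saturated_saturation[OF A]] False by blast
  then obtain d where d: "d \<in> adjoin M y" "d \<noteq> \<zero>" "z \<otimes> d \<in> adjoin M y" by (auto simp: saturation_def)
  note dR = Ac[OF d(1)]
  let ?c = "d [^] p"
  have c: "?c \<in> M" "?c \<in> carrier R" "?c \<noteq> \<zero>" using pp[OF dR] dR nat_pow_nonzero[OF dR d(2)] by auto
  have "d [^] p = d \<otimes> d [^] (p - 1)" using nat_pow_mult[OF dR, of 1 "p - 1"] p_pos dR by simp
  then have "z \<otimes> ?c = (z \<otimes> d) \<otimes> d [^] (p - 1)" using z dR by (simp add: m_assoc)
  then have zc: "z \<otimes> ?c \<in> adjoin M y" using subringE(6)[OF A d(3) subring_nat_pow[OF A d(1)]] by simp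
  let ?u = "\<lambda>i. if i < p then z [^] i else y"
  have "\<exists>a. (\<forall>i\<in>{..p}. a i \<in> M) \<and> (\<exists>i\<in>{..p}. a i \<noteq> \<zero>) \<and> (\<Oplus>i\<in>{..p}. a i \<otimes> ?u i) = \<zero>"
  proof (rule poly_span_dependence[OF M y])
    show "?u i \<in> carrier R" for i using z y by simp
    fix i :: nat
    show "\<exists>e\<in>M - {\<zero>}. e \<otimes> ?u i \<in> poly_span M y p"
    proof (cases "i < p")
      case True
      have "?c [^] i \<otimes> z [^] i = (z \<otimes> ?c) [^] i" using z c by (simp add: nat_pow_distrib m_comm)
      then have "?c [^] i \<otimes> ?u i \<in> poly_span M y p"
        using True subring_nat_pow[OF A zc, of i] unfolding Asp[symmetric] by simp
      then show ?thesis using subring_nat_pow[OF M c(1), of i] nat_pow_nonzero[OF c(2,3), of i] by blast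
    next
      case False
      then have "\<one> \<otimes> ?u i \<in> poly_span M y p" using y subset_adjoin(2)[OF M y] unfolding Asp by simp
      then show ?thesis using subringE(3)[OF M] one_not_zero by blast
    qed
  qed auto
  then obtain a where a: "\<And>i. i \<le> p \<Longrightarrow> a i \<in> M" "\<exists>i\<le>p. a i \<noteq> \<zero>" "(\<Oplus>i\<in>{..p}. a i \<otimes> ?u i) = \<zero>" by auto
  have aR: "a i \<in> carrier R" if "i \<le> p" for i by (rule Mc[OF a(1)[OF that]])
  have "{..p} = insert p {..<p}" by auto
  then have "(\<Oplus>i\<in>{..p}. a i \<otimes> ?u i) = a p \<otimes> y \<oplus> (\<Oplus>i\<in>{..<p}. a i \<otimes> ?u i)"
    using aR y z by (simp add: finsum_insert Pi_def)
  also have "(\<Oplus>i\<in>{..<p}. a i \<otimes> ?u i) = (\<Oplus>i\<in>{..<p}. a i \<otimes> z [^] i)"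
    using aR z by (intro finsum_cong') auto
  finally have sum: "a p \<otimes> y \<oplus> (\<Oplus>i\<in>{..<p}. a i \<otimes> z [^] i) = \<zero>" using a(3) by simp
  have sR: "(\<Oplus>i\<in>{..<p}. a i \<otimes> z [^] i) \<in> carrier R" using aR z by (intro finsum_closed) auto
  have "a p \<noteq> \<zero>"
  proof
    assume 0: "a p = \<zero>"
    then have "(\<Oplus>i\<in>{..<p}. a i \<otimes> z [^] i) = \<zero>" using sum sR y by simp
    then have "\<forall>i<p. a i = \<zero>"
      using sat a(1) by (intro independent_powers[OF prime_p odd_p char_p M _ z pp[OF z(1)]]) (auto simp: saturated_def)
    then show False using 0 a(2) by (auto simp: le_less)
  qed
  moreover have "a p \<otimes> y \<in> poly_span M z p"
  proof -
    have "(\<Oplus>i\<in>{..<p}. (\<ominus> \<one> \<otimes> a i) \<otimes> z [^] i) = (\<Oplus>i\<in>{..<p}. \<ominus> \<one> \<otimes> (a i \<otimes> z [^] i))"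
      using aR z by (intro finsum_cong') (auto simp: m_assoc)
    also have "\<dots> = \<ominus> \<one> \<otimes> (\<Oplus>i\<in>{..<p}. a i \<otimes> z [^] i)" using aR z by (intro finsum_rdistr[symmetric]) auto
    also have "\<dots> = a p \<otimes> y" using minus_equality[OF sum] sR aR y by (simp add: l_minus)
    finally show ?thesis
      using a(1) by (intro poly_spanI[of p "\<lambda>i. \<ominus> \<one> \<otimes> a i"] subringE(6)[OF M] subringE(5)[OF M] subringE(3)[OF M]) auto
  qed
  ultimately show ?thesis using a(1)[of p] by auto
qed

text \<open>
  Adjoin the generators one at a time; as their \<open>p\<close>-th powers lie in \<open>M\<close>, powers up to \<open>p - 1\<close> suffice, and the
  product of the denominators found so far with a \<open>p\<close>-th power of the new one works.
\<close>

lemma common_denominator: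
  assumes M: "subring M R" and pp: "\<And>x. x \<in> carrier R \<Longrightarrow> x [^] p \<in> M" and z: "z \<in> carrier R"
    and den: "\<And>y. y \<in> carrier R \<Longrightarrow> \<exists>a\<in>M. a \<noteq> \<zero> \<and> a \<otimes> y \<in> poly_span M z p"
    and ts: "set ts \<subseteq> carrier R"
  shows "\<exists>b\<in>M. b \<noteq> \<zero> \<and> (\<forall>y\<in>generate_ring R (M \<union> set ts). b \<otimes> y \<in> poly_span M z p)"
  using ts
proof (induction ts)
  case Nil
  note Mc = subringE(1)[OF M]
  have "generate_ring R M = M" using generate_ring_min_subring1[OF Mc M] generate_ring.incl[of _ M R] by blast
  moreover have "\<one> \<otimes> y \<in> poly_span M z p" if "y \<in> M" for y
    using monom_in_poly_span[OF M z that, of 0 p] p_pos that Mc by auto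
  ultimately show ?case using subringE(3)[OF M] one_not_zero by (intro bexI[of _ \<one>]) simp_all
next
  case (Cons t ts)
  let ?S = "generate_ring R (M \<union> set ts)" and ?L = "poly_span M z p"
  have t: "t \<in> carrier R" and ts: "set ts \<subseteq> carrier R" using Cons.prems by auto
  have gen: "M \<union> set ts \<subseteq> carrier R" using subringE(1)[OF M] ts by auto
  have S: "subring ?S R" by (rule generate_ring_is_subring[OF gen])
  have MS: "M \<subseteq> ?S" using generate_ring.incl[of _ "M \<union> set ts" R] by blast
  have L: "?L = adjoin M z" using adjoin_eq_span[OF M z _ pp[OF z]] p_pos by simp
  have Ls: "subring ?L R" unfolding L by (rule subring_adjoin[OF M z])
  have M_L: "M \<subseteq> ?L" unfolding L by (rule subset_adjoin[OF M z])
  have T: "generate_ring R (M \<union> set (t # ts)) = poly_span ?S t p"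
    using adjoin_generate_ring[OF gen t] adjoin_eq_span[OF S t, of p] MS pp[OF t] p_pos by auto
  obtain b where b: "b \<in> M" "b \<noteq> \<zero>" "\<And>y. y \<in> ?S \<Longrightarrow> b \<otimes> y \<in> ?L" using Cons.IH[OF ts] by blast
  obtain a where a: "a \<in> M" "a \<noteq> \<zero>" "a \<otimes> t \<in> ?L" using den[OF t] by blast
  note c = subsetD[OF subringE(1)[OF M]]
  have bR: "b \<in> carrier R" and aR: "a \<in> carrier R" using c a b by auto
  let ?b = "b \<otimes> a [^] p"
  have "?b \<otimes> y \<in> ?L" if "y \<in> generate_ring R (M \<union> set (t # ts))" for y
  proof -
    obtain r where r: "\<And>i. i < p \<Longrightarrow> r i \<in> ?S" "y = (\<Oplus>i\<in>{..<p}. r i \<otimes> t [^] i)"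
      using \<open>y \<in> _\<close> unfolding T by (auto simp: poly_span_def)
    have rR: "r i \<in> carrier R" if "i < p" for i using r(1)[OF that] subringE(1)[OF S] by blast
    have "?b \<otimes> y = (\<Oplus>i\<in>{..<p}. ?b \<otimes> (r i \<otimes> t [^] i))"
      unfolding r(2) using rR t aR bR by (intro finsum_rdistr) auto
    also have "\<dots> \<in> ?L"
    proof (rule subring_finsum[OF Ls])
      fix i assume "i \<in> {..<p}"
      then have i: "i < p" by simp
      have "a [^] p = a [^] i \<otimes> a [^] (p - i)" using nat_pow_mult[OF aR, of i "p - i"] i by simp
      then have "?b \<otimes> (r i \<otimes> t [^] i) = ((b \<otimes> r i) \<otimes> (a \<otimes> t) [^] i) \<otimes> a [^] (p - i)"
        using rR[OF i] t aR bR by (simp add: nat_pow_distrib m_ac)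
      also have "\<dots> \<in> ?L"
        using M_L a(1) by (intro subringE(6)[OF Ls] b(3) r(1)[OF i] subring_nat_pow[OF Ls] a(3)) auto
      finally show "?b \<otimes> (r i \<otimes> t [^] i) \<in> ?L" .
    qed simp
    finally show ?thesis .
  qed
  moreover have "?b \<in> M" "?b \<noteq> \<zero>"
    using subringE(6)[OF M b(1) subring_nat_pow[OF M a(1)]] nat_pow_nonzero[OF aR a(2), of p] b bR aR
    by (auto simp: integral_iff)
  ultimately show ?case by blast
qed

lemma exists_degree_p_extension:
  assumes sat: "saturated frobenius_image" and z: "z \<in> carrier R" "z \<notin> frobenius_image"
    and ts: "set ts \<subseteq> carrier R" and gen: "generate_ring R (frobenius_image \<union> set ts) = carrier R"
  shows "\<exists>M b. degree_p_extension R p M z b"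
proof -
  obtain M where M: "subring M R" "frobenius_image \<subseteq> M" "saturated M" "z \<notin> M"
    and max: "\<And>N. subring N R \<Longrightarrow> saturated N \<Longrightarrow> M \<subseteq> N \<Longrightarrow> z \<notin> N \<Longrightarrow> N = M"
    using exists_maximal_saturated_subring[OF subring_frobenius_image sat z(2)] by blast
  have pp: "x [^] p \<in> M" if "x \<in> carrier R" for x using M(2) that by (auto simp: frobenius_image_def)
  have Mc: "M \<union> set ts \<subseteq> carrier R" using subringE(1)[OF M(1)] ts by auto
  have "generate_ring R (M \<union> set ts) = carrier R"
    using mono_generate_ring[OF _ Mc, of "frobenius_image \<union> set ts"] M(2) gen generate_ring_incl[OF Mc] by auto
  then obtain b where b: "b \<in> M" "b \<noteq> \<zero>" "\<And>y. y \<in> carrier R \<Longrightarrow> b \<otimes> y \<in> poly_span M z p"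
    using common_denominator[OF M(1) pp z(1) power_basis_denominator[OF M(1) pp M(3) z(1) M(4) max] ts] by auto
  then have "degree_p_extension R p M z b"
    by (intro degree_p_extension.intro frobenius_domain_axioms degree_p_extension_axioms.intro M(1) pp M(3) z(1) M(4) b)
  then show ?thesis by blast
qed

end

section \<open>A derivation with a Cartier operator\<close>

context frobenius_domain
begin

abbreviation nat_elem :: "nat \<Rightarrow> 'a" where "nat_elem k \<equiv> add_pow R k \<one>"

lemma nat_elem_add: "nat_elem (i + j) = nat_elem i \<oplus> nat_elem j" by (simp add: add.nat_pow_mult)

lemma nat_elem_mult: "nat_elem (i * j) = nat_elem i \<otimes> nat_elem j"
  by (simp add: add_pow_ldistr add.nat_pow_pow mult.commute)

lemma nat_elem_mod: "nat_elem n = nat_elem (n mod p)"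
proof -
  have "nat_elem n = nat_elem (p * (n div p) + n mod p)" by simp
  also have "\<dots> = nat_elem (n mod p)" unfolding nat_elem_add nat_elem_mult char_p by simp
  finally show ?thesis .
qed

lemma nat_elem_nonzero: "0 < k \<Longrightarrow> k < p \<Longrightarrow> nat_elem k \<noteq> \<zero>"
proof
  assume k: "0 < k" "k < p" and 0: "nat_elem k = \<zero>"
  have "coprime k p" using k prime_p by (metis coprime_commute nat_dvd_not_less prime_imp_coprime_nat)
  then obtain u v where "k * u = p * v + 1" using bezout_nat[of k p] k by auto
  then have "nat_elem k \<otimes> nat_elem u = nat_elem p \<otimes> nat_elem v \<oplus> \<one>" using nat_elem_mult[of k u] nat_elem_mult[of p v] nat_elem_add[of "p * v" 1] by simp
  then show False using 0 char_p by simp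
qed

lemma nat_elem_frob: "nat_elem k [^] p = nat_elem k"
  by (induction k) (simp_all add: zero_pow_p frob_add)

lemma nat_elem_in_subring: "subring M R \<Longrightarrow> nat_elem k \<in> M"
  by (induction k) (simp_all add: subringE(2,3,7))

lemma binom_nat_elem:
  assumes "x \<in> carrier R" "y \<in> carrier R"
  shows "(x \<oplus> y) [^] n = (\<Oplus>k\<in>{..n}. nat_elem (n choose k) \<otimes> (x [^] k \<otimes> y [^] (n - k)))"
proof -
  have "(x \<oplus> y) [^] n = ordered_binom x y n"
  proof (induction n)
    case (Suc n)
    then show ?case using assms by (simp add: ordered_binom_Suc l_distr r_distr m_comm)
  qed (use assms in \<open>simp add: ordered_binom_0\<close>)
  also have "\<dots> = (\<Oplus>k\<in>{..n}. nat_elem (n choose k) \<otimes> (x [^] k \<otimes> y [^] (n - k)))"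
    unfolding ordered_binom_def using assms by (intro finsum_cong') (auto simp: add_pow_ldistr)
  finally show ?thesis .
qed

end

lemma (in abelian_group) additive_map_zero:
  assumes "f \<in> carrier G \<rightarrow> carrier G" "\<And>x y. x \<in> carrier G \<Longrightarrow> y \<in> carrier G \<Longrightarrow> f (x \<oplus> y) = f x \<oplus> f y"
  shows "f \<zero> = \<zero>"
  using assms(2)[of \<zero> \<zero>] assms(1) add_eq_selfD[of "f \<zero>" "f \<zero>"] by auto

lemma (in abelian_group) additive_map_finsum:
  assumes f: "f \<in> carrier G \<rightarrow> carrier G" "\<And>x y. x \<in> carrier G \<Longrightarrow> y \<in> carrier G \<Longrightarrow> f (x \<oplus> y) = f x \<oplus> f y"
    and "finite I" "\<And>i. i \<in> I \<Longrightarrow> g i \<in> carrier G"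
  shows "f (\<Oplus>i\<in>I. g i) = (\<Oplus>i\<in>I. f (g i))"
  using assms(3,4)
proof (induction I rule: finite_induct)
  case empty
  then show ?case using additive_map_zero[OF f] by simp
next
  case (insert x I)
  then have "f (\<Oplus>i\<in>insert x I. g i) = f (g x) \<oplus> f (\<Oplus>i\<in>I. g i)"
    using f(2) by (subst finsum_insert) auto
  also have "\<dots> = (\<Oplus>i\<in>insert x I. f (g i))"
    using insert f(1) by (subst finsum_insert) auto
  finally show ?case .
qed

context degree_p_extension
begin

lemmas M_carrier = subsetD[OF subringE(1)[OF M]]

lemma zp: "z [^] p \<in> M" using p_powers z(1) by simp

definition is_coord :: "'a \<Rightarrow> (nat \<Rightarrow> 'a) \<Rightarrow> bool" where
  "is_coord y c \<longleftrightarrow> (\<forall>i<p. c i \<in> M) \<and> b \<otimes> y = (\<Oplus>i\<in>{..<p}. c i \<otimes> z [^] i)"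

text \<open>
  The coordinates of \<open>b y\<close> in the basis \<open>1, z, \<dots>, z\<^sup>p\<^sup>-\<^sup>1\<close>.
\<close>

definition coord :: "'a \<Rightarrow> nat \<Rightarrow> 'a" where
  "coord y = (SOME c. is_coord y c)"

lemma coord:
  assumes "y \<in> carrier R"
  shows "i < p \<Longrightarrow> coord y i \<in> M" and "b \<otimes> y = (\<Oplus>i\<in>{..<p}. coord y i \<otimes> z [^] i)"
proof -
  have "\<exists>c. is_coord y c" using denominator[OF assms] by (auto simp: is_coord_def poly_span_def)
  then have "is_coord y (coord y)" unfolding coord_def by (rule someI_ex)
  then show "i < p \<Longrightarrow> coord y i \<in> M" and "b \<otimes> y = (\<Oplus>i\<in>{..<p}. coord y i \<otimes> z [^] i)"
    by (auto simp: is_coord_def)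
qed

lemma coord_closed: "y \<in> carrier R \<Longrightarrow> i < p \<Longrightarrow> coord y i \<in> carrier R"
  using coord(1) M_carrier by blast

lemma coord_unique:
  assumes y: "y \<in> carrier R" and c: "\<And>i. i < p \<Longrightarrow> c i \<in> M" "b \<otimes> y = (\<Oplus>i\<in>{..<p}. c i \<otimes> z [^] i)" and i: "i < p"
  shows "coord y i = c i"
proof -
  let ?d = "\<lambda>i. coord y i \<oplus> (\<ominus> \<one>) \<otimes> c i"
  have cR: "c i \<in> carrier R" if "i < p" for i by (rule M_carrier[OF c(1)[OF that]])
  note kR = coord_closed[OF y]
  have "\<forall>i<p. ?d i = \<zero>"
  proof (rule independent_powers[OF prime_p odd_p char_p M _ z zp])
    show "?d i \<in> M" if "i < p" for i
      using coord(1)[OF y that] c(1)[OF that] by (intro subringE(3,5,6,7)[OF M])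
    have "(\<Oplus>i\<in>{..<p}. ?d i \<otimes> z [^] i) = (\<Oplus>i\<in>{..<p}. coord y i \<otimes> z [^] i \<oplus> (\<ominus> \<one>) \<otimes> (c i \<otimes> z [^] i))"
      using kR cR z(1) by (intro finsum_cong') (auto simp: l_distr m_assoc)
    also have "\<dots> = (\<Oplus>i\<in>{..<p}. coord y i \<otimes> z [^] i) \<oplus> (\<Oplus>i\<in>{..<p}. (\<ominus> \<one>) \<otimes> (c i \<otimes> z [^] i))"
      using kR cR z(1) by (intro finsum_addf) auto
    also have "(\<Oplus>i\<in>{..<p}. (\<ominus> \<one>) \<otimes> (c i \<otimes> z [^] i)) = (\<ominus> \<one>) \<otimes> (b \<otimes> y)"
      unfolding c(2) using cR z(1) by (intro finsum_rdistr[symmetric]) auto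
    finally show "(\<Oplus>i\<in>{..<p}. ?d i \<otimes> z [^] i) = \<zero>"
      using M_carrier[OF b(1)] y unfolding coord(2)[OF y, symmetric] by (simp add: l_minus r_neg)
  qed (use sat_M in \<open>auto simp: saturated_def\<close>)
  then have "coord y i \<oplus> \<ominus> \<one> \<otimes> c i = \<zero>" using i by blast
  then have "coord y i \<oplus> \<ominus> c i = \<zero>" using cR[OF i] by (simp add: l_minus)
  then show ?thesis using r_right_minus_eq[OF kR[OF i] cR[OF i]] by (simp add: minus_eq)
qed

lemma coord_add:
  assumes "x \<in> carrier R" "y \<in> carrier R" "i < p"
  shows "coord (x \<oplus> y) i = coord x i \<oplus> coord y i"
proof (rule coord_unique)
  show "coord x i \<oplus> coord y i \<in> M" if "i < p" for i using assms that by (intro subringE(7)[OF M] coord(1))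
  have "(\<Oplus>i\<in>{..<p}. (coord x i \<oplus> coord y i) \<otimes> z [^] i) = (\<Oplus>i\<in>{..<p}. coord x i \<otimes> z [^] i \<oplus> coord y i \<otimes> z [^] i)"
    using assms z(1) coord_closed by (intro finsum_cong') (auto simp: l_distr)
  also have "\<dots> = b \<otimes> x \<oplus> b \<otimes> y"
    unfolding coord(2)[OF assms(1)] coord(2)[OF assms(2)] using assms z(1) coord_closed by (intro finsum_addf) auto
  finally show "b \<otimes> (x \<oplus> y) = (\<Oplus>i\<in>{..<p}. (coord x i \<oplus> coord y i) \<otimes> z [^] i)"
    using assms M_carrier[OF b(1)] by (simp add: r_distr)
qed (use assms in auto)

lemma coord_scale:
  assumes "m \<in> M" "y \<in> carrier R" "i < p"
  shows "coord (m \<otimes> y) i = m \<otimes> coord y i"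
proof (rule coord_unique)
  note mR = M_carrier[OF assms(1)]
  show "m \<otimes> coord y i \<in> M" if "i < p" for i using assms that by (intro subringE(6)[OF M] coord(1))
  have "(\<Oplus>i\<in>{..<p}. (m \<otimes> coord y i) \<otimes> z [^] i) = (\<Oplus>i\<in>{..<p}. m \<otimes> (coord y i \<otimes> z [^] i))"
    using assms mR z(1) coord_closed by (intro finsum_cong') (auto simp: m_assoc)
  also have "\<dots> = m \<otimes> (b \<otimes> y)"
    unfolding coord(2)[OF assms(2)] using assms mR z(1) coord_closed by (intro finsum_rdistr[symmetric]) auto
  finally show "b \<otimes> (m \<otimes> y) = (\<Oplus>i\<in>{..<p}. (m \<otimes> coord y i) \<otimes> z [^] i)"
    using assms mR M_carrier[OF b(1)] by (simp add: m_lcomm)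
qed (use assms M_carrier in auto)

lemma pow_z_split: "z [^] n = (z [^] p) [^] (n div p) \<otimes> z [^] (n mod p)"
  using nat_pow_mult[OF z(1), of "p * (n div p)" "n mod p"] z(1) by (simp add: nat_pow_pow)

lemma coord_pow:
  assumes "i < p"
  shows "coord (z [^] n) i = (if n mod p = i then b \<otimes> (z [^] p) [^] (n div p) else \<zero>)"
proof (rule coord_unique[OF _ _ _ assms])
  let ?m = "b \<otimes> (z [^] p) [^] (n div p)"
  have m: "?m \<in> M" by (intro subringE(6)[OF M] b(1) subring_nat_pow[OF M] zp)
  note mR = M_carrier[OF m]
  show "z [^] n \<in> carrier R" using z(1) by simp
  show "(if n mod p = i then ?m else \<zero>) \<in> M" for i using m subringE(2)[OF M] by simp
  have "(\<Oplus>i\<in>{..<p}. (if n mod p = i then ?m else \<zero>) \<otimes> z [^] i) = (\<Oplus>i\<in>{..<p}. if n mod p = i then ?m \<otimes> z [^] i else \<zero>)"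
    using mR z(1) M_carrier[OF b(1)] by (intro finsum_cong') auto
  also have "\<dots> = ?m \<otimes> z [^] (n mod p)"
    using finsum_singleton[of "n mod p" "{..<p}" "\<lambda>i. ?m \<otimes> z [^] i"] p_pos mR z(1) M_carrier[OF b(1)] by auto
  finally show "b \<otimes> z [^] n = (\<Oplus>i\<in>{..<p}. (if n mod p = i then ?m else \<zero>) \<otimes> z [^] i)"
    unfolding pow_z_split[of n] using z(1) M_carrier[OF b(1)] by (simp add: m_assoc)
qed

text \<open>
  \<open>b \<cdot> \<partial>/\<partial>z\<close>, where \<open>\<partial>/\<partial>z\<close> is the derivation of the fraction field that kills \<open>M\<close>.
\<close>

definition der :: "'a \<Rightarrow> 'a" where
  "der y = (\<Oplus>i\<in>{..<p}. nat_elem i \<otimes> (coord y i \<otimes> z [^] (i - 1)))"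

text \<open>
  The coefficient of \<open>z\<^sup>p\<^sup>-\<^sup>1\<close>, the part of a function that is not a derivative with respect to \<open>z\<close>: up to the factor \<open>b\<close>, the Cartier
  operator in the variable \<open>z\<close> with values still raised to the \<open>p\<close>-th power.
\<close>

definition cartier :: "'a \<Rightarrow> 'a" where "cartier y = coord y (p - 1)"

lemma der_closed: "y \<in> carrier R \<Longrightarrow> der y \<in> carrier R"
  unfolding der_def using z(1) coord_closed by (intro finsum_closed) auto

lemma der_add:
  assumes "x \<in> carrier R" "y \<in> carrier R"
  shows "der (x \<oplus> y) = der x \<oplus> der y"
proof -
  have "der (x \<oplus> y) = (\<Oplus>i\<in>{..<p}. nat_elem i \<otimes> (coord x i \<otimes> z [^] (i - 1)) \<oplus> nat_elem i \<otimes> (coord y i \<otimes> z [^] (i - 1)))"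
    unfolding der_def using assms z(1) coord_closed by (intro finsum_cong') (auto simp: coord_add l_distr r_distr)
  also have "\<dots> = der x \<oplus> der y"
    unfolding der_def using assms z(1) coord_closed by (intro finsum_addf) auto
  finally show ?thesis .
qed

lemma der_scale:
  assumes "m \<in> M" "y \<in> carrier R"
  shows "der (m \<otimes> y) = m \<otimes> der y"
proof -
  note mR = M_carrier[OF assms(1)]
  have "der (m \<otimes> y) = (\<Oplus>i\<in>{..<p}. m \<otimes> (nat_elem i \<otimes> (coord y i \<otimes> z [^] (i - 1))))"
    unfolding der_def using assms mR z(1) coord_closed by (intro finsum_cong') (auto simp: coord_scale m_ac)
  also have "\<dots> = m \<otimes> der y"
    unfolding der_def using assms mR z(1) coord_closed by (intro finsum_rdistr[symmetric]) auto
  finally show ?thesis .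
qed

lemma der_pow: "der (z [^] n) = nat_elem n \<otimes> (b \<otimes> z [^] (n - 1))"
proof -
  note bR = M_carrier[OF b(1)]
  let ?m = "b \<otimes> (z [^] p) [^] (n div p)"
  have m: "?m \<in> carrier R" using bR z(1) by simp
  have "der (z [^] n) = (\<Oplus>i\<in>{..<p}. if n mod p = i then nat_elem i \<otimes> (?m \<otimes> z [^] (i - 1)) else \<zero>)"
    unfolding der_def using m z(1) by (intro finsum_cong') (auto simp: coord_pow)
  also have "\<dots> = nat_elem (n mod p) \<otimes> (?m \<otimes> z [^] (n mod p - 1))"
    using finsum_singleton[of "n mod p" "{..<p}" "\<lambda>i. nat_elem i \<otimes> (?m \<otimes> z [^] (i - 1))"] p_pos m z(1) by auto
  also have "\<dots> = nat_elem n \<otimes> (b \<otimes> z [^] (n - 1))"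
  proof (cases "n mod p = 0")
    case True
    then show ?thesis using nat_elem_mod[of n] m bR z(1) by simp
  next
    case False
    have "n - 1 = p * (n div p) + (n mod p - 1)" using False mult_div_mod_eq[of p n] by linarith
    then have "z [^] (n - 1) = (z [^] p) [^] (n div p) \<otimes> z [^] (n mod p - 1)"
      using nat_pow_mult[OF z(1), of "p * (n div p)" "n mod p - 1"] z(1) by (simp add: nat_pow_pow)
    then show ?thesis using nat_elem_mod[of n] bR z(1) by (simp add: m_assoc)
  qed
  finally show ?thesis .
qed

lemma cartier_closed: "y \<in> carrier R \<Longrightarrow> cartier y \<in> carrier R"
  unfolding cartier_def using coord_closed p_pos by simp

lemma cartier_add: "x \<in> carrier R \<Longrightarrow> y \<in> carrier R \<Longrightarrow> cartier (x \<oplus> y) = cartier x \<oplus> cartier y"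
  unfolding cartier_def using coord_add p_pos by simp

lemma cartier_scale: "m \<in> M \<Longrightarrow> y \<in> carrier R \<Longrightarrow> cartier (m \<otimes> y) = m \<otimes> cartier y"
  unfolding cartier_def using coord_scale p_pos by simp

lemma cartier_zero: "cartier \<zero> = \<zero>"
  by (rule additive_map_zero) (auto simp: cartier_closed cartier_add)

lemma cartier_pow:
  "cartier (z [^] n) = (if n mod p = p - 1 then b \<otimes> (z [^] p) [^] (n div p) else \<zero>)"
  unfolding cartier_def using coord_pow[of "p - 1" n] p_pos by simp

text \<open>
  Every element is, up to the denominator \<open>b\<close>, an \<open>M\<close>-combination of the powers of \<open>z\<close>. The twist \<open>tw\<close> is the identity
  for \<open>M\<close>-linear maps and the \<open>p\<close>-th power for semilinear ones.
\<close>

lemma agree_on_powers: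
  assumes f: "f \<in> carrier R \<rightarrow> carrier R" "\<And>x y. x \<in> carrier R \<Longrightarrow> y \<in> carrier R \<Longrightarrow> f (x \<oplus> y) = f x \<oplus> f y"
    "\<And>m y. m \<in> M \<Longrightarrow> y \<in> carrier R \<Longrightarrow> f (m \<otimes> y) = tw m \<otimes> f y"
    and g: "g \<in> carrier R \<rightarrow> carrier R" "\<And>x y. x \<in> carrier R \<Longrightarrow> y \<in> carrier R \<Longrightarrow> g (x \<oplus> y) = g x \<oplus> g y"
    "\<And>m y. m \<in> M \<Longrightarrow> y \<in> carrier R \<Longrightarrow> g (m \<otimes> y) = tw m \<otimes> g y"
    and twist: "\<And>m. m \<in> M \<Longrightarrow> tw m \<in> carrier R" "tw b \<noteq> \<zero>"
    and eq: "\<And>i. i < p \<Longrightarrow> f (z [^] i) = g (z [^] i)" and y: "y \<in> carrier R"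
  shows "f y = g y"
proof -
  have "tw b \<otimes> f y = f (b \<otimes> y)" using f(3)[OF b(1) y] by simp
  also have "\<dots> = (\<Oplus>i\<in>{..<p}. f (coord y i \<otimes> z [^] i))"
    unfolding coord(2)[OF y] using coord_closed[OF y] z(1) by (intro additive_map_finsum[OF f(1,2)]) auto
  also have "\<dots> = (\<Oplus>i\<in>{..<p}. g (coord y i \<otimes> z [^] i))"
    using g(1) coord_closed[OF y] coord(1)[OF y] z(1) eq f(3) g(3) by (intro finsum_cong') auto
  also have "\<dots> = g (b \<otimes> y)"
    unfolding coord(2)[OF y] using coord_closed[OF y] z(1) by (intro additive_map_finsum[OF g(1,2), symmetric]) auto
  also have "\<dots> = tw b \<otimes> g y" using g(3)[OF b(1) y] by simp
  finally show ?thesis using m_lcancel[of "tw b" "f y" "g y"] twist b(1) f(1) g(1) y by auto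
qed

lemma der_mult_pow:
  fixes j :: nat
  assumes x: "x \<in> carrier R"
  shows "der (x \<otimes> z [^] j) = x \<otimes> der (z [^] j) \<oplus> z [^] j \<otimes> der x"
proof (rule agree_on_powers[where tw = "\<lambda>m. m" and f = "\<lambda>x. der (x \<otimes> z [^] j)"
      and g = "\<lambda>x. x \<otimes> der (z [^] j) \<oplus> z [^] j \<otimes> der x"])
  show "(\<lambda>x. der (x \<otimes> z [^] j)) \<in> carrier R \<rightarrow> carrier R" using der_closed z(1) by auto
  show "(\<lambda>x. x \<otimes> der (z [^] j) \<oplus> z [^] j \<otimes> der x) \<in> carrier R \<rightarrow> carrier R" using der_closed z(1) by auto
  show "der ((x \<oplus> y) \<otimes> z [^] j) = der (x \<otimes> z [^] j) \<oplus> der (y \<otimes> z [^] j)" if "x \<in> carrier R" "y \<in> carrier R" for x y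
    using that z(1) by (simp add: l_distr der_add)
  show "der ((m \<otimes> y) \<otimes> z [^] j) = m \<otimes> der (y \<otimes> z [^] j)" if "m \<in> M" "y \<in> carrier R" for m y
    using that z(1) M_carrier[OF that(1)] by (simp add: m_assoc der_scale)
  show "(x \<oplus> y) \<otimes> der (z [^] j) \<oplus> z [^] j \<otimes> der (x \<oplus> y) =
      (x \<otimes> der (z [^] j) \<oplus> z [^] j \<otimes> der x) \<oplus> (y \<otimes> der (z [^] j) \<oplus> z [^] j \<otimes> der y)"
    if "x \<in> carrier R" "y \<in> carrier R" for x y
    using that z(1) der_closed by (simp add: der_add l_distr r_distr a_ac)
  show "(m \<otimes> y) \<otimes> der (z [^] j) \<oplus> z [^] j \<otimes> der (m \<otimes> y) = m \<otimes> (y \<otimes> der (z [^] j) \<oplus> z [^] j \<otimes> der y)"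
    if "m \<in> M" "y \<in> carrier R" for m y
    using that z(1) der_closed M_carrier[OF that(1)] by (simp add: der_scale r_distr m_ac)
  fix i
  note bR = M_carrier[OF b(1)]
  let ?v = "b \<otimes> z [^] (i + j - 1)"
  have pull: "z [^] i \<otimes> der (z [^] j) = nat_elem j \<otimes> (b \<otimes> z [^] (i + j - 1))" for i j :: nat
  proof (cases j)
    case 0
    then show ?thesis unfolding der_pow using bR z(1) by simp
  next
    case (Suc j')
    have "u \<otimes> (v \<otimes> (b \<otimes> w)) = v \<otimes> (b \<otimes> (u \<otimes> w))" if "u \<in> carrier R" "v \<in> carrier R" "w \<in> carrier R" for u v w
      using that bR by (simp add: m_lcomm)
    then have "z [^] i \<otimes> (nat_elem j \<otimes> (b \<otimes> z [^] j')) = nat_elem j \<otimes> (b \<otimes> (z [^] i \<otimes> z [^] j'))" using z(1) by simp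
    moreover have "j - 1 = j'" "i + j - 1 = i + j'" using Suc by auto
    ultimately show ?thesis unfolding der_pow using nat_pow_mult[OF z(1), of i j'] by simp
  qed
  have "z [^] i \<otimes> der (z [^] j) = nat_elem j \<otimes> ?v" by (rule pull)
  moreover have "z [^] j \<otimes> der (z [^] i) = nat_elem i \<otimes> ?v" using pull[of j i] by (simp add: add.commute)
  moreover have "der (z [^] i \<otimes> z [^] j) = nat_elem (i + j) \<otimes> ?v" using nat_pow_mult[OF z(1), of i j] der_pow[of "i + j"] by simp
  ultimately show "der (z [^] i \<otimes> z [^] j) = z [^] i \<otimes> der (z [^] j) \<oplus> z [^] j \<otimes> der (z [^] i)"
    using bR z(1) by (simp only: nat_elem_add) (simp add: l_distr a_comm)
qed (use x b M_carrier in auto)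

lemma der_mult:
  assumes x: "x \<in> carrier R" and y: "y \<in> carrier R"
  shows "der (x \<otimes> y) = x \<otimes> der y \<oplus> y \<otimes> der x"
proof (rule agree_on_powers[where tw = "\<lambda>m. m" and f = "\<lambda>y. der (x \<otimes> y)" and g = "\<lambda>y. x \<otimes> der y \<oplus> y \<otimes> der x"])
  show "(\<lambda>y. der (x \<otimes> y)) \<in> carrier R \<rightarrow> carrier R" using der_closed x by auto
  show "(\<lambda>y. x \<otimes> der y \<oplus> y \<otimes> der x) \<in> carrier R \<rightarrow> carrier R" using der_closed x by auto
  show "der (x \<otimes> (u \<oplus> v)) = der (x \<otimes> u) \<oplus> der (x \<otimes> v)" if "u \<in> carrier R" "v \<in> carrier R" for u v
    using that x by (simp add: r_distr der_add)
  show "der (x \<otimes> (m \<otimes> y)) = m \<otimes> der (x \<otimes> y)" if "m \<in> M" "y \<in> carrier R" for m y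
    using that x M_carrier[OF that(1)] by (simp add: m_lcomm der_scale)
  show "x \<otimes> der (u \<oplus> v) \<oplus> (u \<oplus> v) \<otimes> der x = (x \<otimes> der u \<oplus> u \<otimes> der x) \<oplus> (x \<otimes> der v \<oplus> v \<otimes> der x)"
    if "u \<in> carrier R" "v \<in> carrier R" for u v
    using that x der_closed by (simp add: der_add l_distr r_distr a_ac)
  show "x \<otimes> der (m \<otimes> y) \<oplus> (m \<otimes> y) \<otimes> der x = m \<otimes> (x \<otimes> der y \<oplus> y \<otimes> der x)"
    if "m \<in> M" "y \<in> carrier R" for m y
    using that x der_closed M_carrier[OF that(1)] by (simp add: der_scale r_distr m_ac)
  show "der (x \<otimes> z [^] i) = x \<otimes> der (z [^] i) \<oplus> z [^] i \<otimes> der x" for i :: nat by (rule der_mult_pow[OF x])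
qed (use y b M_carrier in auto)

lemma der_M: "m \<in> M \<Longrightarrow> der m = \<zero>"
  using der_scale[of m \<one>] der_pow[of 0] M_carrier[of m] M_carrier[OF b(1)] by simp

lemma der_z: "der z = b"
  using der_pow[of 1] M_carrier[OF b(1)] z(1) by simp

lemma der_nat_pow:
  assumes x: "x \<in> carrier R"
  shows "der (x [^] Suc n) = nat_elem (Suc n) \<otimes> (x [^] n \<otimes> der x)"
proof (induction n)
  case 0
  then show ?case using x der_closed by simp
next
  case (Suc n)
  have "der (x [^] Suc (Suc n)) = x [^] Suc n \<otimes> der x \<oplus> x \<otimes> der (x [^] Suc n)"
    using der_mult[of "x [^] Suc n" x] x by simp
  also have "x \<otimes> der (x [^] Suc n) = nat_elem (Suc n) \<otimes> (x [^] Suc n \<otimes> der x)"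
    unfolding Suc.IH using x der_closed by (simp add: m_ac)
  finally show ?case using x der_closed nat_elem_add[of 1 "Suc n"] by (simp add: l_distr del: nat_pow_Suc)
qed

lemma cartier_der:
  assumes y: "y \<in> carrier R"
  shows "cartier (der y) = \<zero>"
proof (rule agree_on_powers[where tw = "\<lambda>m. m" and f = "\<lambda>y. cartier (der y)" and g = "\<lambda>_. \<zero>"])
  note bR = M_carrier[OF b(1)]
  show "cartier (der (z [^] i)) = \<zero>" if i: "i < p" for i
  proof (cases i)
    case 0
    then show ?thesis using der_pow[of 0] bR cartier_zero by simp
  next
    case (Suc i')
    have "nat_elem i \<otimes> b \<in> M" by (intro subringE(6)[OF M] nat_elem_in_subring[OF M] b(1))
    moreover have "der (z [^] i) = (nat_elem i \<otimes> b) \<otimes> z [^] i'" unfolding der_pow Suc using bR z(1) by (simp add: m_assoc)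
    moreover have "cartier (z [^] i') = \<zero>"
    proof -
      have "i' mod p \<noteq> p - 1" using i Suc by simp
      then show ?thesis unfolding cartier_pow by simp
    qed
    ultimately show ?thesis using cartier_scale[of "nat_elem i \<otimes> b" "z [^] i'"] z(1) bR by simp
  qed
qed (use y b M_carrier cartier_closed der_closed in \<open>auto simp: der_add cartier_add der_scale cartier_scale\<close>)

text \<open>
  Expand \<open>(x + y)\<^sup>p\<^sup>-\<^sup>1 (D x + D y)\<close>. The term with \<open>x\<^sup>k y\<^sup>p\<^sup>-\<^sup>1\<^sup>-\<^sup>k D x\<close> and the one with \<open>x\<^sup>k\<^sup>+\<^sup>1 y\<^sup>p\<^sup>-\<^sup>2\<^sup>-\<^sup>k D y\<close> add up, after multiplication
  by the invertible \<open>k + 1\<close>, to a multiple of \<open>D (x\<^sup>k\<^sup>+\<^sup>1 y\<^sup>p\<^sup>-\<^sup>1\<^sup>-\<^sup>k)\<close>, which \<open>cartier\<close> kills. The two extreme terms remain.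
\<close>

lemma cartier_log_add:
  assumes x: "x \<in> carrier R" and y: "y \<in> carrier R"
  shows "cartier ((x \<oplus> y) [^] (p - 1) \<otimes> der (x \<oplus> y)) =
    cartier (x [^] (p - 1) \<otimes> der x) \<oplus> cartier (y [^] (p - 1) \<otimes> der y)"
proof -
  have "p \<ge> 3" using prime_ge_2_nat[OF prime_p] odd_p by (cases "p = 2") auto
  then have "p - 1 = Suc (p - 2)" "p = Suc (Suc (p - 2))" by auto
  then obtain q where q: "p - 1 = Suc q" "p = Suc (Suc q)" by blast
  let ?n = "Suc q"
  let ?t = "\<lambda>k. x [^] k \<otimes> y [^] (?n - k)" and ?c = "\<lambda>k. nat_elem (?n choose k)"
  note dx = der_closed[OF x] and dy = der_closed[OF y]
  have t: "?t k \<in> carrier R" for k using x y by simp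
  have C_sum: "cartier (\<Oplus>k\<in>{..?n}. ?c k \<otimes> (?t k \<otimes> d)) = (\<Oplus>k\<in>{..?n}. ?c k \<otimes> cartier (?t k \<otimes> d))" if d: "d \<in> carrier R" for d
  proof -
    have "cartier (\<Oplus>k\<in>{..?n}. ?c k \<otimes> (?t k \<otimes> d)) = (\<Oplus>k\<in>{..?n}. cartier (?c k \<otimes> (?t k \<otimes> d)))"
      using t d by (intro additive_map_finsum) (auto simp: cartier_closed cartier_add)
    also have "\<dots> = (\<Oplus>k\<in>{..?n}. ?c k \<otimes> cartier (?t k \<otimes> d))"
      using t d cartier_closed by (intro finsum_cong') (auto simp: cartier_scale nat_elem_in_subring[OF M])
    finally show ?thesis .
  qed
  have E: "(x \<oplus> y) [^] ?n \<otimes> d = (\<Oplus>k\<in>{..?n}. ?c k \<otimes> (?t k \<otimes> d))" if d: "d \<in> carrier R" for d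
  proof -
    have "(x \<oplus> y) [^] ?n \<otimes> d = (\<Oplus>k\<in>{..?n}. (?c k \<otimes> ?t k) \<otimes> d)"
      unfolding binom_nat_elem[OF x y] using t d by (intro finsum_ldistr) auto
    also have "\<dots> = (\<Oplus>k\<in>{..?n}. ?c k \<otimes> (?t k \<otimes> d))"
      using t d by (intro finsum_cong') (auto simp: m_assoc)
    finally show ?thesis .
  qed
  let ?X = "\<lambda>k. ?c k \<otimes> cartier (?t k \<otimes> der x)" and ?Y = "\<lambda>k. ?c k \<otimes> cartier (?t k \<otimes> der y)"
  have Xc: "?X k \<in> carrier R" and Yc: "?Y k \<in> carrier R" for k using t dx dy cartier_closed by auto
  have "cartier ((x \<oplus> y) [^] ?n \<otimes> der (x \<oplus> y)) = cartier ((x \<oplus> y) [^] ?n \<otimes> der x) \<oplus> cartier ((x \<oplus> y) [^] ?n \<otimes> der y)"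
    using x y dx dy by (simp add: der_add r_distr cartier_add del: nat_pow_Suc)
  also have "\<dots> = (\<Oplus>k\<in>{..?n}. ?X k) \<oplus> (\<Oplus>k\<in>{..?n}. ?Y k)"
    unfolding E[OF dx] E[OF dy] C_sum[OF dx] C_sum[OF dy] ..
  also have "(\<Oplus>k\<in>{..?n}. ?X k) = ?X ?n \<oplus> (\<Oplus>k\<in>{..q}. ?X k)" using Xc by (intro finsum_Suc) auto
  also have "(\<Oplus>k\<in>{..?n}. ?Y k) = (\<Oplus>k\<in>{..q}. ?Y (Suc k)) \<oplus> ?Y 0" using Yc by (intro finsum_Suc2) auto
  also have "(?X ?n \<oplus> (\<Oplus>k\<in>{..q}. ?X k)) \<oplus> ((\<Oplus>k\<in>{..q}. ?Y (Suc k)) \<oplus> ?Y 0) =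
      ((\<Oplus>k\<in>{..q}. ?X k) \<oplus> (\<Oplus>k\<in>{..q}. ?Y (Suc k))) \<oplus> (?X ?n \<oplus> ?Y 0)"
  proof -
    have "(u \<oplus> v) \<oplus> (w \<oplus> t) = (v \<oplus> w) \<oplus> (u \<oplus> t)"
      if "u \<in> carrier R" "v \<in> carrier R" "w \<in> carrier R" "t \<in> carrier R" for u v w t
      using that by (simp add: a_ac)
    then show ?thesis by this (intro Xc Yc finsum_closed funcsetI)+
  qed
  also have "(\<Oplus>k\<in>{..q}. ?X k) \<oplus> (\<Oplus>k\<in>{..q}. ?Y (Suc k)) = (\<Oplus>k\<in>{..q}. ?X k \<oplus> ?Y (Suc k))"
    by (intro finsum_addf[symmetric] funcsetI Xc Yc)
  also have "\<dots> = (\<Oplus>k\<in>{..q}. \<zero>)"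
  proof (rule finsum_cong')
    fix k assume "k \<in> {..q}"
    then have k: "k \<le> q" by simp
    define l where "l = q - k"
    have l: "?n - k = Suc l" "?n - Suc k = l" using k by (auto simp: l_def)
    let ?w = "x [^] Suc k \<otimes> y [^] Suc l"
    let ?a = "?t k \<otimes> der x" and ?b = "?t (Suc k) \<otimes> der y"
    have ab: "?a \<in> carrier R" "?b \<in> carrier R" by (intro m_closed nat_pow_closed x y dx dy)+
    have "Suc k * (?n choose Suc k) = ?n * (q choose k)" by (rule Suc_times_binomial)
    moreover have "(?n - k) * (?n choose k) = ?n * (q choose k)" using binomial_absorb_comp[of ?n k] by simp
    ultimately have "Suc k * (?n choose Suc k) = (?n choose k) * Suc l" unfolding l by (simp only: mult.commute)
    then have cc: "nat_elem (Suc k) \<otimes> ?c (Suc k) = ?c k \<otimes> nat_elem (Suc l)" unfolding nat_elem_mult[symmetric] by (simp only:)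
    have w: "der ?w = nat_elem (Suc k) \<otimes> ?a \<oplus> nat_elem (Suc l) \<otimes> ?b"
    proof -
      have "der ?w = x [^] Suc k \<otimes> der (y [^] Suc l) \<oplus> y [^] Suc l \<otimes> der (x [^] Suc k)"
        using x y by (intro der_mult) auto
      also have "\<dots> = x [^] Suc k \<otimes> (nat_elem (Suc l) \<otimes> (y [^] l \<otimes> der y)) \<oplus> y [^] Suc l \<otimes> (nat_elem (Suc k) \<otimes> (x [^] k \<otimes> der x))"
        unfolding der_nat_pow[OF x] der_nat_pow[OF y] ..
      also have "\<dots> = nat_elem (Suc k) \<otimes> ?a \<oplus> nat_elem (Suc l) \<otimes> ?b"
        unfolding l using x y dx dy by (simp add: m_ac a_comm del: nat_pow_Suc add.nat_pow_Suc)
      finally show ?thesis .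
    qed
    have Cab: "cartier ?a \<in> carrier R" "cartier ?b \<in> carrier R" using ab cartier_closed by auto
    have "nat_elem (Suc k) \<otimes> (?X k \<oplus> ?Y (Suc k)) = ?c k \<otimes> (nat_elem (Suc k) \<otimes> cartier ?a) \<oplus> (nat_elem (Suc k) \<otimes> ?c (Suc k)) \<otimes> cartier ?b"
      using Cab by (simp add: r_distr m_ac del: add.nat_pow_Suc)
    also have "\<dots> = ?c k \<otimes> (nat_elem (Suc k) \<otimes> cartier ?a \<oplus> nat_elem (Suc l) \<otimes> cartier ?b)"
      unfolding cc using Cab by (simp add: r_distr m_assoc del: add.nat_pow_Suc)
    also have "nat_elem (Suc k) \<otimes> cartier ?a \<oplus> nat_elem (Suc l) \<otimes> cartier ?b = cartier (der ?w)"
      unfolding w using ab nat_elem_in_subring[OF M] by (simp add: cartier_add cartier_scale del: add.nat_pow_Suc)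
    also have "\<dots> = \<zero>" using x y by (intro cartier_der) auto
    finally have "nat_elem (Suc k) \<otimes> (?X k \<oplus> ?Y (Suc k)) = \<zero>" by simp
    moreover have "nat_elem (Suc k) \<noteq> \<zero>" using k q by (intro nat_elem_nonzero) auto
    moreover have "?X k \<oplus> ?Y (Suc k) \<in> carrier R" by (intro a_closed Xc Yc)
    ultimately show "?X k \<oplus> ?Y (Suc k) = \<zero>" using integral[of "nat_elem (Suc k)" "?X k \<oplus> ?Y (Suc k)"] by blast
  qed auto
  also have "?X ?n = cartier (x [^] ?n \<otimes> der x)" using x dx cartier_closed by (simp del: nat_pow_Suc)
  also have "?Y 0 = cartier (y [^] ?n \<otimes> der y)" using y dy cartier_closed by (simp del: nat_pow_Suc)
  finally show ?thesis unfolding q(1) using x y dx dy cartier_closed by (simp del: nat_pow_Suc)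
qed

text \<open>
  Katz's formula for the Cartier operator on \<open>y\<^sup>p\<^sup>-\<^sup>1 dy\<close>. Both sides are additive and scale by \<open>m\<^sup>p\<close>, so it is enough to
  check powers of \<open>z\<close>, where it reduces to \<open>i\<^sup>p = i\<close> in the prime field.
\<close>

lemma cartier_formula:
  assumes y: "y \<in> carrier R"
  shows "b [^] (p - 2) \<otimes> cartier (y [^] (p - 1) \<otimes> der y) = der y [^] p"
proof (rule agree_on_powers[where tw = "\<lambda>m. m [^] p" and f = "\<lambda>y. b [^] (p - 2) \<otimes> cartier (y [^] (p - 1) \<otimes> der y)"
      and g = "\<lambda>y. der y [^] p"])
  note bR = M_carrier[OF b(1)]
  have "p \<ge> 3" using prime_ge_2_nat[OF prime_p] odd_p by (cases "p = 2") auto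
  then have p2: "p = Suc (Suc (p - 2))" "p - 1 = Suc (p - 2)" by auto
  have C: "cartier (y [^] (p - 1) \<otimes> der y) \<in> carrier R" if "y \<in> carrier R" for y
    using that cartier_closed der_closed by simp
  show "(\<lambda>y. b [^] (p - 2) \<otimes> cartier (y [^] (p - 1) \<otimes> der y)) \<in> carrier R \<rightarrow> carrier R" using C bR by auto
  show "(\<lambda>y. der y [^] p) \<in> carrier R \<rightarrow> carrier R" using der_closed by auto
  show "b [^] (p - 2) \<otimes> cartier ((x \<oplus> y) [^] (p - 1) \<otimes> der (x \<oplus> y)) =
      b [^] (p - 2) \<otimes> cartier (x [^] (p - 1) \<otimes> der x) \<oplus> b [^] (p - 2) \<otimes> cartier (y [^] (p - 1) \<otimes> der y)"
    if "x \<in> carrier R" "y \<in> carrier R" for x y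
    unfolding cartier_log_add[OF that] using C that bR by (simp add: r_distr)
  show "der (x \<oplus> y) [^] p = der x [^] p \<oplus> der y [^] p" if "x \<in> carrier R" "y \<in> carrier R" for x y
    using that der_closed by (simp add: der_add frob_add)
  show "der (m \<otimes> y) [^] p = m [^] p \<otimes> der y [^] p" if "m \<in> M" "y \<in> carrier R" for m y
    using that der_closed M_carrier by (simp add: der_scale nat_pow_distrib)
  show "b [^] (p - 2) \<otimes> cartier ((m \<otimes> y) [^] (p - 1) \<otimes> der (m \<otimes> y)) =
      m [^] p \<otimes> (b [^] (p - 2) \<otimes> cartier (y [^] (p - 1) \<otimes> der y))" if m: "m \<in> M" and y: "y \<in> carrier R" for m y
  proof -
    note mR = M_carrier[OF m]
    have "m [^] p = m [^] (p - 1) \<otimes> m" using nat_pow_mult[OF mR, of "p - 1" 1] p_pos mR by simp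
    then have "(m \<otimes> y) [^] (p - 1) \<otimes> der (m \<otimes> y) = m [^] p \<otimes> (y [^] (p - 1) \<otimes> der y)"
      using mR y der_closed by (simp add: der_scale[OF m y] nat_pow_distrib m_ac)
    then show ?thesis
      using cartier_scale[OF subring_nat_pow[OF M m, of p]] y mR bR der_closed C by (simp add: m_lcomm)
  qed
  show "b [^] (p - 2) \<otimes> cartier ((z [^] i) [^] (p - 1) \<otimes> der (z [^] i)) = der (z [^] i) [^] p" if i: "i < p" for i
  proof (cases i)
    case 0
    then show ?thesis using der_pow[of 0] bR cartier_zero zero_pow_p by simp
  next
    case (Suc j)
    have zi: "(z [^] i) [^] (p - 1) \<otimes> z [^] j = z [^] (j * p + (p - 1))"
    proof -
      have "(z [^] i) [^] (p - 1) \<otimes> z [^] j = z [^] (i * (p - 1) + j)" using z(1) by (simp add: nat_pow_pow nat_pow_mult)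
      moreover have "i * (p - 1) + j = j * p + (p - 1)" unfolding Suc using p_pos by (cases p) auto
      ultimately show ?thesis by simp
    qed
    have m: "nat_elem i \<otimes> b \<in> M" by (intro subringE(6)[OF M] nat_elem_in_subring[OF M] b(1))
    have "(z [^] i) [^] (p - 1) \<otimes> der (z [^] i) = (nat_elem i \<otimes> b) \<otimes> ((z [^] i) [^] (p - 1) \<otimes> z [^] j)"
      unfolding der_pow using bR z(1) Suc by (simp add: m_ac del: add.nat_pow_Suc nat_pow_Suc)
    also have "\<dots> = (nat_elem i \<otimes> b) \<otimes> z [^] (j * p + (p - 1))" unfolding zi ..
    finally have "cartier ((z [^] i) [^] (p - 1) \<otimes> der (z [^] i)) = (nat_elem i \<otimes> b) \<otimes> cartier (z [^] (j * p + (p - 1)))"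
      using cartier_scale[OF m] z(1) by simp
    also have "cartier (z [^] (j * p + (p - 1))) = b \<otimes> (z [^] p) [^] j"
    proof -
      obtain r where r: "p - 1 = r" "r < p" using p_pos by auto
      then have "(j * p + r) mod p = r" "(j * p + r) div p = j" by auto
      then show ?thesis unfolding cartier_pow r(1) by simp
    qed
    finally have "b [^] (p - 2) \<otimes> cartier ((z [^] i) [^] (p - 1) \<otimes> der (z [^] i)) =
        nat_elem i \<otimes> ((b [^] (p - 2) \<otimes> b \<otimes> b) \<otimes> (z [^] p) [^] j)"
      using bR z(1) by (simp add: m_ac)
    also have "b [^] (p - 2) \<otimes> b \<otimes> b = b [^] p" by (subst (2) p2(1)) simp
    also have "nat_elem i \<otimes> (b [^] p \<otimes> (z [^] p) [^] j) = der (z [^] i) [^] p"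
    proof -
      have "(z [^] p) [^] j = (z [^] j) [^] p" using z(1) by (simp add: nat_pow_pow mult.commute)
      then show ?thesis unfolding der_pow using bR z(1) Suc nat_elem_frob[of i]
        by (simp add: nat_pow_distrib del: add.nat_pow_Suc)
    qed
    finally show ?thesis .
  qed
qed (use y b M_carrier nat_pow_nonzero in auto)

end

section \<open>Logarithmic forms\<close>

context frobenius_domain
begin

text \<open>
  The properties of a Cartier operator \<open>C\<close> for \<open>D\<close> that are needed below; \<open>e\<close> absorbs the denominator.
\<close>

definition cartier_companion :: "('a \<Rightarrow> 'a) \<Rightarrow> ('a \<Rightarrow> 'a) \<Rightarrow> 'a \<Rightarrow> bool" where
  "cartier_companion D C e \<longleftrightarrow> C \<in> carrier R \<rightarrow> carrier R \<and> e \<in> carrier R \<and>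
     (\<forall>x\<in>carrier R. \<forall>y\<in>carrier R. C (x \<oplus> y) = C x \<oplus> C y) \<and>
     (\<forall>x\<in>carrier R. \<forall>y\<in>carrier R. C (x [^] p \<otimes> y) = x [^] p \<otimes> C y) \<and>
     (\<forall>x\<in>carrier R. C (D x) = \<zero>) \<and>
     (\<forall>x\<in>carrier R. e \<otimes> C (x [^] (p - 1) \<otimes> D x) = D x [^] p)"

definition cartier_derivation :: "('a \<Rightarrow> 'a) \<Rightarrow> bool" where
  "cartier_derivation D \<longleftrightarrow> D \<in> carrier R \<rightarrow> carrier R \<and>
     (\<forall>x\<in>carrier R. \<forall>y\<in>carrier R. D (x \<oplus> y) = D x \<oplus> D y) \<and>
     (\<forall>x\<in>carrier R. \<forall>y\<in>carrier R. D (x \<otimes> y) = x \<otimes> D y \<oplus> y \<otimes> D x) \<and>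
     (\<forall>x\<in>carrier R. D (x [^] p) = \<zero>) \<and> (\<exists>C e. cartier_companion D C e)"

lemma cartier_companionD:
  assumes "cartier_companion D C e"
  shows "C \<in> carrier R \<rightarrow> carrier R" and "e \<in> carrier R"
    and "x \<in> carrier R \<Longrightarrow> y \<in> carrier R \<Longrightarrow> C (x \<oplus> y) = C x \<oplus> C y"
    and "x \<in> carrier R \<Longrightarrow> y \<in> carrier R \<Longrightarrow> C (x [^] p \<otimes> y) = x [^] p \<otimes> C y"
    and "x \<in> carrier R \<Longrightarrow> C (D x) = \<zero>"
    and "x \<in> carrier R \<Longrightarrow> e \<otimes> C (x [^] (p - 1) \<otimes> D x) = D x [^] p"
  using assms unfolding cartier_companion_def by blast+

lemma cartier_derivationD:
  assumes "cartier_derivation D"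
  shows "x \<in> carrier R \<Longrightarrow> D x \<in> carrier R"
    and "x \<in> carrier R \<Longrightarrow> y \<in> carrier R \<Longrightarrow> D (x \<oplus> y) = D x \<oplus> D y"
    and "x \<in> carrier R \<Longrightarrow> y \<in> carrier R \<Longrightarrow> D (x \<otimes> y) = x \<otimes> D y \<oplus> y \<otimes> D x"
    and "x \<in> carrier R \<Longrightarrow> D (x [^] p) = \<zero>"
  using assms unfolding cartier_derivation_def Pi_iff by blast+

text \<open>
  Let \<open>\<omega>\<^sub>k(D)\<close> be the sum in the hypothesis. The companion of \<open>D\<close> turns \<open>\<omega>\<^sub>k\<^sub>+\<^sub>1(D) = 0\<close> into \<open>\<omega>\<^sub>k(D)\<^sup>p = 0\<close>, since it kills the term \<open>D z\<^sub>k\<^sub>+\<^sub>1\<close>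
  and takes every other term to a \<open>p\<close>-th power. By induction \<open>z\<^sub>0, \<dots>, z\<^sub>k\<close> are \<open>p\<close>-th powers, so they are killed by \<open>D\<close> and
  \<open>\<omega>\<^sub>k\<^sub>+\<^sub>1(D) = 0\<close> becomes \<open>D z\<^sub>k\<^sub>+\<^sub>1 = 0\<close> for all \<open>D\<close>.
\<close>

lemma cartier_descent:
  assumes detect: "\<And>z. z \<in> carrier R \<Longrightarrow> z \<notin> frobenius_image \<Longrightarrow> \<exists>D. cartier_derivation D \<and> D z \<noteq> \<zero>"
  shows "(\<And>i. i \<le> k \<Longrightarrow> z i \<in> carrier R) \<Longrightarrow>
    (\<And>D. cartier_derivation D \<Longrightarrow> (\<Oplus>i\<in>{..k}. z i [^] (p ^ (k - i) - 1) \<otimes> D (z i)) = \<zero>) \<Longrightarrow>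
    i \<le> k \<Longrightarrow> z i \<in> frobenius_image"
proof (induction k arbitrary: i)
  case 0
  have "D (z 0) = \<zero>" if D: "cartier_derivation D" for D
    using 0(2)[OF D] 0(1)[of 0] cartier_derivationD(1)[OF D, of "z 0"] by simp
  then show ?case using detect[of "z 0"] 0(1)[of 0] 0(3) by auto
next
  case (Suc k)
  have zR: "z i \<in> carrier R" if "i \<le> Suc k" for i by (rule Suc.prems(1)[OF that])
  let ?t = "\<lambda>D k i. z i [^] (p ^ (k - i) - 1) \<otimes> D (z i)"
  have split: "(\<Oplus>i\<in>{..Suc k}. ?t D (Suc k) i) = D (z (Suc k)) \<oplus> (\<Oplus>i\<in>{..k}. ?t D (Suc k) i)"
    if D: "cartier_derivation D" for D
  proof -
    have Dc: "D x \<in> carrier R" if "x \<in> carrier R" for x by (rule cartier_derivationD(1)[OF D that])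
    have "(\<Oplus>i\<in>{..Suc k}. ?t D (Suc k) i) = ?t D (Suc k) (Suc k) \<oplus> (\<Oplus>i\<in>{..k}. ?t D (Suc k) i)"
      unfolding atMost_Suc using zR Dc by (intro finsum_insert) auto
    then show ?thesis using zR Dc by simp
  qed
  have low: "z i \<in> frobenius_image" if i: "i \<le> k" for i
  proof (rule Suc.IH[OF _ _ i])
    show "z i \<in> carrier R" if "i \<le> k" for i using zR that by simp
    fix D assume D: "cartier_derivation D"
    have Dc: "D x \<in> carrier R" if "x \<in> carrier R" for x by (rule cartier_derivationD(1)[OF D that])
    obtain C e where Ce: "cartier_companion D C e" using D unfolding cartier_derivation_def by blast
    note C = cartier_companionD(1,3,4,5)[OF Ce] and e = cartier_companionD(2,6)[OF Ce]
    have Cc: "C x \<in> carrier R" if "x \<in> carrier R" for x using C(1) that by auto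
    have tc: "?t D j i \<in> carrier R" if "i \<le> k" for i j using zR Dc that by simp
    let ?w = "\<Oplus>i\<in>{..k}. ?t D (Suc k) i"
    have wc: "?w \<in> carrier R" using tc by (intro finsum_closed) auto
    have "C (D (z (Suc k)) \<oplus> ?w) = C \<zero>" using Suc.prems(2)[OF D] split[OF D] by simp
    also have "\<dots> = \<zero>" by (rule additive_map_zero[OF C(1,2)])
    finally have "C ?w = \<zero>" using C(2)[OF Dc wc] C(4) zR Cc[OF wc] by simp
    then have "(\<Oplus>i\<in>{..k}. C (?t D (Suc k) i)) = \<zero>"
      using additive_map_finsum[OF C(1,2), of "{..k}" "?t D (Suc k)"] tc by simp
    then have "\<zero> = e \<otimes> (\<Oplus>i\<in>{..k}. C (?t D (Suc k) i))" using e(1) by simp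
    also have "\<dots> = (\<Oplus>i\<in>{..k}. e \<otimes> C (?t D (Suc k) i))"
      using tc Cc e(1) by (intro finsum_rdistr) auto
    also have "\<dots> = (\<Oplus>i\<in>{..k}. ?t D k i [^] p)"
    proof (rule finsum_cong')
      fix i assume "i \<in> {..k}"
      then have i: "i \<le> k" by simp
      have zi: "z i \<in> carrier R" using zR i by simp
      define N where "N = p ^ (k - i) - 1"
      have "p ^ (k - i) = Suc N" using p_pos by (simp add: N_def)
      then have "p ^ (Suc k - i) = p * Suc N" using i by (simp add: Suc_diff_le)
      then have "p ^ (Suc k - i) - 1 = N * p + (p - 1)" using p_pos by (simp add: algebra_simps)
      then have "z i [^] (p ^ (Suc k - i) - 1) = (z i [^] N) [^] p \<otimes> z i [^] (p - 1)"
        using zi by (simp add: nat_pow_pow nat_pow_mult)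
      then have "?t D (Suc k) i = (z i [^] N) [^] p \<otimes> (z i [^] (p - 1) \<otimes> D (z i))"
        using zi Dc by (simp add: m_assoc)
      then have "e \<otimes> C (?t D (Suc k) i) = (z i [^] N) [^] p \<otimes> (e \<otimes> C (z i [^] (p - 1) \<otimes> D (z i)))"
        using C(3)[of "z i [^] N" "z i [^] (p - 1) \<otimes> D (z i)"] zi Dc Cc e(1) by (simp add: m_lcomm)
      then show "e \<otimes> C (?t D (Suc k) i) = ?t D k i [^] p"
        using e(2)[OF zi] zi Dc by (simp add: N_def nat_pow_distrib)
    qed (use tc in auto)
    also have "\<dots> = (\<Oplus>i\<in>{..k}. ?t D k i) [^] p"
      using tc frob_add by (intro additive_map_finsum[of "\<lambda>x. x [^] p", symmetric]) auto
    finally have "(\<Oplus>i\<in>{..k}. ?t D k i) [^] p = \<zero>" by simp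
    moreover have "(\<Oplus>i\<in>{..k}. ?t D k i) \<in> carrier R" using tc by (intro finsum_closed) auto
    ultimately show "(\<Oplus>i\<in>{..k}. ?t D k i) = \<zero>" using nat_pow_nonzero by blast
  qed
  have "D (z (Suc k)) = \<zero>" if D: "cartier_derivation D" for D
  proof -
    have Dc: "D x \<in> carrier R" if "x \<in> carrier R" for x by (rule cartier_derivationD(1)[OF D that])
    have Dz: "D (z i) = \<zero>" if "i \<le> k" for i
      using low[OF that] cartier_derivationD(4)[OF D] by (auto simp: frobenius_image_def)
    have "(\<Oplus>i\<in>{..k}. ?t D (Suc k) i) = (\<Oplus>i\<in>{..k}. \<zero>)"
      using zR Dz by (intro finsum_cong') auto
    then show ?thesis using Suc.prems(2)[OF D] split[OF D] Dc zR by simp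
  qed
  then have "z (Suc k) \<in> frobenius_image" using detect[of "z (Suc k)"] zR by blast
  then show ?case using low Suc.prems(3) le_Suc_eq by auto
qed

end

lemma (in degree_p_extension) cartier_derivation_der: "cartier_derivation der"
proof -
  have "cartier_companion der cartier (b [^] (p - 2))"
    unfolding cartier_companion_def
    using M_carrier[OF b(1)] cartier_scale[OF p_powers] cartier_closed cartier_add cartier_der cartier_formula
    by (auto simp del: One_nat_def)
  moreover have "der \<in> carrier R \<rightarrow> carrier R" using der_closed by auto
  ultimately show ?thesis
    unfolding cartier_derivation_def
    by (intro conjI ballI exI[of _ cartier] exI[of _ "b [^] (p - 2)"]) (simp_all add: der_add der_mult der_M p_powers)
qed

text \<open>
  Apply the construction to a maximal saturated subring without \<open>z\<close>: there \<open>D z = b \<noteq> 0\<close>.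
\<close>

lemma (in frobenius_domain) exists_detecting_derivation:
  assumes "saturated frobenius_image" and "z \<in> carrier R" "z \<notin> frobenius_image"
    and "set ts \<subseteq> carrier R" and "generate_ring R (frobenius_image \<union> set ts) = carrier R"
  shows "\<exists>D. cartier_derivation D \<and> D z \<noteq> \<zero>"
proof -
  obtain M b where "degree_p_extension R p M z b" using exists_degree_p_extension[OF assms] by blast
  then interpret E: degree_p_extension R p M z b .
  show ?thesis using E.cartier_derivation_der E.der_z E.b(2) by (intro exI[of _ E.der]) simp
qed

section \<open>The Poisson bracket on an open leaf\<close>

text \<open>
  If \<open>a u\<^sup>p = v\<^sup>p\<close>, the fraction \<open>v/u\<close> is a root of \<open>Y\<^sup>p - a\<close>, hence lies in the normal ring \<open>R\<close>.
\<close>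

lemma (in frobenius_domain) saturated_frobenius_image:
  assumes "normal_domain R"
  shows "saturated frobenius_image"
  unfolding saturated_def
proof (intro ballI impI)
  fix a d assume a: "a \<in> carrier R" and "d \<in> frobenius_image" "d \<noteq> \<zero>" "a \<otimes> d \<in> frobenius_image"
  then obtain u v where u: "u \<in> carrier R" "d = u [^] p" and v: "v \<in> carrier R" "a \<otimes> u [^] p = v [^] p"
    by (auto simp: frobenius_image_def)
  have u0: "u \<noteq> \<zero>" using u \<open>d \<noteq> \<zero>\<close> zero_pow_p by auto
  \<comment> \<open>The lower coefficients of \<open>Y\<^sup>p - a\<close>.\<close>
  let ?c = "\<lambda>i::nat. if i = 0 then \<ominus> a else \<zero>"
  have "(\<Oplus>i\<in>{..<p}. ?c i \<otimes> v [^] i \<otimes> u [^] (p - i)) = (\<Oplus>i\<in>{..<p}. if 0 = i then \<ominus> a \<otimes> u [^] p else \<zero>)"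
    using a u v by (intro finsum_cong') auto
  also have "\<dots> = \<ominus> a \<otimes> u [^] p"
    using finsum_singleton[of 0 "{..<p}" "\<lambda>_. \<ominus> a \<otimes> u [^] p"] p_pos a u by auto
  finally have "v [^] p \<oplus> (\<Oplus>i\<in>{..<p}. ?c i \<otimes> v [^] i \<otimes> u [^] (p - i)) = \<zero>"
    using a u(1) v by (simp add: l_minus r_neg)
  moreover have "?c \<in> {..<p} \<rightarrow> carrier R" using a by auto
  moreover have "u \<in> carrier R - {\<zero>}" using u u0 by simp
  ultimately have "\<exists>q\<in>carrier R. v = q \<otimes> u"
    using v(1) by (intro conjunct2[OF assms[unfolded normal_domain_def], THEN bspec[of _ _ v], THEN bspec[of _ _ u],
        THEN spec[of _ p], THEN bspec[of _ _ ?c], THEN mp])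
  then obtain q where q: "q \<in> carrier R" "v = q \<otimes> u" by blast
  have "q [^] p \<otimes> u [^] p = a \<otimes> u [^] p" using q u(1) v(2) by (simp add: nat_pow_distrib)
  then have "q [^] p = a" using m_rcancel[of "u [^] p" "q [^] p" a] nat_pow_nonzero[OF u(1) u0] q a u by simp
  then show "a \<in> frobenius_image" using q(1) by (auto simp: frobenius_image_def)
qed

text \<open>
  A one-form \<open>\<Sum> a\<^sub>i df\<^sub>i\<close> in the kernel of the bracket vanishes at the closed points of the leaf. These are
  dense, so it pairs to zero with every derivation.
\<close>

lemma radical_covector_vanishes:
  fixes a f :: "nat \<Rightarrow> 'o"
  assumes variety: "normal_poisson_variety K R br" and leaf: "open_symplectic_leaf K R br U"
    and a: "\<And>i. i < r \<Longrightarrow> a i \<in> carrier R" and f: "\<And>i. i < r \<Longrightarrow> f i \<in> carrier R"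
    and radical: "\<And>g. g \<in> carrier R \<Longrightarrow> (\<Oplus>\<^bsub>R\<^esub>i\<in>{..<r}. a i \<otimes>\<^bsub>R\<^esub> br (f i) g) = \<zero>\<^bsub>R\<^esub>"
    and D: "D \<in> carrier R \<rightarrow> carrier R" "\<And>x y. x \<in> carrier R \<Longrightarrow> y \<in> carrier R \<Longrightarrow> D (x \<oplus>\<^bsub>R\<^esub> y) = D x \<oplus>\<^bsub>R\<^esub> D y"
      "\<And>x y. x \<in> carrier R \<Longrightarrow> y \<in> carrier R \<Longrightarrow> D (x \<otimes>\<^bsub>R\<^esub> y) = x \<otimes>\<^bsub>R\<^esub> D y \<oplus>\<^bsub>R\<^esub> y \<otimes>\<^bsub>R\<^esub> D x"
      "\<And>c. c \<in> carrier K \<Longrightarrow> D (c \<odot>\<^bsub>R\<^esub> \<one>\<^bsub>R\<^esub>) = \<zero>\<^bsub>R\<^esub>"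
  shows "(\<Oplus>\<^bsub>R\<^esub>i\<in>{..<r}. a i \<otimes>\<^bsub>R\<^esub> D (f i)) = \<zero>\<^bsub>R\<^esub>"
proof (rule ccontr)
  let ?w = "\<Oplus>\<^bsub>R\<^esub>i\<in>{..<r}. a i \<otimes>\<^bsub>R\<^esub> D (f i)"
  assume w0: "?w \<noteq> \<zero>\<^bsub>R\<^esub>"
  have K: "field K" and fg: "fg_algebra K R" and dom: "domain R" and pb: "poisson_bracket K R br"
    using variety by (auto simp: normal_poisson_variety_def normal_domain_def)
  interpret domain R by fact
  interpret alg: algebra K R using fg by (simp add: fg_algebra_def)
  have br: "br g h \<in> carrier R" if "g \<in> carrier R" "h \<in> carrier R" for g h using pb that by (simp add: poisson_bracket_def)
  have Dc: "D x \<in> carrier R" if "x \<in> carrier R" for x using D(1) that by auto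
  have w: "?w \<in> carrier R" using a f Dc by (intro finsum_closed) auto
  obtain S where S: "S \<subseteq> carrier R" "U = {x. maximalideal x R \<and> \<not> S \<subseteq> x}" "U \<noteq> {}"
    and nondeg: "\<And>x. x \<in> U \<Longrightarrow> nondegenerate_at K R br x"
    using leaf by (auto simp: open_symplectic_leaf_def zariski_open_def)
  \<comment> \<open>Some \<open>s\<close> defining the leaf is nonzero, so that a point outside the zeros of \<open>?w \<otimes> s\<close> lies on the leaf.\<close>
  obtain x0 s where x0: "maximalideal x0 R" "s \<in> S" "s \<notin> x0" using S(2,3) by blast
  have s: "s \<in> carrier R" "s \<noteq> \<zero>\<^bsub>R\<^esub>"
    using x0 S(1) additive_subgroup.zero_closed[OF ideal.axioms(1)[OF maximalideal.axioms(1)[OF x0(1)]]] by auto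
  have "?w \<otimes>\<^bsub>R\<^esub> s \<noteq> \<zero>\<^bsub>R\<^esub>" using w s w0 integral by blast
  then obtain x where x: "maximalideal x R" "?w \<otimes>\<^bsub>R\<^esub> s \<notin> x"
    using exists_maximalideal_avoiding[OF fg K dom, of "?w \<otimes>\<^bsub>R\<^esub> s"] w s by blast
  have idl: "ideal x R" by (rule maximalideal.axioms(1)[OF x(1)])
  have "s \<notin> x" "?w \<notin> x" using x(2) w s ideal.I_l_closed[OF idl] ideal.I_r_closed[OF idl] by blast+
  then have xU: "x \<in> U" using x(1) x0(2) S(2) by blast
  obtain Q q where Q: "Q = R Quot x" and q: "q = (\<lambda>h. x +>\<^bsub>R\<^esub> h)" by blast
  have hom: "ring_hom_ring R Q q" unfolding Q q by (rule ideal.rcos_ring_hom_ring[OF idl])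
  interpret q: ring_hom_ring R Q q by (rule hom)
  \<comment> \<open>The tangent vector at \<open>x\<close> that the vector field \<open>D\<close> defines.\<close>
  let ?D = "restrict (\<lambda>h. q (D h)) (carrier R)"
  have "?D \<in> tangent_space K R x"
    unfolding tangent_space_def Q[symmetric]
    using D Dc by (auto simp: q[THEN fun_cong, symmetric])
  moreover have "\<forall>g\<in>carrier R. (\<Oplus>\<^bsub>Q\<^esub>i\<in>{..<r}. q (a i) \<otimes>\<^bsub>Q\<^esub> q (br (f i) g)) = \<zero>\<^bsub>Q\<^esub>"
  proof
    fix g assume g: "g \<in> carrier R"
    have "(\<Oplus>\<^bsub>Q\<^esub>i\<in>{..<r}. q (a i) \<otimes>\<^bsub>Q\<^esub> q (br (f i) g)) = (\<Oplus>\<^bsub>Q\<^esub>i\<in>{..<r}. q (a i \<otimes>\<^bsub>R\<^esub> br (f i) g))"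
      using a f br g by (intro q.S.finsum_cong') auto
    also have "\<dots> = q (\<Oplus>\<^bsub>R\<^esub>i\<in>{..<r}. a i \<otimes>\<^bsub>R\<^esub> br (f i) g)"
      using a f br g by (subst q.hom_finsum) (auto simp: comp_def)
    finally show "(\<Oplus>\<^bsub>Q\<^esub>i\<in>{..<r}. q (a i) \<otimes>\<^bsub>Q\<^esub> q (br (f i) g)) = \<zero>\<^bsub>Q\<^esub>" using radical[OF g] by simp
  qed
  moreover have "(\<lambda>i. q (a i)) \<in> {..<r} \<rightarrow> carrier Q" "f \<in> {..<r} \<rightarrow> carrier R" using a f by auto
  ultimately have "(\<Oplus>\<^bsub>Q\<^esub>i\<in>{..<r}. q (a i) \<otimes>\<^bsub>Q\<^esub> ?D (f i)) = \<zero>\<^bsub>Q\<^esub>"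
    by (intro nondeg[OF xU, unfolded nondegenerate_at_def Q[symmetric] fun_cong[OF q, symmetric],
          THEN spec[of _ r], THEN bspec[of _ _ "\<lambda>i. q (a i)"], THEN bspec[of _ _ f], THEN mp, THEN bspec[of _ _ ?D]])
  also have "(\<Oplus>\<^bsub>Q\<^esub>i\<in>{..<r}. q (a i) \<otimes>\<^bsub>Q\<^esub> ?D (f i)) = (\<Oplus>\<^bsub>Q\<^esub>i\<in>{..<r}. q (a i \<otimes>\<^bsub>R\<^esub> D (f i)))"
    using a f Dc by (intro q.S.finsum_cong') auto
  also have "\<dots> = q ?w"
    using a f Dc by (subst q.hom_finsum) (auto simp: comp_def)
  finally have "q ?w = \<zero>\<^bsub>Q\<^esub>" .
  then have "?w \<in> x" using ideal.rcos_const_imp_mem[OF idl w] by (simp add: Q q FactRing_def)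
  then show False using \<open>?w \<notin> x\<close> by blast
qed

section \<open>The isomorphism\<close>

lemma algebra_add_pow_one:
  assumes "module K M" "x \<in> carrier M" "c \<in> carrier K"
  shows "add_pow K (j::nat) c \<odot>\<^bsub>M\<^esub> x = add_pow M j (c \<odot>\<^bsub>M\<^esub> x)"
proof -
  interpret module K M by fact
  show ?thesis using assms by (induction j) (simp_all add: smult_l_distr)
qed

lemma scalar_nat_pow:
  assumes "algebra K R" "c \<in> carrier K"
  shows "(c \<odot>\<^bsub>R\<^esub> \<one>\<^bsub>R\<^esub>) [^]\<^bsub>R\<^esub> (j::nat) = (c [^]\<^bsub>K\<^esub> j) \<odot>\<^bsub>R\<^esub> \<one>\<^bsub>R\<^esub>"
proof -
  interpret algebra K R by fact
  show ?thesis
  proof (induction j)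
    case (Suc j)
    then show ?case using assms(2) smult_assoc2[of "c [^]\<^bsub>K\<^esub> j" "\<one>\<^bsub>R\<^esub>" "c \<odot>\<^bsub>R\<^esub> \<one>\<^bsub>R\<^esub>"] smult_assoc1[of "c [^]\<^bsub>K\<^esub> j" c "\<one>\<^bsub>R\<^esub>"] by simp
  qed simp
qed

text \<open>
  In \<open>W\<^sub>n(K)\<close> the annihilator of \<open>p\<close> is generated by \<open>p\<^sup>n\<^sup>-\<^sup>1\<close>, and flatness transfers this to \<open>A\<close>.
\<close>

lemma flat_witt_torsion:
  assumes K: "perfect_field_char p K" and odd: "odd p" and n: "n \<ge> 1"
    and flat: "flat_module (witt_ring p n K) A" and A: "ring A"
    and c: "c \<in> carrier A" "add_pow A p c = \<zero>\<^bsub>A\<^esub>"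
  shows "\<exists>d\<in>carrier A. c = add_pow A (p ^ (n - 1)) d"
proof -
  let ?W = "witt_ring p n K"
  have mod: "module ?W A" using flat by (simp add: flat_module_def)
  interpret M: module ?W A by fact
  let ?q = "add_pow ?W p \<one>\<^bsub>?W\<^esub>"
  have "c \<in> nat_multiples A (p ^ (n - 1))"
  proof (rule flat_annihilator[OF flat A _ c(1)])
    show "?q \<in> carrier ?W" by simp
    show "?q \<odot>\<^bsub>A\<^esub> c = \<zero>\<^bsub>A\<^esub>" using algebra_add_pow_one[OF mod c(1), of "\<one>\<^bsub>?W\<^esub>" p] c by simp
    fix w x assume w: "w \<in> carrier ?W" "w \<otimes>\<^bsub>?W\<^esub> ?q = \<zero>\<^bsub>?W\<^esub>" and x: "x \<in> carrier A"
    have "add_pow ?W p w = \<zero>\<^bsub>?W\<^esub>" using w M.add_pow_rdistr[of w "\<one>\<^bsub>?W\<^esub>" p] by simp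
    then obtain w' where w': "w' \<in> carrier ?W" "w = add_pow ?W (p ^ (n - 1)) w'"
      using witt_annihilator_p[OF K odd n M.is_abelian_group w(1)] by blast
    then have "w \<odot>\<^bsub>A\<^esub> x = add_pow A (p ^ (n - 1)) (w' \<odot>\<^bsub>A\<^esub> x)" using algebra_add_pow_one[OF mod x w'(1)] by simp
    then show "w \<odot>\<^bsub>A\<^esub> x \<in> nat_multiples A (p ^ (n - 1))" using w'(1) x by (auto simp: nat_multiples_def)
  qed
  then show ?thesis by (auto simp: nat_multiples_def)
qed

text \<open>
  As \<open>K\<close> is perfect, scalars are \<open>p\<close>-th powers, so the derivations with a Cartier operator are \<open>K\<close>-linear. By density of the
  leaf the form vanishes on them, and \<open>cartier_descent\<close> applies.
\<close>

lemma logarithmic_radical: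
  fixes z :: "nat \<Rightarrow> 'o"
  assumes K: "perfect_field_char p K" and odd: "odd p"
    and variety: "normal_poisson_variety K R br" and leaf: "open_symplectic_leaf K R br U"
    and z: "\<And>i. i \<le> k \<Longrightarrow> z i \<in> carrier R"
    and radical: "\<And>g. g \<in> carrier R \<Longrightarrow>
      (\<Oplus>\<^bsub>R\<^esub>i\<in>{..k}. z i [^]\<^bsub>R\<^esub> (p ^ (k - i) - 1) \<otimes>\<^bsub>R\<^esub> br (z i) g) = \<zero>\<^bsub>R\<^esub>"
    and i: "i \<le> k"
  shows "\<exists>w\<in>carrier R. z i = w [^]\<^bsub>R\<^esub> p"
proof -
  have prime: "Factorial_Ring.prime p" and char: "add_pow K p \<one>\<^bsub>K\<^esub> = \<zero>\<^bsub>K\<^esub>"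
    and root: "\<And>c. c \<in> carrier K \<Longrightarrow> \<exists>y\<in>carrier K. y [^]\<^bsub>K\<^esub> p = c" using K by (auto simp: perfect_field_char_def)
  have fg: "fg_algebra K R" and nd: "normal_domain R" using variety by (auto simp: normal_poisson_variety_def)
  have alg: "algebra K R" using fg by (simp add: fg_algebra_def)
  interpret alg: algebra K R by fact
  have "add_pow R p \<one>\<^bsub>R\<^esub> = \<zero>\<^bsub>R\<^esub>"
    using algebra_add_pow_one[of K R "\<one>\<^bsub>R\<^esub>" "\<one>\<^bsub>K\<^esub>" p] char alg.module_axioms by simp
  then have "frobenius_domain R p"
    using nd prime odd by (intro frobenius_domain.intro frobenius_domain_axioms.intro) (auto simp: normal_domain_def)
  then interpret frobenius_domain R p .
  have scalars: "c \<odot>\<^bsub>R\<^esub> \<one>\<^bsub>R\<^esub> \<in> frobenius_image" if c: "c \<in> carrier K" for c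
  proof -
    obtain y where y: "y \<in> carrier K" "y [^]\<^bsub>K\<^esub> p = c" using root[OF c] by blast
    then have "c \<odot>\<^bsub>R\<^esub> \<one>\<^bsub>R\<^esub> = (y \<odot>\<^bsub>R\<^esub> \<one>\<^bsub>R\<^esub>) [^]\<^bsub>R\<^esub> p" using scalar_nat_pow[OF alg y(1), of p] by simp
    then show ?thesis using y(1) by (auto simp: frobenius_image_def)
  qed
  obtain S where S: "finite S" "S \<subseteq> carrier R"
    "generate_ring R ((\<lambda>c. c \<odot>\<^bsub>R\<^esub> \<one>\<^bsub>R\<^esub>) ` carrier K \<union> S) = carrier R" using fg by (auto simp: fg_algebra_def)
  obtain ts where ts: "set ts = S" using finite_list[OF S(1)] by blast
  have FS: "frobenius_image \<union> set ts \<subseteq> carrier R" using subringE(1)[OF subring_frobenius_image] S(2) ts by auto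
  have gen: "generate_ring R (frobenius_image \<union> set ts) = carrier R"
    using alg.mono_generate_ring[OF _ FS, of "(\<lambda>c. c \<odot>\<^bsub>R\<^esub> \<one>\<^bsub>R\<^esub>) ` carrier K \<union> S"] scalars alg.generate_ring_incl[OF FS] ts S(3) by auto
  have "z i \<in> frobenius_image"
  proof (rule cartier_descent[OF exists_detecting_derivation[OF saturated_frobenius_image[OF nd] _ _ _ gen] z _ i])
    show "set ts \<subseteq> carrier R" using S(2) ts by simp
    fix D assume D: "cartier_derivation D"
    note Dr = cartier_derivationD[OF D]
    have "(\<Oplus>\<^bsub>R\<^esub>i\<in>{..<Suc k}. z i [^]\<^bsub>R\<^esub> (p ^ (k - i) - 1) \<otimes>\<^bsub>R\<^esub> D (z i)) = \<zero>\<^bsub>R\<^esub>"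
    proof (rule radical_covector_vanishes[OF variety leaf, where D = D and f = z
          and a = "\<lambda>i. z i [^]\<^bsub>R\<^esub> (p ^ (k - i) - 1)"])
      show "D \<in> carrier R \<rightarrow> carrier R" using Dr(1) by auto
      show "D (c \<odot>\<^bsub>R\<^esub> \<one>\<^bsub>R\<^esub>) = \<zero>\<^bsub>R\<^esub>" if "c \<in> carrier K" for c
        using scalars[OF that] Dr(4) by (auto simp: frobenius_image_def)
    qed (use z Dr radical in \<open>simp_all add: lessThan_Suc_atMost\<close>)
    then show "(\<Oplus>\<^bsub>R\<^esub>i\<in>{..k}. z i [^]\<^bsub>R\<^esub> (p ^ (k - i) - 1) \<otimes>\<^bsub>R\<^esub> D (z i)) = \<zero>\<^bsub>R\<^esub>"
      by (simp only: lessThan_Suc_atMost)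
  qed
  then show ?thesis by (auto simp: frobenius_image_def)
qed

text \<open>
  Whatever lifts are chosen, the map is the class of \<open>teich\<close> at the representatives \<open>rep\<close> of the components.
\<close>

theorem (in poisson_witt_center) witt_iso:
  assumes k: "Suc k \<le> n"
    and lifts: "\<And>xs j. xs \<in> carrier (witt_ring p (Suc k) Z) \<Longrightarrow> j \<le> k \<Longrightarrow>
       \<exists>a\<in>carrier A. lift xs j = res (Suc k) a \<and> \<iota> (xs ! j) = res 1 a"
  shows "phi_map p (Suc k) A lift \<in> ring_iso (witt_ring p (Suc k) Z) (ring_center (red (Suc k)))"
proof -
  let ?W = "witt_ring p (Suc k) Z" and ?Q = "red (Suc k)"
  let ?T = "\<lambda>xs. teich k (\<lambda>j. rep (xs ! j))"
  have mem: "xs ! j \<in> carrier Z" if "xs \<in> carrier ?W" "j \<le> k" for xs j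
    using that by (auto simp: witt_ring_def)
  have T: "central_mod (Suc k) (?T xs)" if "xs \<in> carrier ?W" for xs
    using mem[OF that] by (intro teich_central rep_central)
  have phi: "phi_map p (Suc k) A lift xs = res (Suc k) (?T xs)" if xs: "xs \<in> carrier ?W" for xs
  proof -
    have "\<exists>a. j \<le> k \<longrightarrow> a \<in> carrier A \<and> lift xs j = res (Suc k) a \<and> \<iota> (xs ! j) = res 1 a" for j
      using lifts[OF xs] by blast
    then obtain a where a: "\<And>j. j \<le> k \<Longrightarrow> a j \<in> carrier A" "\<And>j. j \<le> k \<Longrightarrow> lift xs j = res (Suc k) (a j)"
      "\<And>j. j \<le> k \<Longrightarrow> \<iota> (xs ! j) = res 1 (a j)" by metis
    have "phi_map p (Suc k) A lift xs = (\<Oplus>\<^bsub>?Q\<^esub>j\<in>{..k}. add_pow ?Q (p ^ j) (lift xs j [^]\<^bsub>?Q\<^esub> (p ^ (k - j))))"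
      unfolding phi_map_def red_def by (simp add: lessThan_Suc_atMost)
    also have "\<dots> = (\<Oplus>\<^bsub>?Q\<^esub>j\<in>{..k}. res (Suc k) (add_pow A (p ^ j) (a j [^] (p ^ (k - j)))))"
      using a by (intro res.S.finsum_cong') (auto simp: res.hom_nat_pow res_hom_add_pow)
    also have "\<dots> = res (Suc k) (teich k a)"
      unfolding teich_def using a by (subst res.hom_finsum) (auto simp: comp_def)
    also have "\<dots> = res (Suc k) (?T xs)"
      using a mem[OF xs] by (intro teich_cong) (auto simp: rep_central rep_res simp del: One_nat_def)
    finally show ?thesis .
  qed
  show ?thesis
  proof (rule ring_iso_memI)
    fix xs assume xs: "xs \<in> carrier ?W"
    show "phi_map p (Suc k) A lift xs \<in> carrier (ring_center ?Q)"
      unfolding phi[OF xs] center_carrier using T[OF xs] by blast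
    fix ys assume ys: "ys \<in> carrier ?W"
    show "phi_map p (Suc k) A lift (xs \<otimes>\<^bsub>?W\<^esub> ys) = phi_map p (Suc k) A lift xs \<otimes>\<^bsub>ring_center ?Q\<^esub> phi_map p (Suc k) A lift ys"
      unfolding phi[OF xs] phi[OF ys] phi[OF witt_mult_closed[OF xs ys]] witt_hom_mult[OF xs ys]
      using T[OF xs] T[OF ys] by simp
    show "phi_map p (Suc k) A lift (xs \<oplus>\<^bsub>?W\<^esub> ys) = phi_map p (Suc k) A lift xs \<oplus>\<^bsub>ring_center ?Q\<^esub> phi_map p (Suc k) A lift ys"
      unfolding phi[OF xs] phi[OF ys] phi[OF witt_add_closed[OF xs ys]] witt_hom_add[OF xs ys]
      using T[OF xs] T[OF ys] by simp
  next
    have "\<one>\<^bsub>?W\<^esub> \<in> carrier ?W" by (auto simp: witt_ring_def)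
    then show "phi_map p (Suc k) A lift \<one>\<^bsub>?W\<^esub> = \<one>\<^bsub>ring_center ?Q\<^esub>"
      using phi witt_hom_one by simp
  next
    show "bij_betw (phi_map p (Suc k) A lift) (carrier ?W) (carrier (ring_center ?Q))"
    proof (rule bij_betw_imageI)
      show "inj_on (phi_map p (Suc k) A lift) (carrier ?W)"
      proof (rule inj_onI)
        fix xs ys assume xs: "xs \<in> carrier ?W" and ys: "ys \<in> carrier ?W"
          and "phi_map p (Suc k) A lift xs = phi_map p (Suc k) A lift ys"
        then have eq: "res (Suc k) (?T xs) = res (Suc k) (?T ys)" using phi by simp
        have "xs ! j = ys ! j" if j: "j \<le> k" for j
        proof -
          have "res 1 (rep (xs ! j)) = res 1 (rep (ys ! j))"
            by (rule teich_inj[OF _ _ k eq j]) (use mem xs ys rep_central in blast)+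
          then have "\<iota> (xs ! j) = \<iota> (ys ! j)" using rep_res mem xs ys j by (simp del: One_nat_def)
          then show ?thesis using inj_onD[OF \<iota>_inj] mem xs ys j by blast
        qed
        then show "xs = ys" using xs ys by (intro nth_equalityI) (auto simp: witt_ring_def)
      qed
      show "phi_map p (Suc k) A lift ` carrier ?W = carrier (ring_center ?Q)"
      proof
        show "phi_map p (Suc k) A lift ` carrier ?W \<subseteq> carrier (ring_center ?Q)"
          unfolding center_carrier using phi T by auto
        show "carrier (ring_center ?Q) \<subseteq> phi_map p (Suc k) A lift ` carrier ?W"
        proof
          fix u assume "u \<in> carrier (ring_center ?Q)"
          then obtain a where a: "central_mod (Suc k) a" "u = res (Suc k) a" unfolding center_carrier by blast
          obtain z where z: "\<forall>i\<le>k. z i \<in> carrier Z" "res (Suc k) a = res (Suc k) (teich k (\<lambda>i. rep (z i)))"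
            using teich_surj[OF a(1) k] by blast
          let ?xs = "map z [0..<Suc k]"
          have xs: "?xs \<in> carrier ?W" using z(1) by (auto simp: witt_ring_def simp del: upt_Suc)
          have "?T ?xs = teich k (\<lambda>i. rep (z i))"
            unfolding teich_def using z(1) rep_closed by (intro finsum_cong') (auto simp del: upt_Suc)
          then have "u = phi_map p (Suc k) A lift ?xs" using phi[OF xs] z(2) a(2) by simp
          then show "u \<in> phi_map p (Suc k) A lift ` carrier ?W" using xs by blast
        qed
      qed
    qed
  qed
qed

theorem theorem4:
  fixes p n m :: nat
    and K :: "'k ring"
    and OX :: "('k, 'o) module"
    and br :: "'o \<Rightarrow> 'o \<Rightarrow> 'o"
    and A :: "('k list, 'a) module"
    and \<iota> :: "'o \<Rightarrow> 'a set"
    and lift :: "'o list \<Rightarrow> nat \<Rightarrow> 'a set"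
  assumes "perfect_field_char p K" and "p > 2"
    and "normal_poisson_variety K OX br"
    and "\<exists>U. open_symplectic_leaf K OX br U"
    and "n \<ge> 1"
    and "assoc_algebra (witt_ring p n K) A"
    and "flat_module (witt_ring p n K) A"
    and center_iso: "\<iota> \<in> ring_iso OX (ring_center (reduction A p))"
    and center_linear: "\<forall>w\<in>carrier (witt_ring p n K). \<forall>f\<in>carrier OX. \<forall>a\<in>\<iota> f.
           \<iota> (w ! 0 \<odot>\<^bsub>OX\<^esub> f) = residue_class A p (w \<odot>\<^bsub>A\<^esub> a)"
    and bracket: "\<forall>f\<in>carrier OX. \<forall>g\<in>carrier OX.
           deformation_bracket p A (\<iota> f) (\<iota> g) (\<iota> (br f g))"
    and "1 \<le> m" and "m \<le> n"
    and any_lift: "\<forall>z\<in>carrier (witt_ring p m OX). \<forall>i<m. is_lift p m A (lift z i) (\<iota> (z ! i))"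
  shows "phi_map p m A lift \<in> ring_iso (witt_ring p m OX) (ring_center (reduction A (p ^ m)))"
proof -
  have prime: "Factorial_Ring.prime p" using assms(1) by (simp add: perfect_field_char_def)
  have odd: "odd p" using prime_odd_nat[OF prime] assms(2) by simp
  have A: "ring A" using assms(6) by (simp add: assoc_algebra_def)
  interpret O: odd_prime_ring A p
    by (intro odd_prime_ring.intro odd_prime_ring_axioms.intro A prime odd)
  obtain U where leaf: "open_symplectic_leaf K OX br U" using assms(4) by blast
  have dom: "domain OX" using assms(3) by (simp add: normal_poisson_variety_def normal_domain_def)
  have red1: "O.red 1 = reduction A p" and res1: "O.res 1 = residue_class A p" by (simp_all add: O.red_def O.res_def)
  interpret W: witt_center A p OX \<iota>
    by (intro witt_center.intro O.odd_prime_ring_axioms domain.axioms(1) witt_center_axioms.intro dom)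
      (simp only: red1 center_iso)
  interpret W: torsion_witt_center A p OX \<iota> n
    by (intro torsion_witt_center.intro W.witt_center_axioms dom torsion_witt_center_axioms.intro
        flat_witt_torsion[OF assms(1) odd assms(5,7) A])
  interpret W: poisson_witt_center A p OX \<iota> n br
  proof (intro poisson_witt_center.intro W.torsion_witt_center_axioms poisson_witt_center_axioms.intro)
    show br: "br f g \<in> carrier OX" if "f \<in> carrier OX" "g \<in> carrier OX" for f g
      using assms(3) that by (simp add: normal_poisson_variety_def poisson_bracket_def)
    show "\<exists>w\<in>carrier OX. z i = w [^]\<^bsub>OX\<^esub> p"
      if "\<And>i. i \<le> k \<Longrightarrow> z i \<in> carrier OX" "\<And>g. g \<in> carrier OX \<Longrightarrow>
        (\<Oplus>\<^bsub>OX\<^esub>i\<in>{..k}. z i [^]\<^bsub>OX\<^esub> (p ^ (k - i) - 1) \<otimes>\<^bsub>OX\<^esub> br (z i) g) = \<zero>\<^bsub>OX\<^esub>" "i \<le> k" for k z i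
      by (rule logarithmic_radical[OF assms(1) odd assms(3) leaf that])
    fix f g a b assume f: "f \<in> carrier OX" and g: "g \<in> carrier OX" and a: "a \<in> carrier A" and b: "b \<in> carrier A"
      and fa: "O.res 1 a = \<iota> f" and gb: "O.res 1 b = \<iota> g"
    have "a \<in> \<iota> f" "b \<in> \<iota> g"
      using O.residue_class_self[OF a, of p] O.residue_class_self[OF b, of p] fa gb unfolding res1 by auto
    then obtain c where c: "c \<in> \<iota> (br f g)" "a \<otimes>\<^bsub>A\<^esub> b \<ominus>\<^bsub>A\<^esub> b \<otimes>\<^bsub>A\<^esub> a = add_pow A p c"
      using bracket f g unfolding deformation_bracket_def by blast
    let ?h = "W.rep (br f g)"
    have "c \<in> residue_class A p ?h" using c(1) W.rep_res[OF br[OF f g]] unfolding res1 by simp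
    then have c': "c \<in> carrier A" "O.res 1 c = \<iota> (br f g)"
      using O.mem_residue_class_iff[OF W.rep_closed[OF br[OF f g]], of c p] W.rep_res[OF br[OF f g]] unfolding res1 by auto
    have "a \<otimes>\<^bsub>A\<^esub> b = b \<otimes>\<^bsub>A\<^esub> a \<oplus>\<^bsub>A\<^esub> (a \<otimes>\<^bsub>A\<^esub> b \<ominus>\<^bsub>A\<^esub> b \<otimes>\<^bsub>A\<^esub> a)"
      using a b by (simp add: O.minus_eq O.a_lcomm O.r_neg)
    then show "\<exists>c\<in>carrier A. O.res 1 c = \<iota> (br f g) \<and> a \<otimes>\<^bsub>A\<^esub> b = b \<otimes>\<^bsub>A\<^esub> a \<oplus>\<^bsub>A\<^esub> add_pow A p c"
      using c' c(2) by auto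
  qed
  obtain k where k: "m = Suc k" using \<open>1 \<le> m\<close> by (cases m) auto
  have "phi_map p (Suc k) A lift \<in> ring_iso (witt_ring p (Suc k) OX) (ring_center (O.red (Suc k)))"
  proof (rule W.witt_iso)
    show "Suc k \<le> n" using \<open>m \<le> n\<close> k by simp
    show "\<exists>a\<in>carrier A. lift xs j = O.res (Suc k) a \<and> \<iota> (xs ! j) = O.res 1 a"
      if "xs \<in> carrier (witt_ring p (Suc k) OX)" "j \<le> k" for xs j
      using any_lift that unfolding k is_lift_def res1 by (auto simp: O.res_def simp del: power_Suc)
  qed
  then show ?thesis unfolding k O.red_def .
qed

end
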